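(* For every $c$ with $1<c<\tfrac{24979}{20803}$ and every sufficiently small $\varepsilon>0$, $$ \#\{n\le x:P(\lfloor n^c\rfloor)\le n^\varepsilon\}\gg x^{1-\varepsilon} $$ for all sufficiently large $x$, where $n$ runs over natural numbers and the implied constant is positive and depends only on $c$ and $\varepsilon$.
   Context: $\lfloor t\rfloor$ is the integer part of the real number $t$. For an integer $m\ge 2$, $P(m)$ denotes the largest prime factor of $m$ (the case $n=1$, where $\lfloor n^c\rfloor=1$, may be disregarded). $X\gg Y$ means $X\ge C\,Y$ for a constant $C>0$ (the implied constant). *)

theory Defs
  imports Complex_Main "HOL-Computational_Algebra.Primes"
begin

(* Meaningful for m >= 2 only: for m = 1 the set of prime factors is empty. *)
definition largest_prime_factor :: "nat \<Rightarrow> nat" where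
  "largest_prime_factor m = Max (prime_factors m)"

(* The n with 2 <= n <= x for which the largest prime factor of the integer part of n^c
   is at most n^eps. Since c > 1 in all uses, n >= 2 makes the integer part at least 2;
   n = 1 is left out because there the largest prime factor is undefined. *)
definition smooth_ps_set :: "real \<Rightarrow> real \<Rightarrow> real \<Rightarrow> nat set" where
  "smooth_ps_set c \<epsilon> x =
    {n. 2 \<le> n \<and> real n \<le> x \<and>
        real (largest_prime_factor (nat \<lfloor>real n powr c\<rfloor>)) \<le> real n powr \<epsilon>}"

end

theory Submission
  imports Defs "HOL-Probability.Probability" "HOL-Real_Asymp.Real_Asymp"
begin

text \<open>
  Put \<open>\<gamma> = 1 / c\<close>, \<open>\<theta> = 1 - \<gamma>\<close> and \<open>e(t) = exp (2 \<pi> i t)\<close>. An integer \<open>m \<approx> N\<close> is the floor of some \<open>n^c\<close> as soon as \<open>- m^\<gamma>\<close> lies,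
  modulo one, in \<open>[0, \<Delta>)\<close> with \<open>\<Delta> \<approx> N^(- \<theta>)\<close>. We look for such \<open>m\<close> among the products \<open>a b\<close>, where \<open>a \<approx> A\<close> and \<open>b \<approx> B \<approx> N^(\<theta> + \<delta>)\<close>
  are themselves products of \<open>k\<close> integers of size \<open>A^(1/k)\<close> and \<open>B^(1/k)\<close>, hence smooth. The interval is detected by a power of the
  Fejer kernel of degree \<open>H \<approx> N^(\<theta> + \<sigma>)\<close>. For most \<open>a\<close> the number of hits \<open>b\<close> is as expected, by a second moment over all integers
  \<open>a\<close> (the smoothness of \<open>a\<close> is dropped), which leaves the bound

  \<open>\<Sum> |F(h b^\<gamma> - h' b'^\<gamma>)| \<le> A B^2 N^(- \<eta>)\<close> over \<open>h, h' \<le> H\<close> and \<open>b, b' \<approx> B\<close>, where \<open>F(y) = \<Sum> e(y a^\<gamma>)\<close> over \<open>a \<approx> A\<close>.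

  Let \<open>\<tau> = |y| A^\<gamma>\<close>. Small \<open>\<tau>\<close> are rare, by a count of close pairs \<open>h b^\<gamma>, h' b'^\<gamma>\<close>. For larger \<open>\<tau>\<close> the van der Corput bound
  \<open>|F| \<lless> \<tau>^(1/2) + A \<tau>^(- 1/2)\<close> suffices, except in the range \<open>\<tau> \<ge> N^0.9968\<close> when \<open>\<theta>\<close> is close to \<open>1/6\<close>. There stationary phase turns \<open>F(y)\<close>
  into a sum of \<open>e(x l^(1 - \<rho>))\<close> over \<open>l \<approx> \<tau> / A\<close>, with \<open>\<rho> = 1 / (1 - \<gamma>)\<close> and \<open>x\<close> proportional to \<open>y^\<rho>\<close>. Four Weyl steps in blocks of \<open>l\<close>, followed
  by the large sieve over the points \<open>x\<close> (for fixed \<open>h', b'\<close>), whose spacing is controlled by the same pair count, save a power of \<open>N\<close>.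
\<close>

subsection \<open>Exponential sums against exponential integrals\<close>

text \<open>Why 24979 / 20803: there are about N^(4 \<theta>) pairs of frequencies, and the
  square-root bound N^(1/2) for each F meets the target A B^2, about N^(1 + \<theta>), only for
  \<theta> < 1/6, that is c < 6/5. The claimed range goes slightly beyond 6/5; the excess is paid by
  a saving N^(-0.00158) in the top range, which moves the barrier to 3 \<theta> < 0.50156 up to
  small margins. The order 0 < \<sigma> < \<delta> is forced. The kernel must resolve an interval of
  length N^(-\<theta>), so its degree exceeds N^\<theta>; the diagonal pairs contribute A H B, about
  N^(1 + \<theta> + \<sigma>), which must stay below A B^2, about N^(1 + \<theta> + \<delta>). A
  high power of the Fejer kernel is taken because its values off the interval must fall below its
  mean value, about N^(-\<theta>); with a degree only slightly above N^\<theta>, a single kernel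
  does not decay that far. Four Weyl steps on l ~ K ~ N^(1/6) bring the large sieve factor down to A
  Q^4 / K^4, about N^(1/6) Q^4, against H B ~ N^(1/3) points; this leaves room for shifts up to Q =
  N^0.0254.\<close>

definition ee :: "real \<Rightarrow> complex" where
  "ee t = cis (2 * pi * t)"

lemma norm_ee [simp]: "norm (ee t) = 1"
  by (simp add: ee_def)

lemma ee_add: "ee (s + t) = ee s * ee t"
  by (simp add: ee_def cis_mult algebra_simps)

lemma ee_0 [simp]: "ee 0 = 1"
  by (simp add: ee_def)

lemma ee_int [simp]: "ee (of_int k) = 1"
  by (simp add: ee_def cis_multiple_2pi)

lemma cnj_ee [simp]: "cnj (ee t) = ee (- t)"
  by (simp add: ee_def cis_cnj)

lemma ee_diff: "ee (s - t) = ee s * ee (- t)"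
  using ee_add[of s "- t"] by simp

lemma ee_exp: "ee t = exp (\<i> * of_real (2 * pi * t))"
  by (simp add: ee_def cis_conv_exp)

lemma has_vector_derivative_ee:
  assumes "(f has_real_derivative d) (at x within S)"
  shows "((\<lambda>x. ee (f x)) has_vector_derivative (2 * pi * \<i> * d * ee (f x))) (at x within S)"
  unfolding ee_def has_vector_derivative_def
  by (auto intro!: derivative_eq_intros assms[unfolded has_field_derivative_def]
           simp: scaleR_conv_of_real mult_ac)

lemma continuous_on_ee [continuous_intros]:
  assumes "continuous_on S f"
  shows "continuous_on S (\<lambda>x. ee (f x))"
  unfolding ee_def by (intro continuous_intros assms)

lemma norm_ee_diff_le: "norm (ee s - ee t) \<le> 2 * pi * \<bar>s - t\<bar>"
proof -
  have "norm (cis a - cis b) \<le> \<bar>a - b\<bar>" for a b :: real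
  proof -
    have "(norm (cis a - cis b))\<^sup>2 = (cos a - cos b)\<^sup>2 + (sin a - sin b)\<^sup>2"
      by (simp add: cmod_power2)
    also have "\<dots> = 2 - 2 * cos (a - b)"
    proof -
      have "(cos a - cos b)\<^sup>2 + (sin a - sin b)\<^sup>2
          = ((sin a)\<^sup>2 + (cos a)\<^sup>2) + ((sin b)\<^sup>2 + (cos b)\<^sup>2) - 2 * (cos a * cos b + sin a * sin b)"
        by (simp only: power2_diff) algebra
      then show ?thesis by (simp add: cos_diff)
    qed
    also have "\<dots> = (2 * sin ((a - b) / 2))\<^sup>2"
    proof -
      have "2 * ((a - b) / 2) = a - b" by simp
      then have "cos (a - b) = 1 - 2 * (sin ((a - b) / 2))\<^sup>2"
        using cos_double_sin[of "(a - b) / 2"] by argo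
      then show ?thesis by (simp add: power2_eq_square)
    qed
    also have "\<dots> \<le> \<bar>a - b\<bar>\<^sup>2"
    proof -
      have "\<bar>2 * sin ((a - b) / 2)\<bar> \<le> \<bar>a - b\<bar>"
        using abs_sin_x_le_abs_x[of "(a - b) / 2"] by simp
      then show ?thesis by (metis abs_le_square_iff abs_idempotent)
    qed
    finally show ?thesis by (rule power2_le_imp_le) simp
  qed
  from this[of "2 * pi * s" "2 * pi * t"] show ?thesis
    by (simp add: ee_def abs_mult flip: right_diff_distrib)
qed

text \<open>From sin x >= x - x^3 / 6, the integrated form of cos t >= 1 - t^2 / 2, and x <=
  2.\<close>

lemma sin_ge_third:
  assumes "0 \<le> x" "x \<le> pi / 2"
  shows "x / 3 \<le> sin x"
proof -
  have cos_ge: "cos t \<ge> 1 - t\<^sup>2 / 2" for t :: real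
  proof -
    have "2 * (t / 2) = t" by simp
    then have "cos t = 1 - 2 * (sin (t / 2))\<^sup>2"
      using cos_double_sin[of "t / 2"] by argo
    moreover have "(sin (t / 2))\<^sup>2 \<le> (t / 2)\<^sup>2"
      using abs_sin_x_le_abs_x[of "t / 2"] abs_le_square_iff by blast
    ultimately show ?thesis by (simp add: power2_eq_square)
  qed
  have "sin 0 - 0 + 0 ^ 3 / 6 \<le> sin x - x + x ^ 3 / 6"
  proof (rule DERIV_nonneg_imp_nondecreasing[OF assms(1)])
    fix t :: real
    have "((\<lambda>t. sin t - t + t ^ 3 / 6) has_real_derivative (cos t - 1 + t\<^sup>2 / 2)) (at t)"
      by (auto intro!: derivative_eq_intros simp: power2_eq_square)
    then show "\<exists>y. ((\<lambda>t. sin t - t + t ^ 3 / 6) has_real_derivative y) (at t) \<and> 0 \<le> y"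
      using cos_ge[of t] by (intro exI[of _ "cos t - 1 + t\<^sup>2 / 2"]) auto
  qed
  moreover have "x ^ 3 / 6 \<le> x * 2 / 3"
  proof -
    have "x \<le> 2" using assms(2) pi_less_4 by simp
    then have "x * x \<le> 2 * 2" using assms(1) by (intro mult_mono) auto
    then have "x * (x * x) \<le> x * 4" using assms(1) by (intro mult_left_mono) auto
    then show ?thesis by (simp add: power3_eq_cube)
  qed
  ultimately show ?thesis by simp
qed

text \<open>Factoring out \<open>ee (k / 2)\<close> shows that the norm is 2 |sin (pi k)|.\<close>

lemma norm_ee_minus_1_ge:
  assumes "\<bar>k\<bar> \<le> 1 / 2"
  shows "2 * pi / 3 * \<bar>k\<bar> \<le> norm (ee k - 1)"
proof -
  have "ee k - 1 = ee (k / 2) * (ee (k / 2) - ee (- (k / 2)))"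
    by (simp add: right_diff_distrib flip: ee_add)
  also have "ee (k / 2) - ee (- (k / 2)) = 2 * \<i> * sin (pi * k)"
    by (simp add: ee_def complex_eq_iff)
  finally have "norm (ee k - 1) = 2 * \<bar>sin (pi * k)\<bar>"
    by (simp add: norm_mult)
  moreover have "\<bar>sin (pi * k)\<bar> = sin (pi * \<bar>k\<bar>)"
  proof -
    have "0 \<le> sin (pi * \<bar>k\<bar>)"
      using assms pi_gt_zero by (intro sin_ge_zero) (auto simp: mult_le_cancel_left1)
    then show ?thesis by (cases "k \<ge> 0") auto
  qed
  moreover have "pi * \<bar>k\<bar> / 3 \<le> sin (pi * \<bar>k\<bar>)"
    using assms by (intro sin_ge_third) (auto simp: mult_le_cancel_left)
  ultimately show ?thesis by simp
qed

text \<open>The entire function (ee k - 1) / (2 pi i k); the integral form needs no separate value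
  at k = 0.\<close>

definition ee_mean :: "real \<Rightarrow> complex" where
  "ee_mean k = integral {0..1} (\<lambda>s. ee (k * s))"

lemma ee_minus_1_eq: "ee k - 1 = 2 * pi * \<i> * k * ee_mean k"
proof -
  have "((\<lambda>s. 2 * pi * \<i> * k * ee (k * s)) has_integral ee (k * 1) - ee (k * 0)) {0..1}"
    by (intro fundamental_theorem_of_calculus has_vector_derivative_ee)
       (auto intro!: derivative_eq_intros)
  then have "integral {0..1} (\<lambda>s. 2 * pi * \<i> * k * ee (k * s)) = ee k - 1"
    by (auto dest: integral_unique)
  then show ?thesis
    by (simp add: ee_mean_def)
qed

lemma norm_ee_mean_le: "norm (ee_mean k) \<le> 1"
proof -
  have "norm (ee_mean k) \<le> 1 * (1 - 0)"
    unfolding ee_mean_def by (intro integral_bound continuous_intros) auto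
  then show ?thesis by simp
qed

lemma norm_ee_mean_ge:
  assumes "\<bar>k\<bar> \<le> 1 / 2"
  shows "1 / 3 \<le> norm (ee_mean k)"
proof (cases "k = 0")
  case True
  then show ?thesis by (simp add: ee_mean_def)
next
  case False
  have "2 * pi / 3 * \<bar>k\<bar> \<le> 2 * pi * \<bar>k\<bar> * norm (ee_mean k)"
    using norm_ee_minus_1_ge[OF assms] by (simp add: ee_minus_1_eq norm_mult)
  then have "(2 * pi * \<bar>k\<bar>) * (1 / 3) \<le> (2 * pi * \<bar>k\<bar>) * norm (ee_mean k)"
    by (simp add: field_simps)
  then show ?thesis
    by (rule mult_left_le_imp_le) (use False in auto)
qed

lemma norm_ee_mean_diff_le: "norm (ee_mean k - ee_mean k') \<le> 2 * pi * \<bar>k - k'\<bar>"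
proof -
  have "ee_mean k - ee_mean k' = integral {0..1} (\<lambda>s. ee (k * s) - ee (k' * s))"
    unfolding ee_mean_def
    by (intro integral_diff[symmetric] integrable_continuous_interval continuous_intros)
  also have "norm \<dots> \<le> (2 * pi * \<bar>k - k'\<bar>) * (1 - 0)"
  proof (rule integral_bound)
    fix t :: real assume t: "t \<in> {0..1}"
    have "norm (ee (k * t) - ee (k' * t)) \<le> 2 * pi * \<bar>k * t - k' * t\<bar>"
      by (rule norm_ee_diff_le)
    also have "\<bar>k * t - k' * t\<bar> = \<bar>k - k'\<bar> * t"
      using t by (simp add: abs_mult flip: left_diff_distrib)
    also have "2 * pi * (\<bar>k - k'\<bar> * t) \<le> 2 * pi * (\<bar>k - k'\<bar> * 1)"
      using t by (intro mult_left_mono) auto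
    finally show "norm (ee (k * t) - ee (k' * t)) \<le> 2 * pi * \<bar>k - k'\<bar>" by simp
  qed (auto intro!: continuous_intros)
  finally show ?thesis by simp
qed

text \<open>The factor \<open>(ee (t k) - 1) / (ee k - 1)\<close> without its removable singularity.\<close>

definition ee_ratio :: "real \<Rightarrow> real \<Rightarrow> complex" where
  "ee_ratio t k = t * ee_mean (t * k) / ee_mean k"

lemma ee_ratio_mult:
  assumes "\<bar>k\<bar> \<le> 1 / 2"
  shows "ee_ratio t k * (ee k - 1) = ee (t * k) - 1"
proof -
  have "ee_mean k \<noteq> 0" using norm_ee_mean_ge[OF assms] by auto
  then show ?thesis by (simp add: ee_ratio_def ee_minus_1_eq)
qed

lemma norm_ee_ratio_le:
  assumes "\<bar>k\<bar> \<le> 1 / 2" "0 \<le> t" "t \<le> 1"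
  shows "norm (ee_ratio t k) \<le> 3"
proof -
  have "norm (ee_ratio t k) = t * norm (ee_mean (t * k)) / norm (ee_mean k)"
    using assms by (simp add: ee_ratio_def norm_mult norm_divide)
  also have "\<dots> \<le> 1 * 1 / (1 / 3)"
    using assms norm_ee_mean_le[of "t * k"] norm_ee_mean_ge[OF assms(1)]
    by (intro frac_le mult_mono) auto
  finally show ?thesis by simp
qed

text \<open>The Lipschitz dependence on \<open>k\<close> bounds the total variation of the weights
  in the partial summation that follows.\<close>

lemma norm_ee_ratio_diff_le:
  assumes "\<bar>k\<bar> \<le> 1 / 2" "\<bar>k'\<bar> \<le> 1 / 2" "0 \<le> t" "t \<le> 1"
  shows "norm (ee_ratio t k - ee_ratio t k') \<le> 100 * \<bar>k - k'\<bar>"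
proof -
  let ?q = ee_mean
  note ge = norm_ee_mean_ge[OF assms(1)] norm_ee_mean_ge[OF assms(2)]
  have nz: "?q k \<noteq> 0" "?q k' \<noteq> 0" using ge by auto
  have eq: "ee_ratio t k - ee_ratio t k'
      = t * ((?q (t * k) - ?q (t * k')) / ?q k + ?q (t * k') * (?q k' - ?q k) / (?q k * ?q k'))"
    using nz by (simp add: ee_ratio_def field_simps)
  have 1: "norm ((?q (t * k) - ?q (t * k')) / ?q k) \<le> (2 * pi * \<bar>k - k'\<bar>) / (1 / 3)"
    unfolding norm_divide
  proof (intro frac_le)
    have "norm (?q (t * k) - ?q (t * k')) \<le> 2 * pi * \<bar>t * k - t * k'\<bar>"
      by (rule norm_ee_mean_diff_le)
    also have "\<bar>t * k - t * k'\<bar> = t * \<bar>k - k'\<bar>"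
      using assms by (simp add: abs_mult flip: right_diff_distrib)
    also have "2 * pi * (t * \<bar>k - k'\<bar>) \<le> 2 * pi * (1 * \<bar>k - k'\<bar>)"
      using assms by (intro mult_left_mono mult_right_mono) auto
    finally show "norm (?q (t * k) - ?q (t * k')) \<le> 2 * pi * \<bar>k - k'\<bar>" by simp
  qed (use ge in auto)
  have 2: "norm (?q (t * k') * (?q k' - ?q k) / (?q k * ?q k')) \<le> (1 * (2 * pi * \<bar>k' - k\<bar>)) / (1 / 3 * (1 / 3))"
    unfolding norm_divide norm_mult
    using ge norm_ee_mean_le norm_ee_mean_diff_le by (intro frac_le mult_mono) auto
  have "norm (ee_ratio t k - ee_ratio t k') \<le> 1 * ((2 * pi * \<bar>k - k'\<bar>) / (1 / 3) + (1 * (2 * pi * \<bar>k' - k\<bar>)) / (1 / 3 * (1 / 3)))"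
    unfolding eq norm_mult using assms
    by (intro mult_mono order.trans[OF norm_triangle_ineq] add_mono 1 2) auto
  also have "\<dots> = 24 * pi * \<bar>k - k'\<bar>" by (simp add: abs_minus_commute)
  also have "\<dots> \<le> 100 * \<bar>k - k'\<bar>"
    using pi_less_4 by (intro mult_right_mono) auto
  finally show ?thesis .
qed

text \<open>Two steps, each costing O(1). Replacing \<open>f (a + t)\<close> by the chord
  \<open>f a + t * D a\<close> costs a telescoping sum of \<open>g\<close>. For the chord,
  \<open>ee (t * D a) - 1\<close> is \<open>ee_ratio t (D a)\<close> times
  \<open>ee (D a) - 1\<close>, so the sum runs over differences of \<open>Z\<close> with weights of
  bounded variation, as in the Kusmin-Landau inequality.\<close>

lemma sum_shift_ee_le:
  fixes f g :: "real \<Rightarrow> real" and m n :: nat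
  assumes mn: "m < n"
    and deriv: "\<And>x. real m \<le> x \<Longrightarrow> x \<le> real n \<Longrightarrow> (f has_real_derivative g x) (at x)"
    and mono: "\<And>x y. real m \<le> x \<Longrightarrow> x \<le> y \<Longrightarrow> y \<le> real n \<Longrightarrow> g y \<le> g x"
    and small: "\<And>x. real m \<le> x \<Longrightarrow> x \<le> real n \<Longrightarrow> \<bar>g x\<bar> \<le> 1 / 2"
    and t: "0 \<le> t" "t \<le> 1"
  shows "norm (\<Sum>a\<in>{m..<n}. ee (f (real a + t)) - ee (f (real a))) \<le> 120"
proof -
  define D where "D = (\<lambda>a::nat. f (real a + 1) - f (real a))"
  have mvt: "\<exists>z. real a \<le> z \<and> z \<le> real a + s \<and> f (real a + s) - f (real a) = s * g z"
    if "a \<in> {m..<n}" "0 \<le> s" "s \<le> 1" for a s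
  proof (cases "s = 0")
    case True then show ?thesis by auto
  next
    case False
    have le: "real m \<le> real a" "real a + 1 \<le> real n" using that by auto
    have "\<exists>z>real a. z < real a + s \<and> f (real a + s) - f (real a) = (real a + s - real a) * g z"
      by (rule MVT2) (use False that le in \<open>auto intro!: deriv\<close>)
    then show ?thesis by (auto intro: less_imp_le)
  qed
  have D_between: "g (real a + 1) \<le> D a \<and> D a \<le> g (real a)" if a: "a \<in> {m..<n}" for a
  proof -
    obtain z where z: "real a \<le> z" "z \<le> real a + 1" "D a = g z"
      using mvt[OF a, of 1] by (auto simp: D_def)
    have le: "real m \<le> real a" "real a + 1 \<le> real n" using a by auto
    show ?thesis using z le by (auto intro!: mono)
  qed
  have D_small: "\<bar>D a\<bar> \<le> 1 / 2" if "a \<in> {m..<n}" for a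
  proof -
    have "real m \<le> real a" "real a + 1 \<le> real n" using that by auto
    then show ?thesis
      using D_between[OF that] small[of "real a"] small[of "real a + 1"] by auto
  qed
  have D_mono: "D (Suc a) \<le> D a" if "a \<in> {m..<n}" "Suc a \<in> {m..<n}" for a
    using D_between[OF that(1)] D_between[OF that(2)] by (auto simp: add_ac)
  define Z where "Z = (\<lambda>a::nat. ee (f (real a)))"
  have near: "\<bar>f (real a + t) - f (real a) - t * D a\<bar> \<le> g (real a) - g (real a + 1)" if a: "a \<in> {m..<n}" for a
  proof -
    have le: "real m \<le> real a" "real a + 1 \<le> real n" using a by auto
    obtain z where z: "real a \<le> z" "z \<le> real a + t" "f (real a + t) - f (real a) = t * g z"
      using mvt[OF a t] by auto
    have "g (real a + 1) \<le> g z" "g z \<le> g (real a)"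
      using z le t by (auto intro!: mono)
    then have "\<bar>g z - D a\<bar> \<le> g (real a) - g (real a + 1)"
      using D_between[OF a] by auto
    then have "t * \<bar>g z - D a\<bar> \<le> 1 * (g (real a) - g (real a + 1))"
      using t by (intro mult_mono) auto
    moreover have "f (real a + t) - f (real a) - t * D a = t * (g z - D a)"
      using z(3) by (simp add: algebra_simps)
    ultimately show ?thesis using t by (simp add: abs_mult)
  qed
  have tel: "(\<Sum>a\<in>{m..<n}. g (real a) - g (real a + 1)) = g (real m) - g (real n)"
    using sum_Suc_diff'[of m n "\<lambda>a. - g (real a)"] mn by (simp add: add_ac)
  have part1: "norm (\<Sum>a\<in>{m..<n}. ee (f (real a + t)) - ee (f (real a) + t * D a)) \<le> 8"
  proof -
    have "norm (\<Sum>a\<in>{m..<n}. ee (f (real a + t)) - ee (f (real a) + t * D a))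
        \<le> (\<Sum>a\<in>{m..<n}. 2 * pi * (g (real a) - g (real a + 1)))"
    proof (rule order.trans[OF norm_sum], rule sum_mono)
      fix a assume a: "a \<in> {m..<n}"
      have "norm (ee (f (real a + t)) - ee (f (real a) + t * D a)) \<le> 2 * pi * \<bar>f (real a + t) - (f (real a) + t * D a)\<bar>"
        by (rule norm_ee_diff_le)
      also have "\<dots> \<le> 2 * pi * (g (real a) - g (real a + 1))"
        using near[OF a] by (intro mult_left_mono) (auto simp: algebra_simps)
      finally show "norm (ee (f (real a + t)) - ee (f (real a) + t * D a)) \<le> 2 * pi * (g (real a) - g (real a + 1))" .
    qed
    also have "\<dots> = 2 * pi * (g (real m) - g (real n))"
      by (simp add: tel flip: sum_distrib_left)
    also have "\<dots> \<le> 2 * pi * 1"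
      using small[of "real m"] small[of "real n"] mn by (intro mult_left_mono) auto
    finally show ?thesis using pi_less_4 by simp
  qed
  \<comment> \<open>Summation by parts as an induction on the upper end. \<open>D\<close> decreases
    and stays within 1/2 of zero, so the variation of the weights is at most 100 in all.\<close>
  have abel: "norm ((\<Sum>a\<in>{m..<n'}. ee_ratio t (D a) * (Z (Suc a) - Z a))
        - ee_ratio t (D (n' - 1)) * Z n' + ee_ratio t (D m) * Z m) \<le> 100 * (D m - D (n' - 1))"
    if "Suc m \<le> n'" "n' \<le> n" for n'
    using that
  proof (induction n' rule: dec_induct)
    case base
    then show ?case by (simp add: algebra_simps)
  next
    case (step k)
    let ?S = "(\<Sum>a\<in>{m..<k}. ee_ratio t (D a) * (Z (Suc a) - Z a))
        - ee_ratio t (D (k - 1)) * Z k + ee_ratio t (D m) * Z m"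
    have k: "k \<in> {m..<n}" "k - 1 \<in> {m..<n}" "Suc (k - 1) = k" using step by auto
    have "(\<Sum>a\<in>{m..<Suc k}. ee_ratio t (D a) * (Z (Suc a) - Z a))
        - ee_ratio t (D (Suc k - 1)) * Z (Suc k) + ee_ratio t (D m) * Z m
        = ?S + (ee_ratio t (D (k - 1)) - ee_ratio t (D k)) * Z k"
      using step by (simp add: algebra_simps)
    also have "norm \<dots> \<le> 100 * (D m - D (k - 1)) + 100 * (D (k - 1) - D k)"
    proof (rule order.trans[OF norm_triangle_ineq], rule add_mono)
      show "norm ?S \<le> 100 * (D m - D (k - 1))" using step by auto
      have "norm ((ee_ratio t (D (k - 1)) - ee_ratio t (D k)) * Z k) \<le> 100 * \<bar>D (k - 1) - D k\<bar>"
        using norm_ee_ratio_diff_le[OF D_small D_small t, OF k(2,1)] by (simp add: norm_mult Z_def)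
      then show "norm ((ee_ratio t (D (k - 1)) - ee_ratio t (D k)) * Z k) \<le> 100 * (D (k - 1) - D k)"
        using D_mono[of "k - 1"] k by simp
    qed
    finally show ?case by simp
  qed
  have n: "n - 1 \<in> {m..<n}" "m \<in> {m..<n}" using mn by auto
  have part2: "norm (\<Sum>a\<in>{m..<n}. ee (f (real a) + t * D a) - ee (f (real a))) \<le> 106"
  proof -
    have "ee (f (real a) + t * D a) - ee (f (real a)) = ee_ratio t (D a) * (Z (Suc a) - Z a)"
      if "a \<in> {m..<n}" for a
    proof -
      have "Z (Suc a) = ee (D a) * Z a" by (simp add: Z_def D_def add_ac flip: ee_add)
      then have "ee_ratio t (D a) * (Z (Suc a) - Z a) = (ee_ratio t (D a) * (ee (D a) - 1)) * Z a"
        by (simp add: algebra_simps)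
      also have "\<dots> = (ee (t * D a) - 1) * Z a"
        by (simp only: ee_ratio_mult[OF D_small[OF that]])
      finally show ?thesis by (simp add: ee_add Z_def algebra_simps)
    qed
    then have "(\<Sum>a\<in>{m..<n}. ee (f (real a) + t * D a) - ee (f (real a)))
        = (\<Sum>a\<in>{m..<n}. ee_ratio t (D a) * (Z (Suc a) - Z a))" by (rule sum.cong[OF refl])
    also have "\<dots> = ((\<Sum>a\<in>{m..<n}. ee_ratio t (D a) * (Z (Suc a) - Z a))
        - ee_ratio t (D (n - 1)) * Z n + ee_ratio t (D m) * Z m) + (ee_ratio t (D (n - 1)) * Z n - ee_ratio t (D m) * Z m)"
      by simp
    also have "norm \<dots> \<le> 100 * (D m - D (n - 1)) + (3 + 3)"
    proof (rule order.trans[OF norm_triangle_ineq], intro add_mono abel order.trans[OF norm_triangle_ineq4])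
      show "norm (ee_ratio t (D (n - 1)) * Z n) \<le> 3"
        using norm_ee_ratio_le[OF D_small[OF n(1)] t] by (simp add: norm_mult Z_def)
      show "norm (ee_ratio t (D m) * Z m) \<le> 3"
        using norm_ee_ratio_le[OF D_small[OF n(2)] t] by (simp add: norm_mult Z_def)
    qed (use mn in auto)
    also have "\<dots> \<le> 106" using D_small[OF n(1)] D_small[OF n(2)] by auto
    finally show ?thesis .
  qed
  have "(\<Sum>a\<in>{m..<n}. ee (f (real a + t)) - ee (f (real a)))
      = (\<Sum>a\<in>{m..<n}. ee (f (real a + t)) - ee (f (real a) + t * D a)) +
        (\<Sum>a\<in>{m..<n}. ee (f (real a) + t * D a) - ee (f (real a)))"
    by (simp flip: sum.distrib)
  then show ?thesis
    using norm_triangle_le[OF add_mono[OF part1 part2]] by simp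
qed

text \<open>Averaging the shift \<open>t\<close> over the unit interval turns the shifted sum into
  the integral. In terms of the Poisson formula, a derivative of modulus at most 1/2 leaves only the
  zero frequency. The bound is 120 plus 1 for the term at \<open>n\<close>.\<close>

lemma sum_minus_integral_ee_le:
  fixes f g :: "real \<Rightarrow> real" and m n :: nat
  assumes mn: "m \<le> n"
    and deriv: "\<And>x. real m \<le> x \<Longrightarrow> x \<le> real n \<Longrightarrow> (f has_real_derivative g x) (at x)"
    and mono: "\<And>x y. real m \<le> x \<Longrightarrow> x \<le> y \<Longrightarrow> y \<le> real n \<Longrightarrow> g y \<le> g x"
    and small: "\<And>x. real m \<le> x \<Longrightarrow> x \<le> real n \<Longrightarrow> \<bar>g x\<bar> \<le> 1 / 2"
  shows "norm ((\<Sum>a\<in>{m..n}. ee (f (real a))) - integral {real m..real n} (\<lambda>u. ee (f u))) \<le> 121"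
proof (cases "m = n")
  case True
  then show ?thesis by simp
next
  case False
  then have mn': "m < n" using mn by simp
  have contf: "continuous_on {real m..real n} f"
    using deriv by (intro continuous_at_imp_continuous_on ballI DERIV_isCont) auto
  have split: "integral {real m..real k} (\<lambda>u. ee (f u)) = (\<Sum>a\<in>{m..<k}. integral {0..1} (\<lambda>t. ee (f (real a + t))))"
    if "m \<le> k" "k \<le> n" for k
    using that
  proof (induction k rule: dec_induct)
    case base then show ?case by simp
  next
    case (step k)
    have int: "(\<lambda>u. ee (f u)) integrable_on {real m..real (Suc k)}"
      by (intro integrable_continuous_interval continuous_intros continuous_on_subset[OF contf]) (use step in auto)
    have "integral {real m..real (Suc k)} (\<lambda>u. ee (f u)) =
        integral {real m..real k} (\<lambda>u. ee (f u)) + integral {real k..real (Suc k)} (\<lambda>u. ee (f u))"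
      by (rule Henstock_Kurzweil_Integration.integral_combine[symmetric]) (use step int in auto)
    also have "integral {real k..real (Suc k)} (\<lambda>u. ee (f u)) = integral {0..1} (\<lambda>t. ee (f (real k + t)))"
      using integral_shift_Icc_real[of 0 1 "\<lambda>u. ee (f u)" "real k"] by (simp add: o_def add_ac)
    finally show ?case using step by simp
  qed
  let ?D = "\<lambda>t. \<Sum>a\<in>{m..<n}. ee (f (real a + t)) - ee (f (real a))"
  have cont: "continuous_on {0..1} (\<lambda>t. ee (f (real a + t)))" if "a \<in> {m..<n}" for a
    by (intro continuous_intros continuous_on_compose2[OF contf]) (use that in auto)
  have "integral {real m..real n} (\<lambda>u. ee (f u)) - (\<Sum>a\<in>{m..<n}. ee (f (real a)))
     = (\<Sum>a\<in>{m..<n}. integral {0..1} (\<lambda>t. ee (f (real a + t))) - integral {0..1} (\<lambda>t::real. ee (f (real a))))"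
    using split[of n] mn by (simp add: sum_subtractf)
  also have "\<dots> = (\<Sum>a\<in>{m..<n}. integral {0..1} (\<lambda>t. ee (f (real a + t)) - ee (f (real a))))"
    by (intro sum.cong refl Henstock_Kurzweil_Integration.integral_diff[symmetric] integrable_continuous_interval cont) auto
  also have "\<dots> = integral {0..1} ?D"
    by (intro Henstock_Kurzweil_Integration.integral_sum[symmetric] integrable_continuous_interval continuous_on_diff cont) auto
  also have "norm \<dots> \<le> 120 * (1 - 0)"
  proof (rule integral_bound)
    show "continuous_on {0..1} ?D" by (intro continuous_intros cont)
    show "norm (?D t) \<le> 120" if "t \<in> {0..1}" for t
      using that by (intro sum_shift_ee_le[OF mn' deriv mono small]) auto
  qed simp
  finally have "norm (integral {real m..real n} (\<lambda>u. ee (f u)) - (\<Sum>a\<in>{m..<n}. ee (f (real a)))) \<le> 120" by simp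
  moreover have "(\<Sum>a\<in>{m..n}. ee (f (real a))) = (\<Sum>a\<in>{m..<n}. ee (f (real a))) + ee (f (real n))"
    using mn by (simp add: sum.last_plus add_ac atLeastLessThanSuc_atLeastAtMost[symmetric])
  ultimately show ?thesis
    using norm_triangle_ineq[of "(\<Sum>a\<in>{m..<n}. ee (f (real a))) - integral {real m..real n} (\<lambda>u. ee (f u))" "ee (f (real n))"]
    by (simp add: norm_minus_commute algebra_simps)
qed

subsection \<open>Derivative tests and stationary phase\<close>

text \<open>Integration by parts with ee f / (2 pi i g). As \<open>k\<close> keeps its sign, the
  integral of |k| / g^2 is a difference of values of 1 / g; the three resulting terms are at most 1
  / (2 pi r) each.\<close>

lemma integral_ee_first_derivative:
  fixes f g k :: "real \<Rightarrow> real"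
  assumes ab: "a \<le> b" and mpos: "0 < r"
    and f: "\<And>x. a \<le> x \<Longrightarrow> x \<le> b \<Longrightarrow> (f has_real_derivative g x) (at x)"
    and g: "\<And>x. a \<le> x \<Longrightarrow> x \<le> b \<Longrightarrow> (g has_real_derivative k x) (at x)"
    and kcont: "continuous_on {a..b} k"
    and kneg: "\<And>x. a \<le> x \<Longrightarrow> x \<le> b \<Longrightarrow> k x \<le> 0"
    and large: "(\<forall>x\<in>{a..b}. r \<le> g x) \<or> (\<forall>x\<in>{a..b}. g x \<le> - r)"
  shows "norm (integral {a..b} (\<lambda>u. ee (f u))) \<le> 1 / r"
proof -
  let ?G = "\<lambda>x. ee (f x) / (2 * pi * \<i> * g x)"
  have g_nz: "g x \<noteq> 0" "r \<le> \<bar>g x\<bar>" if "a \<le> x" "x \<le> b" for x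
    using large that mpos by force+
  have contf: "continuous_on {a..b} f"
    using f by (intro continuous_at_imp_continuous_on ballI DERIV_isCont) auto
  have contg: "continuous_on {a..b} g"
    using g by (intro continuous_at_imp_continuous_on ballI DERIV_isCont) auto
  have dinv: "((\<lambda>x. - (1 / g x)) has_real_derivative (k x / (g x)\<^sup>2)) (at x within {a..b})"
    if x: "a \<le> x" "x \<le> b" for x
    using DERIV_minus[OF DERIV_inverse_fun[OF has_field_derivative_at_within[OF g[OF x]] g_nz(1)[OF x]]]
    by (simp add: power2_eq_square divide_simps)
  have dG: "(?G has_vector_derivative (ee (f x) - ee (f x) * (k x / (g x)\<^sup>2) / (2 * pi * \<i>))) (at x within {a..b})"
    if x: "x \<in> {a..b}" for x
  proof -
    have 1: "((\<lambda>x. ee (f x)) has_vector_derivative (2 * pi * \<i> * g x * ee (f x))) (at x within {a..b})"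
      using x by (intro has_vector_derivative_ee[OF has_field_derivative_at_within[OF f]]) auto
    have 2: "((\<lambda>x. complex_of_real (- (1 / g x))) has_vector_derivative complex_of_real (k x / (g x)\<^sup>2)) (at x within {a..b})"
      using x by (intro has_vector_derivative_of_real[OF dinv]) auto
    have "((\<lambda>x. - (ee (f x) * complex_of_real (- (1 / g x))) / (2 * pi * \<i>)) has_vector_derivative
        - (ee (f x) * complex_of_real (k x / (g x)\<^sup>2) + 2 * pi * \<i> * g x * ee (f x) * complex_of_real (- (1 / g x))) / (2 * pi * \<i>)) (at x within {a..b})"
      by (intro has_vector_derivative_divide has_vector_derivative_minus has_vector_derivative_mult 1 2)
    moreover have "(\<lambda>x. - (ee (f x) * complex_of_real (- (1 / g x))) / (2 * pi * \<i>)) = ?G"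
      by (auto simp: fun_eq_iff divide_simps)
    moreover have "- (ee (f x) * complex_of_real (k x / (g x)\<^sup>2) + 2 * pi * \<i> * g x * ee (f x) * complex_of_real (- (1 / g x))) / (2 * pi * \<i>)
      = ee (f x) - ee (f x) * (k x / (g x)\<^sup>2) / (2 * pi * \<i>)"
      using g_nz[of x] x by (simp add: field_simps)
    ultimately show ?thesis by simp
  qed
  have I1: "((\<lambda>x. ee (f x) - ee (f x) * (k x / (g x)\<^sup>2) / (2 * pi * \<i>)) has_integral (?G b - ?G a)) {a..b}"
    by (rule fundamental_theorem_of_calculus[OF ab dG])
  have cont2: "continuous_on {a..b} (\<lambda>x. ee (f x) * (k x / (g x)\<^sup>2) / (2 * pi * \<i>))"
    using g_nz by (intro continuous_intros contf contg kcont) auto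
  have I2: "((\<lambda>x. ee (f x)) has_integral (integral {a..b} (\<lambda>u. ee (f u)))) {a..b}"
    by (intro integrable_integral integrable_continuous_interval continuous_intros contf)
  have I3: "((\<lambda>x. ee (f x) * (k x / (g x)\<^sup>2) / (2 * pi * \<i>)) has_integral
      integral {a..b} (\<lambda>x. ee (f x) * (k x / (g x)\<^sup>2) / (2 * pi * \<i>))) {a..b}"
    by (intro integrable_integral integrable_continuous_interval cont2)
  have eq: "integral {a..b} (\<lambda>u. ee (f u)) = ?G b - ?G a + integral {a..b} (\<lambda>x. ee (f x) * (k x / (g x)\<^sup>2) / (2 * pi * \<i>))"
    using has_integral_unique[OF I1 Henstock_Kurzweil_Integration.has_integral_diff[OF I2 I3]] by (simp add: algebra_simps)
  have I4: "((\<lambda>x. k x / (g x)\<^sup>2) has_integral (- (1 / g b) - (- (1 / g a)))) {a..b}"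
    by (rule fundamental_theorem_of_calculus[OF ab])
       (use dinv in \<open>auto simp: has_real_derivative_iff_has_vector_derivative\<close>)
  have I5: "((\<lambda>x. - (k x / (g x)\<^sup>2) / (2 * pi)) has_integral ((1 / g b - 1 / g a) / (2 * pi))) {a..b}"
    using has_integral_divide[OF Henstock_Kurzweil_Integration.has_integral_neg[OF I4], of "2 * pi"] by simp
  have bound3: "norm (integral {a..b} (\<lambda>x. ee (f x) * (k x / (g x)\<^sup>2) / (2 * pi * \<i>))) \<le> (1 / g b - 1 / g a) / (2 * pi)"
  proof -
    have "norm (integral {a..b} (\<lambda>x. ee (f x) * (k x / (g x)\<^sup>2) / (2 * pi * \<i>))) \<le> integral {a..b} (\<lambda>x. - (k x / (g x)\<^sup>2) / (2 * pi))"
    proof (rule Henstock_Kurzweil_Integration.integral_norm_bound_integral)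
      show "(\<lambda>x. - (k x / (g x)\<^sup>2) / (2 * pi)) integrable_on {a..b}" using I5 by blast
      show "norm (ee (f x) * (k x / (g x)\<^sup>2) / (2 * pi * \<i>)) \<le> - (k x / (g x)\<^sup>2) / (2 * pi)" if "x \<in> {a..b}" for x
        using that kneg[of x] by (simp add: norm_mult norm_divide norm_power divide_nonpos_nonneg)
    qed (intro integrable_continuous_interval cont2)
    then show ?thesis unfolding integral_unique[OF I5] .
  qed
  have Gb: "norm (?G x) \<le> 1 / (2 * pi * r)" if "a \<le> x" "x \<le> b" for x
    using g_nz[OF that] mpos by (simp add: norm_mult norm_divide frac_le)
  have diff: "1 / g b - 1 / g a \<le> 1 / r"
  proof -
    from large show ?thesis
    proof
      assume "\<forall>x\<in>{a..b}. r \<le> g x"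
      then have "r \<le> g a" "r \<le> g b" using ab by auto
      then have "1 / g b \<le> 1 / r" "0 \<le> 1 / g a" using mpos by (auto intro!: frac_le)
      then show ?thesis by linarith
    next
      assume "\<forall>x\<in>{a..b}. g x \<le> - r"
      then have "r \<le> - g a" "g b < 0" using ab mpos by force+
      then have "1 / (- g a) \<le> 1 / r" "1 / g b \<le> 0" using mpos by (auto intro!: frac_le[of 1 1 r "- g a", simplified])
      then show ?thesis by linarith
    qed
  qed
  have "norm (integral {a..b} (\<lambda>u. ee (f u))) \<le> 1 / (2 * pi * r) + 1 / (2 * pi * r) + (1 / r) / (2 * pi)"
    unfolding eq
    by (intro order.trans[OF norm_triangle_ineq] add_mono order.trans[OF norm_triangle_ineq4] Gb
        order.trans[OF bound3] divide_right_mono diff) (use ab in auto)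
  also have "\<dots> = (3 / (2 * pi)) / r" using mpos by (simp add: field_simps)
  also have "\<dots> \<le> 1 / r" using pi_gt3 mpos by (intro divide_right_mono) auto
  finally show ?thesis .
qed

text \<open>At distance \<open>U\<close> to the right of a point with non-positive derivative,
  \<open>g\<close> has fallen below \<open>- lam * U\<close>, so the first derivative test applies
  from there on.\<close>

lemma integral_ee_second_derivative_right:
  fixes f g k :: "real \<Rightarrow> real"
  assumes ab: "a \<le> b" and lpos: "0 < lam"
    and f: "\<And>x. a \<le> x \<Longrightarrow> x \<le> b \<Longrightarrow> (f has_real_derivative g x) (at x)"
    and g: "\<And>x. a \<le> x \<Longrightarrow> x \<le> b \<Longrightarrow> (g has_real_derivative k x) (at x)"
    and kcont: "continuous_on {a..b} k"
    and kneg: "\<And>x. a \<le> x \<Longrightarrow> x \<le> b \<Longrightarrow> k x \<le> - lam"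
    and ga: "g a \<le> 0" and U: "0 < U"
  shows "norm (integral {a + U..b} (\<lambda>u. ee (f u))) \<le> 1 / (lam * U)"
proof (cases "a + U \<le> b")
  case False
  then show ?thesis using lpos U by simp
next
  case True
  show ?thesis
  proof (rule integral_ee_first_derivative[where g = g and k = k])
    have "g x \<le> - (lam * U)" if "x \<in> {a + U..b}" for x
    proof -
      have "\<exists>z>a. z < x \<and> g x - g a = (x - a) * k z"
        using that U by (intro MVT2) (auto intro!: g)
      then obtain z where z: "z > a" "z < x" "g x - g a = (x - a) * k z" by blast
      have "(x - a) * k z \<le> (x - a) * (- lam)"
        using z that U by (intro mult_left_mono kneg) auto
      also have "\<dots> \<le> U * (- lam)"
        using that lpos by (intro mult_right_mono_neg) auto
      finally show ?thesis using z ga by (simp add: mult_ac)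
    qed
    then show "(\<forall>x\<in>{a + U..b}. lam * U \<le> g x) \<or> (\<forall>x\<in>{a + U..b}. g x \<le> - (lam * U))" by blast
    show "k x \<le> 0" if "a + U \<le> x" "x \<le> b" for x using kneg[of x] that U lpos by auto
  qed (use True lpos U in \<open>auto intro!: f g continuous_on_subset[OF kcont]\<close>)
qed

lemma integral_ee_second_derivative_left:
  fixes f g k :: "real \<Rightarrow> real"
  assumes ab: "a \<le> b" and lpos: "0 < lam"
    and f: "\<And>x. a \<le> x \<Longrightarrow> x \<le> b \<Longrightarrow> (f has_real_derivative g x) (at x)"
    and g: "\<And>x. a \<le> x \<Longrightarrow> x \<le> b \<Longrightarrow> (g has_real_derivative k x) (at x)"
    and kcont: "continuous_on {a..b} k"
    and kneg: "\<And>x. a \<le> x \<Longrightarrow> x \<le> b \<Longrightarrow> k x \<le> - lam"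
    and gb: "0 \<le> g b" and U: "0 < U"
  shows "norm (integral {a..b - U} (\<lambda>u. ee (f u))) \<le> 1 / (lam * U)"
proof (cases "a \<le> b - U")
  case False
  then show ?thesis using lpos U by simp
next
  case True
  show ?thesis
  proof (rule integral_ee_first_derivative[where g = g and k = k])
    have "lam * U \<le> g x" if "x \<in> {a..b - U}" for x
    proof -
      have "\<exists>z>x. z < b \<and> g b - g x = (b - x) * k z"
        using that U by (intro MVT2) (auto intro!: g)
      then obtain z where z: "z > x" "z < b" "g b - g x = (b - x) * k z" by blast
      have "(b - x) * k z \<le> (b - x) * (- lam)"
        using z that U by (intro mult_left_mono kneg) auto
      also have "\<dots> \<le> U * (- lam)"
        using that lpos by (intro mult_right_mono_neg) auto
      finally show ?thesis using z gb by (simp add: mult_ac)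
    qed
    then show "(\<forall>x\<in>{a..b - U}. lam * U \<le> g x) \<or> (\<forall>x\<in>{a..b - U}. g x \<le> - (lam * U))" by blast
    show "k x \<le> 0" if "a \<le> x" "x \<le> b - U" for x using kneg[of x] that U lpos by auto
  qed (use True lpos U in \<open>auto intro!: f g continuous_on_subset[OF kcont]\<close>)
qed

lemma integral_ee_split_le:
  fixes f :: "real \<Rightarrow> real"
  assumes "continuous_on {a..b} f" "a \<le> c" "c \<le> b"
    and "norm (integral {a..c} (\<lambda>u. ee (f u))) \<le> B1" "norm (integral {c..b} (\<lambda>u. ee (f u))) \<le> B2"
  shows "norm (integral {a..b} (\<lambda>u. ee (f u))) \<le> B1 + B2"
proof -
  have "(\<lambda>u. ee (f u)) integrable_on {a..b}"
    by (intro integrable_continuous_interval continuous_intros assms)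
  then have "integral {a..b} (\<lambda>u. ee (f u)) = integral {a..c} (\<lambda>u. ee (f u)) + integral {c..b} (\<lambda>u. ee (f u))"
    by (intro Henstock_Kurzweil_Integration.integral_combine[symmetric] assms)
  then show ?thesis using assms by (auto intro!: order.trans[OF norm_triangle_ineq] add_mono)
qed

lemma norm_integral_ee_le:
  fixes f :: "real \<Rightarrow> real"
  assumes "continuous_on {a..b} f" "a \<le> b"
  shows "norm (integral {a..b} (\<lambda>u. ee (f u))) \<le> b - a"
  using integral_bound[OF assms(2), of "\<lambda>u. ee (f u)" 1] continuous_on_ee[OF assms(1)] by simp

text \<open>Next to the zero of \<open>g\<close> (or to an end, if there is none) a length U = 1 /
  sqrt lam is estimated trivially; this U balances the trivial part against 1 / (lam U). Two sides
  with 2 U each give the 4.\<close>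

lemma integral_ee_second_derivative:
  fixes f g k :: "real \<Rightarrow> real"
  assumes ab: "a \<le> b" and lpos: "0 < lam"
    and f: "\<And>x. a \<le> x \<Longrightarrow> x \<le> b \<Longrightarrow> (f has_real_derivative g x) (at x)"
    and g: "\<And>x. a \<le> x \<Longrightarrow> x \<le> b \<Longrightarrow> (g has_real_derivative k x) (at x)"
    and kcont: "continuous_on {a..b} k"
    and kneg: "\<And>x. a \<le> x \<Longrightarrow> x \<le> b \<Longrightarrow> k x \<le> - lam"
  shows "norm (integral {a..b} (\<lambda>u. ee (f u))) \<le> 4 / sqrt lam"
proof -
  define U where "U = 1 / sqrt lam"
  have U: "0 < U" "1 / (lam * U) = U" using lpos by (auto simp: U_def field_simps)
  have contf: "continuous_on {a..b} f"
    using f by (intro continuous_at_imp_continuous_on ballI DERIV_isCont) auto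
  have contg: "continuous_on {a..b} g"
    using g by (intro continuous_at_imp_continuous_on ballI DERIV_isCont) auto
  have right: "norm (integral {c..b} (\<lambda>u. ee (f u))) \<le> 2 * U" if c: "a \<le> c" "c \<le> b" "g c \<le> 0" for c
  proof (cases "c + U \<le> b")
    case False
    then show ?thesis using norm_integral_ee_le[OF continuous_on_subset[OF contf], of c b] c U by auto
  next
    case True
    have "norm (integral {c..b} (\<lambda>u. ee (f u))) \<le> U + U"
    proof (rule integral_ee_split_le[where c = "c + U"])
      show "norm (integral {c..c + U} (\<lambda>u. ee (f u))) \<le> U"
        using norm_integral_ee_le[OF continuous_on_subset[OF contf], of c "c + U"] c U True by auto
      show "norm (integral {c + U..b} (\<lambda>u. ee (f u))) \<le> U"
        using integral_ee_second_derivative_right[of c b lam f g k U] c U lpos f g kneg continuous_on_subset[OF kcont, of "{c..b}"] by auto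
    qed (use c U True in \<open>auto intro!: continuous_on_subset[OF contf]\<close>)
    then show ?thesis by simp
  qed
  have left: "norm (integral {a..c} (\<lambda>u. ee (f u))) \<le> 2 * U" if c: "a \<le> c" "c \<le> b" "0 \<le> g c" for c
  proof (cases "a \<le> c - U")
    case False
    then show ?thesis using norm_integral_ee_le[OF continuous_on_subset[OF contf], of a c] c U by auto
  next
    case True
    have "norm (integral {a..c} (\<lambda>u. ee (f u))) \<le> U + U"
    proof (rule integral_ee_split_le[where c = "c - U"])
      show "norm (integral {c - U..c} (\<lambda>u. ee (f u))) \<le> U"
        using norm_integral_ee_le[OF continuous_on_subset[OF contf], of "c - U" c] c U True by auto
      show "norm (integral {a..c - U} (\<lambda>u. ee (f u))) \<le> U"
        using integral_ee_second_derivative_left[of a c lam f g k U] c U lpos f g kneg continuous_on_subset[OF kcont, of "{a..c}"] by auto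
    qed (use c U True in \<open>auto intro!: continuous_on_subset[OF contf]\<close>)
    then show ?thesis by simp
  qed
  consider "g a \<le> 0" | "0 \<le> g b" | "0 < g a" "g b < 0" by linarith
  then have "norm (integral {a..b} (\<lambda>u. ee (f u))) \<le> 2 * U + 2 * U"
  proof cases
    case 1
    then have "norm (integral {a..b} (\<lambda>u. ee (f u))) \<le> 2 * U" using right[of a] ab by simp
    then show ?thesis using U(1) by linarith
  next
    case 2
    then have "norm (integral {a..b} (\<lambda>u. ee (f u))) \<le> 2 * U" using left[of b] ab by simp
    then show ?thesis using U(1) by linarith
  next
    case 3
    then obtain c where c: "a \<le> c" "c \<le> b" "g c = 0"
      using IVT2'[of g b 0 a] ab contg by auto
    show ?thesis
      by (rule integral_ee_split_le[OF contf c(1,2)]) (use left[of c] right[of c] c in auto)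
  qed
  then show ?thesis by (simp add: U_def)
qed

text \<open>A truncated Fresnel integral, with limit e^(- pi i / 4). The truncation is kept: the
  value depends neither on the label nor on the frequency, so it factors out of all later sums, and
  boundedness is enough.\<close>

definition fresnel :: "real \<Rightarrow> complex" where
  "fresnel X = integral {- X..X} (\<lambda>v. ee (- (v\<^sup>2 / 2)))"

lemma norm_fresnel_le:
  assumes "0 \<le> X"
  shows "norm (fresnel X) \<le> 4"
proof -
  have "norm (integral {- X..X} (\<lambda>v. ee (- (v\<^sup>2 / 2)))) \<le> 4 / sqrt 1"
    by (rule integral_ee_second_derivative[where g = "\<lambda>v. - v" and k = "\<lambda>_. - 1"])
       (use assms in \<open>auto intro!: derivative_eq_intros\<close>)
  then show ?thesis by (simp add: fresnel_def)
qed

lemma integral_gauss_scale: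
  assumes "0 < lam"
  shows "integral {- (X / sqrt lam)..X / sqrt lam} (\<lambda>v. ee (- (lam * v\<^sup>2 / 2))) = fresnel X / sqrt lam"
proof (cases "X < 0")
  case True
  then show ?thesis using assms by (simp add: fresnel_def divide_less_0_iff)
next
  case False
  have sq: "sqrt lam > 0" using assms by simp
  have "((\<lambda>v. ee (- (v\<^sup>2 / 2))) has_integral fresnel X) {- X..X}"
    unfolding fresnel_def by (intro integrable_integral integrable_continuous_interval continuous_intros) auto
  from has_integral_stretch_real[OF this, of "sqrt lam"]
  have "((\<lambda>v. ee (- ((sqrt lam * v)\<^sup>2 / 2))) has_integral (1 / \<bar>sqrt lam\<bar>) *\<^sub>R fresnel X)
      ((\<lambda>x. x / sqrt lam) ` {- X..X})"
    using sq by simp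
  moreover have "(\<lambda>x. x / sqrt lam) ` {- X..X} = {- (X / sqrt lam)..X / sqrt lam}"
    using sq False by (simp add: image_divide_atLeastAtMost)
  moreover have "(sqrt lam * v)\<^sup>2 = lam * v\<^sup>2" for v
    using assms by (simp add: power_mult_distrib)
  ultimately show ?thesis using sq
    by (auto dest!: integral_unique simp: scaleR_conv_of_real)
qed

text \<open>Up to distance \<open>U\<close> from the stationary point the phase is replaced by its
  quadratic part; further out the one-sided derivative tests apply. \<open>X\<close> measures the
  window in units of 1 / sqrt lam: a larger \<open>X\<close> shortens the tails and increases the
  cubic error.\<close>

lemma stationary_phase:
  fixes f g k :: "real \<Rightarrow> real"
  assumes lpos: "0 < lmin" "0 < lam" "0 < X"
    and f: "\<And>x. a \<le> x \<Longrightarrow> x \<le> b \<Longrightarrow> (f has_real_derivative g x) (at x)"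
    and g: "\<And>x. a \<le> x \<Longrightarrow> x \<le> b \<Longrightarrow> (g has_real_derivative k x) (at x)"
    and kcont: "continuous_on {a..b} k"
    and kneg: "\<And>x. a \<le> x \<Longrightarrow> x \<le> b \<Longrightarrow> k x \<le> - lmin"
    and u0: "g u0 = 0"
    and U: "U = X / sqrt lam" "a \<le> u0 - U" "u0 + U \<le> b"
    and cubic: "\<And>v. \<bar>v\<bar> \<le> U \<Longrightarrow> \<bar>f (u0 + v) - f u0 + lam * v\<^sup>2 / 2\<bar> \<le> E"
  shows "norm (integral {a..b} (\<lambda>u. ee (f u)) - ee (f u0) * fresnel X / sqrt lam)
      \<le> 2 / (lmin * U) + 4 * pi * U * E"
proof -
  have Upos: "0 < U" using U lpos by simp
  have contf: "continuous_on {a..b} f"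
    using f by (intro continuous_at_imp_continuous_on ballI DERIV_isCont) auto
  let ?I = "\<lambda>a b. integral {a..b} (\<lambda>u. ee (f u))"
  have int: "(\<lambda>u. ee (f u)) integrable_on {c..d}" if "a \<le> c" "d \<le> b" for c d
    by (intro integrable_continuous_interval continuous_intros continuous_on_subset[OF contf]) (use that in auto)
  have split: "?I a b = ?I a (u0 - U) + (?I (u0 - U) (u0 + U) + ?I (u0 + U) b)"
    using Henstock_Kurzweil_Integration.integral_combine[OF _ _ int[of a b], of "u0 - U"]
      Henstock_Kurzweil_Integration.integral_combine[OF _ _ int[of "u0 - U" b], of "u0 + U"] U Upos by simp
  have L: "norm (?I a (u0 - U)) \<le> 1 / (lmin * U)"
    using integral_ee_second_derivative_left[of a u0 lmin f g k U] U Upos u0 lpos f g kneg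
      continuous_on_subset[OF kcont, of "{a..u0}"] by auto
  have R: "norm (?I (u0 + U) b) \<le> 1 / (lmin * U)"
    using integral_ee_second_derivative_right[of u0 b lmin f g k U] U Upos u0 lpos f g kneg
      continuous_on_subset[OF kcont, of "{u0..b}"] by auto
  have contv: "continuous_on {- U..U} (\<lambda>v. f (u0 + v))"
    by (intro continuous_on_compose2[OF contf] continuous_intros) (use U in auto)
  have shift: "?I (u0 - U) (u0 + U) = integral {- U..U} (\<lambda>v. ee (f (u0 + v)))"
    using integral_shift_Icc_real[of "- U" U "\<lambda>u. ee (f u)" u0] by (simp add: o_def add_ac)
  have gauss: "ee (f u0) * fresnel X / sqrt lam = integral {- U..U} (\<lambda>v. ee (f u0 + - (lam * v\<^sup>2 / 2)))"
    using integral_gauss_scale[OF lpos(2), of X] by (simp add: U ee_diff)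
  have "norm (?I (u0 - U) (u0 + U) - ee (f u0) * fresnel X / sqrt lam) \<le> (2 * pi * E) * (U - - U)"
    unfolding shift gauss
  proof (subst Henstock_Kurzweil_Integration.integral_diff[symmetric], goal_cases)
    case 3
    show ?case
    proof (rule integral_bound)
      fix t assume t: "t \<in> {- U..U}"
      have "norm (ee (f (u0 + t)) - ee (f u0 + - (lam * t\<^sup>2 / 2))) \<le> 2 * pi * \<bar>f (u0 + t) - (f u0 + - (lam * t\<^sup>2 / 2))\<bar>"
        by (rule norm_ee_diff_le)
      also have "\<dots> \<le> 2 * pi * E"
        using cubic[of t] t by (intro mult_left_mono) (auto simp: algebra_simps)
      finally show "norm (ee (f (u0 + t)) - ee (f u0 + - (lam * t\<^sup>2 / 2))) \<le> 2 * pi * E" .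
    qed (use Upos in \<open>auto intro!: continuous_intros contv\<close>)
  qed (intro integrable_continuous_interval continuous_intros contv; simp)+
  then have M: "norm (?I (u0 - U) (u0 + U) - ee (f u0) * fresnel X / sqrt lam) \<le> 4 * pi * U * E"
    by (simp add: mult_ac)
  have "?I a b - ee (f u0) * fresnel X / sqrt lam
      = ?I a (u0 - U) + ?I (u0 + U) b + (?I (u0 - U) (u0 + U) - ee (f u0) * fresnel X / sqrt lam)"
    unfolding split by simp
  also have "norm \<dots> \<le> 1 / (lmin * U) + 1 / (lmin * U) + 4 * pi * U * E"
    by (intro order.trans[OF norm_triangle_ineq] add_mono L R M)
  finally show ?thesis by (simp add: mult_ac)
qed

subsection \<open>Sums of monomial phases\<close>

lemma card_nat_between:
  fixes lo hi :: real
  shows "finite {l::nat. lo \<le> real l \<and> real l \<le> hi}" "lo \<le> hi + 1 \<Longrightarrow> real (card {l::nat. lo \<le> real l \<and> real l \<le> hi}) \<le> hi - lo + 1"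
proof -
  have sub: "{l::nat. lo \<le> real l \<and> real l \<le> hi} \<subseteq> nat ` {\<lceil>lo\<rceil>..\<lfloor>hi\<rfloor>}"
  proof
    fix l :: nat assume "l \<in> {l::nat. lo \<le> real l \<and> real l \<le> hi}"
    then have "int l \<in> {\<lceil>lo\<rceil>..\<lfloor>hi\<rfloor>}" by (auto simp: le_floor_iff ceiling_le_iff)
    then show "l \<in> nat ` {\<lceil>lo\<rceil>..\<lfloor>hi\<rfloor>}" by (metis image_eqI nat_int)
  qed
  then show "finite {l::nat. lo \<le> real l \<and> real l \<le> hi}" by (rule finite_subset) auto
  assume "lo \<le> hi + 1"
  have "card {l::nat. lo \<le> real l \<and> real l \<le> hi} \<le> card {\<lceil>lo\<rceil>..\<lfloor>hi\<rfloor>}"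
    using card_mono[OF _ sub] card_image_le[of "{\<lceil>lo\<rceil>..\<lfloor>hi\<rfloor>}" nat] by force
  also have "\<dots> = nat (\<lfloor>hi\<rfloor> + 1 - \<lceil>lo\<rceil>)" by simp
  finally have "real (card {l::nat. lo \<le> real l \<and> real l \<le> hi}) \<le> real (nat (\<lfloor>hi\<rfloor> + 1 - \<lceil>lo\<rceil>))" by simp
  also have "\<dots> \<le> hi - lo + 1"
  proof (cases "0 \<le> \<lfloor>hi\<rfloor> + 1 - \<lceil>lo\<rceil>")
    case True
    then have "real (nat (\<lfloor>hi\<rfloor> + 1 - \<lceil>lo\<rceil>)) = of_int \<lfloor>hi\<rfloor> + 1 - of_int \<lceil>lo\<rceil>" by simp
    then show ?thesis using of_int_floor_le[of hi] le_of_int_ceiling[of lo] by argo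
  next
    case False
    then show ?thesis using \<open>lo \<le> hi + 1\<close> by simp
  qed
  finally show "real (card {l::nat. lo \<le> real l \<and> real l \<le> hi}) \<le> hi - lo + 1" .
qed

text \<open>The upper end \<open>3 * A\<close> is dictated by the application: products of
  \<open>k\<close> factors from \<open>{M<..M + M div k}\<close> are at most
  \<open>3 * M ^ k\<close>, because (1 + 1/k)^k < e < 3.\<close>

definition mono_sum :: "real \<Rightarrow> nat \<Rightarrow> real \<Rightarrow> complex" where
  "mono_sum \<gamma> A y = (\<Sum>a\<in>{A<..3 * A}. ee (y * real a powr \<gamma>))"

locale monomial_phase =
  fixes \<gamma> y :: real and A :: nat
  assumes gam: "0 < \<gamma>" "\<gamma> < 1" and ypos: "0 < y" and Apos: "0 < A"
begin

definition ph where "ph u = y * u powr \<gamma>"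
definition ph1 where "ph1 u = \<gamma> * y * u powr (\<gamma> - 1)"
definition ph2 where "ph2 u = - (\<gamma> * (1 - \<gamma>) * y * u powr (\<gamma> - 2))"
definition ph3 where "ph3 u = \<gamma> * (1 - \<gamma>) * (2 - \<gamma>) * y * u powr (\<gamma> - 3)"
definition \<tau> where "\<tau> = y * real A powr \<gamma>"
definition \<kappa> where "\<kappa> = \<gamma> * (1 - \<gamma>)"

lemma tau_pos: "0 < \<tau>" and kap_pos: "0 < \<kappa>"
  using gam ypos Apos by (auto simp: \<tau>_def \<kappa>_def)

lemma deriv_ph: "0 < u \<Longrightarrow> (ph has_real_derivative ph1 u) (at u)"
  unfolding ph_def[abs_def] ph1_def by (auto intro!: derivative_eq_intros simp: powr_diff)

lemma deriv_ph1: "0 < u \<Longrightarrow> (ph1 has_real_derivative ph2 u) (at u)"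
  unfolding ph1_def[abs_def] ph2_def
  by (rule DERIV_cong, rule DERIV_cmult, rule has_real_derivative_powr) (auto simp: algebra_simps)

lemma deriv_ph2: "0 < u \<Longrightarrow> (ph2 has_real_derivative ph3 u) (at u)"
  unfolding ph2_def[abs_def] ph3_def
  by (rule DERIV_cong, rule DERIV_minus, rule DERIV_cmult, rule has_real_derivative_powr) (auto simp: algebra_simps)

lemma ph1_antimono: "0 < u \<Longrightarrow> u \<le> v \<Longrightarrow> ph1 v \<le> ph1 u"
  using gam ypos unfolding ph1_def by (intro mult_left_mono powr_mono2') auto

lemma ph1_pos: "0 < u \<Longrightarrow> 0 < ph1 u"
  using gam ypos by (simp add: ph1_def)

lemma powr_range:
  assumes "real A \<le> u" "u \<le> 3 * real A" "- real n \<le> p" "p \<le> 0"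
  shows "u powr p \<le> real A powr p" "real A powr p / 3 ^ n \<le> u powr p"
proof -
  show "u powr p \<le> real A powr p"
    using assms Apos by (intro powr_mono2') auto
  have "real A powr p / 3 ^ n = real A powr p * 3 powr (- real n)"
    by (simp add: powr_minus powr_realpow divide_inverse)
  also have "\<dots> \<le> real A powr p * 3 powr p"
    using assms by (intro mult_left_mono powr_mono) auto
  also have "\<dots> = (3 * real A) powr p" by (simp add: powr_mult)
  also have "\<dots> \<le> u powr p"
    using assms Apos by (intro powr_mono2') auto
  finally show "real A powr p / 3 ^ n \<le> u powr p" .
qed

lemma A_powr: "k * y * real A powr (\<gamma> - real n) = k * \<tau> / real A ^ n"
  using Apos by (simp add: \<tau>_def powr_diff powr_realpow)

lemma ph2_range:
  assumes "real A \<le> u" "u \<le> 3 * real A"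
  shows "ph2 u \<le> - (\<kappa> * \<tau> / (9 * real A ^ 2))" "- (\<kappa> * \<tau> / real A ^ 2) \<le> ph2 u"
proof -
  note r = powr_range[OF assms, of 2 "\<gamma> - 2"]
  have e: "\<kappa> * \<tau> / real A ^ 2 = \<kappa> * y * real A powr (\<gamma> - 2)"
    using A_powr[of "\<kappa>" 2] by simp
  have "\<kappa> * y * real A powr (\<gamma> - 2) / 9 \<le> \<kappa> * y * u powr (\<gamma> - 2)"
    using r(2) gam mult_left_mono[of "real A powr (\<gamma> - 2) / 9" "u powr (\<gamma> - 2)" "\<kappa> * y"] kap_pos ypos by simp
  then show "ph2 u \<le> - (\<kappa> * \<tau> / (9 * real A ^ 2))"
    using e by (simp add: ph2_def \<kappa>_def)
  have "\<kappa> * y * u powr (\<gamma> - 2) \<le> \<kappa> * y * real A powr (\<gamma> - 2)"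
    using r(1) gam mult_left_mono[of "u powr (\<gamma> - 2)" "real A powr (\<gamma> - 2)" "\<kappa> * y"] kap_pos ypos by simp
  then show "- (\<kappa> * \<tau> / real A ^ 2) \<le> ph2 u"
    unfolding e by (simp add: ph2_def \<kappa>_def)
qed

lemma ph3_bound:
  assumes "real A \<le> u" "u \<le> 3 * real A"
  shows "\<bar>ph3 u\<bar> \<le> 2 * \<kappa> * \<tau> / real A ^ 3"
proof -
  note r = powr_range[OF assms, of 3 "\<gamma> - 3"]
  have e: "\<kappa> * \<tau> / real A ^ 3 = \<kappa> * y * real A powr (\<gamma> - 3)"
    using A_powr[of "\<kappa>" 3] by simp
  have "\<bar>ph3 u\<bar> = (2 - \<gamma>) * (\<kappa> * y * u powr (\<gamma> - 3))"
    using gam ypos by (simp add: ph3_def \<kappa>_def mult_ac)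
  also have "\<dots> \<le> 2 * (\<kappa> * y * real A powr (\<gamma> - 3))"
    using r(1) gam kap_pos ypos by (intro mult_mono) auto
  also have "\<dots> = 2 * \<kappa> * \<tau> / real A ^ 3" by (simp flip: e)
  finally show ?thesis .
qed

lemma ph1_range:
  assumes "real A \<le> u" "u \<le> 3 * real A"
  shows "\<gamma> * \<tau> / (3 * real A) \<le> ph1 u" "ph1 u \<le> \<gamma> * \<tau> / real A"
proof -
  note r = powr_range[OF assms, of 1 "\<gamma> - 1"]
  have e: "\<gamma> * \<tau> / real A = \<gamma> * y * real A powr (\<gamma> - 1)"
    using A_powr[of "\<gamma>" 1] by simp
  have "\<gamma> * y * real A powr (\<gamma> - 1) / 3 \<le> \<gamma> * y * u powr (\<gamma> - 1)"
    using r(2) gam mult_left_mono[of "real A powr (\<gamma> - 1) / 3" "u powr (\<gamma> - 1)" "\<gamma> * y"] gam ypos by simp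
  then show "\<gamma> * \<tau> / (3 * real A) \<le> ph1 u"
    using e by (simp add: ph1_def)
  show "ph1 u \<le> \<gamma> * \<tau> / real A"
    unfolding e ph1_def using r(1) gam ypos by (intro mult_left_mono) auto
qed

text \<open>Nearest integer to the derivative. On the fibre of l, subtracting \<open>l * u\<close>
  from the phase leaves a derivative of modulus at most 1/2 and changes nothing at integers. This
  replaces the Poisson formula in van der Corput's process B, one frequency at a time.\<close>

definition lab :: "nat \<Rightarrow> nat" where "lab a = nat \<lfloor>ph1 (real a) + 1 / 2\<rfloor>"
definition fib :: "nat \<Rightarrow> nat set" where "fib l = {a \<in> {A<..3 * A}. lab a = l}"

lemma lab_near: "a > 0 \<Longrightarrow> real (lab a) \<le> ph1 (real a) + 1 / 2" "a > 0 \<Longrightarrow> ph1 (real a) - 1 / 2 < real (lab a)"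
proof -
  assume "a > 0"
  then have "0 \<le> \<lfloor>ph1 (real a) + 1 / 2\<rfloor>" using ph1_pos[of "real a"] by simp
  then have "real (lab a) = of_int \<lfloor>ph1 (real a) + 1 / 2\<rfloor>" by (simp add: lab_def)
  then show "real (lab a) \<le> ph1 (real a) + 1 / 2" "ph1 (real a) - 1 / 2 < real (lab a)"
    by linarith+
qed

lemma lab_antimono: "0 < a \<Longrightarrow> a \<le> b \<Longrightarrow> lab b \<le> lab a"
  unfolding lab_def using ph1_antimono[of "real a" "real b"] by (intro nat_mono floor_mono) auto

lemma fib_interval:
  assumes "fib l \<noteq> {}"
  obtains m n where "m \<le> n" "fib l = {m..n}" "A < m" "n \<le> 3 * A"
proof -
  have fin: "finite (fib l)" by (simp add: fib_def)
  define m n where "m = Min (fib l)" and "n = Max (fib l)"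
  have mem: "m \<in> fib l" "n \<in> fib l" using fin assms by (auto simp: m_def n_def)
  have "a \<in> fib l" if "a \<in> {m..n}" for a
  proof -
    have "A < m" "lab m = l" "lab n = l" using mem by (simp_all add: fib_def)
    moreover from this have "lab a \<le> lab m" "lab n \<le> lab a"
      using that lab_antimono[of m a] lab_antimono[of a n] by simp_all
    ultimately have "lab a = l" by linarith
    then show ?thesis using that mem by (simp add: fib_def)
  qed
  moreover have "a \<in> {m..n}" if "a \<in> fib l" for a
    using that fin by (auto simp: m_def n_def)
  ultimately have "fib l = {m..n}" by blast
  moreover have "m \<le> n" using fin assms by (auto simp: m_def n_def)
  moreover have "A < m" "n \<le> 3 * A" using mem by (simp_all add: fib_def)
  ultimately show ?thesis by (intro that[of m n])
qed

lemma fib_sum_integral: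
  assumes "m \<le> n" "fib l = {m..n}" "A < m" "n \<le> 3 * A"
  shows "norm ((\<Sum>a\<in>fib l. ee (ph (real a))) - integral {real m..real n} (\<lambda>u. ee (ph u - real l * u))) \<le> 121"
proof -
  have "m \<in> fib l" "n \<in> fib l" using assms(1) by (simp_all add: assms(2))
  then have mem: "lab m = l" "lab n = l" by (auto simp: fib_def)
  have "(\<Sum>a\<in>fib l. ee (ph (real a))) = (\<Sum>a\<in>{m..n}. ee (ph (real a) - real l * real a))"
  proof (unfold assms(2), intro sum.cong refl)
    fix a
    have "ee (of_int (- (int l * int a))) = 1" by (rule ee_int)
    then have "ee (- (real l * real a)) = 1" by (simp del: ee_int)
    then show "ee (ph (real a)) = ee (ph (real a) - real l * real a)" by (simp add: ee_diff)
  qed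
  moreover have "norm ((\<Sum>a\<in>{m..n}. ee (ph (real a) - real l * real a)) - integral {real m..real n} (\<lambda>u. ee (ph u - real l * u))) \<le> 121"
  proof (rule sum_minus_integral_ee_le[where g = "\<lambda>u. ph1 u - real l"])
    show "((\<lambda>u. ph u - real l * u) has_real_derivative (ph1 x - real l)) (at x)" if "real m \<le> x" for x
    proof -
      have "0 < x" using that assms by linarith
      then show ?thesis by (auto intro!: derivative_eq_intros deriv_ph)
    qed
    show "ph1 y - real l \<le> ph1 x - real l" if "real m \<le> x" "x \<le> y" for x y
      using ph1_antimono[of x y] that assms by force
    show "\<bar>ph1 x - real l\<bar> \<le> 1 / 2" if x: "real m \<le> x" "x \<le> real n" for x
    proof -
      have "ph1 (real n) \<le> ph1 x" "ph1 x \<le> ph1 (real m)"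
        using ph1_antimono[of x "real n"] ph1_antimono[of "real m" x] x assms by force+
      moreover have "ph1 (real m) - 1 / 2 < real l" using lab_near(2)[of m] assms(3) mem(1) by simp
      moreover have "real l \<le> ph1 (real n) + 1 / 2" using lab_near(1)[of n] assms(1,3) mem(2) by simp
      ultimately show ?thesis unfolding abs_le_iff by linarith
    qed
  qed (use assms in auto)
  ultimately show ?thesis by simp
qed

lemma integral_phase_le:
  assumes "m \<le> n" "A < m" "n \<le> 3 * A"
  shows "norm (integral {real m..real n} (\<lambda>u. ee (ph u - real l * u))) \<le> 12 * real A / sqrt (\<kappa> * \<tau>)"
proof -
  have "norm (integral {real m..real n} (\<lambda>u. ee (ph u - real l * u))) \<le> 4 / sqrt (\<kappa> * \<tau> / (9 * real A ^ 2))"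
  proof (rule integral_ee_second_derivative[where g = "\<lambda>u. ph1 u - real l" and k = ph2])
    have pos: "0 < x" if "real m \<le> x" for x using that assms by linarith
    show "((\<lambda>u. ph u - real l * u) has_real_derivative (ph1 x - real l)) (at x)" if "real m \<le> x" for x
      using pos[OF that] by (auto intro!: derivative_eq_intros deriv_ph)
    show "((\<lambda>u. ph1 u - real l) has_real_derivative ph2 x) (at x)" if "real m \<le> x" for x
      using pos[OF that] by (auto intro!: derivative_eq_intros deriv_ph1)
    show "continuous_on {real m..real n} ph2"
      using pos by (intro continuous_at_imp_continuous_on ballI DERIV_isCont[OF deriv_ph2]) auto
    show "ph2 x \<le> - (\<kappa> * \<tau> / (9 * real A ^ 2))" if "real m \<le> x" "x \<le> real n" for x
      using that assms by (intro ph2_range) auto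
  qed (use assms kap_pos tau_pos Apos in auto)
  also have "\<dots> = 12 * real A / sqrt (\<kappa> * \<tau>)"
    using Apos by (simp add: real_sqrt_divide real_sqrt_mult)
  finally show ?thesis .
qed

lemma norm_fib_sum_le: "norm (\<Sum>a\<in>fib l. ee (ph (real a))) \<le> 121 + 12 * real A / sqrt (\<kappa> * \<tau>)"
proof (cases "fib l = {}")
  case True
  then show ?thesis using kap_pos tau_pos by simp
next
  case False
  then obtain m n where mn: "m \<le> n" "fib l = {m..n}" "A < m" "n \<le> 3 * A" by (rule fib_interval)
  show ?thesis
    using norm_triangle_sub[of "\<Sum>a\<in>fib l. ee (ph (real a))" "integral {real m..real n} (\<lambda>u. ee (ph u - real l * u))"]
      fib_sum_integral[OF mn] integral_phase_le[OF mn(1,3,4), of l] by linarith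
qed

lemma mono_sum_fibs: "mono_sum \<gamma> A y = (\<Sum>l\<in>lab ` {A<..3 * A}. \<Sum>a\<in>fib l. ee (ph (real a)))"
  unfolding mono_sum_def fib_def ph_def by (rule sum.image_gen) auto

lemma lab_range:
  assumes "a \<in> {A<..3 * A}"
  shows "ph1 (3 * real A) - 1 / 2 \<le> real (lab a)" "real (lab a) \<le> ph1 (real A) + 1 / 2"
  using lab_near[of a] ph1_antimono[of "real a" "3 * real A"] ph1_antimono[of "real A" "real a"] assms Apos by auto

text \<open>Number of labels times the bound per fibre. Multiplied out, the order is \<tau>^(1/2) +
  A \<tau>^(-1/2), together with \<tau> / A and a constant, up to factors depending on
  \<gamma>.\<close>

lemma norm_mono_sum_le:
  "norm (mono_sum \<gamma> A y) \<le> (\<tau> / real A + 2) * (121 + 12 * real A / sqrt (\<kappa> * \<tau>))"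
proof -
  let ?R = "lab ` {A<..3 * A}"
  let ?B = "121 + 12 * real A / sqrt (\<kappa> * \<tau>)"
  have B: "0 \<le> ?B" using kap_pos tau_pos by simp
  have ord: "ph1 (3 * real A) \<le> ph1 (real A)" using Apos by (intro ph1_antimono) auto
  have "?R \<subseteq> {l. ph1 (3 * real A) - 1 / 2 \<le> real l \<and> real l \<le> ph1 (real A) + 1 / 2}"
    using lab_range by auto
  then have "real (card ?R) \<le> real (card {l. ph1 (3 * real A) - 1 / 2 \<le> real l \<and> real l \<le> ph1 (real A) + 1 / 2})"
    by (intro of_nat_mono card_mono card_nat_between(1))
  also have "\<dots> \<le> ph1 (real A) + 1 / 2 - (ph1 (3 * real A) - 1 / 2) + 1"
    by (rule card_nat_between(2)) (use ord in simp)
  also have "\<dots> \<le> \<tau> / real A + 2"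
  proof -
    have "ph1 (real A) \<le> \<gamma> * \<tau> / real A" using ph1_range(2)[of "real A"] Apos by simp
    also have "\<dots> \<le> \<tau> / real A" using gam tau_pos by (intro divide_right_mono) auto
    finally show ?thesis using ph1_pos[of "3 * real A"] Apos by simp
  qed
  finally have card: "real (card ?R) \<le> \<tau> / real A + 2" .
  have "norm (mono_sum \<gamma> A y) \<le> (\<Sum>l\<in>?R. ?B)"
    unfolding mono_sum_fibs by (rule order.trans[OF norm_sum sum_mono[OF norm_fib_sum_le]])
  also have "\<dots> = real (card ?R) * ?B" by simp
  also have "\<dots> \<le> (\<tau> / real A + 2) * ?B" using B card by (intro mult_right_mono)
  finally show ?thesis .
qed

end

section \<open>Stationary phase on the fibres\<close>

lemma cubic_remainder:
  fixes f g k kt :: "real \<Rightarrow> real"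
  assumes f: "\<And>x. a \<le> x \<Longrightarrow> x \<le> b \<Longrightarrow> (f has_real_derivative g x) (at x)"
    and g: "\<And>x. a \<le> x \<Longrightarrow> x \<le> b \<Longrightarrow> (g has_real_derivative k x) (at x)"
    and k: "\<And>x. a \<le> x \<Longrightarrow> x \<le> b \<Longrightarrow> (k has_real_derivative kt x) (at x)"
    and M: "\<And>x. a \<le> x \<Longrightarrow> x \<le> b \<Longrightarrow> \<bar>kt x\<bar> \<le> M"
    and u0: "g u0 = 0" "k u0 = - lam" and v: "a \<le> u0 - \<bar>v\<bar>" "u0 + \<bar>v\<bar> \<le> b"
  shows "\<bar>f (u0 + v) - f u0 + lam * v\<^sup>2 / 2\<bar> \<le> M * \<bar>v\<bar> ^ 3"
proof -
  define S where "S = {- \<bar>v\<bar>..\<bar>v\<bar>}"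
  have S: "convex S" "0 \<in> S" "v \<in> S" by (auto simp: S_def)
  have in_ab: "a \<le> u0 + t" "u0 + t \<le> b" "\<bar>t\<bar> \<le> \<bar>v\<bar>" if "t \<in> S" for t
    using that v by (auto simp: S_def)
  have M0: "0 \<le> M" using M[of u0] v by fastforce
  have sh: "((\<lambda>t. h (u0 + t)) has_real_derivative h' (u0 + t)) (at t within S)"
    if "(h has_real_derivative h' (u0 + t)) (at (u0 + t))" for h h' :: "real \<Rightarrow> real" and t
    using DERIV_shift[of h "h' (u0 + t)" t u0] that by (auto simp: add_ac intro: has_field_derivative_at_within)
  have 1: "\<bar>k (u0 + t) + lam\<bar> \<le> M * \<bar>v\<bar>" if "t \<in> S" for t
  proof -
    have "norm (k (u0 + t) - k (u0 + 0)) \<le> M * norm (t - 0)"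
      by (rule field_differentiable_bound[OF S(1) sh[where h = k and h' = kt, OF k]]) (use that S in_ab M in auto)
    also have "\<dots> \<le> M * \<bar>v\<bar>" using in_ab[OF that] M0 by (simp add: mult_left_mono)
    finally show ?thesis using u0 by simp
  qed
  have 2: "\<bar>g (u0 + t) + lam * t\<bar> \<le> M * \<bar>v\<bar> * \<bar>v\<bar>" if "t \<in> S" for t
  proof -
    have "norm ((g (u0 + t) + lam * t) - (g (u0 + 0) + lam * 0)) \<le> M * \<bar>v\<bar> * norm (t - 0)"
    proof (rule field_differentiable_bound[OF S(1)])
      show "((\<lambda>t. g (u0 + t) + lam * t) has_real_derivative (k (u0 + z) + lam)) (at z within S)" if "z \<in> S" for z
        by (rule DERIV_add[OF sh[where h = g and h' = k, OF g]]) (use that in_ab in \<open>auto intro!: derivative_eq_intros\<close>)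
    qed (use that S in_ab 1 in auto)
    also have "\<dots> \<le> M * \<bar>v\<bar> * \<bar>v\<bar>" using in_ab[OF that] M0 by (simp add: mult_left_mono)
    finally show ?thesis using u0 by simp
  qed
  have "norm ((f (u0 + v) + lam * v\<^sup>2 / 2) - (f (u0 + 0) + lam * 0\<^sup>2 / 2)) \<le> M * \<bar>v\<bar> * \<bar>v\<bar> * norm (v - 0)"
  proof (rule field_differentiable_bound[OF S(1)])
    show "((\<lambda>t. f (u0 + t) + lam * t\<^sup>2 / 2) has_real_derivative (g (u0 + z) + lam * z)) (at z within S)" if "z \<in> S" for z
      by (rule DERIV_add[OF sh[where h = f and h' = g, OF f]]) (use that in_ab in \<open>auto intro!: derivative_eq_intros\<close>)
  qed (use S in_ab 2 in auto)
  then show ?thesis by (simp add: power3_eq_cube mult_ac algebra_simps)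
qed

context monomial_phase
begin

text \<open>The stationary point of \<open>ph u - l * u\<close>.\<close>

definition u0 :: "nat \<Rightarrow> real" where "u0 l = (\<gamma> * y / real l) powr (1 / (1 - \<gamma>))"

text \<open>The margin 1 ensures that the ends of the range do not cut off the fibre of
  \<open>l\<close> before the derivative has moved well past \<open>l\<close> on either
  side.\<close>

definition good :: "nat set" where
  "good = {l. ph1 (3 * real A) + 1 \<le> real l \<and> real l \<le> ph1 (real A) - 1}"

lemma good_pos: "l \<in> good \<Longrightarrow> 0 < l"
  using ph1_pos[of "3 * real A"] Apos by (auto simp: good_def intro: Nat.gr0I)

lemma u0_pos: "0 < l \<Longrightarrow> 0 < u0 l"
  using gam ypos by (simp add: u0_def)

lemma ph1_u0: assumes "0 < l" shows "ph1 (u0 l) = real l"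
proof -
  have "u0 l powr (\<gamma> - 1) = (\<gamma> * y / real l) powr (1 / (1 - \<gamma>) * (\<gamma> - 1))"
    by (simp add: u0_def powr_powr)
  also have "1 / (1 - \<gamma>) * (\<gamma> - 1) = - 1" using gam by (simp add: field_simps)
  finally show ?thesis using assms gam ypos by (simp add: ph1_def powr_minus field_simps)
qed

lemma ph2_eq: "0 < u \<Longrightarrow> ph2 u = - ((1 - \<gamma>) * ph1 u / u)"
  by (simp add: ph1_def ph2_def powr_diff power2_eq_square)

lemma ph_eq: "0 < u \<Longrightarrow> ph u = ph1 u * u / \<gamma>"
  using gam by (simp add: ph1_def ph_def powr_diff)

lemma u0_range:
  assumes "l \<in> good"
  shows "real A < u0 l" "u0 l \<le> 3 * real A"
proof -
  note l = good_pos[OF assms] u0_pos[OF good_pos[OF assms]] ph1_u0[OF good_pos[OF assms]]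
  show "real A < u0 l"
    using ph1_antimono[OF l(2), of "real A"] l(3) assms by (force simp: good_def)
  show "u0 l \<le> 3 * real A"
    using ph1_antimono[of "3 * real A" "u0 l"] Apos l(3) assms by (force simp: good_def)
qed

lemma ph1_lipschitz:
  assumes "real A \<le> v" "v \<le> w" "w \<le> 3 * real A"
  shows "ph1 v - ph1 w \<le> (w - v) * (\<kappa> * \<tau> / real A ^ 2)"
proof (cases "v = w")
  case False
  have "\<exists>z>v. z < w \<and> ph1 w - ph1 v = (w - v) * ph2 z"
    using assms False Apos by (intro MVT2 deriv_ph1) auto
  then obtain z where z: "v < z" "z < w" "ph1 w - ph1 v = (w - v) * ph2 z" by blast
  have "(w - v) * (- (\<kappa> * \<tau> / real A ^ 2)) \<le> (w - v) * ph2 z"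
    using z assms by (intro mult_left_mono ph2_range) auto
  then show ?thesis using z by simp
qed simp

text \<open>The neighbours \<open>m - 1\<close> and \<open>n + 1\<close> have other labels, hence
  derivatives at least 1/2 away from \<open>l\<close>, and one step changes the derivative by at
  most 1/4. So the stationary point lies well inside the fibre.\<close>

lemma fib_margin:
  assumes l: "l \<in> good" and small: "144 * (\<kappa> * \<tau>) \<le> real A ^ 2"
  obtains m n where "m \<le> n" "fib l = {m..n}" "A < m" "n \<le> 3 * A"
    "real l + 1 / 4 \<le> ph1 (real m)" "ph1 (real n) \<le> real l - 1 / 4"
proof -
  have sm: "\<kappa> * \<tau> / real A ^ 2 \<le> 1 / 144" using small Apos by (simp add: field_simps)
  have step: "ph1 v - ph1 w \<le> 1 / 4" if "real A \<le> v" "v \<le> w" "w \<le> 3 * real A" "w \<le> v + 1" for v w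
  proof -
    have "(w - v) * (\<kappa> * \<tau> / real A ^ 2) \<le> 1 * (1 / 144)"
      using that sm kap_pos tau_pos by (intro mult_mono) auto
    then show ?thesis using ph1_lipschitz[OF that(1-3)] by linarith
  qed
  define a where "a = nat \<lceil>u0 l\<rceil>"
  have a: "u0 l \<le> real a" "real a < u0 l + 1" using u0_range[OF l] Apos by (auto simp: a_def) linarith
  have aA: "A < a" "a \<le> 3 * A"
  proof -
    show "A < a" using a u0_range[OF l] by linarith
    have "\<lceil>u0 l\<rceil> \<le> int (3 * A)" using u0_range[OF l] by (simp add: ceiling_le_iff)
    then show "a \<le> 3 * A" by (simp only: a_def nat_le_iff)
  qed
  have "ph1 (u0 l) - ph1 (real a) \<le> 1 / 4"
    using u0_range[OF l] a aA by (intro step) auto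
  moreover have "ph1 (real a) \<le> ph1 (u0 l)"
    using a u0_pos[OF good_pos[OF l]] by (intro ph1_antimono) auto
  ultimately have near: "real l - 1 / 4 \<le> ph1 (real a)" "ph1 (real a) \<le> real l"
    by (auto simp: ph1_u0[OF good_pos[OF l]])
  have "lab a = l"
  proof -
    have "real l - 1 < real (lab a)" "real (lab a) < real l + 1" using lab_near[of a] aA near by auto
    then show ?thesis by linarith
  qed
  then have "fib l \<noteq> {}" using aA by (auto simp: fib_def)
  then obtain m n where mn: "m \<le> n" "fib l = {m..n}" "A < m" "n \<le> 3 * A" by (rule fib_interval)
  have mem: "m \<in> fib l" "n \<in> fib l" using mn(1) by (simp_all add: mn(2))
  then have lab: "lab m = l" "lab n = l" by (simp_all add: fib_def)
  have "m - 1 \<notin> fib l" "n + 1 \<notin> fib l" using mn(1,3) by (auto simp: mn(2))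
  have 1: "real l + 1 / 2 \<le> ph1 (real (m - 1))"
  \<comment> \<open>\<open>A\<close> itself lies outside the range of summation, so its label says
    nothing; there the margin in \<open>good\<close> takes over.\<close>
  proof (cases "m - 1 = A")
    case True
    then show ?thesis using l by (simp add: good_def)
  next
    case False
    then have r: "m - 1 \<in> {A<..3 * A}" using mn by auto
    then have "lab (m - 1) \<noteq> l" using \<open>m - 1 \<notin> fib l\<close> by (simp add: fib_def)
    moreover have "lab m \<le> lab (m - 1)" using r Apos by (intro lab_antimono) auto
    ultimately have "real l + 1 \<le> real (lab (m - 1))" using lab by linarith
    moreover have "0 < m - 1" using r unfolding greaterThanAtMost_iff by linarith
    ultimately show ?thesis using lab_near(1)[of "m - 1"] by linarith
  qed
  have "ph1 (real (m - 1)) - ph1 (real m) \<le> 1 / 4"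
    using mn by (intro step) auto
  then have M: "real l + 1 / 4 \<le> ph1 (real m)" using 1 by simp
  have N: "ph1 (real n) \<le> real l - 1 / 4"
  proof (cases "n = 3 * A")
    case True
    then show ?thesis using l by (simp add: good_def)
  next
    case False
    then have r: "n + 1 \<in> {A<..3 * A}" using mn by auto
    then have "lab (n + 1) \<noteq> l" using \<open>n + 1 \<notin> fib l\<close> by (simp add: fib_def)
    moreover have "lab (n + 1) \<le> lab n" using mn Apos by (intro lab_antimono) auto
    ultimately have "real (lab (n + 1)) \<le> real l - 1" using lab by linarith
    then have "ph1 (real (n + 1)) \<le> real l - 1 / 2" using lab_near(2)[of "n + 1"] by simp
    moreover have "ph1 (real n) - ph1 (real (n + 1)) \<le> 1 / 4"
      using mn r by (intro step) auto
    ultimately show ?thesis by simp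
  qed
  show ?thesis using that[OF mn M N] .
qed

text \<open>By \<open>small\<close> the derivative changes by at most 1/4 within distance U = X /
  sqrt lam, so by \<open>fib_margin\<close> the window of stationary phase fits into the fibre. The
  three error terms come from passing to the integral, from the tails and from the cubic
  remainder.\<close>

lemma stationary_fib:
  assumes l: "l \<in> good" and X: "1 \<le> X" and small: "12 * X * sqrt (\<kappa> * \<tau>) \<le> real A"
  shows "norm ((\<Sum>a\<in>fib l. ee (ph (real a))) - ee ((1 / \<gamma> - 1) * real l * u0 l) * fresnel X * sqrt (u0 l / ((1 - \<gamma>) * real l)))
      \<le> 121 + 18 * real A / (X * sqrt (\<kappa> * \<tau>)) + 2592 * X ^ 4 * real A / (\<kappa> * \<tau>)"
proof -
  define q where "q = sqrt (\<kappa> * \<tau>)"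
  have q: "0 < q" "q\<^sup>2 = \<kappa> * \<tau>" using kap_pos tau_pos by (auto simp: q_def)
  have A0: "0 < real A" using Apos by simp
  have "12 * q \<le> 12 * X * q" using X q by simp
  also have "\<dots> \<le> real A" using small by (simp add: q_def)
  finally have "(12 * q)\<^sup>2 \<le> (real A)\<^sup>2" using q by (intro power_mono) auto
  then have small': "144 * (\<kappa> * \<tau>) \<le> real A ^ 2" by (simp add: power_mult_distrib q)
  obtain m n where mn: "m \<le> n" "fib l = {m..n}" "A < m" "n \<le> 3 * A"
    and mar: "real l + 1 / 4 \<le> ph1 (real m)" "ph1 (real n) \<le> real l - 1 / 4"
    using fib_margin[OF l small'] .
  note lpos = good_pos[OF l]
  note u0 = u0_pos[OF lpos] u0_range[OF l] ph1_u0[OF lpos]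
  define lam where "lam = - ph2 (u0 l)"
  define lmin where "lmin = q\<^sup>2 / (9 * real A ^ 2)"
  have lmin: "0 < lmin" "lmin \<le> lam" "lam \<le> q\<^sup>2 / real A ^ 2"
    using ph2_range[of "u0 l"] u0 q A0 kap_pos tau_pos by (auto simp: lmin_def lam_def)
  then have lam: "0 < lam" by simp
  define U where "U = X / sqrt lam"
  have U: "0 < U" using X lam by (simp add: U_def)
  have sl: "sqrt lam \<le> q / real A"
    using real_sqrt_le_mono[OF lmin(3)] q A0 by (simp add: real_sqrt_divide q_def)
  have sl': "q / (3 * real A) \<le> sqrt lam"
    using real_sqrt_le_mono[OF lmin(2)] q A0 by (simp add: lmin_def real_sqrt_divide real_sqrt_mult q_def)
  have Ule: "U \<le> 3 * X * real A / q"
  proof -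
    have "U \<le> X / (q / (3 * real A))" unfolding U_def using sl' X q A0 lam by (intro divide_left_mono) auto
    then show ?thesis by (simp add: mult_ac)
  qed
  have Umar: "U * (q\<^sup>2 / real A ^ 2) \<le> 1 / 4"
  proof -
    have "U * (q\<^sup>2 / real A ^ 2) \<le> (3 * X * real A / q) * (q\<^sup>2 / real A ^ 2)"
      using Ule by (intro mult_right_mono) auto
    also have "\<dots> = 3 * X * q / real A" using q(1) A0 by (simp add: power2_eq_square)
    also have "\<dots> \<le> 1 / 4" using small A0 by (simp add: q_def field_simps)
    finally show ?thesis .
  qed
  have in_m: "real m \<le> u0 l - U"
  proof (rule ccontr)
    assume neg: "\<not> real m \<le> u0 l - U"
    have "ph1 (real m) - ph1 (u0 l) < 1 / 4"
    proof (cases "real m \<le> u0 l")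
      case True
      have "ph1 (real m) - ph1 (u0 l) \<le> (u0 l - real m) * (q\<^sup>2 / real A ^ 2)"
        using ph1_lipschitz[of "real m" "u0 l"] mn True u0 q by simp
      also have "\<dots> < U * (q\<^sup>2 / real A ^ 2)" using neg q(1) A0 by (intro mult_strict_right_mono) auto
      finally show ?thesis using Umar by linarith
    next
      case False
      then show ?thesis using ph1_antimono[of "u0 l" "real m"] u0 by simp
    qed
    then show False using mar u0 by simp
  qed
  have in_n: "u0 l + U \<le> real n"
  proof (rule ccontr)
    assume neg: "\<not> u0 l + U \<le> real n"
    have "ph1 (u0 l) - ph1 (real n) < 1 / 4"
    proof (cases "u0 l \<le> real n")
      case True
      have "ph1 (u0 l) - ph1 (real n) \<le> (real n - u0 l) * (q\<^sup>2 / real A ^ 2)"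
        using ph1_lipschitz[of "u0 l" "real n"] mn True u0 q by simp
      also have "\<dots> < U * (q\<^sup>2 / real A ^ 2)" using neg q(1) A0 by (intro mult_strict_right_mono) auto
      finally show ?thesis using Umar by linarith
    next
      case False
      then show ?thesis using ph1_antimono[of "real n" "u0 l"] mn Apos by simp
    qed
    then show False using mar u0 by simp
  qed
  define M where "M = 2 * q\<^sup>2 / real A ^ 3"
  have M: "0 \<le> M" using q(1) A0 by (simp add: M_def)
  have pos: "0 < x" if "real m \<le> x" for x using that mn by linarith
  have df: "((\<lambda>u. ph u - real l * u) has_real_derivative (ph1 x - real l)) (at x)" if "real m \<le> x" for x
    using pos[OF that] by (auto intro!: derivative_eq_intros deriv_ph)
  have dg: "((\<lambda>u. ph1 u - real l) has_real_derivative ph2 x) (at x)" if "real m \<le> x" for x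
    using pos[OF that] by (auto intro!: derivative_eq_intros deriv_ph1)
  have cub: "\<bar>(ph (u0 l + v) - real l * (u0 l + v)) - (ph (u0 l) - real l * u0 l) + lam * v\<^sup>2 / 2\<bar> \<le> M * U ^ 3"
    if v: "\<bar>v\<bar> \<le> U" for v
  proof -
    have "\<bar>(ph (u0 l + v) - real l * (u0 l + v)) - (ph (u0 l) - real l * u0 l) + lam * v\<^sup>2 / 2\<bar> \<le> M * \<bar>v\<bar> ^ 3"
    proof (rule cubic_remainder[where g = "\<lambda>u. ph1 u - real l" and k = ph2 and kt = ph3 and a = "real m" and b = "real n"])
      show "\<bar>ph3 x\<bar> \<le> M" if "real m \<le> x" "x \<le> real n" for x
        using that mn ph3_bound[of x] by (simp add: M_def q mult_ac)
    qed (use in_m in_n v u0 pos in \<open>auto simp: lam_def intro!: df dg deriv_ph2\<close>)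
    also have "\<dots> \<le> M * U ^ 3" using v M by (intro mult_left_mono power_mono) auto
    finally show ?thesis .
  qed
  have "norm (integral {real m..real n} (\<lambda>u. ee (ph u - real l * u)) - ee (ph (u0 l) - real l * u0 l) * fresnel X / sqrt lam)
      \<le> 2 / (lmin * U) + 4 * pi * U * (M * U ^ 3)"
  proof (rule stationary_phase[where g = "\<lambda>u. ph1 u - real l" and k = ph2])
    show "continuous_on {real m..real n} ph2"
      using pos by (intro continuous_at_imp_continuous_on ballI DERIV_isCont[OF deriv_ph2]) auto
    show "ph2 x \<le> - lmin" if "real m \<le> x" "x \<le> real n" for x
      using that mn ph2_range(1)[of x] by (simp add: lmin_def q)
  qed (use lmin lam X u0 in_m in_n in \<open>auto simp: U_def[symmetric] intro!: df dg cub\<close>)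
  also have "2 / (lmin * U) \<le> 18 * real A / (X * q)"
  proof -
    have "2 / (lmin * U) = (18 * real A ^ 2 / (q\<^sup>2 * X)) * sqrt lam"
      using lam X by (simp add: lmin_def U_def field_simps)
    also have "\<dots> \<le> (18 * real A ^ 2 / (q\<^sup>2 * X)) * (q / real A)"
      using sl X by (intro mult_left_mono) auto
    also have "\<dots> = 18 * real A / (X * q)" using q(1) A0 by (simp add: power2_eq_square field_simps)
    finally show ?thesis .
  qed
  \<comment> \<open>2592 = 16 * 2 * 81, from pi < 4, the factor 2 in \<open>M\<close> and U <= 3 X A
    / q.\<close>
  also have "4 * pi * U * (M * U ^ 3) \<le> 2592 * X ^ 4 * real A / q\<^sup>2"
  proof -
    have "4 * pi * U * (M * U ^ 3) = 4 * pi * (M * U ^ 4)" by (simp add: power_def numeral_eq_Suc mult_ac)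
    also have "\<dots> \<le> 16 * (M * (3 * X * real A / q) ^ 4)"
      using Ule U M pi_less_4 by (intro mult_mono power_mono) auto
    also have "\<dots> = 2592 * X ^ 4 * real A / q\<^sup>2"
      using q(1) A0 by (simp add: M_def power_mult_distrib power_divide field_simps power2_eq_square power3_eq_cube power4_eq_xxxx)
    finally show ?thesis .
  qed
  finally have int: "norm (integral {real m..real n} (\<lambda>u. ee (ph u - real l * u)) - ee (ph (u0 l) - real l * u0 l) * fresnel X / sqrt lam)
      \<le> 18 * real A / (X * q) + 2592 * X ^ 4 * real A / q\<^sup>2" by simp
  \<comment> \<open>Homogeneity of the phase: at the stationary point \<open>ph\<close> equals l u0
    / \<gamma>.\<close>
  have e1: "ph (u0 l) - real l * u0 l = (1 / \<gamma> - 1) * real l * u0 l"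
    using ph_eq[OF u0(1)] u0(4) by (simp add: algebra_simps)
  have e2: "lam = (1 - \<gamma>) * real l / u0 l"
    using ph2_eq[OF u0(1)] u0(4) by (simp add: lam_def)
  have e3: "1 / complex_of_real (sqrt lam) = complex_of_real (sqrt (u0 l / ((1 - \<gamma>) * real l)))"
  proof -
    have "1 / sqrt lam = sqrt (1 / lam)" by (simp add: real_sqrt_divide)
    also have "1 / lam = u0 l / ((1 - \<gamma>) * real l)" by (simp add: e2)
    finally show ?thesis by (metis of_real_1 of_real_divide)
  qed
  have e4: "ee (ph (u0 l) - real l * u0 l) * fresnel X / complex_of_real (sqrt lam)
      = ee ((1 / \<gamma> - 1) * real l * u0 l) * fresnel X * sqrt (u0 l / ((1 - \<gamma>) * real l))"
    unfolding e1 e3[symmetric] by simp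
  show ?thesis
    using norm_triangle_ineq[of "(\<Sum>a\<in>fib l. ee (ph (real a))) - integral {real m..real n} (\<lambda>u. ee (ph u - real l * u))"
        "integral {real m..real n} (\<lambda>u. ee (ph u - real l * u)) - ee (ph (u0 l) - real l * u0 l) * fresnel X / sqrt lam"]
      fib_sum_integral[OF mn] int q(1)
    by (simp add: e4 flip: q_def q(2))
qed

lemma good_sub: "144 * (\<kappa> * \<tau>) \<le> real A ^ 2 \<Longrightarrow> good \<subseteq> lab ` {A<..3 * A}"
proof
  fix l assume *: "144 * (\<kappa> * \<tau>) \<le> real A ^ 2" "l \<in> good"
  obtain m n where "m \<le> n" "fib l = {m..n}" by (rule fib_margin[OF *(2,1)])
  then have "m \<in> fib l" by simp
  then show "l \<in> lab ` {A<..3 * A}" by (auto simp: fib_def)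
qed

text \<open>Stationary phase for the good labels and \<open>norm_fib_sum_le\<close> for the others.
  The latter lie in two windows of length 3/2 at the ends of the range of the derivative, and length
  plus one bounds their number by 5/2 in each.\<close>

lemma mono_sum_expand:
  assumes X: "1 \<le> X" and small: "12 * X * sqrt (\<kappa> * \<tau>) \<le> real A"
  shows "norm (mono_sum \<gamma> A y - fresnel X * (\<Sum>l\<in>good. ee ((1 / \<gamma> - 1) * real l * u0 l) * sqrt (u0 l / ((1 - \<gamma>) * real l))))
     \<le> \<tau> / real A * (121 + 18 * real A / (X * sqrt (\<kappa> * \<tau>)) + 2592 * X ^ 4 * real A / (\<kappa> * \<tau>))
        + 5 * (121 + 12 * real A / sqrt (\<kappa> * \<tau>))"
proof -
  define q where "q = sqrt (\<kappa> * \<tau>)"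
  have q: "0 < q" "q\<^sup>2 = \<kappa> * \<tau>" using kap_pos tau_pos by (auto simp: q_def)
  have A0: "0 < real A" using Apos by simp
  have "12 * q \<le> 12 * X * q" using X q by simp
  also have "\<dots> \<le> real A" using small by (simp add: q_def)
  finally have "(12 * q)\<^sup>2 \<le> (real A)\<^sup>2" using q by (intro power_mono) auto
  then have small': "144 * (\<kappa> * \<tau>) \<le> real A ^ 2" by (simp add: power_mult_distrib q)
  define R where "R = lab ` {A<..3 * A}"
  have R: "finite R" "good \<subseteq> R" using good_sub[OF small'] by (auto simp: R_def)
  define s where "s = (\<lambda>l. \<Sum>a\<in>fib l. ee (ph (real a)))"
  define t where "t = (\<lambda>l. ee ((1 / \<gamma> - 1) * real l * u0 l) * fresnel X * sqrt (u0 l / ((1 - \<gamma>) * real l)))"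
  define B1 where "B1 = 121 + 18 * real A / (X * sqrt (\<kappa> * \<tau>)) + 2592 * X ^ 4 * real A / (\<kappa> * \<tau>)"
  define B2 where "B2 = 121 + 12 * real A / sqrt (\<kappa> * \<tau>)"
  have B: "0 \<le> B1" "0 \<le> B2" using X kap_pos tau_pos by (auto simp: B1_def B2_def)
  have ms: "mono_sum \<gamma> A y = sum s R" by (simp add: mono_sum_fibs s_def R_def)
  have "mono_sum \<gamma> A y - (\<Sum>l\<in>good. t l) = (\<Sum>l\<in>good. s l - t l) + (\<Sum>l\<in>R - good. s l)"
    using R by (simp add: ms sum_subtractf sum.subset_diff[of good R])
  also have "norm \<dots> \<le> real (card good) * B1 + real (card (R - good)) * B2"
  proof (intro order.trans[OF norm_triangle_ineq] add_mono)
    have "norm (\<Sum>l\<in>good. s l - t l) \<le> (\<Sum>l\<in>good. B1)"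
      unfolding s_def t_def B1_def by (intro sum_norm_le stationary_fib X small)
    then show "norm (\<Sum>l\<in>good. s l - t l) \<le> real (card good) * B1" by simp
    have "norm (\<Sum>l\<in>R - good. s l) \<le> (\<Sum>l\<in>R - good. B2)"
      unfolding s_def B2_def by (intro sum_norm_le norm_fib_sum_le)
    then show "norm (\<Sum>l\<in>R - good. s l) \<le> real (card (R - good)) * B2" by simp
  qed
  also have "\<dots> \<le> \<tau> / real A * B1 + 5 * B2"
  proof (intro add_mono mult_right_mono B)
    show "real (card good) \<le> \<tau> / real A"
    proof (cases "ph1 (3 * real A) + 1 \<le> (ph1 (real A) - 1) + 1")
      case True
      have "real (card good) \<le> ph1 (real A) - 1 - (ph1 (3 * real A) + 1) + 1"
        unfolding good_def by (rule card_nat_between(2)[OF True])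
      also have "\<dots> \<le> ph1 (real A)" using ph1_pos[of "3 * real A"] A0 by simp
      also have "\<dots> \<le> \<gamma> * \<tau> / real A" using ph1_range(2)[of "real A"] A0 by simp
      also have "\<dots> \<le> \<tau> / real A" using gam tau_pos by (intro divide_right_mono) auto
      finally show ?thesis .
    next
      case False
      then have "good = {}" by (auto simp: good_def)
      then show ?thesis using tau_pos by simp
    qed
    let ?P = "{l. ph1 (3 * real A) - 1 / 2 \<le> real l \<and> real l \<le> ph1 (3 * real A) + 1}"
    let ?Q = "{l. ph1 (real A) - 1 \<le> real l \<and> real l \<le> ph1 (real A) + 1 / 2}"
    have "R - good \<subseteq> ?P \<union> ?Q"
    proof
      fix l assume l: "l \<in> R - good"
      then obtain a where "a \<in> {A<..3 * A}" "l = lab a" by (auto simp: R_def)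
      then show "l \<in> ?P \<union> ?Q" using lab_range[of a] l by (auto simp: good_def)
    qed
    then have "card (R - good) \<le> card (?P \<union> ?Q)"
      by (intro card_mono) (auto intro: card_nat_between(1))
    also have "\<dots> \<le> card ?P + card ?Q" by (rule card_Un_le)
    finally have "real (card (R - good)) \<le> real (card ?P) + real (card ?Q)" by linarith
    also have "\<dots> \<le> (ph1 (3 * real A) + 1 - (ph1 (3 * real A) - 1 / 2) + 1) + (ph1 (real A) + 1 / 2 - (ph1 (real A) - 1) + 1)"
      by (intro add_mono card_nat_between(2)) auto
    finally show "real (card (R - good)) \<le> 5" by simp
  qed
  finally show ?thesis
    by (simp add: B1_def B2_def t_def sum_distrib_left mult_ac)
qed

end

subsection \<open>Weyl differencing\<close>

definition wdiff :: "nat \<Rightarrow> (nat \<Rightarrow> complex) \<Rightarrow> nat \<Rightarrow> complex" where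
  "wdiff q z = (\<lambda>l. z (l + q) * cnj (z l))"

definition wdiffs :: "nat list \<Rightarrow> (nat \<Rightarrow> complex) \<Rightarrow> nat \<Rightarrow> complex" where
  "wdiffs qs z = fold wdiff qs z"

locale weyl_block =
  fixes K N Q :: nat
  assumes K: "0 < K" and Q: "0 < Q" "Q \<le> N"
begin

text \<open>Vanishing outside the block is included so that all correlations are sums over the same
  block, without shrinking ranges.\<close>

definition adm :: "(nat \<Rightarrow> complex) \<Rightarrow> bool" where
  "adm z \<longleftrightarrow> (\<forall>l. norm (z l) \<le> 1) \<and> (\<forall>l. l \<notin> {K..<K + N} \<longrightarrow> z l = 0)"

definition amp :: "(nat \<Rightarrow> complex) \<Rightarrow> real" where
  "amp z = norm (\<Sum>l\<in>{K..<K + N}. z l) / real N"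

lemma adm_wdiff: "adm z \<Longrightarrow> adm (wdiff q z)"
  by (auto simp: adm_def wdiff_def norm_mult mult_le_one)

lemma amp_nonneg: "0 \<le> amp z" by (simp add: amp_def)

lemma correlation:
  assumes z: "adm z" and rs: "r \<le> s" "s < Q"
  shows "(\<Sum>n\<in>{K..<K + N + Q}. z (n - r) * cnj (z (n - s))) = (\<Sum>l\<in>{K..<K + N}. wdiff (s - r) z l)"
proof -
  have "(\<Sum>l\<in>{K..<K + N}. wdiff (s - r) z l) = (\<Sum>n\<in>{K + s..<K + N + s}. z (n - r) * cnj (z (n - s)))"
    unfolding wdiff_def
    by (rule sum.reindex_bij_witness[of _ "\<lambda>n. n - s" "\<lambda>l. l + s"]) (use rs in auto)
  also have "\<dots> = (\<Sum>n\<in>{K..<K + N + Q}. z (n - r) * cnj (z (n - s)))"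
  proof (rule sum.mono_neutral_left)
    show "\<forall>i\<in>{K..<K + N + Q} - {K + s..<K + N + s}. z (i - r) * cnj (z (i - s)) = 0"
    proof
      fix i assume i: "i \<in> {K..<K + N + Q} - {K + s..<K + N + s}"
      \<comment> \<open>For \<open>i < s\<close> the truncated difference is 0, which is outside the
        block because \<open>K\<close> is positive.\<close>
      then have "i - s \<notin> {K..<K + N}" using K by auto
      then have "z (i - s) = 0" using z unfolding adm_def by blast
      then show "z (i - r) * cnj (z (i - s)) = 0" by simp
    qed
  qed (use rs in auto)
  finally show ?thesis ..
qed

text \<open>\<open>Q\<close> times the sum is a sum over n of \<open>Q\<close> shifted values.
  Cauchy-Schwarz over the \<open>N + Q\<close> (at most \<open>2 * N\<close>) values of n, then
  grouping by the difference of the two shifts, produces the correlations.\<close>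

lemma van_der_corput:
  assumes z: "adm z"
  shows "(amp z)\<^sup>2 \<le> 2 / real Q + 4 / real Q * (\<Sum>q\<in>{1..<Q}. amp (wdiff q z))"
proof -
  define S where "S = (\<Sum>l\<in>{K..<K + N}. z l)"
  define C where "C = (\<lambda>q. norm (\<Sum>l\<in>{K..<K + N}. wdiff q z l))"
  define R where "R = {K..<K + N + Q}"
  have shifted: "(\<Sum>n\<in>R. z (n - r)) = S" if "r < Q" for r
  proof -
    have "S = (\<Sum>n\<in>{K + r..<K + N + r}. z (n - r))"
      unfolding S_def by (rule sum.reindex_bij_witness[of _ "\<lambda>n. n - r" "\<lambda>l. l + r"]) auto
    also have "\<dots> = (\<Sum>n\<in>R. z (n - r))" unfolding R_def
    proof (rule sum.mono_neutral_left)
      show "\<forall>i\<in>{K..<K + N + Q} - {K + r..<K + N + r}. z (i - r) = 0"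
      proof
        fix i assume "i \<in> {K..<K + N + Q} - {K + r..<K + N + r}"
        then have "i - r \<notin> {K..<K + N}" using K by auto
        then show "z (i - r) = 0" using z unfolding adm_def by blast
      qed
    qed (use that in auto)
    finally show ?thesis ..
  qed
  have Q_S: "of_nat Q * S = (\<Sum>n\<in>R. \<Sum>r<Q. z (n - r))"
  proof -
    have "(\<Sum>n\<in>R. \<Sum>r<Q. z (n - r)) = (\<Sum>r<Q. \<Sum>n\<in>R. z (n - r))" by (rule sum.swap)
    also have "\<dots> = (\<Sum>r<Q. S)" by (intro sum.cong refl shifted) auto
    finally show ?thesis by simp
  qed
  have sq: "(norm (\<Sum>r<Q. z (n - r)))\<^sup>2 = Re (\<Sum>r<Q. \<Sum>s<Q. z (n - r) * cnj (z (n - s)))" for n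
  proof -
    have "complex_of_real ((norm (\<Sum>r<Q. z (n - r)))\<^sup>2) = (\<Sum>r<Q. \<Sum>s<Q. z (n - r) * cnj (z (n - s)))"
      by (simp add: complex_norm_square sum_product del: of_real_power)
    then show ?thesis by (metis Re_complex_of_real)
  qed
  have corr: "norm (\<Sum>n\<in>R. z (n - r) * cnj (z (n - s))) = C (if r \<le> s then s - r else r - s)" if "r < Q" "s < Q" for r s
  proof (cases "r \<le> s")
    case True
    then show ?thesis using correlation[OF z True that(2)] by (simp add: R_def C_def)
  next
    case False
    have "(\<Sum>n\<in>R. z (n - r) * cnj (z (n - s))) = cnj (\<Sum>n\<in>R. z (n - s) * cnj (z (n - r)))"
      by (simp add: mult.commute)
    also have "norm \<dots> = C (r - s)"
      using correlation[OF z, of s r] False that by (simp add: R_def C_def del: cnj_sum)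
    finally show ?thesis using False by simp
  qed
  have C0: "C 0 \<le> real N"
  proof -
    have "C 0 \<le> (\<Sum>l\<in>{K..<K + N}. 1)"
      unfolding C_def using adm_wdiff[OF z, of 0] by (intro sum_norm_le) (auto simp: adm_def)
    then show ?thesis by simp
  qed
  have C_nonneg: "0 \<le> C q" for q by (simp add: C_def)
  have pairs: "(\<Sum>s<Q. C (if r \<le> s then s - r else r - s)) \<le> C 0 + 2 * (\<Sum>q\<in>{1..<Q}. C q)" if "r < Q" for r
  proof -
    have "(\<Sum>s<Q. C (if r \<le> s then s - r else r - s)) = (\<Sum>s\<in>{..<r}. C (r - s)) + (\<Sum>s\<in>{r..<Q}. C (s - r))"
    proof -
      have "{..<Q} = {..<r} \<union> {r..<Q}" using that by auto
      then have "(\<Sum>s<Q. C (if r \<le> s then s - r else r - s)) =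
         (\<Sum>s\<in>{..<r}. C (if r \<le> s then s - r else r - s)) + (\<Sum>s\<in>{r..<Q}. C (if r \<le> s then s - r else r - s))"
        by (simp add: sum.union_disjoint ivl_disj_int)
      moreover have "(\<Sum>s\<in>{..<r}. C (if r \<le> s then s - r else r - s)) = (\<Sum>s\<in>{..<r}. C (r - s))"
        by (intro sum.cong) auto
      moreover have "(\<Sum>s\<in>{r..<Q}. C (if r \<le> s then s - r else r - s)) = (\<Sum>s\<in>{r..<Q}. C (s - r))"
        by (intro sum.cong) auto
      ultimately show ?thesis by simp
    qed
    also have "(\<Sum>s\<in>{..<r}. C (r - s)) \<le> (\<Sum>q\<in>{1..<Q}. C q)"
    proof -
      have "(\<Sum>s\<in>{..<r}. C (r - s)) = (\<Sum>q\<in>{1..r}. C q)"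
        by (rule sum.reindex_bij_witness[of _ "\<lambda>q. r - q" "\<lambda>s. r - s"]) auto
      also have "\<dots> \<le> (\<Sum>q\<in>{1..<Q}. C q)" using that by (intro sum_mono2) (auto simp: C_nonneg)
      finally show ?thesis .
    qed
    also have "(\<Sum>s\<in>{r..<Q}. C (s - r)) \<le> C 0 + (\<Sum>q\<in>{1..<Q}. C q)"
    proof -
      have "(\<Sum>s\<in>{r..<Q}. C (s - r)) = (\<Sum>q\<in>{0..<Q - r}. C q)"
        by (rule sum.reindex_bij_witness[of _ "\<lambda>q. q + r" "\<lambda>s. s - r"]) auto
      also have "\<dots> \<le> (\<Sum>q\<in>{0..<Q}. C q)" by (intro sum_mono2) (auto simp: C_nonneg)
      also have "\<dots> = C 0 + (\<Sum>q\<in>{1..<Q}. C q)" using Q by (simp add: sum.atLeast_Suc_lessThan)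
      finally show ?thesis .
    qed
    finally show ?thesis by simp
  qed
  have "(real Q * norm S)\<^sup>2 = (norm (\<Sum>n\<in>R. \<Sum>r<Q. z (n - r)))\<^sup>2"
    by (simp add: norm_mult flip: Q_S)
  also have "\<dots> \<le> (\<Sum>n\<in>R. norm (\<Sum>r<Q. z (n - r)))\<^sup>2"
    by (intro power_mono norm_sum) auto
  also have "\<dots> \<le> real (card R) * (\<Sum>n\<in>R. (norm (\<Sum>r<Q. z (n - r)))\<^sup>2)"
    using sum_squared_le_sum_of_squares[of "\<lambda>n. norm (\<Sum>r<Q. z (n - r))" R] by (simp add: mult.commute)
  also have "(\<Sum>n\<in>R. (norm (\<Sum>r<Q. z (n - r)))\<^sup>2) = Re (\<Sum>r<Q. \<Sum>s<Q. \<Sum>n\<in>R. z (n - r) * cnj (z (n - s)))"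
  proof -
    have "(\<Sum>n\<in>R. (norm (\<Sum>r<Q. z (n - r)))\<^sup>2) = Re (\<Sum>n\<in>R. \<Sum>r<Q. \<Sum>s<Q. z (n - r) * cnj (z (n - s)))"
      by (simp add: sq)
    also have "(\<Sum>n\<in>R. \<Sum>r<Q. \<Sum>s<Q. z (n - r) * cnj (z (n - s))) = (\<Sum>r<Q. \<Sum>n\<in>R. \<Sum>s<Q. z (n - r) * cnj (z (n - s)))"
      by (rule sum.swap)
    also have "\<dots> = (\<Sum>r<Q. \<Sum>s<Q. \<Sum>n\<in>R. z (n - r) * cnj (z (n - s)))"
      by (intro sum.cong refl sum.swap)
    finally show ?thesis .
  qed
  also have "\<dots> \<le> (\<Sum>r<Q. C 0 + 2 * (\<Sum>q\<in>{1..<Q}. C q))"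
  proof -
    have "Re (\<Sum>r<Q. \<Sum>s<Q. \<Sum>n\<in>R. z (n - r) * cnj (z (n - s))) \<le> norm (\<Sum>r<Q. \<Sum>s<Q. \<Sum>n\<in>R. z (n - r) * cnj (z (n - s)))"
      by (rule complex_Re_le_cmod)
    also have "\<dots> \<le> (\<Sum>r<Q. \<Sum>s<Q. C (if r \<le> s then s - r else r - s))"
      by (intro sum_norm_le order.trans[OF sum_norm_le order.refl]) (auto simp: corr)
    also have "\<dots> \<le> (\<Sum>r<Q. C 0 + 2 * (\<Sum>q\<in>{1..<Q}. C q))"
      by (intro sum_mono pairs) auto
    finally show ?thesis .
  qed
  finally have "(real Q * norm S)\<^sup>2 \<le> real (N + Q) * (real Q * (C 0 + 2 * (\<Sum>q\<in>{1..<Q}. C q)))"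
    by (simp add: R_def mult_left_mono)
  also have "\<dots> \<le> (2 * real N) * (real Q * (real N + 2 * (\<Sum>q\<in>{1..<Q}. C q)))"
    using Q C0 by (intro mult_mono add_mono) (auto intro!: add_nonneg_nonneg mult_nonneg_nonneg sum_nonneg simp: C_nonneg)
  finally have main: "(real Q)\<^sup>2 * (norm S)\<^sup>2 \<le> real Q * (2 * (real N)\<^sup>2 + 4 * real N * (\<Sum>q\<in>{1..<Q}. C q))"
    by (simp add: power_mult_distrib algebra_simps power2_eq_square)
  have N0: "0 < real N" "0 < real Q" using Q by auto
  have "(amp z)\<^sup>2 = (real Q)\<^sup>2 * (norm S)\<^sup>2 / ((real Q)\<^sup>2 * (real N)\<^sup>2)"
    using N0 by (simp add: amp_def S_def power_divide)
  also have "\<dots> \<le> real Q * (2 * (real N)\<^sup>2 + 4 * real N * (\<Sum>q\<in>{1..<Q}. C q)) / ((real Q)\<^sup>2 * (real N)\<^sup>2)"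
    by (intro divide_right_mono main) auto
  also have "\<dots> = 2 / real Q + 4 / real Q * ((\<Sum>q\<in>{1..<Q}. C q) / real N)"
    using N0 by (simp add: field_simps power2_eq_square)
  also have "(\<Sum>q\<in>{1..<Q}. C q) / real N = (\<Sum>q\<in>{1..<Q}. amp (wdiff q z))"
    by (simp add: amp_def C_def sum_divide_distrib)
  finally show ?thesis .
qed

text \<open>A mean over all \<open>k\<close>-fold differences. With a mean, the shifts need to be
  fixed only after summing over a family of functions, and it is that sum over the family which the
  large sieve bounds.\<close>

primrec avg_amp :: "nat \<Rightarrow> (nat \<Rightarrow> complex) \<Rightarrow> real" where
  "avg_amp 0 z = amp z"
| "avg_amp (Suc k) z = (\<Sum>q\<in>{1..<Q}. avg_amp k (wdiff q z)) / real Q"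

lemma avg_amp_square:
  assumes "adm z"
  shows "(avg_amp k z)\<^sup>2 \<le> 2 / real Q + 4 * avg_amp (Suc k) z"
  using assms
proof (induction k arbitrary: z)
  case 0
  then show ?case using van_der_corput[of z] by simp
next
  case (Suc k)
  have Q0: "0 < real Q" using Q by simp
  have "(\<Sum>q\<in>{1..<Q}. avg_amp k (wdiff q z))\<^sup>2 \<le> real (card {1..<Q}) * (\<Sum>q\<in>{1..<Q}. (avg_amp k (wdiff q z))\<^sup>2)"
    using sum_squared_le_sum_of_squares[of "\<lambda>q. avg_amp k (wdiff q z)" "{1..<Q}"] by (simp only: mult.commute)
  also have "\<dots> \<le> real Q * (\<Sum>q\<in>{1..<Q}. 2 / real Q + 4 * avg_amp (Suc k) (wdiff q z))"
    by (intro mult_mono sum_mono Suc.IH adm_wdiff Suc.prems) (auto intro!: sum_nonneg)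
  also have "\<dots> = real Q * (real (Q - 1) * (2 / real Q) + 4 * (\<Sum>q\<in>{1..<Q}. avg_amp (Suc k) (wdiff q z)))"
    by (simp add: sum.distrib sum_distrib_left del: avg_amp.simps)
  also have "\<dots> \<le> real Q * (real Q * (2 / real Q) + 4 * (\<Sum>q\<in>{1..<Q}. avg_amp (Suc k) (wdiff q z)))"
    by (intro mult_left_mono add_right_mono mult_right_mono) auto
  also have "\<dots> = real Q * (2 + 4 * (real Q * avg_amp (Suc (Suc k)) z))"
    using Q0 by (subst avg_amp.simps(2)[of "Suc k"]) simp
  finally have "(real Q * avg_amp (Suc k) z)\<^sup>2 \<le> real Q * (2 + 4 * (real Q * avg_amp (Suc (Suc k)) z))"
    using Q0 by (simp del: avg_amp.simps add: avg_amp.simps(2)[of k])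
  moreover have "real Q * (2 + 4 * (real Q * w)) = (real Q)\<^sup>2 * (2 / real Q + 4 * w)" for w
    using Q0 by (simp add: power2_eq_square algebra_simps)
  ultimately have "(real Q)\<^sup>2 * (avg_amp (Suc k) z)\<^sup>2 \<le> (real Q)\<^sup>2 * (2 / real Q + 4 * avg_amp (Suc (Suc k)) z)"
    by (simp only: power_mult_distrib)
  then show ?case by (rule mult_left_le_imp_le) (use Q0 in simp)
qed

text \<open>The square of 1 / Q + \<open>avg_amp k\<close> is at most 6 / Q + 8
  \<open>avg_amp (Suc k)\<close>, hence the factor 8.\<close>

primrec weyl_const :: "nat \<Rightarrow> real" where
  "weyl_const 0 = 1"
| "weyl_const (Suc k) = 8 * (weyl_const k)\<^sup>2"

lemma weyl_const_pos: "0 < weyl_const k" by (induction k) auto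

lemma weyl_iterate:
  assumes "adm z"
  shows "amp z ^ (2 ^ k) \<le> weyl_const k * (1 / real Q + avg_amp k z)"
proof (induction k)
  case 0
  then show ?case by simp
next
  case (Suc k)
  have Q1: "0 < real Q" "1 / real Q \<le> 1" and iQ: "0 \<le> inverse (real Q)" using Q by auto
  have aux: "a \<le> 8 * (i + w)" if "a \<le> 2 * b + 2 * c" "b \<le> i" "c \<le> 2 * i + 4 * w" "0 \<le> i" for a b c i w :: real
    using that by argo
  have "amp z ^ (2 ^ Suc k) = (amp z ^ (2 ^ k))\<^sup>2" by (simp add: power_mult[symmetric] mult.commute)
  also have "\<dots> \<le> (weyl_const k * (1 / real Q + avg_amp k z))\<^sup>2"
    by (intro power_mono Suc zero_le_power amp_nonneg)
  also have "\<dots> = (weyl_const k)\<^sup>2 * (1 / real Q + avg_amp k z)\<^sup>2" by (simp add: power_mult_distrib)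
  also have "\<dots> \<le> (weyl_const k)\<^sup>2 * (8 * (1 / real Q + avg_amp (Suc k) z))"
  proof (intro mult_left_mono)
    have "(1 / real Q + avg_amp k z)\<^sup>2 \<le> 2 * (1 / real Q)\<^sup>2 + 2 * (avg_amp k z)\<^sup>2"
      using sum_squares_bound[of "1 / real Q" "avg_amp k z"] by (simp add: power2_sum)
    moreover have "(1 / real Q)\<^sup>2 \<le> 1 / real Q"
      using Q1 power_decreasing[of 1 2 "1 / real Q"] by simp
    ultimately show "(1 / real Q + avg_amp k z)\<^sup>2 \<le> 8 * (1 / real Q + avg_amp (Suc k) z)"
      using avg_amp_square[OF assms, of k] iQ by (intro aux) (simp_all only: divide_inverse mult_1)
  qed simp
  finally show ?case by (simp only: weyl_const.simps mult_ac)
qed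

lemma avg_amp_sum_le:
  assumes "\<And>qs. length qs = k \<Longrightarrow> set qs \<subseteq> {1..<Q} \<Longrightarrow> (\<Sum>y\<in>Y. amp (wdiffs qs (z y))) \<le> B" "0 \<le> B"
  shows "(\<Sum>y\<in>Y. avg_amp k (z y)) \<le> B"
  using assms(1)
proof (induction k arbitrary: z)
  case 0
  then show ?case using 0[of "[]"] by (simp add: wdiffs_def)
next
  case (Suc k)
  have Q0: "0 < real Q" using Q by simp
  have IH: "(\<Sum>y\<in>Y. avg_amp k (wdiff q (z y))) \<le> B" if "q \<in> {1..<Q}" for q
  proof (rule Suc.IH)
    fix qs :: "nat list" assume "length qs = k" "set qs \<subseteq> {1..<Q}"
    then show "(\<Sum>y\<in>Y. amp (wdiffs qs (wdiff q (z y)))) \<le> B"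
      using Suc.prems[of "q # qs"] that by (simp add: wdiffs_def)
  qed
  have "(\<Sum>y\<in>Y. avg_amp (Suc k) (z y)) = (\<Sum>y\<in>Y. \<Sum>q\<in>{1..<Q}. avg_amp k (wdiff q (z y))) / real Q"
    by (simp add: sum_divide_distrib)
  also have "(\<Sum>y\<in>Y. \<Sum>q\<in>{1..<Q}. avg_amp k (wdiff q (z y))) = (\<Sum>q\<in>{1..<Q}. \<Sum>y\<in>Y. avg_amp k (wdiff q (z y)))"
    by (rule sum.swap)
  also have "\<dots> \<le> (\<Sum>q\<in>{1..<Q}. B)" by (intro sum_mono IH)
  also have "\<dots> \<le> real Q * B" using assms(2) by (simp add: mult_right_mono)
  finally show ?case using Q0 by (simp add: divide_right_mono field_simps)
qed

lemma weyl_average: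
  assumes "\<And>y. y \<in> Y \<Longrightarrow> adm (z y)"
    and "\<And>qs. length qs = k \<Longrightarrow> set qs \<subseteq> {1..<Q} \<Longrightarrow> (\<Sum>y\<in>Y. amp (wdiffs qs (z y))) \<le> B" "0 \<le> B"
  shows "(\<Sum>y\<in>Y. amp (z y) ^ (2 ^ k)) \<le> weyl_const k * (real (card Y) / real Q + B)"
proof -
  have "(\<Sum>y\<in>Y. amp (z y) ^ (2 ^ k)) \<le> (\<Sum>y\<in>Y. weyl_const k * (1 / real Q + avg_amp k (z y)))"
    by (intro sum_mono weyl_iterate assms(1))
  also have "\<dots> = weyl_const k * (real (card Y) / real Q + (\<Sum>y\<in>Y. avg_amp k (z y)))"
    by (simp add: sum.distrib flip: sum_distrib_left)
  also have "\<dots> \<le> weyl_const k * (real (card Y) / real Q + B)"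
    using weyl_const_pos[of k] by (intro mult_left_mono add_left_mono avg_amp_sum_le assms(2,3)) auto
  finally show ?thesis .
qed

end

subsection \<open>A large sieve inequality\<close>

abbreviation gauss :: "real measure" where "gauss \<equiv> std_normal_distribution"

text \<open>The radius 2 covers sample points in [-1, 1] together with windows of radius at most
  1.\<close>

lemma gauss_density_ge:
  assumes "\<bar>s\<bar> \<le> 2"
  shows "1 \<le> 25 * std_normal_density s"
proof -
  have "s\<^sup>2 \<le> 2\<^sup>2" using assms by (metis abs_le_square_iff abs_numeral)
  then have "exp (- 2) \<le> exp (- s\<^sup>2 / 2)" by simp
  moreover have "exp 2 \<le> (25 / 3 :: real)"
  proof -
    have "exp 2 = (exp 1 :: real)\<^sup>2" by (simp add: power2_eq_square flip: exp_add)
    also have "\<dots> \<le> (272 / 100)\<^sup>2" using e_less_272 by (intro power_mono) auto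
    finally show ?thesis by (simp add: power2_eq_square)
  qed
  then have "3 / 25 \<le> exp (- 2 :: real)" by (simp add: exp_minus field_simps)
  ultimately have 1: "3 / 25 \<le> exp (- s\<^sup>2 / 2)" by linarith
  have "sqrt (2 * pi) \<le> sqrt 9" using pi_less_4 by (intro real_sqrt_le_mono) auto
  then have 2: "sqrt (2 * pi) \<le> 3" by simp
  have "1 / 3 \<le> 1 / sqrt (2 * pi)" using 2 by (intro divide_left_mono) auto
  then have "1 / 3 * (3 / 25) \<le> 1 / sqrt (2 * pi) * exp (- s\<^sup>2 / 2)"
    using 1 by (intro mult_mono) auto
  then show ?thesis by (simp add: std_normal_density_def)
qed

lemma integral_le_gauss:
  fixes f :: "real \<Rightarrow> real"
  assumes cont: "continuous_on UNIV f" and nonneg: "\<And>s. 0 \<le> f s" and ab: "- 2 \<le> a" "b \<le> 2"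
  shows "integral {a..b} f \<le> 25 * (LINT s|gauss. indicator {a..b} s * f s)"
proof -
  have si: "set_integrable lborel {a..b} f"
    by (rule borel_integrable_atLeastAtMost') (rule continuous_on_subset[OF cont], simp)
  have si2: "set_integrable lborel {a..b} (\<lambda>s. std_normal_density s * f s)"
    unfolding normal_density_def
    by (rule borel_integrable_atLeastAtMost') (auto intro!: continuous_intros continuous_on_subset[OF cont])
  have meas: "f \<in> borel_measurable borel" using cont by (rule borel_measurable_continuous_onI)
  have "integral {a..b} f = (LINT s|lborel. indicator {a..b} s * f s)"
    using set_borel_integral_eq_integral(2)[OF si] by (simp add: set_lebesgue_integral_def)
  also have "\<dots> \<le> (LINT s|lborel. 25 * (std_normal_density s * (indicator {a..b} s * f s)))"
  proof (rule integral_mono)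
    show "integrable lborel (\<lambda>s. indicator {a..b} s * f s)"
      using si by (simp add: set_integrable_def)
    show "integrable lborel (\<lambda>s. 25 * (std_normal_density s * (indicator {a..b} s * f s)))"
      using si2 by (intro integrable_mult_right) (simp add: set_integrable_def mult_ac)
    fix s
    show "indicator {a..b} s * f s \<le> 25 * (std_normal_density s * (indicator {a..b} s * f s))"
    proof (cases "s \<in> {a..b}")
      case True
      then have "1 * f s \<le> (25 * std_normal_density s) * f s"
        using ab nonneg gauss_density_ge[of s] by (intro mult_right_mono) auto
      then show ?thesis using True by simp
    qed simp
  qed
  also have "\<dots> = 25 * (LINT s|gauss. indicator {a..b} s * f s)"
    using meas by (subst integral_density) auto
  finally show ?thesis .
qed

text \<open>\<open>G c\<close> exceeds each \<open>G s\<close> by at most the integral of the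
  majorant \<open>h\<close> over the whole window; averaging over s gives Gallagher's form of the
  Sobolev inequality.\<close>

lemma gallagher:
  fixes G G' h :: "real \<Rightarrow> real"
  assumes G: "\<And>t. (G has_real_derivative G' t) (at t)" and G'h: "\<And>t. G' t \<le> h t" "\<And>t. - G' t \<le> h t"
    and cont: "continuous_on UNIV G'" "continuous_on UNIV h" and r: "0 < r"
  shows "2 * r * G c \<le> integral {c - r..c + r} (\<lambda>s. G s + 2 * r * h s)"
proof -
  let ?I = "{c - r..c + r}"
  have h0: "0 \<le> h t" for t using G'h[of t] by linarith
  have inth: "h integrable_on {a..b}" for a b
    by (intro integrable_continuous_interval continuous_on_subset[OF cont(2)]) auto
  have contG: "continuous_on S G" for S
    using G by (intro continuous_at_imp_continuous_on ballI DERIV_isCont) auto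
  have key: "G c \<le> G s + integral ?I h" if s: "s \<in> ?I" for s
  proof -
    have ftc: "integral {a..b} G' = G b - G a" "G' integrable_on {a..b}" if "a \<le> b" for a b
    proof -
      have "(G' has_integral G b - G a) {a..b}"
        by (rule fundamental_theorem_of_calculus[OF that])
           (use G in \<open>auto simp: has_real_derivative_iff_has_vector_derivative[symmetric] intro: has_field_derivative_at_within\<close>)
      then show "integral {a..b} G' = G b - G a" "G' integrable_on {a..b}" by (auto dest: integral_unique)
    qed
    have sub: "integral {a..b} h \<le> integral ?I h" if "{a..b} \<subseteq> ?I" for a b
      using that h0 by (intro integral_subset_le inth) auto
    show ?thesis
    proof (cases "s \<le> c")
      case True
      have "G c - G s \<le> integral {s..c} h"
        unfolding ftc(1)[OF True, symmetric] by (intro integral_le ftc(2)[OF True] inth G'h)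
      also have "\<dots> \<le> integral ?I h" using s True r by (intro sub) auto
      finally show ?thesis by simp
    next
      case False
      then have cs: "c \<le> s" by simp
      have "- (G s - G c) = integral {c..s} (\<lambda>t. - G' t)"
        by (simp add: ftc(1)[OF cs])
      also have "\<dots> \<le> integral {c..s} h"
        by (intro integral_le inth G'h integrable_neg ftc(2)[OF cs])
      also have "\<dots> \<le> integral ?I h" using s False r by (intro sub) auto
      finally show ?thesis by simp
    qed
  qed
  have "2 * r * G c = integral ?I (\<lambda>s. G c)" using r by simp
  also have "\<dots> \<le> integral ?I (\<lambda>s. G s + integral ?I h)"
    using key by (intro integral_le integrable_continuous_interval continuous_intros contG) auto
  also have "\<dots> = integral ?I G + 2 * r * integral ?I h"
    using r by (subst Henstock_Kurzweil_Integration.integral_add) (auto intro!: integrable_continuous_interval continuous_intros contG)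
  also have "\<dots> = integral ?I G + integral ?I (\<lambda>s. 2 * r * h s)"
    by simp
  also have "\<dots> = integral ?I (\<lambda>s. G s + 2 * r * h s)"
    by (subst Henstock_Kurzweil_Integration.integral_add)
       (auto intro!: integrable_continuous_interval continuous_intros contG continuous_on_subset[OF cont(2)])
  finally show ?thesis .
qed

context
  fixes Y :: "'a set"
  assumes finY: "finite Y"
begin

definition trig :: "('a \<Rightarrow> real) \<Rightarrow> ('a \<Rightarrow> complex) \<Rightarrow> real \<Rightarrow> complex" where
  "trig x e s = (\<Sum>y\<in>Y. e y * ee (x y * s))"

text \<open>By the characteristic function of the normal distribution this is the Gaussian mean
  square of \<open>trig\<close> with all coefficients 1. Its terms are positive, so coefficients of
  modulus at most 1 can be estimated trivially; in essence it counts pairs of points at distance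
  O(1).\<close>

definition gauss_form :: "('a \<Rightarrow> real) \<Rightarrow> real" where
  "gauss_form x = (\<Sum>y\<in>Y. \<Sum>y'\<in>Y. exp (- (2 * pi * (x y - x y'))\<^sup>2 / 2))"

lemma gauss_form_nonneg: "0 \<le> gauss_form x"
  by (auto simp: gauss_form_def intro!: sum_nonneg)

lemma continuous_trig: "continuous_on S (trig x e)"
  unfolding trig_def by (intro continuous_intros)

lemma norm_trig_le: "(\<And>y. y \<in> Y \<Longrightarrow> norm (e y) \<le> 1) \<Longrightarrow> norm (trig x e s) \<le> real (card Y)"
  unfolding trig_def using sum_norm_le[of Y "\<lambda>y. e y * ee (x y * s)" "\<lambda>_. 1"] by (auto simp: norm_mult)

lemma gauss_mean_square:
  assumes e: "\<And>y. y \<in> Y \<Longrightarrow> norm (e y) \<le> 1"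
  shows "integrable gauss (\<lambda>s. (norm (trig x e s))\<^sup>2)" "(LINT s|gauss. (norm (trig x e s))\<^sup>2) \<le> gauss_form x"
proof -
  interpret real_distribution gauss by (rule real_dist_normal_dist)
  have meas: "trig x e \<in> borel_measurable borel"
    by (intro borel_measurable_continuous_onI continuous_trig)
  show int: "integrable gauss (\<lambda>s. (norm (trig x e s))\<^sup>2)"
    by (rule integrable_const_bound[where B = "(real (card Y))\<^sup>2"])
       (use norm_trig_le[OF e] meas in \<open>auto intro!: power_mono AE_I2\<close>)
  have ie: "integrable gauss (\<lambda>s. ee (t * s))" for t
    by (rule integrable_const_bound[where B = 1]) (auto intro!: borel_measurable_continuous_onI continuous_intros)
  have ch: "(LINT s|gauss. ee (t * s)) = complex_of_real (exp (- (2 * pi * t)\<^sup>2 / 2))" for t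
  proof -
    have "(LINT s|gauss. ee (t * s)) = char gauss (2 * pi * t)"
      unfolding char_def ee_exp by (simp add: mult_ac)
    then show ?thesis by (simp add: char_std_normal_distribution)
  qed
  have "complex_of_real (LINT s|gauss. (norm (trig x e s))\<^sup>2) = (LINT s|gauss. complex_of_real ((norm (trig x e s))\<^sup>2))"
    by (rule integral_complex_of_real[symmetric])
  also have "\<dots> = (LINT s|gauss. (\<Sum>y\<in>Y. \<Sum>y'\<in>Y. (e y * cnj (e y')) * ee ((x y - x y') * s)))"
  proof (rule Bochner_Integration.integral_cong[OF refl])
    fix s
    have "complex_of_real ((norm (trig x e s))\<^sup>2) = trig x e s * cnj (trig x e s)"
      by (rule complex_norm_square)
    also have "\<dots> = (\<Sum>y\<in>Y. \<Sum>y'\<in>Y. (e y * ee (x y * s)) * (cnj (e y') * ee (- (x y' * s))))"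
      by (simp add: trig_def sum_product)
    also have "\<dots> = (\<Sum>y\<in>Y. \<Sum>y'\<in>Y. (e y * cnj (e y')) * ee ((x y - x y') * s))"
      by (intro sum.cong refl) (simp add: left_diff_distrib ee_diff)
    finally show "complex_of_real ((norm (trig x e s))\<^sup>2) = (\<Sum>y\<in>Y. \<Sum>y'\<in>Y. (e y * cnj (e y')) * ee ((x y - x y') * s))" .
  qed
  also have "\<dots> = (\<Sum>y\<in>Y. \<Sum>y'\<in>Y. (e y * cnj (e y')) * complex_of_real (exp (- (2 * pi * (x y - x y'))\<^sup>2 / 2)))"
    by (simp add: ie ch)
  finally have eq: "complex_of_real (LINT s|gauss. (norm (trig x e s))\<^sup>2) =
      (\<Sum>y\<in>Y. \<Sum>y'\<in>Y. (e y * cnj (e y')) * complex_of_real (exp (- (2 * pi * (x y - x y'))\<^sup>2 / 2)))" .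
  have "(LINT s|gauss. (norm (trig x e s))\<^sup>2) \<le> norm (complex_of_real (LINT s|gauss. (norm (trig x e s))\<^sup>2))"
    by simp
  also have "\<dots> \<le> gauss_form x"
    unfolding eq gauss_form_def
  proof (intro sum_norm_le order.trans[OF sum_norm_le order.refl])
    fix y y' assume yy: "y \<in> Y" "y' \<in> Y"
    have "norm (e y * cnj (e y')) * exp (- (2 * pi * (x y - x y'))\<^sup>2 / 2) \<le> 1 * exp (- (2 * pi * (x y - x y'))\<^sup>2 / 2)"
      using e[OF yy(1)] e[OF yy(2)] by (intro mult_right_mono) (auto simp: norm_mult mult_le_one)
    then show "norm (e y * cnj (e y') * complex_of_real (exp (- (2 * pi * (x y - x y'))\<^sup>2 / 2))) \<le> exp (- (2 * pi * (x y - x y'))\<^sup>2 / 2)"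
      by (simp add: norm_mult)
  qed
  finally show "(LINT s|gauss. (norm (trig x e s))\<^sup>2) \<le> gauss_form x" .
qed

text \<open>Gallagher's inequality on disjoint windows around the points \<open>d l\<close>. The
  derivative of \<open>trig x e\<close> is 2 pi i X times another \<open>trig\<close>, with
  coefficients \<open>e y * (x y / X)\<close> of modulus at most 1, so the same
  \<open>gauss_form\<close> bounds both mean squares.\<close>

lemma large_sieve:
  fixes d :: "'b \<Rightarrow> real"
  assumes e: "\<And>y. y \<in> Y \<Longrightarrow> norm (e y) \<le> 1" and x: "\<And>y. y \<in> Y \<Longrightarrow> \<bar>x y\<bar> \<le> X" and X: "0 < X"
    and L: "finite L" "\<And>l. l \<in> L \<Longrightarrow> \<bar>d l\<bar> \<le> 1"
    and del: "0 < \<delta>" "\<delta> \<le> 1" "\<And>l l'. l \<in> L \<Longrightarrow> l' \<in> L \<Longrightarrow> l \<noteq> l' \<Longrightarrow> \<delta> \<le> \<bar>d l - d l'\<bar>"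
  shows "(\<Sum>l\<in>L. (norm (trig x e (d l)))\<^sup>2) \<le> 400 * (1 / \<delta> + X) * gauss_form x"
proof -
  interpret real_distribution gauss by (rule real_dist_normal_dist)
  define e2 where "e2 = (\<lambda>y. e y * (x y / X))"
  have e2: "norm (e2 y) \<le> 1" if "y \<in> Y" for y
  proof -
    have "norm (e2 y) = norm (e y) * (\<bar>x y\<bar> / X)" using X by (simp add: e2_def norm_mult norm_divide)
    also have "\<dots> \<le> 1" using e[OF that] x[OF that] X by (intro mult_le_one) auto
    finally show ?thesis .
  qed
  define R R2 where "R = trig x e" and "R2 = trig x e2"
  define R' where "R' = (\<lambda>s. 2 * pi * \<i> * X * R2 s)"
  have dR: "(R has_vector_derivative R' s) (at s)" for s
  proof -
    have "((\<lambda>s. \<Sum>y\<in>Y. e y * ee (x y * s)) has_vector_derivative (\<Sum>y\<in>Y. e y * (2 * pi * \<i> * x y * ee (x y * s)))) (at s)"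
      by (intro has_vector_derivative_sum has_vector_derivative_mult_right has_vector_derivative_ee)
         (auto intro!: derivative_eq_intros)
    moreover have "(\<Sum>y\<in>Y. e y * (2 * pi * \<i> * x y * ee (x y * s))) = R' s"
      using X by (simp add: R'_def R2_def trig_def e2_def sum_distrib_left mult_ac)
    ultimately show ?thesis by (simp add: R_def trig_def[abs_def])
  qed
  define G where "G = (\<lambda>s. (norm (R s))\<^sup>2)"
  define G' where "G' = (\<lambda>s. 2 * (Re (R s) * Re (R' s) + Im (R s) * Im (R' s)))"
  define h where "h = (\<lambda>s. 2 * pi * X * ((norm (R s))\<^sup>2 + (norm (R2 s))\<^sup>2))"
  have dG: "(G has_real_derivative G' s) (at s)" for s
  proof -
    have re: "((\<lambda>s. Re (R s)) has_real_derivative Re (R' s)) (at s)"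
      using dR[of s] by (simp add: has_vector_derivative_complex_iff has_real_derivative_iff_has_vector_derivative)
    have im: "((\<lambda>s. Im (R s)) has_real_derivative Im (R' s)) (at s)"
      using dR[of s] by (simp add: has_vector_derivative_complex_iff has_real_derivative_iff_has_vector_derivative)
    show ?thesis
      unfolding G_def G'_def cmod_power2
      by (rule DERIV_cong[OF DERIV_add[OF DERIV_power[OF re, of 2] DERIV_power[OF im, of 2]]]) simp
  qed
  have G'h: "\<bar>G' s\<bar> \<le> h s" for s
  proof -
    have "G' s = 2 * Re (cnj (R s) * R' s)" by (simp add: G'_def)
    then have "\<bar>G' s\<bar> \<le> 2 * norm (cnj (R s) * R' s)" using abs_Re_le_cmod[of "cnj (R s) * R' s"] by simp
    also have "\<dots> = 2 * pi * X * (2 * norm (R s) * norm (R2 s))"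
      using X by (simp add: R'_def norm_mult)
    also have "\<dots> \<le> h s"
      unfolding h_def using X sum_squares_bound[of "norm (R s)" "norm (R2 s)"] by (intro mult_left_mono) auto
    finally show ?thesis .
  qed
  have contR: "continuous_on S R" "continuous_on S R2" for S by (auto simp: R_def R2_def intro: continuous_trig)
  have contG': "continuous_on UNIV G'" unfolding G'_def R'_def by (intro continuous_intros contR)
  have conth: "continuous_on UNIV h" unfolding h_def by (intro continuous_intros contR)
  have contG: "continuous_on UNIV G" unfolding G_def by (intro continuous_intros contR)
  \<comment> \<open>A third of the separation instead of a half, so that the closed windows are
    disjoint.\<close>
  define r where "r = \<delta> / 3"
  have r: "0 < r" "r \<le> 1" using del by (auto simp: r_def)
  define f where "f = (\<lambda>s. G s + 2 * r * h s)"
  have f0: "0 \<le> f s" for s using X r by (auto simp: f_def G_def h_def)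
  have contf: "continuous_on UNIV f" unfolding f_def by (intro continuous_intros contG conth)
  have intG: "integrable gauss G" unfolding G_def R_def by (rule gauss_mean_square[OF e])
  have intR2: "integrable gauss (\<lambda>s. (norm (R2 s))\<^sup>2)" unfolding R2_def by (rule gauss_mean_square[OF e2])
  have inth: "integrable gauss h" unfolding h_def using intG intR2 by (simp add: G_def)
  have intf: "integrable gauss f" unfolding f_def using intG inth by simp
  have LG: "(LINT s|gauss. G s) \<le> gauss_form x" unfolding G_def R_def by (rule gauss_mean_square[OF e])
  have LR2: "(LINT s|gauss. (norm (R2 s))\<^sup>2) \<le> gauss_form x" unfolding R2_def by (rule gauss_mean_square[OF e2])
  define I where "I = (\<lambda>l. {d l - r..d l + r})"
  have int_ind: "integrable gauss (\<lambda>s. indicator (I l) s * f s)" for l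
    using integrable_mult_indicator[OF _ intf, of "I l"] by (simp add: I_def)
  have disj: "(\<Sum>l\<in>L. indicator (I l) s) \<le> (1::real)" for s
  proof (cases "\<exists>l\<in>L. s \<in> I l")
    case False
    then have "(\<Sum>l\<in>L. indicator (I l) s) = (0::real)" by (intro sum.neutral) auto
    then show ?thesis by simp
  next
    case True
    then obtain l where l: "l \<in> L" "s \<in> I l" by blast
    have "(\<Sum>l'\<in>L. indicator (I l') s) = (\<Sum>l'\<in>{l}. indicator (I l') s :: real)"
    proof (rule sum.mono_neutral_right)
      show "\<forall>i\<in>L - {l}. indicator (I i) s = (0::real)"
      proof
        fix i assume i: "i \<in> L - {l}"
        have "s \<notin> I i"
        proof
          assume "s \<in> I i"
          then have "\<bar>d l - d i\<bar> \<le> 2 * r" using l by (auto simp: I_def)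
          then show False using del(3)[of l i] i l(1) del(1) by (auto simp: r_def)
        qed
        then show "indicator (I i) s = (0::real)" by simp
      qed
    qed (use L l in auto)
    then show ?thesis using l by simp
  qed
  have "(\<Sum>l\<in>L. 2 * r * G (d l)) \<le> (\<Sum>l\<in>L. 25 * (LINT s|gauss. indicator (I l) s * f s))"
  proof (rule sum_mono)
    fix l assume l: "l \<in> L"
    have "2 * r * G (d l) \<le> integral {d l - r..d l + r} f"
      unfolding f_def by (rule gallagher[OF dG _ _ contG' conth r(1)]) (use G'h in \<open>auto simp: abs_le_iff\<close>)
    also have "\<dots> \<le> 25 * (LINT s|gauss. indicator {d l - r..d l + r} s * f s)"
      using L(2)[OF l] r by (intro integral_le_gauss contf f0) (auto simp: abs_le_iff)
    finally show "2 * r * G (d l) \<le> 25 * (LINT s|gauss. indicator (I l) s * f s)" by (simp add: I_def)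
  qed
  also have "\<dots> = 25 * (LINT s|gauss. (\<Sum>l\<in>L. indicator (I l) s * f s))"
    using int_ind by (simp add: sum_distrib_left)
  also have "\<dots> \<le> 25 * (LINT s|gauss. f s)"
  proof (intro mult_left_mono integral_mono intf)
    show "integrable gauss (\<lambda>s. \<Sum>l\<in>L. indicator (I l) s * f s)" using int_ind by simp
    fix s
    have "(\<Sum>l\<in>L. indicator (I l) s * f s) = (\<Sum>l\<in>L. indicator (I l) s) * f s" by (simp add: sum_distrib_right)
    also have "\<dots> \<le> 1 * f s" by (intro mult_right_mono disj f0)
    finally show "(\<Sum>l\<in>L. indicator (I l) s * f s) \<le> f s" by simp
  qed simp
  also have "(LINT s|gauss. f s) = (LINT s|gauss. G s) + 2 * r * (LINT s|gauss. h s)"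
    unfolding f_def using intG inth by simp
  also have "(LINT s|gauss. h s) = 2 * pi * X * ((LINT s|gauss. G s) + (LINT s|gauss. (norm (R2 s))\<^sup>2))"
    unfolding h_def using intG intR2 by (simp add: G_def)
  also have "25 * ((LINT s|gauss. G s) + 2 * r * (2 * pi * X * ((LINT s|gauss. G s) + (LINT s|gauss. (norm (R2 s))\<^sup>2))))
      \<le> 25 * (gauss_form x + 2 * r * (2 * pi * X * (gauss_form x + gauss_form x)))"
    using r X by (intro mult_left_mono add_mono LG LR2) auto
  finally have "2 * r * (\<Sum>l\<in>L. G (d l)) \<le> 25 * (gauss_form x + 2 * r * (2 * pi * X * (gauss_form x + gauss_form x)))"
    by (simp add: sum_distrib_left)
  then have "(\<Sum>l\<in>L. G (d l)) \<le> 25 * (gauss_form x + 2 * r * (2 * pi * X * (gauss_form x + gauss_form x))) / (2 * r)"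
    using r by (simp add: pos_le_divide_eq mult_ac)
  also have "\<dots> = (75 / 2 / \<delta> + 100 * pi * X) * gauss_form x"
    using del by (simp add: r_def field_simps)
  also have "\<dots> \<le> (400 / \<delta> + 400 * X) * gauss_form x"
    using pi_less_4 X del by (intro mult_right_mono add_mono gauss_form_nonneg divide_right_mono) auto
  finally show ?thesis by (simp add: G_def R_def algebra_simps)
qed

end

subsection \<open>Counting close pairs\<close>

lemma card_spaced:
  fixes S :: "real set"
  assumes sub: "S \<subseteq> {a..a + L}" and s: "0 < s" and L: "0 \<le> L"
    and sep: "\<And>x y. x \<in> S \<Longrightarrow> y \<in> S \<Longrightarrow> x \<noteq> y \<Longrightarrow> s \<le> \<bar>x - y\<bar>"
  shows "finite S" "real (card S) \<le> 1 + L / s"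
proof -
  define f where "f = (\<lambda>x. \<lfloor>(x - a) / s\<rfloor>)"
  have inj: "inj_on f S"
  proof (rule inj_onI, rule ccontr)
    fix x y assume xy: "x \<in> S" "y \<in> S" "f x = f y" "x \<noteq> y"
    have "\<bar>(x - a) / s - (y - a) / s\<bar> < 1" using xy(3) unfolding f_def by linarith
    moreover have "(x - a) / s - (y - a) / s = (x - y) / s" by (simp add: diff_divide_distrib)
    ultimately have "\<bar>x - y\<bar> < s" using s by (simp add: abs_divide)
    then show False using sep[OF xy(1,2,4)] by simp
  qed
  have img: "f ` S \<subseteq> {0..\<lfloor>L / s\<rfloor>}"
  proof
    fix z assume "z \<in> f ` S"
    then obtain x where x: "x \<in> S" "z = f x" by blast
    have "0 \<le> (x - a) / s" "(x - a) / s \<le> L / s" using sub x s by (auto intro!: divide_right_mono)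
    then show "z \<in> {0..\<lfloor>L / s\<rfloor>}" by (auto simp: x(2) f_def intro: floor_mono)
  qed
  show "finite S" using finite_subset[OF img] finite_imageD[OF _ inj] by simp
  have "card S = card (f ` S)" by (simp add: card_image inj)
  also have "\<dots> \<le> card {0..\<lfloor>L / s\<rfloor>}" by (intro card_mono img) simp
  also have "\<dots> = nat (\<lfloor>L / s\<rfloor> + 1)" by simp
  finally have "real (card S) \<le> real (nat (\<lfloor>L / s\<rfloor> + 1))" by simp
  also have "\<dots> = of_int \<lfloor>L / s\<rfloor> + 1" using L s by simp
  also have "\<dots> \<le> 1 + L / s" by simp
  finally show "real (card S) \<le> 1 + L / s" .
qed

lemma fraction_separation:
  fixes k l k' l' :: nat
  assumes "coprime k l" "coprime k' l'" "0 < l" "0 < l'" "(k, l) \<noteq> (k', l')"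
  shows "1 / (real l * real l') \<le> \<bar>real k / real l - real k' / real l'\<bar>"
proof -
  have "k * l' \<noteq> k' * l"
  proof
    assume "k * l' = k' * l"
    moreover have "k * l' = k' * l \<longleftrightarrow> k = k' \<and> l' = l"
      by (rule coprime_crossproduct_nat) (use assms in \<open>auto simp: coprime_commute\<close>)
    ultimately show False using assms(5) by simp
  qed
  then have "1 \<le> \<bar>int (k * l') - int (k' * l)\<bar>" by linarith
  then have "real_of_int 1 \<le> real_of_int \<bar>int (k * l') - int (k' * l)\<bar>" by linarith
  then have "1 \<le> \<bar>real k * real l' - real k' * real l\<bar>" by simp
  moreover have "real k / real l - real k' / real l' = (real k * real l' - real k' * real l) / (real l * real l')"
    using assms by (simp add: field_simps)
  ultimately show ?thesis using assms by (simp add: abs_mult divide_right_mono)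
qed

text \<open>Dyadic in \<open>l\<close>: for \<open>l\<close> between 2^i and 2^(i + 1) the fractions
  k / l lie within \<omega> / 2^i of \<xi>. Coprimality makes them distinct, hence 1 / 4^(i + 1)
  apart.\<close>

lemma card_coprime_strip:
  fixes K \<xi> \<omega> :: real
  assumes \<omega>: "0 \<le> \<omega>" and K: "0 \<le> K" and n: "K < 2 ^ n"
  defines "S \<equiv> {(k, l). coprime k l \<and> 0 < l \<and> real l \<le> K \<and> \<bar>real k - real l * \<xi>\<bar> \<le> \<omega>}"
  shows "finite S" "real (card S) \<le> real n * (1 + 8 * \<omega> * K)"
proof -
  define T where "T = (\<lambda>i::nat. {p \<in> S. 2 ^ i \<le> snd p \<and> snd p < 2 ^ Suc i})"
  have T: "finite (T i) \<and> real (card (T i)) \<le> 1 + 8 * \<omega> * K" for i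
  proof (cases "T i = {}")
    case True
    then show ?thesis using K \<omega> by simp
  next
    case False
    then obtain k0 l0 where kl: "(k0, l0) \<in> T i" by auto
    have l0: "2 ^ i \<le> l0" "real l0 \<le> K" using kl by (auto simp: T_def S_def)
    have "(2::real) ^ i = real (2 ^ i)" by simp
    also have "\<dots> \<le> real l0" using l0(1) by (simp only: of_nat_le_iff)
    also note l0(2)
    finally have iK: "2 ^ i \<le> K" .
    define f where "f = (\<lambda>p::nat \<times> nat. real (fst p) / real (snd p))"
    have sep: "1 / 4 ^ Suc i \<le> \<bar>f p - f q\<bar>" if "p \<in> T i" "q \<in> T i" "p \<noteq> q" for p q
    proof -
      have lt: "real (snd p) \<le> 2 ^ Suc i" "real (snd q) \<le> 2 ^ Suc i" "0 < snd p" "0 < snd q"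
        using that of_nat_mono[of "snd p" "2 ^ Suc i", where 'a = real] of_nat_mono[of "snd q" "2 ^ Suc i", where 'a = real]
        by (auto simp: T_def S_def)
      have "1 / 4 ^ Suc i = 1 / ((2::real) ^ Suc i * 2 ^ Suc i)" by (simp add: flip: power_mult_distrib)
      also have "\<dots> \<le> 1 / (real (snd p) * real (snd q))"
        using lt by (intro divide_left_mono mult_mono) auto
      also have "\<dots> \<le> \<bar>f p - f q\<bar>"
        unfolding f_def using that by (intro fraction_separation) (auto simp: T_def S_def)
      finally show ?thesis .
    qed
    have inj: "inj_on f (T i)"
    proof (rule inj_onI, rule ccontr)
      fix p q assume pq: "p \<in> T i" "q \<in> T i" "f p = f q" "p \<noteq> q"
      have "(0::real) < 1 / 4 ^ Suc i" by simp
      also have "\<dots> \<le> \<bar>f p - f q\<bar>" using pq by (intro sep)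
      finally show False using pq(3) by simp
    qed
    have range: "f ` T i \<subseteq> {\<xi> - \<omega> / 2 ^ i..\<xi> - \<omega> / 2 ^ i + 2 * \<omega> / 2 ^ i}"
    proof
      fix x assume "x \<in> f ` T i"
      then obtain k l where kl: "(k, l) \<in> T i" "x = real k / real l" by (auto simp: f_def)
      have l: "0 < l" "2 ^ i \<le> real l" "\<bar>real k - real l * \<xi>\<bar> \<le> \<omega>"
        using kl of_nat_mono[of "2 ^ i" l, where 'a = real] by (auto simp: T_def S_def)
      have "\<bar>x - \<xi>\<bar> = \<bar>real k - real l * \<xi>\<bar> / real l"
        using l by (simp add: kl(2) field_simps abs_divide flip: abs_of_pos)
      also have "\<dots> \<le> \<omega> / 2 ^ i" using l \<omega> by (intro frac_le) auto
      finally show "x \<in> {\<xi> - \<omega> / 2 ^ i..\<xi> - \<omega> / 2 ^ i + 2 * \<omega> / 2 ^ i}"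
        by (simp add: abs_le_iff)
    qed
    have "finite (f ` T i)" "real (card (f ` T i)) \<le> 1 + (2 * \<omega> / 2 ^ i) / (1 / 4 ^ Suc i)"
      by (rule card_spaced[OF range]; use sep \<omega> in auto)+
    moreover have "(4::real) ^ i = 2 ^ i * 2 ^ i" by (simp flip: power_mult_distrib)
    then have "(2 * \<omega> / 2 ^ i) / (1 / 4 ^ Suc i) = 8 * \<omega> * 2 ^ i"
      by (simp add: field_simps)
    moreover have "8 * \<omega> * 2 ^ i \<le> 8 * \<omega> * K" using iK \<omega> by (intro mult_left_mono) auto
    ultimately show ?thesis using inj by (auto simp: card_image finite_image_iff)
  qed
  have cover: "S = (\<Union>i<n. T i)"
  proof (intro set_eqI iffI)
    fix p assume p: "p \<in> S"
    obtain k l where kl: "p = (k, l)" by (cases p)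
    have l: "0 < l" "real l \<le> K" using p by (auto simp: S_def kl)
    note l(2)
    also note n
    also have "(2::real) ^ n = real (2 ^ n)" by simp
    finally have ln: "l < 2 ^ n" by (simp only: of_nat_less_iff)
    obtain i where i: "2 ^ i \<le> l" "l < 2 ^ (i + 1)"
      using ex_power_ivl1[of 2 l] l by auto
    have "i < n"
      using i(1) ln by (metis le_less_trans nat_power_less_imp_less pos2)
    then show "p \<in> (\<Union>i<n. T i)" using i p by (auto simp: T_def kl)
  qed (auto simp: T_def)
  show "finite S" unfolding cover using T by auto
  have "card S \<le> (\<Sum>i<n. card (T i))" unfolding cover by (rule card_UN_le) auto
  then have "real (card S) \<le> (\<Sum>i<n. real (card (T i)))" by (simp flip: of_nat_sum)
  also have "\<dots> \<le> (\<Sum>i<n. 1 + 8 * \<omega> * K)" using T by (intro sum_mono) auto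
  finally show "real (card S) \<le> real n * (1 + 8 * \<omega> * K)" by simp
qed

lemma powr_expand:
  fixes x y \<gamma> :: real
  assumes "0 < \<gamma>" "\<gamma> < 1" "1 / 3 \<le> x" "x \<le> 3" "1 / 3 \<le> y" "y \<le> 3"
  shows "\<gamma> / 3 * \<bar>x - y\<bar> \<le> \<bar>x powr \<gamma> - y powr \<gamma>\<bar>"
proof -
  have *: "\<gamma> / 3 * (v - u) \<le> v powr \<gamma> - u powr \<gamma>" if "1 / 3 \<le> u" "u < v" "v \<le> 3" for u v :: real
  proof -
    have "\<exists>z>u. z < v \<and> v powr \<gamma> - u powr \<gamma> = (v - u) * (\<gamma> * z powr (\<gamma> - 1))"
      using that by (intro MVT2 has_real_derivative_powr) auto
    then obtain z where z: "u < z" "z < v" "v powr \<gamma> - u powr \<gamma> = (v - u) * (\<gamma> * z powr (\<gamma> - 1))" by blast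
    have "1 / 3 = 3 powr (- 1 :: real)" by (simp add: powr_minus)
    also have "\<dots> \<le> 3 powr (\<gamma> - 1)" using assms by (intro powr_mono) auto
    also have "\<dots> \<le> z powr (\<gamma> - 1)" using z that assms by (intro powr_mono2') auto
    finally have "(v - u) * (\<gamma> * (1 / 3)) \<le> (v - u) * (\<gamma> * z powr (\<gamma> - 1))"
      using that assms by (intro mult_left_mono) auto
    then show ?thesis by (simp add: z(3) mult_ac)
  qed
  show ?thesis
  proof (cases x y rule: linorder_cases)
    case less
    then have "\<bar>x - y\<bar> = y - x" by simp
    then show ?thesis using *[of x y] assms less by (intro order.trans[OF _ abs_ge_minus_self]) simp
  next
    case greater
    then have "\<bar>x - y\<bar> = x - y" by simp
    then show ?thesis using *[of y x] assms greater by (intro order.trans[OF _ abs_ge_self]) simp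
  qed simp
qed

text \<open>With \<open>k\<close> and \<open>l\<close> fixed, (m' / m)^\<gamma> lies in a short
  interval around k / l. The fractions m' / m are distinct with denominators up to 3 M, and on
  [1/3, 3] the power \<gamma> preserves their spacing up to a constant.\<close>

lemma card_coprime_powr_strip:
  fixes M r \<gamma> :: real and k l :: nat
  assumes g: "0 < \<gamma>" "\<gamma> < 1" and M: "0 < M" and r: "0 \<le> r" and l: "0 < l"
  defines "S \<equiv> {(m, m'). coprime m' m \<and> M < real m \<and> real m \<le> 3 * M \<and> M < real m' \<and> real m' \<le> 3 * M \<and>
      \<bar>real k * real m powr \<gamma> - real l * real m' powr \<gamma>\<bar> \<le> r}"
  shows "real (card S) \<le> 1 + 54 * r * M powr (2 - \<gamma>) / (\<gamma> * real l)"
proof -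
  define f where "f = (\<lambda>p::nat \<times> nat. (real (snd p) / real (fst p)) powr \<gamma>)"
  have sep: "\<gamma> / (27 * M\<^sup>2) \<le> \<bar>f p - f q\<bar>" if pq: "p \<in> S" "q \<in> S" "p \<noteq> q" for p q
  proof -
    have 3: "1 / 3 \<le> real (snd p) / real (fst p) \<and> real (snd p) / real (fst p) \<le> 3" if "p \<in> S" for p
      using that M by (auto simp: S_def field_simps)
    have pos: "0 < fst p" "0 < fst q" using pq M by (auto simp: S_def intro!: Nat.gr0I)
    have "1 / (9 * M\<^sup>2) \<le> 1 / (real (fst p) * real (fst q))"
    proof (rule divide_left_mono)
      have "real (fst p) * real (fst q) \<le> (3 * M) * (3 * M)" using pq M by (intro mult_mono) (auto simp: S_def)
      then show "real (fst p) * real (fst q) \<le> 9 * M\<^sup>2" by (simp add: power2_eq_square)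
    qed (use pos M in auto)
    also have "\<dots> \<le> \<bar>real (snd p) / real (fst p) - real (snd q) / real (fst q)\<bar>"
      using pq pos by (intro fraction_separation) (auto simp: S_def prod_eq_iff)
    finally have "\<gamma> / 3 * (1 / (9 * M\<^sup>2)) \<le> \<gamma> / 3 * \<bar>real (snd p) / real (fst p) - real (snd q) / real (fst q)\<bar>"
      using g by (intro mult_left_mono) auto
    also have "\<dots> \<le> \<bar>f p - f q\<bar>"
      unfolding f_def using 3[OF pq(1)] 3[OF pq(2)] g by (intro powr_expand) auto
    finally show ?thesis by simp
  qed
  have sp: "0 < \<gamma> / (27 * M\<^sup>2)" using g M by simp
  have inj: "inj_on f S"
  proof (rule inj_onI, rule ccontr)
    fix p q assume "p \<in> S" "q \<in> S" "f p = f q" "p \<noteq> q"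
    then show False using sep[of p q] sp by simp
  qed
  define w where "w = r / (real l * M powr \<gamma>)"
  have w: "0 \<le> w" using r by (simp add: w_def)
  have range: "f ` S \<subseteq> {real k / real l - w..real k / real l - w + 2 * w}"
  proof
    fix x assume "x \<in> f ` S"
    then obtain m m' where mm: "(m, m') \<in> S" "x = (real m' / real m) powr \<gamma>" by (auto simp: f_def)
    have m: "M < real m" "0 < real m" using mm M by (auto simp: S_def)
    have mg: "0 < real m powr \<gamma>" "M powr \<gamma> \<le> real m powr \<gamma>" using m M g by (auto intro!: powr_mono2)
    have "real k / real l - x = (real k * real m powr \<gamma> - real l * real m' powr \<gamma>) / (real l * real m powr \<gamma>)"
      using m l mg by (simp add: mm(2) powr_divide field_simps)
    then have "\<bar>real k / real l - x\<bar> = \<bar>real k * real m powr \<gamma> - real l * real m' powr \<gamma>\<bar> / (real l * real m powr \<gamma>)"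
      by (simp add: abs_mult)
    also have "\<dots> \<le> r / (real l * M powr \<gamma>)"
      using mm(1) r l M mg by (intro frac_le) (auto simp: S_def)
    finally show "x \<in> {real k / real l - w..real k / real l - w + 2 * w}"
      by (auto simp: w_def abs_le_iff)
  qed
  have "real (card (f ` S)) \<le> 1 + (2 * w) / (\<gamma> / (27 * M\<^sup>2))"
    by (rule card_spaced(2)[OF range sp]) (use sep w in auto)
  also have "(2 * w) / (\<gamma> / (27 * M\<^sup>2)) = 54 * r * M powr (2 - \<gamma>) / (\<gamma> * real l)"
    using M l g by (simp add: w_def powr_diff field_simps)
  finally show ?thesis by (simp add: card_image inj)
qed

lemma harmonic_dyadic: "L < 2 ^ n \<Longrightarrow> (\<Sum>l\<in>{1..L}. 1 / real l) \<le> real n"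
proof (induction n arbitrary: L)
  case 0
  then show ?case by simp
next
  case (Suc n)
  show ?case
  proof (cases "L < 2 ^ n")
    case True
    then show ?thesis using Suc.IH[of L] by simp
  next
    case False
    have one: "1 \<le> (2::nat) ^ n" by simp
    have disj: "{1..2 ^ n - 1} \<inter> {2 ^ n..L} = {}"
    proof (intro equals0I)
      fix x assume "x \<in> {1..2 ^ n - 1} \<inter> {2 ^ n..L}"
      then have "x \<le> 2 ^ n - 1" "2 ^ n \<le> x" by auto
      then show False using one by linarith
    qed
    from one have split: "{1..L} = {1..2 ^ n - 1} \<union> {2 ^ n..L}"
      using False by (intro set_eqI) (simp only: Un_iff atLeastAtMost_iff, arith)
    have "(\<Sum>l\<in>{1..L}. 1 / real l) = (\<Sum>l\<in>{1..2 ^ n - 1}. 1 / real l) + (\<Sum>l\<in>{2 ^ n..L}. 1 / real l)"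
      unfolding split using disj by (intro sum.union_disjoint) simp_all
    also have "(\<Sum>l\<in>{1..2 ^ n - 1}. 1 / real l) \<le> real n" by (rule Suc.IH) simp
    also have "(\<Sum>l\<in>{2 ^ n..L}. 1 / real l) \<le> (\<Sum>l\<in>{2 ^ n..L}. 1 / 2 ^ n)"
    proof (intro sum_mono divide_left_mono)
      fix l assume "l \<in> {2 ^ n..L}"
      then show "2 ^ n \<le> real l" using of_nat_mono[of "2 ^ n" l, where 'a = real] by simp
      then show "0 < real l * 2 ^ n" by (auto intro!: mult_pos_pos less_le_trans[of 0 "2 ^ n" "real l"])
    qed simp
    also have "\<dots> = real (Suc L - 2 ^ n) / 2 ^ n" by simp
    also have "\<dots> \<le> 2 ^ n / 2 ^ n"
    proof (intro divide_right_mono)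
      have "Suc L - 2 ^ n \<le> 2 ^ n" using Suc.prems by simp
      then show "real (Suc L - 2 ^ n) \<le> 2 ^ n" by (metis of_nat_le_iff of_nat_numeral of_nat_power)
    qed simp
    finally show ?thesis by simp
  qed
qed

lemma card_relation_le:
  fixes R :: "'a \<Rightarrow> 'b \<Rightarrow> bool"
  assumes "finite U" "\<And>u. u \<in> U \<Longrightarrow> finite {v \<in> V. R v u}" "\<And>u. u \<in> U \<Longrightarrow> real (card {v \<in> V. R v u}) \<le> c u"
  shows "real (card {(v, u). v \<in> V \<and> u \<in> U \<and> R v u}) \<le> (\<Sum>u\<in>U. c u)"
proof -
  have "{(v, u). v \<in> V \<and> u \<in> U \<and> R v u} = (\<lambda>(u, v). (v, u)) ` (SIGMA u:U. {v \<in> V. R v u})" by auto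
  moreover have "finite (SIGMA u:U. {v \<in> V. R v u})" using assms by (intro finite_SigmaI)
  ultimately have "card {(v, u). v \<in> V \<and> u \<in> U \<and> R v u} \<le> card (SIGMA u:U. {v \<in> V. R v u})"
    by (simp only: card_image_le)
  also have "\<dots> = (\<Sum>u\<in>U. card {v \<in> V. R v u})" by (rule card_SigmaI) (use assms(1,2) in auto)
  finally have "real (card {(v, u). v \<in> V \<and> u \<in> U \<and> R v u}) \<le> (\<Sum>u\<in>U. real (card {v \<in> V. R v u}))"
    by (simp flip: of_nat_sum)
  also have "\<dots> \<le> (\<Sum>u\<in>U. c u)" by (intro sum_mono assms)
  finally show ?thesis .
qed

lemma card_greaterThanAtMost_le:
  fixes M :: real
  assumes "1 / 3 \<le> M"
  shows "finite {m::nat. M < real m \<and> real m \<le> 3 * M}" "real (card {m::nat. M < real m \<and> real m \<le> 3 * M}) \<le> 5 * M"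
proof -
  have sub: "{m::nat. M < real m \<and> real m \<le> 3 * M} \<subseteq> {m. M \<le> real m \<and> real m \<le> 3 * M}" by auto
  show "finite {m::nat. M < real m \<and> real m \<le> 3 * M}" by (rule finite_subset[OF sub card_nat_between(1)])
  have "real (card {m::nat. M < real m \<and> real m \<le> 3 * M}) \<le> real (card {m::nat. M \<le> real m \<and> real m \<le> 3 * M})"
    by (intro of_nat_mono card_mono card_nat_between(1) sub)
  also have "\<dots> \<le> 3 * M - M + 1" using assms by (intro card_nat_between(2)) auto
  also have "\<dots> \<le> 5 * M" using assms by simp
  finally show "real (card {m::nat. M < real m \<and> real m \<le> 3 * M}) \<le> 5 * M" .
qed

text \<open>Two counts: fixing \<open>u\<close> gives the main term M^2, fixing \<open>v\<close>
  gives K^2, with the same second term in both. The smaller of M^2 and K^2 is at most M K.\<close>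

lemma coprime_quadruple_count:
  fixes M K r \<gamma> :: real
  assumes g: "0 < \<gamma>" "\<gamma> < 1" and M: "1 / 3 \<le> M" and K: "1 \<le> K" "K < 2 ^ n" and r: "0 \<le> r"
  defines "V \<equiv> {(k::nat, l::nat). coprime k l \<and> 0 < k \<and> real k \<le> K \<and> 0 < l \<and> real l \<le> K}"
    and "U \<equiv> {(m::nat, m'::nat). coprime m' m \<and> M < real m \<and> real m \<le> 3 * M \<and> M < real m' \<and> real m' \<le> 3 * M}"
    and "R \<equiv> \<lambda>v u. \<bar>real (fst v) * real (fst u) powr \<gamma> - real (snd v) * real (snd u) powr \<gamma>\<bar> \<le> r"
  shows "finite V" "finite U"
    "real (card {(v, u). v \<in> V \<and> u \<in> U \<and> R v u}) \<le> 200 / \<gamma> * real n * (M * K + r * K * M powr (2 - \<gamma>))"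
proof -
  define c where "c = r * K * M powr (2 - \<gamma>)"
  have c: "0 \<le> c" using r K by (simp add: c_def)
  have n1: "1 \<le> real n" using K by (cases n) auto
  have Kf: "finite {k::nat. 1 \<le> real k \<and> real k \<le> K}" "real (card {k::nat. 1 \<le> real k \<and> real k \<le> K}) \<le> K"
    using card_nat_between[of 1 K] K by auto
  have V_sub: "V \<subseteq> {k::nat. 1 \<le> real k \<and> real k \<le> K} \<times> {k::nat. 1 \<le> real k \<and> real k \<le> K}"
    by (auto simp: V_def)
  show fV: "finite V" by (rule finite_subset[OF V_sub]) (use Kf in auto)
  have U_sub: "U \<subseteq> {m::nat. M < real m \<and> real m \<le> 3 * M} \<times> {m::nat. M < real m \<and> real m \<le> 3 * M}"
    by (auto simp: U_def)
  show fU: "finite U" by (rule finite_subset[OF U_sub]) (use card_greaterThanAtMost_le[OF M] in auto)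
  have cU: "real (card U) \<le> 25 * M\<^sup>2"
  proof -
    have "card U \<le> card {m::nat. M < real m \<and> real m \<le> 3 * M} * card {m::nat. M < real m \<and> real m \<le> 3 * M}"
      using card_mono[OF _ U_sub] card_greaterThanAtMost_le[OF M] by (simp add: card_cartesian_product)
    then have "real (card U) \<le> real (card {m::nat. M < real m \<and> real m \<le> 3 * M}) * real (card {m::nat. M < real m \<and> real m \<le> 3 * M})"
      by (simp flip: of_nat_mult)
    also have "\<dots> \<le> (5 * M) * (5 * M)"
      using card_greaterThanAtMost_le[OF M] M by (intro mult_mono) auto
    finally show ?thesis by (simp add: power2_eq_square)
  qed
  have b1: "real (card {(v, u). v \<in> V \<and> u \<in> U \<and> R v u}) \<le> 200 * real n * (M\<^sup>2 + c)"
  proof -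
    define w where "w = r / M powr \<gamma>"
    have w: "0 \<le> w" using r by (simp add: w_def)
    have fibre: "finite {v \<in> V. R v u} \<and> real (card {v \<in> V. R v u}) \<le> real n * (1 + 8 * w * K)" if u: "u \<in> U" for u
    proof -
      obtain m m' where mm: "u = (m, m')" "M < real m" using u by (auto simp: U_def)
      define \<xi> where "\<xi> = real m' powr \<gamma> / real m powr \<gamma>"
      have mp: "M powr \<gamma> \<le> real m powr \<gamma>" "0 < M powr \<gamma>" "0 < real m" using mm M g by (auto intro!: powr_mono2)
      let ?S = "{(k, l). coprime k l \<and> 0 < l \<and> real l \<le> K \<and> \<bar>real k - real l * \<xi>\<bar> \<le> w}"
      have sub: "{v \<in> V. R v u} \<subseteq> ?S"
      proof
        fix v assume v: "v \<in> {v \<in> V. R v u}"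
        obtain k l where kl: "v = (k, l)" by (cases v)
        have "real k - real l * \<xi> = (real k * real m powr \<gamma> - real l * real m' powr \<gamma>) / real m powr \<gamma>"
          using mp by (simp add: \<xi>_def diff_divide_distrib)
        then have "\<bar>real k - real l * \<xi>\<bar> = \<bar>real k * real m powr \<gamma> - real l * real m' powr \<gamma>\<bar> / real m powr \<gamma>"
          by simp
        also have "\<dots> \<le> w"
          unfolding w_def using v mp r by (intro frac_le) (auto simp: R_def kl mm)
        finally show "v \<in> ?S" using v by (simp add: kl V_def)
      qed
      have S: "finite ?S" "real (card ?S) \<le> real n * (1 + 8 * w * K)"
        using card_coprime_strip[OF w _ K(2), of \<xi>] K(1) by auto
      then show ?thesis using card_mono[OF S(1) sub] finite_subset[OF sub S(1)] by linarith
    qed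
    have "real (card {(v, u). v \<in> V \<and> u \<in> U \<and> R v u}) \<le> (\<Sum>u\<in>U. real n * (1 + 8 * w * K))"
      by (rule card_relation_le[OF fU]) (use fibre in auto)
    also have "\<dots> = real (card U) * (real n * (1 + 8 * w * K))" by simp
    also have "\<dots> \<le> 25 * M\<^sup>2 * (real n * (1 + 8 * w * K))"
      using cU w K by (intro mult_right_mono) auto
    also have "\<dots> = real n * (25 * M\<^sup>2 + 200 * c)"
    proof -
      have "M\<^sup>2 * w = r * M powr (2 - \<gamma>)" using M by (simp add: w_def powr_diff)
      then have "M\<^sup>2 * w * K = c" by (simp add: c_def)
      then show ?thesis by (simp add: algebra_simps)
    qed
    also have "\<dots> \<le> real n * (200 * (M\<^sup>2 + c))" by (intro mult_left_mono) auto
    finally show ?thesis by (simp add: mult_ac)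
  qed
  have b2: "real (card {(v, u). v \<in> V \<and> u \<in> U \<and> R v u}) \<le> 54 / \<gamma> * real n * (K\<^sup>2 + c)"
  proof -
    define q where "q = 54 * r * M powr (2 - \<gamma>) / \<gamma>"
    have q: "0 \<le> q" using r g by (simp add: q_def)
    have fibre: "finite {u \<in> U. R v u} \<and> real (card {u \<in> U. R v u}) \<le> 1 + q / real (snd v)" if v: "v \<in> V" for v
    proof -
      obtain k l where kl: "v = (k, l)" "0 < l" using v by (auto simp: V_def)
      have fin: "finite {u \<in> U. R v u}" using fU by simp
      have "{u \<in> U. R v u} = {(m, m'). coprime m' m \<and> M < real m \<and> real m \<le> 3 * M \<and> M < real m' \<and> real m' \<le> 3 * M \<and>
          \<bar>real k * real m powr \<gamma> - real l * real m' powr \<gamma>\<bar> \<le> r}"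
        by (auto simp: U_def R_def kl)
      then show ?thesis
        using card_coprime_powr_strip[OF g _ r kl(2), of M k] M fin by (simp add: q_def kl)
    qed
    have "{(v, u). v \<in> V \<and> u \<in> U \<and> R v u} = (\<lambda>(u, v). (v, u)) ` {(u, v). u \<in> U \<and> v \<in> V \<and> R v u}" by auto
    then have "card {(v, u). v \<in> V \<and> u \<in> U \<and> R v u} \<le> card {(u, v). u \<in> U \<and> v \<in> V \<and> R v u}"
      using card_image_le[of "{(u, v). u \<in> U \<and> v \<in> V \<and> R v u}" "\<lambda>(u, v). (v, u)"]
        finite_subset[of "{(u, v). u \<in> U \<and> v \<in> V \<and> R v u}" "U \<times> V"] fU fV by auto
    then have "real (card {(v, u). v \<in> V \<and> u \<in> U \<and> R v u}) \<le> real (card {(u, v). u \<in> U \<and> v \<in> V \<and> R v u})" by simp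
    also have "\<dots> \<le> (\<Sum>v\<in>V. 1 + q / real (snd v))"
      by (rule card_relation_le[OF fV, where R = "\<lambda>u v. R v u"]) (use fibre in auto)
    also have "\<dots> \<le> (\<Sum>v\<in>{1..nat \<lfloor>K\<rfloor>} \<times> {1..nat \<lfloor>K\<rfloor>}. 1 + q / real (snd v))"
    proof (rule sum_mono2)
      show "V \<subseteq> {1..nat \<lfloor>K\<rfloor>} \<times> {1..nat \<lfloor>K\<rfloor>}" by (auto simp: V_def le_nat_floor)
    qed (use q in auto)
    also have "\<dots> = (\<Sum>k\<in>{1..nat \<lfloor>K\<rfloor>}. \<Sum>l\<in>{1..nat \<lfloor>K\<rfloor>}. 1 + q / real l)"
      by (subst sum.cartesian_product) (rule sum.cong; auto)
    also have "\<dots> = real (nat \<lfloor>K\<rfloor>) * (real (nat \<lfloor>K\<rfloor>) + q * (\<Sum>l\<in>{1..nat \<lfloor>K\<rfloor>}. 1 / real l))"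
      by (simp add: sum.distrib sum_distrib_left)
    also have "\<dots> \<le> K * (K + q * real n)"
    proof (intro mult_mono add_mono mult_left_mono q)
      have fl: "real (nat \<lfloor>K\<rfloor>) \<le> K" using K by simp
      then show "real (nat \<lfloor>K\<rfloor>) \<le> K" "real (nat \<lfloor>K\<rfloor>) \<le> K" by simp_all
      note fl
      also note K(2)
      also have "(2::real) ^ n = real (2 ^ n)" by simp
      finally have "nat \<lfloor>K\<rfloor> < 2 ^ n" by (simp only: of_nat_less_iff)
      then show "(\<Sum>l\<in>{1..nat \<lfloor>K\<rfloor>}. 1 / real l) \<le> real n" by (rule harmonic_dyadic)
    qed (use K q in \<open>auto intro!: add_nonneg_nonneg mult_nonneg_nonneg sum_nonneg\<close>)
    also have "\<dots> = K\<^sup>2 + 54 / \<gamma> * real n * c"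
      by (simp add: q_def c_def power2_eq_square algebra_simps)
    also have "\<dots> \<le> 54 / \<gamma> * real n * K\<^sup>2 + 54 / \<gamma> * real n * c"
    proof (intro add_right_mono)
      have "1 * 1 \<le> 54 / \<gamma> * real n" using g n1 by (intro mult_mono) (auto simp: field_simps)
      then show "K\<^sup>2 \<le> 54 / \<gamma> * real n * K\<^sup>2" using mult_right_mono[of 1 "54 / \<gamma> * real n" "K\<^sup>2"] by simp
    qed
    finally show ?thesis by (simp add: distrib_left)
  qed
  have g0: "200 \<le> 200 / \<gamma>" "54 / \<gamma> \<le> 200 / \<gamma>"
    using g by (simp_all add: field_simps)
  show "real (card {(v, u). v \<in> V \<and> u \<in> U \<and> R v u}) \<le> 200 / \<gamma> * real n * (M * K + r * K * M powr (2 - \<gamma>))"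
  proof (cases "M \<le> K")
    case True
    have "200 * real n * (M\<^sup>2 + c) \<le> 200 / \<gamma> * real n * (M * K + c)"
      using True M c g0 g by (intro mult_mono add_right_mono) (auto simp: power2_eq_square)
    then show ?thesis using b1 by (simp add: c_def)
  next
    case False
    have "54 / \<gamma> * real n * (K\<^sup>2 + c) \<le> 200 / \<gamma> * real n * (M * K + c)"
      using False K c g0 g by (intro mult_mono add_right_mono) (auto simp: power2_eq_square)
    then show ?thesis using b2 by (simp add: c_def)
  qed
qed

text \<open>H B is the contribution of the diagonal; the other term is the expected proportion r /
  (H B^\<gamma>) of all (H B)^2 pairs. So nothing but constants and logarithms is lost.\<close>

lemma pair_count:
  fixes r \<gamma> :: real and B H n :: nat
  assumes g: "0 < \<gamma>" "\<gamma> < 1" and B: "0 < B" and r: "0 \<le> r" and H: "H < 2 ^ n" and B3: "3 * B < 2 ^ n"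
  defines "P \<equiv> {((h, b), (h', b')). h \<in> {1..H} \<and> b \<in> {B<..3 * B} \<and> h' \<in> {1..H} \<and> b' \<in> {B<..3 * B} \<and>
      \<bar>real h * real b powr \<gamma> - real h' * real b' powr \<gamma>\<bar> \<le> r}"
  shows "finite P" "real (card P) \<le> 200 / \<gamma> * real n ^ 3 * (real H * real B + r * real H * real B powr (2 - \<gamma>))"
proof -
  have P_sub: "P \<subseteq> ({1..H} \<times> {B<..3 * B}) \<times> ({1..H} \<times> {B<..3 * B})" by (auto simp: P_def)
  show fP: "finite P" by (rule finite_subset[OF P_sub]) auto
  define D where "D = (\<lambda>d e. {p \<in> P. gcd (fst (fst p)) (fst (snd p)) = d \<and> gcd (snd (fst p)) (snd (snd p)) = e})"
  define T where "T = real H * real B + r * real H * real B powr (2 - \<gamma>)"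
  have T: "0 \<le> T" using r by (simp add: T_def)
  \<comment> \<open>Dividing by \<open>d = gcd h h'\<close> and \<open>e = gcd b b'\<close> leaves coprime quadruples; the factors \<open>1 / d\<close> and \<open>1 / e\<close> sum to logarithms.\<close>
  have piece: "real (card (D d e)) \<le> 200 / \<gamma> * real n * T * (1 / real d * (1 / real e))"
    if d: "d \<in> {1..H}" and e: "e \<in> {1..3 * B}" for d e
  proof -
    define M K r' where "M = real B / real e" and "K = real H / real d" and "r' = r / (real d * real e powr \<gamma>)"
    have de: "0 < real d" "0 < real e" using d e by auto
    have M: "1 / 3 \<le> M"
    proof -
      have "real e \<le> 3 * real B" using e by simp
      then show ?thesis using de by (simp add: M_def field_simps)
    qed
    have K: "1 \<le> K" "K < 2 ^ n"
    proof -
      show "1 \<le> K" using d de by (simp add: K_def)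
      have "real H / real d \<le> real H / 1" using d by (intro divide_left_mono) auto
      also have "real H / 1 = real H" by simp
      also have "\<dots> < real (2 ^ n)" using H by (simp only: of_nat_less_iff)
      finally show "K < 2 ^ n" by (simp add: K_def)
    qed
    have r': "0 \<le> r'" using r by (simp add: r'_def)
    let ?V = "{(k::nat, l::nat). coprime k l \<and> 0 < k \<and> real k \<le> K \<and> 0 < l \<and> real l \<le> K}"
    let ?U = "{(m::nat, m'::nat). coprime m' m \<and> M < real m \<and> real m \<le> 3 * M \<and> M < real m' \<and> real m' \<le> 3 * M}"
    let ?R = "\<lambda>v u. \<bar>real (fst v) * real (fst u) powr \<gamma> - real (snd v) * real (snd u) powr \<gamma>\<bar> \<le> r'"
    note cnt = coprime_quadruple_count[OF g M K r']
    define f where "f = (\<lambda>p :: (nat \<times> nat) \<times> (nat \<times> nat). ((fst (fst p) div d, fst (snd p) div d), (snd (fst p) div e, snd (snd p) div e)))"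
    have decomp: "\<exists>k l m m'. p = ((d * k, e * m), (d * l, e * m')) \<and> coprime k l \<and> coprime m' m \<and> f p = ((k, l), (m, m'))" if p: "p \<in> D d e" for p
    proof -
      obtain h b h' b' where p4: "p = ((h, b), (h', b'))" by (metis surj_pair)
      have gd: "gcd h h' = d" "gcd b b' = e" using p by (auto simp: D_def p4)
      have nz: "h \<noteq> 0" "b \<noteq> 0" using p by (auto simp: D_def P_def p4)
      have dv: "d dvd h" "d dvd h'" "e dvd b" "e dvd b'" by (auto simp flip: gd)
      have cop: "coprime (h div d) (h' div d)" "coprime (b div e) (b' div e)"
        using div_gcd_coprime[of h h'] div_gcd_coprime[of b b'] nz gd by auto
      show ?thesis
        by (rule exI[of _ "h div d"], rule exI[of _ "h' div d"], rule exI[of _ "b div e"], rule exI[of _ "b' div e"])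
           (use dv cop in \<open>auto simp: p4 f_def coprime_commute\<close>)
    qed
    have inj: "inj_on f (D d e)"
    proof (rule inj_onI)
      fix p q assume pq: "p \<in> D d e" "q \<in> D d e" "f p = f q"
      show "p = q" using decomp[OF pq(1)] decomp[OF pq(2)] pq(3) by auto
    qed
    have img: "f ` D d e \<subseteq> {(v, u). v \<in> ?V \<and> u \<in> ?U \<and> ?R v u}"
    proof
      fix x assume "x \<in> f ` D d e"
      then obtain p where p: "p \<in> D d e" "x = f p" by blast
      obtain k l m m' where klm: "p = ((d * k, e * m), (d * l, e * m'))" "coprime k l" "coprime m' m" "f p = ((k, l), (m, m'))"
        using decomp[OF p(1)] by blast
      have inP: "d * k \<in> {1..H}" "e * m \<in> {B<..3 * B}" "d * l \<in> {1..H}" "e * m' \<in> {B<..3 * B}"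
        "\<bar>real (d * k) * real (e * m) powr \<gamma> - real (d * l) * real (e * m') powr \<gamma>\<bar> \<le> r"
        using p(1) by (auto simp: D_def P_def klm(1))
      have up: "real k \<le> K" if "d * k \<le> H" for k
      proof -
        have "real (d * k) \<le> real H" using that by (simp only: of_nat_le_iff)
        then show ?thesis using de by (simp add: K_def field_simps)
      qed
      have mid: "M < real m" "real m \<le> 3 * M" if "e * m \<in> {B<..3 * B}" for m
      proof -
        have "real B < real (e * m)" "real (e * m) \<le> real (3 * B)" using that by (simp_all only: of_nat_le_iff of_nat_less_iff greaterThanAtMost_iff)
        then show "M < real m" "real m \<le> 3 * M" using de by (simp_all add: M_def field_simps)
      qed
      have "real (d * k) * real (e * m) powr \<gamma> - real (d * l) * real (e * m') powr \<gamma>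
          = (real d * real e powr \<gamma>) * (real k * real m powr \<gamma> - real l * real m' powr \<gamma>)"
        by (simp add: powr_mult algebra_simps)
      then have "(real d * real e powr \<gamma>) * \<bar>real k * real m powr \<gamma> - real l * real m' powr \<gamma>\<bar> \<le> r"
        using inP(5) by (simp add: abs_mult)
      then have R: "\<bar>real k * real m powr \<gamma> - real l * real m' powr \<gamma>\<bar> \<le> r'"
        using de by (simp add: r'_def pos_le_divide_eq mult_ac)
      show "x \<in> {(v, u). v \<in> ?V \<and> u \<in> ?U \<and> ?R v u}"
        using klm(2,3) inP(1-4) up[of k] up[of l] mid[of m] mid[of m'] R
        by (auto simp: p(2) klm(4) intro!: Nat.gr0I)
    qed
    have fin: "finite {(v, u). v \<in> ?V \<and> u \<in> ?U \<and> ?R v u}"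
      by (rule finite_subset[of _ "?V \<times> ?U"]) (use cnt(1,2) in auto)
    have "card (D d e) = card (f ` D d e)" by (simp add: card_image inj)
    also have "\<dots> \<le> card {(v, u). v \<in> ?V \<and> u \<in> ?U \<and> ?R v u}" by (rule card_mono[OF fin img])
    finally have "real (card (D d e)) \<le> real (card {(v, u). v \<in> ?V \<and> u \<in> ?U \<and> ?R v u})" by simp
    also have "\<dots> \<le> 200 / \<gamma> * real n * (M * K + r' * K * M powr (2 - \<gamma>))" by (rule cnt(3))
    also have "\<dots> \<le> 200 / \<gamma> * real n * (T * (1 / real d * (1 / real e)))"
    proof (intro mult_left_mono)
      have 1: "M * K = real H * real B * (1 / real d * (1 / real e))" by (simp add: M_def K_def mult_ac)
      have "r' * K * M powr (2 - \<gamma>) = (r * real H * real B powr (2 - \<gamma>)) * (1 / (real d * real d) * (1 / (real e powr \<gamma> * real e powr (2 - \<gamma>))))"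
        using de B by (simp add: r'_def K_def M_def powr_divide)
      also have "real e powr \<gamma> * real e powr (2 - \<gamma>) = real e * real e"
        using de by (simp add: power2_eq_square flip: powr_add)
      also have "(r * real H * real B powr (2 - \<gamma>)) * (1 / (real d * real d) * (1 / (real e * real e)))
          \<le> (r * real H * real B powr (2 - \<gamma>)) * (1 / (real d * 1) * (1 / (real e * 1)))"
        using d e r by (intro mult_left_mono mult_mono divide_left_mono) auto
      finally show "M * K + r' * K * M powr (2 - \<gamma>) \<le> T * (1 / real d * (1 / real e))"
        unfolding 1 T_def by (simp add: algebra_simps)
    qed (use g in auto)
    finally show ?thesis by (simp add: mult_ac)
  qed
  have cover: "P = (\<Union>d\<in>{1..H}. \<Union>e\<in>{1..3 * B}. D d e)"
  proof (intro set_eqI iffI)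
    fix p assume p: "p \<in> P"
    obtain h b h' b' where p4: "p = ((h, b), (h', b'))" by (metis surj_pair)
    have hb: "1 \<le> h" "h \<le> H" "0 < b" "b \<le> 3 * B" using p by (auto simp: P_def p4)
    have "gcd h h' \<le> H" "gcd b b' \<le> 3 * B"
      using le_trans[OF gcd_le1_nat[of h h'] hb(2)] le_trans[OF gcd_le1_nat[of b b'] hb(4)] hb by auto
    then have "gcd h h' \<in> {1..H}" "gcd b b' \<in> {1..3 * B}"
      using hb by (auto simp: Suc_le_eq)
    then show "p \<in> (\<Union>d\<in>{1..H}. \<Union>e\<in>{1..3 * B}. D d e)" using p by (auto simp: D_def p4)
  qed (auto simp: D_def)
  have "card P \<le> (\<Sum>d\<in>{1..H}. card (\<Union>e\<in>{1..3 * B}. D d e))" by (subst cover, rule card_UN_le) auto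
  also have "\<dots> \<le> (\<Sum>d\<in>{1..H}. \<Sum>e\<in>{1..3 * B}. card (D d e))" by (intro sum_mono card_UN_le) auto
  finally have "real (card P) \<le> (\<Sum>d\<in>{1..H}. \<Sum>e\<in>{1..3 * B}. real (card (D d e)))" by (simp flip: of_nat_sum)
  also have "\<dots> \<le> (\<Sum>d\<in>{1..H}. \<Sum>e\<in>{1..3 * B}. 200 / \<gamma> * real n * T * (1 / real d * (1 / real e)))"
    by (intro sum_mono piece)
  also have "\<dots> = 200 / \<gamma> * real n * T * ((\<Sum>d\<in>{1..H}. 1 / real d) * (\<Sum>e\<in>{1..3 * B}. 1 / real e))"
    by (subst sum_product) (simp only: sum_distrib_left)
  also have "\<dots> \<le> 200 / \<gamma> * real n * T * (real n * real n)"
    using T g by (intro mult_left_mono mult_mono harmonic_dyadic H B3) (auto intro!: sum_nonneg)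
  also have "\<dots> = 200 / \<gamma> * real n ^ 3 * T" by (simp add: power3_eq_cube)
  finally show "real (card P) \<le> 200 / \<gamma> * real n ^ 3 * (real H * real B + r * real H * real B powr (2 - \<gamma>))"
    by (simp add: T_def)
qed

subsection \<open>Weyl differencing in a short block\<close>

fun rdiffs :: "nat list \<Rightarrow> (real \<Rightarrow> real) \<Rightarrow> real \<Rightarrow> real" where
  "rdiffs [] f = f"
| "rdiffs (q # qs) f = rdiffs qs (\<lambda>u. f (u + real q) - f u)"

lemma deriv_shift_diff:
  fixes f f' :: "real \<Rightarrow> real"
  assumes "\<And>u. 0 < u \<Longrightarrow> (f has_real_derivative f' u) (at u)" "0 < u"
  shows "((\<lambda>u. f (u + real q) - f u) has_real_derivative (f' (u + real q) - f' u)) (at u)"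
  using DERIV_shift[of f "f' (u + real q)" u "real q"] assms(1)[of u] assms(1)[of "u + real q"] assms(2)
  by (intro DERIV_diff) auto

lemma rdiffs_deriv:
  assumes "\<And>u. 0 < u \<Longrightarrow> (f has_real_derivative f' u) (at u)" "0 < u"
  shows "(rdiffs qs f has_real_derivative rdiffs qs f' u) (at u)"
  using assms
proof (induction qs arbitrary: f f')
  case Nil
  then show ?case by simp
next
  case (Cons q qs)
  show ?case
    unfolding rdiffs.simps using deriv_shift_diff[OF Cons.prems(1)] Cons.prems(2) by (intro Cons.IH)
qed

text \<open>\<open>F\<close> is a chain of successive derivatives, so each difference turns into one
  differentiation; the intermediate points are nested and end in a single one.\<close>

lemma rdiffs_mvt:
  fixes F :: "nat \<Rightarrow> real \<Rightarrow> real"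
  assumes "\<And>j u. 0 < u \<Longrightarrow> (F j has_real_derivative F (Suc j) u) (at u)" "0 < u"
  shows "\<exists>\<xi>. u \<le> \<xi> \<and> \<xi> \<le> u + real (sum_list qs) \<and> rdiffs qs (F j) u = real (prod_list qs) * F (j + length qs) \<xi>"
  using assms
proof (induction qs arbitrary: F)
  case Nil
  then show ?case by (auto intro!: exI[of _ u])
next
  case (Cons q qs)
  define G where "G = (\<lambda>j u. F j (u + real q) - F j u)"
  have dG: "(G j has_real_derivative G (Suc j) u) (at u)" if "0 < u" for j u
    unfolding G_def using deriv_shift_diff[OF Cons.prems(1) that] .
  from Cons.IH[of G, OF dG Cons.prems(2)]
  obtain \<xi> where \<xi>: "u \<le> \<xi>" "\<xi> \<le> u + real (sum_list qs)" "rdiffs qs (G j) u = real (prod_list qs) * G (j + length qs) \<xi>"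
    by blast
  have "\<exists>\<zeta>. \<xi> \<le> \<zeta> \<and> \<zeta> \<le> \<xi> + real q \<and> G (j + length qs) \<xi> = real q * F (Suc (j + length qs)) \<zeta>"
  proof (cases "q = 0")
    case True
    then show ?thesis by (auto simp: G_def intro!: exI[of _ \<xi>])
  next
    case False
    have "\<exists>\<zeta>>\<xi>. \<zeta> < \<xi> + real q \<and> F (j + length qs) (\<xi> + real q) - F (j + length qs) \<xi> = (\<xi> + real q - \<xi>) * F (Suc (j + length qs)) \<zeta>"
      by (rule MVT2) (use False \<xi> Cons.prems in auto)
    then show ?thesis by (auto simp: G_def intro: less_imp_le)
  qed
  then obtain \<zeta> where "\<xi> \<le> \<zeta>" "\<zeta> \<le> \<xi> + real q" "G (j + length qs) \<xi> = real q * F (Suc (j + length qs)) \<zeta>" by blast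
  then show ?case using \<xi> by (intro exI[of _ \<zeta>]) (auto simp: G_def)
qed

text \<open>\<open>x\<close> is a constant factor of the phase and passes through all differences.
  Only the function of \<open>l\<close> is differenced, so the result is again a trigonometric sum
  in \<open>x\<close>, as the large sieve requires.\<close>

lemma wdiffs_phase:
  "wdiffs qs (\<lambda>l. g l * ee (x * f (real l))) = (\<lambda>l. wdiffs qs g l * ee (x * rdiffs qs f (real l)))"
proof (induction qs arbitrary: g f)
  case Nil
  then show ?case by (simp add: wdiffs_def)
next
  case (Cons q qs)
  have "wdiff q (\<lambda>l. g l * ee (x * f (real l))) = (\<lambda>l. wdiff q g l * ee (x * (f (real l + real q) - f (real l))))"
    by (simp add: wdiff_def fun_eq_iff right_diff_distrib ee_diff mult_ac)
  then show ?case using Cons.IH[of "wdiff q g" "\<lambda>u. f (u + real q) - f u"] by (simp add: wdiffs_def)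
qed

text \<open>The falling factorial p (p - 1) ... (p - j + 1).\<close>

definition pw_coeff :: "real \<Rightarrow> nat \<Rightarrow> real" where
  "pw_coeff p j = (\<Prod>i<j. p - real i)"

definition pw_deriv :: "real \<Rightarrow> nat \<Rightarrow> real \<Rightarrow> real" where
  "pw_deriv p j u = pw_coeff p j * u powr (p - real j)"

lemma pw_deriv: "0 < u \<Longrightarrow> (pw_deriv p j has_real_derivative pw_deriv p (Suc j) u) (at u)"
  unfolding pw_deriv_def[abs_def] pw_coeff_def
  by (rule DERIV_cong, rule DERIV_cmult, rule has_real_derivative_powr) (auto simp: algebra_simps)

lemma pw_deriv_0: "pw_deriv p 0 = (\<lambda>u. u powr p)"
  by (simp add: pw_deriv_def pw_coeff_def fun_eq_iff)

lemma pw_coeff_nz: "p < 0 \<Longrightarrow> pw_coeff p j \<noteq> 0"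
  by (auto simp: pw_coeff_def)

text \<open>Differencing acts like \<open>prod_list qs\<close> times a derivative of u^p, here of
  order \<open>Suc k\<close>. For negative \<open>p\<close> it has constant sign, and on [K, 2 K]
  its modulus varies by a bounded factor only.\<close>

lemma rdiffs_powr_spacing:
  fixes u v p :: real
  assumes p: "p < 0" and K: "0 < K" and uv: "K \<le> u" "u < v" "v + real (sum_list qs) \<le> 2 * K"
  defines "k \<equiv> length qs"
  shows "\<bar>pw_coeff p (Suc k)\<bar> * real (prod_list qs) * (2 * K) powr (p - real (Suc k)) * (v - u)
       \<le> \<bar>rdiffs qs (\<lambda>u. u powr p) v - rdiffs qs (\<lambda>u. u powr p) u\<bar>"
    and "\<bar>rdiffs qs (\<lambda>u. u powr p) v - rdiffs qs (\<lambda>u. u powr p) u\<bar>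
       \<le> \<bar>pw_coeff p (Suc k)\<bar> * real (prod_list qs) * K powr (p - real (Suc k)) * (v - u)"
proof -
  let ?f = "rdiffs qs (\<lambda>u. u powr p)"
  have "\<exists>z>u. z < v \<and> ?f v - ?f u = (v - u) * rdiffs qs (pw_deriv p (Suc 0)) z"
  proof (rule MVT2[OF uv(2)])
    fix x assume "u \<le> x" "x \<le> v"
    then show "(?f has_real_derivative rdiffs qs (pw_deriv p (Suc 0)) x) (at x)"
      using rdiffs_deriv[OF pw_deriv[of _ p 0], of x qs] uv K by (simp add: pw_deriv_0)
  qed
  then obtain z where z: "u < z" "z < v" "?f v - ?f u = (v - u) * rdiffs qs (pw_deriv p (Suc 0)) z" by blast
  obtain \<xi> where \<xi>: "z \<le> \<xi>" "\<xi> \<le> z + real (sum_list qs)" "rdiffs qs (pw_deriv p (Suc 0)) z = real (prod_list qs) * pw_deriv p (Suc 0 + k) \<xi>"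
    using rdiffs_mvt[of "pw_deriv p" z qs "Suc 0", OF pw_deriv] z uv K unfolding k_def by auto
  have \<xi>K: "K \<le> \<xi>" "\<xi> \<le> 2 * K" using \<xi> z uv by auto
  have eq: "\<bar>?f v - ?f u\<bar> = \<bar>pw_coeff p (Suc k)\<bar> * real (prod_list qs) * \<xi> powr (p - real (Suc k)) * (v - u)"
    using z \<xi> uv by (simp add: pw_deriv_def abs_mult)
  have "(2 * K) powr (p - real (Suc k)) \<le> \<xi> powr (p - real (Suc k))" "\<xi> powr (p - real (Suc k)) \<le> K powr (p - real (Suc k))"
    using \<xi>K K p by (auto intro!: powr_mono2')
  then show "\<bar>pw_coeff p (Suc k)\<bar> * real (prod_list qs) * (2 * K) powr (p - real (Suc k)) * (v - u) \<le> \<bar>?f v - ?f u\<bar>"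
    "\<bar>?f v - ?f u\<bar> \<le> \<bar>pw_coeff p (Suc k)\<bar> * real (prod_list qs) * K powr (p - real (Suc k)) * (v - u)"
    unfolding eq using uv by (auto intro!: mult_left_mono mult_right_mono)
qed

context weyl_block
begin

lemma adm_wdiffs: "adm z \<Longrightarrow> adm (wdiffs qs z)"
  by (induction qs arbitrary: z) (auto simp: wdiffs_def adm_wdiff)

text \<open>The frequencies are rescaled affinely into the unit interval, where the large sieve applies.\<close>

lemma block_large_sieve:
  fixes x :: "'a \<Rightarrow> real"
  assumes Y: "finite Y" and x: "\<And>y. y \<in> Y \<Longrightarrow> 0 < x y \<and> x y \<le> X" and X: "0 < X" and p: "p < 0"
    and g: "adm g" and qs: "length qs = k" "set qs \<subseteq> {1..<Q}" and KN: "N + k * Q \<le> K"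
  defines "W \<equiv> \<bar>pw_coeff p (Suc k)\<bar> * real (prod_list qs) * real K powr (p - real (Suc k)) * real N"
  shows "0 < W"
    "(\<Sum>y\<in>Y. amp (wdiffs qs (\<lambda>l. g l * ee (x y * real l powr p))))\<^sup>2
      \<le> 400 * (2 powr (real (Suc k) - p) + X * W / real N) * gauss_form Y (\<lambda>y. x y * W)"
proof -
  define c where "c = \<bar>pw_coeff p (Suc k)\<bar>"
  have c: "0 < c" using pw_coeff_nz[OF p] by (simp add: c_def)
  have pl: "0 < prod_list qs" using qs(2) by (induction qs arbitrary: k) auto
  have N0: "0 < real N" "0 < real K" using Q K by auto
  have sl: "sum_list qs \<le> k * Q"
  proof -
    have "sum_list qs \<le> length qs * Q" using qs(2) by (induction qs arbitrary: k) auto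
    then show ?thesis using qs by simp
  qed
  show W: "0 < W" unfolding W_def using c pl N0 by (auto simp: c_def)
  define D where "D = (\<lambda>l::nat. rdiffs qs (\<lambda>u. u powr p) (real l))"
  define L where "L = {K..<K + N}"
  have bound: "c * real (prod_list qs) * (2 * real K) powr (p - real (Suc k)) * (real l' - real l) \<le> \<bar>D l' - D l\<bar>"
    "\<bar>D l' - D l\<bar> \<le> c * real (prod_list qs) * real K powr (p - real (Suc k)) * (real l' - real l)"
    if "l \<in> L" "l' \<in> L" "l < l'" for l l'
  proof -
    have "l' + sum_list qs \<le> 2 * K" using that(2) sl KN by (simp add: L_def)
    then have "real l' + real (sum_list qs) \<le> 2 * real K" by linarith
    then show "c * real (prod_list qs) * (2 * real K) powr (p - real (Suc k)) * (real l' - real l) \<le> \<bar>D l' - D l\<bar>"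
      "\<bar>D l' - D l\<bar> \<le> c * real (prod_list qs) * real K powr (p - real (Suc k)) * (real l' - real l)"
      using rdiffs_powr_spacing[OF p N0(2), of "real l" "real l'" qs] that qs(1)
      by (auto simp: L_def D_def c_def)
  qed
  define d where "d = (\<lambda>l. (D l - D K) / W)"
  define \<delta> where "\<delta> = 2 powr (p - real (Suc k)) / real N"
  have \<delta>: "0 < \<delta>" "\<delta> \<le> 1"
  proof -
    show "0 < \<delta>" using N0 by (simp add: \<delta>_def)
    have "2 powr (p - real (Suc k)) \<le> 2 powr 0" using p by (intro powr_mono) auto
    then show "\<delta> \<le> 1" using N0 Q by (simp add: \<delta>_def divide_le_eq)
  qed
  have W_eq: "c * real (prod_list qs) * real K powr (p - real (Suc k)) = W / real N"
    using N0 by (simp add: W_def c_def)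
  have d1: "\<bar>d l\<bar> \<le> 1" if "l \<in> L" for l
  proof (cases "l = K")
    case True
    then show ?thesis by (simp add: d_def)
  next
    case False
    then have l: "K < l" "K \<in> L" using that Q by (auto simp: L_def)
    have "\<bar>D l - D K\<bar> \<le> W / real N * (real l - real K)"
      using bound(2)[OF l(2) that l(1)] by (simp only: W_eq)
    also have "\<dots> \<le> W / real N * real N"
      using that W N0 by (intro mult_left_mono) (auto simp: L_def)
    finally show ?thesis using W N0 by (simp add: d_def abs_divide)
  qed
  have sep: "\<delta> \<le> \<bar>d l - d l'\<bar>" if "l \<in> L" "l' \<in> L" "l \<noteq> l'" for l l'
  proof -
    have *: "\<delta> \<le> \<bar>d b - d a\<bar>" if ab: "a \<in> L" "b \<in> L" "a < b" for a b
    proof -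
      have "W * \<delta> = c * real (prod_list qs) * (2 * real K) powr (p - real (Suc k))"
        using N0 by (simp add: \<delta>_def W_def c_def powr_mult)
      also have "\<dots> \<le> c * real (prod_list qs) * (2 * real K) powr (p - real (Suc k)) * (real b - real a)"
        using ab c mult_left_mono[of 1 "real b - real a" "c * real (prod_list qs) * (2 * real K) powr (p - real (Suc k))"]
        by simp
      also have "\<dots> \<le> \<bar>D b - D a\<bar>" by (rule bound(1)[OF ab])
      also have "\<dots> = W * \<bar>d b - d a\<bar>"
        using W by (simp add: d_def abs_mult flip: diff_divide_distrib)
      finally show ?thesis using W by simp
    qed
    show ?thesis using *[of l l'] *[of l' l] that by (cases "l < l'") (auto simp: abs_minus_commute)
  qed
  define S where "S = (\<lambda>y. \<Sum>l\<in>L. wdiffs qs g l * ee (x y * D l))"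
  have amp_S: "amp (wdiffs qs (\<lambda>l. g l * ee (x y * real l powr p))) = norm (S y) / real N" for y
    unfolding amp_def wdiffs_phase[of qs g "x y" "\<lambda>u. u powr p"] S_def L_def D_def ..
  \<comment> \<open>Factors of modulus at most 1 that turn each norm into a linear expression. The
    sum over \<open>y\<close> can then be moved inside, where it is a trigonometric sum at the
    points \<open>d l\<close>.\<close>
  define sg where "sg = (\<lambda>y. if S y = 0 then 0 else cnj (S y) / norm (S y))"
  define e where "e = (\<lambda>y. sg y * ee (x y * D K))"
  have e1: "norm (e y) \<le> 1" for y by (simp add: e_def sg_def norm_mult norm_divide)
  have S_e: "complex_of_real (norm (S y)) = (\<Sum>l\<in>L. wdiffs qs g l * (e y * ee (x y * W * d l)))" for y
  proof -
    have "complex_of_real (norm (S y)) = sg y * S y"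
    proof (cases "S y = 0")
      case False
      have "cnj (S y) * S y = complex_of_real (norm (S y)) * complex_of_real (norm (S y))"
        by (metis complex_norm_square mult.commute of_real_mult power2_eq_square)
      then show ?thesis using False by (simp add: sg_def field_simps)
    qed (simp add: sg_def)
    also have "\<dots> = (\<Sum>l\<in>L. wdiffs qs g l * (e y * ee (x y * W * d l)))"
    proof -
      have eq: "ee (x y * D l) = ee (x y * D K) * ee (x y * W * d l)" for l
      proof -
        have "W * d l = D l - D K" using W by (simp add: d_def)
        then have "x y * D K + x y * W * d l = x y * D l" by (simp add: mult.assoc right_diff_distrib)
        then show ?thesis by (metis ee_add)
      qed
      have "S y = (\<Sum>l\<in>L. wdiffs qs g l * (ee (x y * D K) * ee (x y * W * d l)))"
        unfolding S_def by (intro sum.cong refl arg_cong2[where f = "(*)"] eq)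
      then have "sg y * S y = sg y * (\<Sum>l\<in>L. wdiffs qs g l * (ee (x y * D K) * ee (x y * W * d l)))"
        by (rule arg_cong)
      then show "sg y * S y = (\<Sum>l\<in>L. wdiffs qs g l * (e y * ee (x y * W * d l)))"
        by (simp add: e_def sum_distrib_left mult_ac)
    qed
    finally show ?thesis .
  qed
  let ?T = "\<lambda>l. trig Y (\<lambda>y. x y * W) e (d l)"
  have "complex_of_real (\<Sum>y\<in>Y. norm (S y)) = (\<Sum>l\<in>L. wdiffs qs g l * ?T l)"
  proof -
    have "complex_of_real (\<Sum>y\<in>Y. norm (S y)) = (\<Sum>y\<in>Y. \<Sum>l\<in>L. wdiffs qs g l * (e y * ee (x y * W * d l)))"
      by (simp add: S_e)
    also have "\<dots> = (\<Sum>l\<in>L. \<Sum>y\<in>Y. wdiffs qs g l * (e y * ee (x y * W * d l)))" by (rule sum.swap)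
    finally show ?thesis by (simp add: trig_def[OF Y] sum_distrib_left)
  qed
  then have "(\<Sum>y\<in>Y. norm (S y)) \<le> norm (\<Sum>l\<in>L. wdiffs qs g l * ?T l)"
    by (metis abs_ge_self norm_of_real)
  also have "\<dots> \<le> (\<Sum>l\<in>L. norm (?T l))"
  proof (rule sum_norm_le)
    fix l
    have "norm (wdiffs qs g l) \<le> 1" using adm_wdiffs[OF g, of qs] by (simp add: adm_def)
    then show "norm (wdiffs qs g l * ?T l) \<le> norm (?T l)" by (simp add: norm_mult mult_left_le_one_le)
  qed
  finally have "(\<Sum>y\<in>Y. norm (S y))\<^sup>2 \<le> (\<Sum>l\<in>L. norm (?T l))\<^sup>2"
    by (intro power_mono sum_nonneg) auto
  also have "\<dots> \<le> (\<Sum>l\<in>L. (norm (?T l))\<^sup>2) * real (card L)" by (rule sum_squared_le_sum_of_squares)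
  also have "\<dots> = real N * (\<Sum>l\<in>L. (norm (?T l))\<^sup>2)" by (simp add: L_def)
  also have "\<dots> \<le> real N * (400 * (1 / \<delta> + X * W) * gauss_form Y (\<lambda>y. x y * W))"
  proof (intro mult_left_mono large_sieve[OF Y e1])
    show "\<bar>x y * W\<bar> \<le> X * W" if "y \<in> Y" for y using x[OF that] W by (simp add: abs_mult)
  qed (use X W \<delta> d1 sep in \<open>auto simp: L_def\<close>)
  finally have main: "(\<Sum>y\<in>Y. norm (S y))\<^sup>2 \<le> real N * (400 * (1 / \<delta> + X * W) * gauss_form Y (\<lambda>y. x y * W))" .
  have "(\<Sum>y\<in>Y. amp (wdiffs qs (\<lambda>l. g l * ee (x y * real l powr p))))\<^sup>2 = (\<Sum>y\<in>Y. norm (S y))\<^sup>2 / (real N)\<^sup>2"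
    by (simp add: amp_S power_divide flip: sum_divide_distrib)
  also have "\<dots> \<le> real N * (400 * (1 / \<delta> + X * W) * gauss_form Y (\<lambda>y. x y * W)) / (real N)\<^sup>2"
    by (intro divide_right_mono main) simp
  also have "\<dots> = 400 * ((1 / \<delta> + X * W) / real N) * gauss_form Y (\<lambda>y. x y * W)"
    using N0 by (simp add: power2_eq_square)
  also have "(1 / \<delta> + X * W) / real N = 2 powr (real (Suc k) - p) + X * W / real N"
  proof -
    have "1 / \<delta> = real N * 2 powr (real (Suc k) - p)"
      using N0 by (simp add: \<delta>_def powr_diff)
    then show ?thesis using N0 by (simp add: add_divide_distrib)
  qed
  finally show "(\<Sum>y\<in>Y. amp (wdiffs qs (\<lambda>l. g l * ee (x y * real l powr p))))\<^sup>2
      \<le> 400 * (2 powr (real (Suc k) - p) + X * W / real N) * gauss_form Y (\<lambda>y. x y * W)" .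
qed

end

text \<open>A pair further apart than \<open>t\<close> contributes at most exp (- t^2), as 2 pi^2 >=
  1; with \<open>t\<close> a power of N this is negligible.\<close>

lemma gauss_form_le:
  assumes Y: "finite Y" and t: "0 < t"
  shows "gauss_form Y v \<le> real (card {(y, y'). y \<in> Y \<and> y' \<in> Y \<and> \<bar>v y - v y'\<bar> \<le> t}) + (real (card Y))\<^sup>2 * exp (- t\<^sup>2)"
proof -
  let ?P = "{(y, y'). y \<in> Y \<and> y' \<in> Y \<and> \<bar>v y - v y'\<bar> \<le> t}"
  let ?f = "\<lambda>(y, y'). exp (- (2 * pi * (v y - v y'))\<^sup>2 / 2)"
  have sub: "?P \<subseteq> Y \<times> Y" by auto
  have "gauss_form Y v = (\<Sum>q\<in>Y \<times> Y. ?f q)"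
    unfolding gauss_form_def[OF Y] by (rule sum.cartesian_product)
  also have "\<dots> = (\<Sum>q\<in>?P. ?f q) + (\<Sum>q\<in>Y \<times> Y - ?P. ?f q)"
    using sub Y by (subst sum.subset_diff[of ?P]) auto
  also have "\<dots> \<le> (\<Sum>q\<in>?P. 1) + (\<Sum>q\<in>Y \<times> Y - ?P. exp (- t\<^sup>2))"
  proof (intro add_mono sum_mono)
    fix q assume q: "q \<in> Y \<times> Y - ?P"
    obtain y y' where yy: "q = (y, y')" by (cases q)
    have tv: "t \<le> \<bar>v y - v y'\<bar>" using q yy by auto
    have "t\<^sup>2 \<le> (v y - v y')\<^sup>2" using tv t by (metis abs_le_square_iff abs_of_pos)
    moreover have "2 * 1 \<le> 4 * pi\<^sup>2"
      using pi_gt3 by (intro mult_mono) (auto intro!: one_le_power)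
    ultimately have "t\<^sup>2 * 2 \<le> (v y - v y')\<^sup>2 * (4 * pi\<^sup>2)"
      by (intro mult_mono) auto
    moreover have "(2 * pi * w)\<^sup>2 / 2 = w\<^sup>2 * (4 * pi\<^sup>2) / 2" for w :: real by (simp add: power_mult_distrib)
    ultimately have "t\<^sup>2 \<le> (2 * pi * (v y - v y'))\<^sup>2 / 2" by (simp only:)
    then show "?f q \<le> exp (- t\<^sup>2)" by (simp add: yy)
  qed auto
  also have "\<dots> = real (card ?P) + real (card (Y \<times> Y - ?P)) * exp (- t\<^sup>2)" by simp
  also have "\<dots> \<le> real (card ?P) + real (card (Y \<times> Y)) * exp (- t\<^sup>2)"
    using Y by (intro add_left_mono mult_right_mono of_nat_mono card_mono) auto
  finally show ?thesis by (simp add: power2_eq_square card_cartesian_product)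
qed

lemma powr_expand_ge1:
  fixes u v Y1 \<rho> :: real
  assumes "1 \<le> \<rho>" "0 < Y1" "Y1 \<le> u" "Y1 \<le> v"
  shows "\<rho> * Y1 powr (\<rho> - 1) * \<bar>u - v\<bar> \<le> \<bar>u powr \<rho> - v powr \<rho>\<bar>"
proof -
  have *: "\<rho> * Y1 powr (\<rho> - 1) * (v - u) \<le> v powr \<rho> - u powr \<rho>" if "Y1 \<le> u" "u < v" for u v
  proof -
    have "\<exists>z>u. z < v \<and> v powr \<rho> - u powr \<rho> = (v - u) * (\<rho> * z powr (\<rho> - 1))"
      using that assms by (intro MVT2 has_real_derivative_powr) auto
    then obtain z where z: "u < z" "z < v" "v powr \<rho> - u powr \<rho> = (v - u) * (\<rho> * z powr (\<rho> - 1))" by blast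
    have "(v - u) * (\<rho> * Y1 powr (\<rho> - 1)) \<le> (v - u) * (\<rho> * z powr (\<rho> - 1))"
      using z that assms by (intro mult_left_mono powr_mono2) auto
    then show ?thesis using z by (simp add: mult_ac)
  qed
  show ?thesis
  proof (cases u v rule: linorder_cases)
    case less
    then have "\<bar>u - v\<bar> = v - u" by simp
    then show ?thesis using *[OF assms(3) less] by (intro order.trans[OF _ abs_ge_minus_self]) simp
  next
    case greater
    then have "\<bar>u - v\<bar> = u - v" by simp
    then show ?thesis using *[OF assms(4) greater] by (intro order.trans[OF _ abs_ge_self]) simp
  qed simp
qed

text \<open>The fixed \<open>y'\<close> cancels in differences, and above \<open>Y1\<close> the map
  v -> v^\<rho> expands distances by at least \<rho> Y1^(\<rho> - 1). So close points
  \<open>x\<close> come from close values of h b^\<gamma>, which \<open>pair_count\<close>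
  counts.\<close>

lemma gauss_form_pairs:
  fixes \<gamma> y' Y1 W t :: real and B H n :: nat and Y :: "(nat \<times> nat) set"
  assumes g: "0 < \<gamma>" "\<gamma> < 1" and B: "0 < B" and n: "H < 2 ^ n" "3 * B < 2 ^ n"
    and Y: "Y \<subseteq> {1..H} \<times> {B<..3 * B}" and Y1: "0 < Y1" and W: "0 < W" and t: "0 < t"
    and Yge: "\<And>h b. (h, b) \<in> Y \<Longrightarrow> Y1 \<le> real h * real b powr \<gamma> - y'"
  defines "\<rho> \<equiv> 1 / (1 - \<gamma>)"
  defines "x \<equiv> \<lambda>(h, b). (1 / \<gamma> - 1) * (\<gamma> * (real h * real b powr \<gamma> - y')) powr \<rho>"
    and "c \<equiv> (1 / \<gamma> - 1) * \<gamma> powr \<rho> * \<rho> * Y1 powr (\<rho> - 1)"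
  shows "gauss_form Y (\<lambda>y. x y * W) \<le> 200 / \<gamma> * real n ^ 3 * (real H * real B + t / (W * c) * real H * real B powr (2 - \<gamma>))
      + 4 * (real H * real B)\<^sup>2 * exp (- t\<^sup>2)"
proof -
  have fY: "finite Y" by (rule finite_subset[OF Y]) auto
  have \<rho>: "1 \<le> \<rho>" using g by (simp add: \<rho>_def field_simps)
  have g1: "0 < 1 / \<gamma> - 1" using g by (simp add: field_simps)
  have c: "0 < c" using g1 g \<rho> Y1 by (auto simp: c_def intro!: mult_pos_pos)
  define r where "r = t / (W * c)"
  have r: "0 \<le> r" using t W c by (simp add: r_def)
  let ?P = "{((h, b), (h', b')). h \<in> {1..H} \<and> b \<in> {B<..3 * B} \<and> h' \<in> {1..H} \<and> b' \<in> {B<..3 * B} \<and>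
      \<bar>real h * real b powr \<gamma> - real h' * real b' powr \<gamma>\<bar> \<le> r}"
  note pc = pair_count[OF g B r n]
  have sub: "{(y, y'). y \<in> Y \<and> y' \<in> Y \<and> \<bar>x y * W - x y' * W\<bar> \<le> t} \<subseteq> ?P"
  proof
    fix q assume q: "q \<in> {(y, y'). y \<in> Y \<and> y' \<in> Y \<and> \<bar>x y * W - x y' * W\<bar> \<le> t}"
    obtain h b h' b' where q4: "q = ((h, b), (h', b'))" by (metis surj_pair)
    define u v where "u = real h * real b powr \<gamma> - y'" and "v = real h' * real b' powr \<gamma> - y'"
    have uv: "Y1 \<le> u" "Y1 \<le> v" using q Yge by (auto simp: u_def v_def q4)
    have "c * \<bar>u - v\<bar> = (1 / \<gamma> - 1) * \<gamma> powr \<rho> * (\<rho> * Y1 powr (\<rho> - 1) * \<bar>u - v\<bar>)"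
      by (simp add: c_def mult_ac)
    also have "\<dots> \<le> (1 / \<gamma> - 1) * \<gamma> powr \<rho> * \<bar>u powr \<rho> - v powr \<rho>\<bar>"
      using g1 powr_expand_ge1[OF \<rho> Y1 uv] by (intro mult_left_mono) auto
    also have "\<dots> = \<bar>x (h, b) - x (h', b')\<bar>"
    proof -
      have "x (h, b) - x (h', b') = (1 / \<gamma> - 1) * \<gamma> powr \<rho> * (u powr \<rho> - v powr \<rho>)"
        using uv Y1 g unfolding x_def prod.case u_def[symmetric] v_def[symmetric]
        by (simp add: powr_mult algebra_simps)
      then show ?thesis using g1 by (simp add: abs_mult)
    qed
    finally have "c * \<bar>u - v\<bar> * W \<le> \<bar>x (h, b) - x (h', b')\<bar> * W" using W by (intro mult_right_mono) auto
    also have "\<dots> = \<bar>x (h, b) * W - x (h', b') * W\<bar>" using W by (simp add: abs_mult flip: left_diff_distrib)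
    also have "\<dots> \<le> t" using q by (simp add: q4)
    finally have "\<bar>u - v\<bar> \<le> r" using W c by (simp add: r_def pos_le_divide_eq mult_ac)
    moreover have "u - v = real h * real b powr \<gamma> - real h' * real b' powr \<gamma>" by (simp add: u_def v_def)
    ultimately show "q \<in> ?P" using q Y by (auto simp: q4)
  qed
  have "real (card {(y, y'). y \<in> Y \<and> y' \<in> Y \<and> \<bar>x y * W - x y' * W\<bar> \<le> t}) \<le> real (card ?P)"
    by (intro of_nat_mono card_mono pc(1) sub)
  also note pc(2)
  finally have cnt: "real (card {(y, y'). y \<in> Y \<and> y' \<in> Y \<and> \<bar>x y * W - x y' * W\<bar> \<le> t})
      \<le> 200 / \<gamma> * real n ^ 3 * (real H * real B + r * real H * real B powr (2 - \<gamma>))" .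
  have "card Y \<le> card ({1..H} \<times> {B<..3 * B})" by (rule card_mono) (use Y in auto)
  also have "\<dots> = H * (2 * B)" by (simp add: card_cartesian_product)
  finally have "real (card Y) \<le> real (H * (2 * B))" by (rule of_nat_mono)
  then have "(real (card Y))\<^sup>2 \<le> (real (H * (2 * B)))\<^sup>2" by (intro power_mono) auto
  then have cY: "(real (card Y))\<^sup>2 * exp (- t\<^sup>2) \<le> 4 * (real H * real B)\<^sup>2 * exp (- t\<^sup>2)"
    by (simp add: power_mult_distrib mult_ac)
  show ?thesis
    using gauss_form_le[OF fY t, of "\<lambda>y. x y * W"] cnt cY unfolding r_def by linarith
qed

text \<open>The product of the constants from the large sieve and from the pair count; the index 5
  is one more than the number of differences.\<close>

definition block_const :: "real \<Rightarrow> real" where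
  "block_const \<gamma> = (let \<rho> = 1 / (1 - \<gamma>); c4 = \<bar>pw_coeff (1 - \<rho>) 5\<bar>; k = 1 / \<gamma> - 1 in
     400 * (2 powr (4 + \<rho>) + k * 3 powr \<rho> * c4) * (200 / \<gamma> * (1 + 1 / (k * \<gamma> * \<rho> * c4)) + 4))"

lemma prod_list_le:
  "set qs \<subseteq> {1..<Q} \<Longrightarrow> 1 \<le> prod_list qs \<and> prod_list qs \<le> Q ^ length qs" for Q :: nat
proof (induction qs)
  case (Cons q qs)
  then have q: "1 \<le> q" "q \<le> Q" and IH: "1 \<le> prod_list qs" "prod_list qs \<le> Q ^ length qs" by auto
  show ?case using mult_le_mono[OF q(1) IH(1)] mult_le_mono[OF q(2) IH(2)] by simp
qed simp

context weyl_block
begin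

text \<open>The shifts enter only through their product q, between 1 and Q^4. The large sieve factor
  grows like q A / K^4, the close-pair term falls like K^5 / q. Each is taken at its worst q, while
  in the product of the two q cancels; this explains the summands \<open>real K ^ 5\<close> and
  \<open>real A * real K\<close>. The exponent 16 is 2^4.\<close>

lemma block_estimate:
  fixes \<gamma> y' t :: real and A B H n :: nat and Y :: "(nat \<times> nat) set"
  assumes g: "0 < \<gamma>" "\<gamma> < 1" and A: "0 < A" and B: "0 < B" and n: "H < 2 ^ n" "3 * B < 2 ^ n"
    and Y: "Y \<subseteq> {1..H} \<times> {B<..3 * B}" and t: "1 \<le> t" and NK: "N + 4 * Q \<le> K"
    and z: "adm z"
  defines "Y1 \<equiv> real K * real A powr (1 - \<gamma>) / \<gamma>"
  assumes Yr: "\<And>h b. (h, b) \<in> Y \<Longrightarrow> Y1 \<le> real h * real b powr \<gamma> - y' \<and> real h * real b powr \<gamma> - y' \<le> 3 * Y1"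
  defines "\<rho> \<equiv> 1 / (1 - \<gamma>)"
  defines "x \<equiv> \<lambda>(h, b). (1 / \<gamma> - 1) * (\<gamma> * (real h * real b powr \<gamma> - y')) powr \<rho>"
  shows "(\<Sum>y\<in>Y. amp (\<lambda>l. z l * ee (x y * real l powr (1 - \<rho>))) ^ 16) \<le> weyl_const 4 * (2 * real H * real B / real Q +
    sqrt (block_const \<gamma> * ((1 + real A * real Q ^ 4 / real K ^ 4) * (real n ^ 3 * (real H * real B) + (real H * real B)\<^sup>2 * exp (- t\<^sup>2))
      + real n ^ 3 * t * real H * real B powr (2 - \<gamma>) / real A powr \<gamma> * (real K ^ 5 + real A * real K) / real N)))"
    (is "_ \<le> _ * (_ + sqrt ?E)")
proof -
  have fY: "finite Y" by (rule finite_subset[OF Y]) auto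
  have pos: "0 < real K" "0 < real N" "0 < real Q" "0 < real A" using K Q A by auto
  define p where "p = 1 - \<rho>"
  have \<rho>: "1 < \<rho>" using g by (simp add: \<rho>_def field_simps)
  have p: "p < 0" using \<rho> by (simp add: p_def)
  define k where "k = 1 / \<gamma> - 1"
  have k: "0 < k" using g by (simp add: k_def field_simps)
  define c4 where "c4 = \<bar>pw_coeff p 5\<bar>"
  have c4: "0 < c4" using pw_coeff_nz[OF p] by (simp add: c4_def)
  have Y1: "0 < Y1" using pos g by (simp add: Y1_def)
  define E where "E = ?E"
  define X where "X = k * (\<gamma> * (3 * Y1)) powr \<rho>"
  have X: "0 < X" using k g Y1 by (simp add: X_def)
  have gr: "(1 - \<gamma>) * \<rho> = 1" using g by (simp add: \<rho>_def)
  have X_eq: "X = k * 3 powr \<rho> * real K powr \<rho> * real A"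
  proof -
    have "\<gamma> * (3 * Y1) = 3 * (real K * real A powr (1 - \<gamma>))" using g by (simp add: Y1_def)
    then show ?thesis unfolding X_def using pos by (simp only:) (simp add: powr_mult powr_powr gr)
  qed
  have x: "0 < x y \<and> x y \<le> X" if "y \<in> Y" for y
  proof -
    obtain h b where hb: "y = (h, b)" by (cases y)
    have "Y1 \<le> real h * real b powr \<gamma> - y'" "real h * real b powr \<gamma> - y' \<le> 3 * Y1" using Yr that hb by auto
    then show ?thesis unfolding x_def X_def hb prod.case k_def[symmetric]
      using k g Y1 \<rho> by (auto intro!: mult_left_mono powr_mono2 mult_pos_pos)
  qed
  define T1 where "T1 = 400 * (2 powr (4 + \<rho>) + k * 3 powr \<rho> * c4)"
  define T2 where "T2 = 200 / \<gamma> * (1 + 1 / (k * \<gamma> * \<rho> * c4)) + 4"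
  have "0 < 1 / (k * \<gamma> * \<rho> * c4)" using k c4 g \<rho> by simp
  then have "0 < 200 / \<gamma> * (1 + 1 / (k * \<gamma> * \<rho> * c4))" using g by (intro mult_pos_pos add_pos_pos) simp_all
  then have T2: "0 < T2" by (simp only: T2_def add_pos_pos zero_less_numeral)
  have T: "0 < T1" "0 < T2" using k c4 T2 by (auto simp: T1_def intro!: add_pos_pos mult_pos_pos)
  have bc: "block_const \<gamma> = T1 * T2"
    by (simp add: block_const_def T1_def T2_def Let_def k_def c4_def p_def \<rho>_def)
  have step: "(\<Sum>y\<in>Y. amp (wdiffs qs (\<lambda>l. z l * ee (x y * real l powr p)))) \<le> sqrt E"
    if qs: "length qs = 4" "set qs \<subseteq> {1..<Q}" for qs
  proof -
    define q where "q = real (prod_list qs)"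
    have q: "1 \<le> q" "q \<le> real Q ^ 4"
    proof -
      have "1 \<le> prod_list qs" "prod_list qs \<le> Q ^ 4" using prod_list_le[OF qs(2)] qs(1) by auto
      then have "real 1 \<le> real (prod_list qs)" "real (prod_list qs) \<le> real (Q ^ 4)" by (simp_all only: of_nat_le_iff)
      then show "1 \<le> q" "q \<le> real Q ^ 4" by (simp_all add: q_def)
    qed
    define W where "W = c4 * q * real K powr (p - 5) * real N"
    have bls: "0 < W" "(\<Sum>y\<in>Y. amp (wdiffs qs (\<lambda>l. z l * ee (x y * real l powr p))))\<^sup>2
        \<le> 400 * (2 powr (5 - p) + X * W / real N) * gauss_form Y (\<lambda>y. x y * W)"
      using block_large_sieve[OF fY x X p z qs(1) qs(2)] NK by (simp_all add: W_def c4_def q_def)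
    have XW: "X * W / real N = k * 3 powr \<rho> * c4 * (q * real A / real K ^ 4)"
    proof -
      have "real K powr \<rho> * real K powr (p - 5) = real K powr (- real 4)"
        by (simp add: p_def flip: powr_add)
      also have "\<dots> = 1 / real K ^ 4" using pos by (subst powr_minus_divide) (simp add: powr_realpow)
      finally have e: "real K powr \<rho> * real K powr (p - 5) = 1 / real K ^ 4" .
      have "X * W / real N = k * 3 powr \<rho> * c4 * q * real A * (real K powr \<rho> * real K powr (p - 5))"
        using pos by (simp add: X_eq W_def mult_ac)
      then show ?thesis by (simp add: e)
    qed
    define a where "a = q * real A / real K ^ 4"
    have a: "0 \<le> a" using q by (simp add: a_def)
    have f1: "400 * (2 powr (5 - p) + X * W / real N) \<le> T1 * (1 + a)"
    proof -
      have e: "5 - p = 4 + \<rho>" by (simp add: p_def)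
      have "T1 * (1 + a) - 400 * (2 powr (5 - p) + X * W / real N) = 400 * (2 powr (4 + \<rho>) * a + k * 3 powr \<rho> * c4)"
        unfolding e XW a_def[symmetric] T1_def by (simp add: algebra_simps)
      moreover have "0 \<le> 400 * (2 powr (4 + \<rho>) * a + k * 3 powr \<rho> * c4)" using a k c4 by simp
      ultimately show ?thesis by linarith
    qed
    define c where "c = k * \<gamma> powr \<rho> * \<rho> * Y1 powr (\<rho> - 1)"
    define d where "d = k * \<gamma> * \<rho> * c4"
    have d: "0 < d" using k g \<rho> c4 by (simp add: d_def)
    have Wc: "W * c = d * (q * real N * real A powr \<gamma> / real K ^ 5)"
    proof -
      have e1: "Y1 powr (\<rho> - 1) = real K powr (\<rho> - 1) * real A powr \<gamma> / \<gamma> powr (\<rho> - 1)"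
      proof -
        have "(1 - \<gamma>) * (\<rho> - 1) = \<gamma>" using gr by (simp add: algebra_simps)
        then show ?thesis using pos g by (simp add: Y1_def powr_mult powr_divide powr_powr)
      qed
      have e2: "real K powr (p - 5) * real K powr (\<rho> - 1) = 1 / real K ^ 5"
      proof -
        have "real K powr (p - 5) * real K powr (\<rho> - 1) = real K powr (- real 5)"
          by (simp add: p_def flip: powr_add)
        also have "\<dots> = 1 / real K ^ 5" using pos by (subst powr_minus_divide) (simp add: powr_realpow)
        finally show ?thesis .
      qed
      have e3: "\<gamma> powr \<rho> / \<gamma> powr (\<rho> - 1) = \<gamma>" using g by (simp flip: powr_diff)
      have "W * c = (c4 * q * real N * k * \<rho> * real A powr \<gamma>) * (real K powr (p - 5) * real K powr (\<rho> - 1)) * (\<gamma> powr \<rho> / \<gamma> powr (\<rho> - 1))"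
        unfolding W_def c_def e1 by simp
      then show ?thesis unfolding e2 e3 by (simp add: d_def mult_ac)
    qed
    define G where "G = real n ^ 3 * (real H * real B)"
    define M where "M = real n ^ 3 * t * real H * real B powr (2 - \<gamma>) / real A powr \<gamma> / real N"
    define V where "V = (real H * real B)\<^sup>2 * exp (- t\<^sup>2)"
    have GMV: "0 \<le> G" "0 \<le> M" "0 \<le> V" using t by (auto simp: G_def M_def V_def)
    have f2: "gauss_form Y (\<lambda>y. x y * W) \<le> T2 * (G + V + M * real K ^ 5 / q)"
    proof -
      have "gauss_form Y (\<lambda>y. x y * W) \<le> 200 / \<gamma> * real n ^ 3 * (real H * real B + t / (W * c) * real H * real B powr (2 - \<gamma>))
          + 4 * (real H * real B)\<^sup>2 * exp (- t\<^sup>2)"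
        using gauss_form_pairs[OF g B n Y Y1 bls(1), of t y'] Yr t
        unfolding x_def c_def k_def \<rho>_def by fastforce
      also have "\<dots> = 200 / \<gamma> * (G + M * real K ^ 5 / q * (1 / d)) + 4 * V"
        unfolding Wc using pos q d by (simp add: G_def M_def V_def field_simps)
      also have "\<dots> \<le> T2 * (G + V + M * real K ^ 5 / q)"
      proof -
        define m where "m = M * real K ^ 5 / q"
        have m: "0 \<le> m" using GMV q by (simp add: m_def)
        define w i where "w = 200 / \<gamma>" and "i = 1 / d"
        have "T2 = w * (1 + i) + 4" by (simp add: T2_def d_def w_def i_def)
        then have "T2 * (G + V + m) - (w * (G + m * i) + 4 * V) = w * (V + m + i * (G + V)) + 4 * (G + m)"
          by (simp add: algebra_simps)
        then have "T2 * (G + V + m) - (200 / \<gamma> * (G + m * (1 / d)) + 4 * V)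
            = 200 / \<gamma> * (V + m + (1 / d) * (G + V)) + 4 * (G + m)"
          by (simp only: w_def i_def)
        moreover have "0 \<le> 200 / \<gamma> * (V + m + (1 / d) * (G + V)) + 4 * (G + m)"
          using g d m GMV by (intro add_nonneg_nonneg mult_nonneg_nonneg) auto
        ultimately show ?thesis unfolding m_def by linarith
      qed
      finally show ?thesis .
    qed
    have "(\<Sum>y\<in>Y. amp (wdiffs qs (\<lambda>l. z l * ee (x y * real l powr p))))\<^sup>2 \<le> (T1 * (1 + a)) * (T2 * (G + V + M * real K ^ 5 / q))"
    proof (rule order.trans[OF bls(2)], rule mult_mono[OF f1 f2])
      show "0 \<le> T1 * (1 + a)" using T a by simp
      show "0 \<le> gauss_form Y (\<lambda>y. x y * W)" by (rule gauss_form_nonneg[OF fY])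
    qed
    also have "\<dots> = T1 * T2 * ((1 + a) * (G + V) + (M * real K ^ 5 / q + M * real A * real K))"
    proof -
      have am: "a * (M * real K ^ 5 / q) = M * real A * real K"
        using q pos by (simp add: a_def field_simps power_def numeral_eq_Suc)
      have "(T1 * (1 + a)) * (T2 * (G + V + m)) = T1 * T2 * ((1 + a) * (G + V) + (m + a * m))" for m
        by (simp add: algebra_simps)
      then show ?thesis by (simp only: am)
    qed
    also have "\<dots> \<le> T1 * T2 * ((1 + real A * real Q ^ 4 / real K ^ 4) * (G + V) + (M * real K ^ 5 / 1 + M * real A * real K))"
    proof (intro mult_left_mono add_mono mult_right_mono divide_left_mono)
      show "a \<le> real A * real Q ^ 4 / real K ^ 4"
        unfolding a_def using q by (intro divide_right_mono) (auto simp: mult.commute[of q] intro: mult_left_mono)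
    qed (use T GMV q in auto)
    also have "\<dots> = E"
      unfolding E_def bc G_def V_def M_def by (simp add: add_divide_distrib distrib_left)
    finally have "(\<Sum>y\<in>Y. amp (wdiffs qs (\<lambda>l. z l * ee (x y * real l powr p))))\<^sup>2 \<le> E" .
    then show ?thesis by (rule real_le_rsqrt)
  qed
  have E0: "0 \<le> sqrt E"
    unfolding E_def bc using T t by (intro real_sqrt_ge_zero mult_nonneg_nonneg add_nonneg_nonneg divide_nonneg_nonneg) auto
  have admz: "adm (\<lambda>l. z l * ee (x y * real l powr p))" for y
    using z by (auto simp: adm_def norm_mult)
  have "(\<Sum>y\<in>Y. amp (\<lambda>l. z l * ee (x y * real l powr p)) ^ (2 ^ 4)) \<le> weyl_const 4 * (real (card Y) / real Q + sqrt E)"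
    by (rule weyl_average[OF admz step E0])
  also have "\<dots> \<le> weyl_const 4 * (2 * real H * real B / real Q + sqrt E)"
  proof (intro mult_left_mono add_right_mono divide_right_mono)
    have "card Y \<le> card ({1..H} \<times> {B<..3 * B})" by (rule card_mono) (use Y in auto)
    also have "\<dots> = H * (2 * B)" by (simp add: card_cartesian_product)
    finally have "real (card Y) \<le> real (H * (2 * B))" by (rule of_nat_mono)
    then show "real (card Y) \<le> 2 * real H * real B" by simp
  qed (use weyl_const_pos[of 4] in auto)
  finally show ?thesis by (simp add: p_def E_def)
qed

end

subsection \<open>The top frequency range\<close>

text \<open>Blocks are aligned to multiples of \<open>N\<close> and so do not move with
  \<open>lo\<close> and \<open>hi\<close>, which vary with the frequency; this permits summing over
  the frequencies block by block. What no full block covers lies within \<open>N\<close> of an end: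
  at most 2 (N + 1) <= 4 N terms.\<close>

lemma sum_blocks_le:
  fixes T :: "nat \<Rightarrow> complex" and lo hi :: real and N :: nat
  assumes N: "0 < N" and M: "\<And>l. lo \<le> real l \<Longrightarrow> real l \<le> hi \<Longrightarrow> norm (T l) \<le> M" "0 \<le> M"
  defines "S \<equiv> {l::nat. lo \<le> real l \<and> real l \<le> hi}"
  defines "F \<equiv> {i. {i * N..<i * N + N} \<subseteq> S}"
  shows "finite F" "norm (\<Sum>l\<in>S. T l) \<le> (\<Sum>i\<in>F. norm (\<Sum>l\<in>{i * N..<i * N + N}. T l)) + 4 * real N * M"
proof -
  have fS: "finite S" unfolding S_def by (rule card_nat_between)
  have "(\<lambda>i. i * N) ` F \<subseteq> S" using N by (auto simp: F_def subset_iff)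
  moreover have "inj_on (\<lambda>i. i * N) F" using N by (auto simp: inj_on_def)
  ultimately show fF: "finite F" using fS finite_imageD finite_subset by metis
  define U where "U = (\<Union>i\<in>F. {i * N..<i * N + N})"
  have US: "U \<subseteq> S" by (auto simp: U_def F_def)
  have disj: "{i * N..<i * N + N} \<inter> {j * N..<j * N + N} = {}" if "i \<noteq> j" for i j
  proof -
    have "l div N = i" if "l \<in> {i * N..<i * N + N}" for l i
      using that by (intro div_nat_eqI) (auto simp: mult.commute)
    then show ?thesis using that by blast
  qed
  have sumU: "(\<Sum>l\<in>U. T l) = (\<Sum>i\<in>F. \<Sum>l\<in>{i * N..<i * N + N}. T l)"
    unfolding U_def using fF disj by (intro sum.UNION_disjoint) auto
  let ?P = "{l::nat. lo \<le> real l \<and> real l \<le> lo + real N}" and ?Q = "{l::nat. hi - real N \<le> real l \<and> real l \<le> hi}"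
  have rest: "S - U \<subseteq> ?P \<union> ?Q"
  proof
    fix l assume l: "l \<in> S - U"
    define i where "i = l div N"
    have li: "i * N \<le> l" "l < i * N + N" using N by (auto simp: i_def div_times_less_eq_dividend dividend_less_div_times add.commute)
    have "i \<notin> F"
    proof
      assume "i \<in> F"
      then have "l \<in> U" using li by (auto simp: U_def)
      then show False using l by simp
    qed
    then obtain m where m: "m \<in> {i * N..<i * N + N}" "m \<notin> S"
      unfolding F_def by blast
    have near: "real l < real m + real N" "real m < real l + real N"
      using m(1) li by (auto simp flip: of_nat_add)
    from m(2) consider "real m < lo" | "hi < real m" by (auto simp: S_def)
    then show "l \<in> ?P \<union> ?Q"
      using near l by cases (auto simp: S_def)
  qed
  have cardP: "real (card ?P) \<le> real N + 1" "real (card ?Q) \<le> real N + 1"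
    using card_nat_between(2)[of lo "lo + real N"] card_nat_between(2)[of "hi - real N" hi] by auto
  have fin: "finite ?P" "finite ?Q" by (rule card_nat_between)+
  have "card (S - U) \<le> card (?P \<union> ?Q)" using fin by (intro card_mono rest) auto
  also have "\<dots> \<le> card ?P + card ?Q" by (rule card_Un_le)
  finally have "real (card (S - U)) \<le> real (card ?P) + real (card ?Q)" by linarith
  then have cSU: "real (card (S - U)) \<le> 4 * real N" using cardP N by linarith
  have "(\<Sum>l\<in>S. T l) = (\<Sum>l\<in>U. T l) + (\<Sum>l\<in>S - U. T l)"
    using fS US by (simp add: sum.subset_diff[of U S])
  also have "norm \<dots> \<le> (\<Sum>i\<in>F. norm (\<Sum>l\<in>{i * N..<i * N + N}. T l)) + 4 * real N * M"
  proof (intro order.trans[OF norm_triangle_ineq] add_mono)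
    show "norm (\<Sum>l\<in>U. T l) \<le> (\<Sum>i\<in>F. norm (\<Sum>l\<in>{i * N..<i * N + N}. T l))"
      unfolding sumU by (rule norm_sum)
    have "norm (\<Sum>l\<in>S - U. T l) \<le> (\<Sum>l\<in>S - U. M)"
      by (rule sum_norm_le) (auto simp: S_def intro!: M)
    also have "\<dots> = real (card (S - U)) * M" by simp
    also have "\<dots> \<le> 4 * real N * M" by (intro mult_right_mono cSU M)
    finally show "norm (\<Sum>l\<in>S - U. T l) \<le> 4 * real N * M" .
  qed
  finally show "norm (\<Sum>l\<in>S. T l) \<le> (\<Sum>i\<in>F. norm (\<Sum>l\<in>{i * N..<i * N + N}. T l)) + 4 * real N * M" .
qed

lemma sum_inverse_sqrt_le: "(\<Sum>i\<in>{1..m}. 1 / sqrt (real i)) \<le> 2 * sqrt (real m)"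
proof (induction m)
  case (Suc m)
  have s: "0 \<le> sqrt (real m)" "sqrt (real m) \<le> sqrt (real (Suc m))" "0 < sqrt (real (Suc m))" by auto
  have "(sqrt (real (Suc m)) - sqrt (real m)) * (sqrt (real (Suc m)) + sqrt (real m)) = 1"
    by (simp add: algebra_simps)
  then have "1 \<le> (sqrt (real (Suc m)) - sqrt (real m)) * (2 * sqrt (real (Suc m)))"
    using s mult_left_mono[of "sqrt (real (Suc m)) + sqrt (real m)" "2 * sqrt (real (Suc m))" "sqrt (real (Suc m)) - sqrt (real m)"]
    by linarith
  then have "1 / sqrt (real (Suc m)) \<le> 2 * (sqrt (real (Suc m)) - sqrt (real m))"
    using s(3) by (simp only: pos_divide_le_eq mult_ac)
  then show ?case using Suc by simp
qed simp

text \<open>Pointwise f <= s + f^16 / s^15, in place of Hoelder's inequality.\<close>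

lemma sum_le_of_high_power:
  fixes f :: "'a \<Rightarrow> real"
  assumes "\<And>y. y \<in> Y \<Longrightarrow> 0 \<le> f y" "0 < s" "(\<Sum>y\<in>Y. f y ^ 16) \<le> C * s ^ 16"
  shows "(\<Sum>y\<in>Y. f y) \<le> (real (card Y) + C) * s"
proof -
  have "f y \<le> s + f y ^ 16 / s ^ 15" if "y \<in> Y" for y
  proof (cases "f y \<le> s")
    case True
    then show ?thesis using assms(1)[OF that] assms(2) by (simp add: add_increasing2)
  next
    case False
    have "f y * s ^ 15 \<le> f y * f y ^ 15" using False assms(2) by (intro mult_left_mono power_mono) auto
    then have "f y \<le> f y ^ 16 / s ^ 15" using assms(2) by (simp add: pos_le_divide_eq power_Suc[symmetric])
    then show ?thesis using assms(2) by simp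
  qed
  then have "(\<Sum>y\<in>Y. f y) \<le> (\<Sum>y\<in>Y. s + f y ^ 16 / s ^ 15)" by (rule sum_mono)
  also have "\<dots> = real (card Y) * s + (\<Sum>y\<in>Y. f y ^ 16) / s ^ 15" by (simp add: sum.distrib sum_divide_distrib)
  also have "\<dots> \<le> real (card Y) * s + C * s ^ 16 / s ^ 15"
    using assms(2,3) by (intro add_left_mono divide_right_mono) auto
  also have "C * s ^ 16 / s ^ 15 = C * s" using assms(2) by (simp add: power_def numeral_eq_Suc)
  finally show ?thesis by (simp add: distrib_right)
qed

text \<open>The right-hand side of \<open>block_estimate\<close>, named so that
  \<open>top_range\<close> can assume a bound for it that is uniform in \<open>K\<close>.\<close>

definition weyl_total :: "real \<Rightarrow> nat \<Rightarrow> nat \<Rightarrow> nat \<Rightarrow> nat \<Rightarrow> nat \<Rightarrow> nat \<Rightarrow> real \<Rightarrow> nat \<Rightarrow> real" where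
  "weyl_total \<gamma> A B H n N Q t K = weyl_block.weyl_const 4 * (2 * real H * real B / real Q +
    sqrt (block_const \<gamma> * ((1 + real A * real Q ^ 4 / real K ^ 4) * (real n ^ 3 * (real H * real B) + (real H * real B)\<^sup>2 * exp (- t\<^sup>2))
      + real n ^ 3 * t * real H * real B powr (2 - \<gamma>) / real A powr \<gamma> * (real K ^ 5 + real A * real K) / real N)))"

text \<open>For fixed \<open>y'\<close> the transformed sums are cut into blocks, and the sum over
  \<open>(h, b)\<close> is taken first; each block then saves \<open>s\<close> by the sixteenth
  moment. A term in block i has size about (A / (i N))^(1/2), and summing i^(-1/2) over the blocks
  restores the square-root bound, times \<open>s\<close>.\<close>

lemma top_range:
  fixes \<gamma> y' t X s t0 t1 :: real and A B H n N Q :: nat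
  assumes g: "0 < \<gamma>" "\<gamma> < 1" and A: "0 < A" and B: "0 < B" and n: "H < 2 ^ n" "3 * B < 2 ^ n"
    and t: "1 \<le> t" and Q: "0 < Q" "Q \<le> N" and s: "0 < s" and t0: "0 < t0" "0 \<le> t1"
    and X: "1 \<le> X" "12 * X * sqrt (\<gamma> * (1 - \<gamma>) * t1) \<le> real A"
    and NQ: "real N + 4 * real Q \<le> \<gamma> * t0 / (3 * real A)"
    and W: "\<And>K. \<gamma> * t0 / (3 * real A) \<le> real K \<Longrightarrow> real K \<le> t1 / real A \<Longrightarrow>
        weyl_total \<gamma> A B H n N Q t K \<le> 2 * real H * real B * s ^ 16"
  defines "Y \<equiv> {(h, b). h \<in> {1..H} \<and> b \<in> {B<..3 * B} \<and> t0 \<le> (real h * real b powr \<gamma> - y') * real A powr \<gamma>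
       \<and> (real h * real b powr \<gamma> - y') * real A powr \<gamma> \<le> t1}"
  shows "(\<Sum>(h, b)\<in>Y. norm (mono_sum \<gamma> A (real h * real b powr \<gamma> - y')))
    \<le> 32 * real H * real B * s * sqrt (3 * t1 / (1 - \<gamma>))
      + 2 * real H * real B * (121 * t1 / real A + 18 * sqrt t1 / (X * sqrt (\<gamma> * (1 - \<gamma>))) + 2592 * X ^ 4 / (\<gamma> * (1 - \<gamma>))
          + 605 + (60 + 48 * real N) * real A / sqrt (\<gamma> * (1 - \<gamma>) * t0))"
proof -
  define \<kappa> where kap: "\<kappa> = \<gamma> * (1 - \<gamma>)"
  have \<kappa>: "0 < \<kappa>" using g by (simp add: kap)
  define \<rho> where "\<rho> = 1 / (1 - \<gamma>)"
  define v where "v = (\<lambda>(h, b). real h * real b powr \<gamma> - y')"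
  have A0: "0 < real A" and N0: "0 < real N" using A Q by auto
  have Y_sub: "Y \<subseteq> {1..H} \<times> {B<..3 * B}" by (auto simp: Y_def)
  have fY: "finite Y" by (rule finite_subset[OF Y_sub]) auto
  have cY: "real (card Y) \<le> 2 * real H * real B"
  proof -
    have "card Y \<le> card ({1..H} \<times> {B<..3 * B})" by (rule card_mono) (use Y_sub in auto)
    also have "\<dots> = H * (2 * B)" by (simp add: card_cartesian_product)
    finally have "real (card Y) \<le> real (H * (2 * B))" by (rule of_nat_mono)
    then show ?thesis by simp
  qed
  define gd where "gd = (\<lambda>y. monomial_phase.good \<gamma> (v y) A)"
  define u where "u = (\<lambda>y l. monomial_phase.u0 \<gamma> (v y) l)"
  define T where "T = (\<lambda>y l. ee ((1 / \<gamma> - 1) * real l * u y l) * sqrt (u y l / ((1 - \<gamma>) * real l)))"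
  have v: "t0 \<le> v y * real A powr \<gamma>" "v y * real A powr \<gamma> \<le> t1" "0 < v y" if "y \<in> Y" for y
  proof -
    show *: "t0 \<le> v y * real A powr \<gamma>" "v y * real A powr \<gamma> \<le> t1" using that by (auto simp: Y_def v_def)
    have "0 < v y * real A powr \<gamma>" using * t0 by linarith
    then show "0 < v y" using A0 by (simp add: zero_less_mult_iff)
  qed
  have mp: "monomial_phase \<gamma> (v y) A" if "y \<in> Y" for y
    by (unfold_locales) (use g v[OF that] A in auto)
  define M where "M = 3 * real A / sqrt (\<kappa> * t0)"
  have M: "0 \<le> M" using \<kappa> t0 by (simp add: M_def)
  have good: "0 < l \<and> \<gamma> * t0 / (3 * real A) \<le> real l \<and> real l \<le> t1 / real A \<and> 0 < u y l \<and> u y l \<le> 3 * real A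
      \<and> real l \<le> \<gamma> * v y * real A powr (\<gamma> - 1) \<and> \<gamma> * v y * (3 * real A) powr (\<gamma> - 1) \<le> real l"
    if "y \<in> Y" "l \<in> gd y" for y l
  proof -
    interpret monomial_phase \<gamma> "v y" A by (rule mp[OF that(1)])
    have l: "l \<in> good" using that by (simp add: gd_def)
    have pl: "0 < l" by (rule good_pos[OF l])
    have b: "ph1 (3 * real A) + 1 \<le> real l" "real l \<le> ph1 (real A) - 1" using l by (auto simp: good_def)
    have 1: "\<gamma> * \<tau> / (3 * real A) \<le> ph1 (3 * real A)" using ph1_range(1)[of "3 * real A"] A0 by simp
    have 2: "ph1 (real A) \<le> \<gamma> * \<tau> / real A" using ph1_range(2)[of "real A"] A0 by simp
    have tt: "t0 \<le> \<tau>" "\<tau> \<le> t1" using v[OF that(1)] by (auto simp: \<tau>_def)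
    have "\<gamma> * t0 / (3 * real A) \<le> \<gamma> * \<tau> / (3 * real A)" using tt g A0 by (intro divide_right_mono mult_left_mono) auto
    moreover have "\<gamma> * \<tau> / real A \<le> t1 / real A"
      using tt g tau_pos mult_mono[of \<gamma> 1 \<tau> t1] by (intro divide_right_mono) auto
    moreover have "0 < u y l" "u y l \<le> 3 * real A"
      using u0_pos[OF pl] u0_range[OF l] by (auto simp: u_def)
    moreover have "real l \<le> \<gamma> * v y * real A powr (\<gamma> - 1)" using b(2) by (simp add: ph1_def)
    moreover have "\<gamma> * v y * (3 * real A) powr (\<gamma> - 1) \<le> real l" using b(1) by (simp add: ph1_def)
    ultimately show ?thesis using pl b 1 2 by linarith
  qed
  have TM: "norm (T y l) \<le> sqrt (3 * real A / ((1 - \<gamma>) * real K))" if "y \<in> Y" "l \<in> gd y" "0 < K" "K \<le> l" for y l K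
  proof -
    have "norm (T y l) = \<bar>sqrt (u y l / ((1 - \<gamma>) * real l))\<bar>" by (simp add: T_def norm_mult)
    also have "\<dots> = sqrt (u y l / ((1 - \<gamma>) * real l))" using good[OF that(1,2)] g by simp
    also have "\<dots> \<le> sqrt (3 * real A / ((1 - \<gamma>) * real K))"
      using good[OF that(1,2)] g that(3,4) by (intro real_sqrt_le_mono frac_le mult_left_mono) auto
    finally show ?thesis .
  qed
  have TM': "norm (T y l) \<le> M" if "y \<in> Y" "l \<in> gd y" for y l
  proof -
    note gl = good[OF that]
    have "norm (T y l) = sqrt (u y l / ((1 - \<gamma>) * real l))" using gl g by (simp add: T_def norm_mult)
    also have "\<dots> \<le> sqrt (3 * real A / ((1 - \<gamma>) * (\<gamma> * t0 / (3 * real A))))"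
      using gl g t0 A0 by (intro real_sqrt_le_mono frac_le mult_left_mono) auto
    also have "3 * real A / ((1 - \<gamma>) * (\<gamma> * t0 / (3 * real A))) = (3 * real A)\<^sup>2 / (\<kappa> * t0)"
      using g t0 A0 by (simp add: kap field_simps power2_eq_square)
    also have "sqrt \<dots> = M" unfolding M_def real_sqrt_divide real_sqrt_abs using A0 by simp
    finally show ?thesis .
  qed
  define e where "e = 121 * t1 / real A + 18 * sqrt t1 / (X * sqrt \<kappa>) + 2592 * X ^ 4 / \<kappa> + 605 + 60 * real A / sqrt (\<kappa> * t0)"
  have point: "norm (mono_sum \<gamma> A (v y)) \<le> 4 * norm (\<Sum>l\<in>gd y. T y l) + e" if y: "y \<in> Y" for y
  proof -
    interpret monomial_phase \<gamma> "v y" A by (rule mp[OF y])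
    have tt: "t0 \<le> \<tau>" "\<tau> \<le> t1" "0 < \<tau>" using v[OF y] tau_pos by (auto simp: \<tau>_def)
    have kk: "monomial_phase.\<kappa> \<gamma> = \<gamma> * (1 - \<gamma>)" by (simp add: \<kappa>_def)
    have "12 * X * sqrt (\<gamma> * (1 - \<gamma>) * \<tau>) \<le> 12 * X * sqrt (\<gamma> * (1 - \<gamma>) * t1)"
      using X tt g by (intro mult_left_mono real_sqrt_le_mono mult_left_mono) auto
    also note X(2)
    finally have sm: "12 * X * sqrt (monomial_phase.\<kappa> \<gamma> * \<tau>) \<le> real A" by (simp add: kk)
    let ?S = "\<Sum>l\<in>gd y. T y l"
    have "norm (mono_sum \<gamma> A (v y) - fresnel X * ?S)
       \<le> \<tau> / real A * (121 + 18 * real A / (X * sqrt (\<gamma> * (1 - \<gamma>) * \<tau>)) + 2592 * X ^ 4 * real A / (\<gamma> * (1 - \<gamma>) * \<tau>))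
        + 5 * (121 + 12 * real A / sqrt (\<gamma> * (1 - \<gamma>) * \<tau>))"
      using mono_sum_expand[OF X(1) sm] by (simp add: gd_def T_def u_def kk)
    also have "\<dots> = 121 * \<tau> / real A + 18 * sqrt \<tau> / (X * sqrt (\<gamma> * (1 - \<gamma>))) + 2592 * X ^ 4 / (\<gamma> * (1 - \<gamma>)) + 605
        + 60 * real A / sqrt (\<gamma> * (1 - \<gamma>) * \<tau>)"
    proof -
      have *: "\<tau> / real A * (18 * real A / (X * (k * r))) = 18 * r / (X * k)" if "\<tau> = r * r" "0 < r" for k r
        using that A0 by simp
      have "\<tau> / real A * (18 * real A / (X * sqrt (\<gamma> * (1 - \<gamma>) * \<tau>))) = 18 * sqrt \<tau> / (X * sqrt (\<gamma> * (1 - \<gamma>)))"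
        unfolding real_sqrt_mult[of _ \<tau>] by (rule *) (use tt in auto)
      moreover have "\<tau> / real A * (2592 * X ^ 4 * real A / (\<gamma> * (1 - \<gamma>) * \<tau>)) = 2592 * X ^ 4 / (\<gamma> * (1 - \<gamma>))"
        using A0 tt by simp
      ultimately show ?thesis by (simp only: distrib_left) simp
    qed
    also have "\<dots> \<le> 121 * t1 / real A + 18 * sqrt t1 / (X * sqrt (\<gamma> * (1 - \<gamma>))) + 2592 * X ^ 4 / (\<gamma> * (1 - \<gamma>)) + 605
        + 60 * real A / sqrt (\<gamma> * (1 - \<gamma>) * t0)"
      using tt t0 g X A0 by (intro add_mono divide_right_mono mult_left_mono divide_left_mono real_sqrt_le_mono mult_pos_pos) auto
    finally have "norm (mono_sum \<gamma> A (v y) - fresnel X * ?S) \<le> e" by (simp add: e_def kap)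
    moreover have "norm (fresnel X * ?S) \<le> 4 * norm ?S"
      unfolding norm_mult using norm_fresnel_le[of X] X by (intro mult_right_mono) auto
    ultimately show ?thesis
      using norm_triangle_sub[of "mono_sum \<gamma> A (v y)" "fresnel X * ?S"] by linarith
  qed
  define blk where "blk = (\<lambda>i. {i * N..<i * N + N})"
  define Fu where "Fu = (\<lambda>y. {i. blk i \<subseteq> gd y})"
  have blocks: "finite (Fu y) \<and> norm (\<Sum>l\<in>gd y. T y l) \<le> (\<Sum>i\<in>Fu y. norm (\<Sum>l\<in>blk i. T y l)) + 4 * real N * M" if y: "y \<in> Y" for y
  proof -
    interpret monomial_phase \<gamma> "v y" A by (rule mp[OF y])
    define lo hi where "lo = ph1 (3 * real A) + 1" and "hi = ph1 (real A) - 1"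
    have gs: "gd y = {l::nat. lo \<le> real l \<and> real l \<le> hi}" by (simp add: gd_def good_def lo_def hi_def)
    have Nn: "0 < N" using Q by simp
    show ?thesis
      unfolding Fu_def blk_def gs
      using sum_blocks_le[OF Nn _ M, of lo hi "T y"] TM'[OF y] by (simp add: gs)
  qed
  define m where "m = nat \<lfloor>t1 / (real A * real N)\<rfloor>"
  have Fu_range: "i \<in> {1..m} \<and> \<gamma> * t0 / (3 * real A) \<le> real (i * N) \<and> real (i * N) \<le> t1 / real A" if "y \<in> Y" "i \<in> Fu y" for y i
  proof -
    have "i * N \<in> gd y" using that Q by (auto simp: Fu_def blk_def subset_iff)
    note gi = good[OF that(1) this]
    have "real i \<le> t1 / (real A * real N)" using gi A0 N0 by (simp add: field_simps)
    then have "i \<le> m" by (simp add: m_def le_nat_floor)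
    then show ?thesis using gi by auto
  qed
  have inner: "(\<Sum>y\<in>{y \<in> Y. i \<in> Fu y}. norm (\<Sum>l\<in>blk i. T y l)) \<le> 4 * real H * real B * s * sqrt (3 * real A * real N / (1 - \<gamma>)) * (1 / sqrt (real i))"
    if i: "i \<in> {1..m}" for i
  proof (cases "{y \<in> Y. i \<in> Fu y} = {}")
    case True
    show ?thesis unfolding True using s g by simp
  next
    case False
    then obtain y0 where y0: "y0 \<in> Y" "i \<in> Fu y0" by blast
    define K where "K = i * N"
    have Kr: "\<gamma> * t0 / (3 * real A) \<le> real K" "real K \<le> t1 / real A" using Fu_range[OF y0] by (auto simp: K_def)
    have K0: "0 < K" using i Q by (auto simp: K_def)
    interpret weyl_block K N Q by unfold_locales (use K0 Q in auto)
    \<comment> \<open>Within a block the stationary phase weight is its value at \<open>K\<close>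
      times (K / l)^((\<rho> + 1) / 2). The latter factor is at most 1 and common to all
      frequencies, so an admissible \<open>z\<close> absorbs it.\<close>
    define z where "z = (\<lambda>l. if l \<in> {K..<K + N} then complex_of_real ((real K / real l) powr ((\<rho> + 1) / 2)) else 0)"
    have \<rho>: "1 < \<rho>" using g by (simp add: \<rho>_def field_simps)
    have admz: "adm z"
    proof -
      have "(real K / real l) powr ((\<rho> + 1) / 2) \<le> 1" if "K \<le> l" for l
        using that K0 \<rho> by (intro powr_le1) auto
      then show ?thesis by (auto simp: adm_def z_def)
    qed
    define Yi where "Yi = {y \<in> Y. i \<in> Fu y}"
    define x where "x = (\<lambda>(h, b). (1 / \<gamma> - 1) * (\<gamma> * (real h * real b powr \<gamma> - y')) powr \<rho>)"
    have xv: "x y = (1 / \<gamma> - 1) * (\<gamma> * v y) powr \<rho>" for y by (cases y) (simp add: x_def v_def)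
    have blkK: "blk i = {K..<K + N}" by (simp add: blk_def K_def)
    have K_in: "K \<in> gd y" if "y \<in> Yi" for y using that Q by (auto simp: Yi_def Fu_def blkK subset_iff)
    have T_eq: "T y l = sqrt (u y K / ((1 - \<gamma>) * real K)) * (z l * ee (x y * real l powr (1 - \<rho>)))"
      if y: "y \<in> Yi" and l: "l \<in> {K..<K + N}" for y l
    proof -
      have yY: "y \<in> Y" using y by (simp add: Yi_def)
      interpret monomial_phase \<gamma> "v y" A by (rule mp[OF yY])
      have l0: "0 < real l" "0 < real K" using l K0 by auto
      have ul: "u y l = (\<gamma> * v y) powr \<rho> * real l powr (- \<rho>)" if "0 < l" for l
        using that g v(3)[OF yY] by (simp add: u_def u0_def \<rho>_def powr_divide powr_minus_divide)
      have 1: "(1 / \<gamma> - 1) * real l * u y l = x y * real l powr (1 - \<rho>)"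
        using l0 by (simp add: ul xv powr_diff powr_minus_divide)
      have "u y l / ((1 - \<gamma>) * real l) = u y K / ((1 - \<gamma>) * real K) * ((real K / real l) powr ((\<rho> + 1) / 2))\<^sup>2"
      proof -
        have "((real K / real l) powr ((\<rho> + 1) / 2))\<^sup>2 = (real K / real l) powr (\<rho> + 1)"
          using l0 by (simp add: power2_eq_square flip: powr_add)
        also have "\<dots> = real K powr \<rho> * real K / (real l powr \<rho> * real l)"
          using l0 by (simp add: powr_divide powr_add)
        finally have e: "((real K / real l) powr ((\<rho> + 1) / 2))\<^sup>2 = real K powr \<rho> * real K / (real l powr \<rho> * real l)" .
        show ?thesis unfolding e using l0 by (simp add: ul powr_minus_divide)
      qed
      then have "sqrt (u y l / ((1 - \<gamma>) * real l)) = sqrt (u y K / ((1 - \<gamma>) * real K)) * (real K / real l) powr ((\<rho> + 1) / 2)"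
        by (simp only: real_sqrt_mult[of "u y K / ((1 - \<gamma>) * real K)"] real_sqrt_abs) simp
      then show ?thesis using l by (simp add: T_def 1 z_def)
    qed
    have bound: "norm (\<Sum>l\<in>blk i. T y l) \<le> sqrt (3 * real A / ((1 - \<gamma>) * real K)) * real N * amp (\<lambda>l. z l * ee (x y * real l powr (1 - \<rho>)))"
      if y: "y \<in> Yi" for y
    proof -
      have yY: "y \<in> Y" using y by (simp add: Yi_def)
      have "(\<Sum>l\<in>blk i. T y l) = sqrt (u y K / ((1 - \<gamma>) * real K)) * (\<Sum>l\<in>{K..<K + N}. z l * ee (x y * real l powr (1 - \<rho>)))"
        unfolding blkK sum_distrib_left by (intro sum.cong refl T_eq y)
      also have "norm \<dots> = \<bar>sqrt (u y K / ((1 - \<gamma>) * real K))\<bar> * (real N * amp (\<lambda>l. z l * ee (x y * real l powr (1 - \<rho>))))"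
        using N0 by (simp add: norm_mult amp_def)
      also have "\<dots> \<le> sqrt (3 * real A / ((1 - \<gamma>) * real K)) * (real N * amp (\<lambda>l. z l * ee (x y * real l powr (1 - \<rho>))))"
        using good[OF yY K_in[OF y]] g K0
        by (intro mult_right_mono) (auto intro!: divide_right_mono mult_nonneg_nonneg amp_nonneg)
      finally show ?thesis by simp
    qed
    have "(\<Sum>y\<in>Yi. amp (\<lambda>l. z l * ee (x y * real l powr (1 - \<rho>))) ^ 16) \<le> weyl_total \<gamma> A B H n N Q t K"
      unfolding weyl_total_def x_def \<rho>_def
    proof (rule block_estimate[OF g A B n _ t _ admz])
      show "Yi \<subseteq> {1..H} \<times> {B<..3 * B}" using Y_sub by (auto simp: Yi_def)
      have "real N + 4 * real Q \<le> real K" using NQ Kr(1) by linarith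
      then have "real (N + 4 * Q) \<le> real K" by simp
      then show "N + 4 * Q \<le> K" by (simp only: of_nat_le_iff)
      \<comment> \<open>That \<open>K\<close> is a good label confines the frequency to a range of
        ratio 3, since the derivative of the phase varies by at most 3^(1 - \<gamma>) <= 3 over
        [A, 3 A].\<close>
      fix h b assume hb: "(h, b) \<in> Yi"
      then have yY: "(h, b) \<in> Y" by (simp add: Yi_def)
      note gk = good[OF yY K_in[OF hb]]
      have AA: "real A powr (\<gamma> - 1) * real A powr (1 - \<gamma>) = 1" using A0 by (simp flip: powr_add)
      have "real K * real A powr (1 - \<gamma>) \<le> \<gamma> * v (h, b) * real A powr (\<gamma> - 1) * real A powr (1 - \<gamma>)"
        using gk by (intro mult_right_mono) auto
      also have "\<dots> = \<gamma> * v (h, b)" using AA by (simp add: mult.assoc)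
      finally have 1: "real K * real A powr (1 - \<gamma>) / \<gamma> \<le> v (h, b)" using g by (simp add: field_simps)
      have "\<gamma> * v (h, b) * (real A powr (\<gamma> - 1) / 3) \<le> \<gamma> * v (h, b) * (3 * real A) powr (\<gamma> - 1)"
      proof -
        have "3 powr (- 1) \<le> (3::real) powr (\<gamma> - 1)" using g by (intro powr_mono) auto
        then have "real A powr (\<gamma> - 1) * (1 / 3) \<le> real A powr (\<gamma> - 1) * 3 powr (\<gamma> - 1)"
          by (intro mult_left_mono) (auto simp: powr_minus)
        then show ?thesis using g v(3)[OF yY] by (intro mult_left_mono) (auto simp: powr_mult mult.commute)
      qed
      also have "\<dots> \<le> real K" using gk by simp
      finally have "\<gamma> * v (h, b) * (real A powr (\<gamma> - 1) / 3) * real A powr (1 - \<gamma>) \<le> real K * real A powr (1 - \<gamma>)"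
        by (intro mult_right_mono) auto
      then have "\<gamma> * v (h, b) / 3 * (real A powr (\<gamma> - 1) * real A powr (1 - \<gamma>)) \<le> real K * real A powr (1 - \<gamma>)"
        by (simp add: mult_ac)
      then have 2: "v (h, b) \<le> 3 * (real K * real A powr (1 - \<gamma>) / \<gamma>)" unfolding AA using g by (simp add: field_simps)
      show "real K * real A powr (1 - \<gamma>) / \<gamma> \<le> real h * real b powr \<gamma> - y' \<and>
          real h * real b powr \<gamma> - y' \<le> 3 * (real K * real A powr (1 - \<gamma>) / \<gamma>)"
        using 1 2 by (simp add: v_def)
    qed
    also have "\<dots> \<le> 2 * real H * real B * s ^ 16" by (rule W[OF Kr])
    finally have "(\<Sum>y\<in>Yi. amp (\<lambda>l. z l * ee (x y * real l powr (1 - \<rho>)))) \<le> (real (card Yi) + 2 * real H * real B) * s"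
      by (intro sum_le_of_high_power s amp_nonneg)
    also have "\<dots> \<le> (4 * real H * real B) * s"
    proof -
      have "card Yi \<le> card Y" by (intro card_mono fY) (auto simp: Yi_def)
      then have "real (card Yi) \<le> 2 * real H * real B" using cY by linarith
      then have "real (card Yi) + 2 * real H * real B \<le> 4 * real H * real B" by linarith
      then show ?thesis using s by (intro mult_right_mono) auto
    qed
    finally have S: "(\<Sum>y\<in>Yi. amp (\<lambda>l. z l * ee (x y * real l powr (1 - \<rho>)))) \<le> (4 * real H * real B) * s" .
    have "(\<Sum>y\<in>Yi. norm (\<Sum>l\<in>blk i. T y l)) \<le> (\<Sum>y\<in>Yi. sqrt (3 * real A / ((1 - \<gamma>) * real K)) * real N * amp (\<lambda>l. z l * ee (x y * real l powr (1 - \<rho>))))"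
      by (intro sum_mono bound)
    also have "\<dots> = sqrt (3 * real A / ((1 - \<gamma>) * real K)) * real N * (\<Sum>y\<in>Yi. amp (\<lambda>l. z l * ee (x y * real l powr (1 - \<rho>))))"
      by (simp add: sum_distrib_left)
    also have "\<dots> \<le> sqrt (3 * real A / ((1 - \<gamma>) * real K)) * real N * ((4 * real H * real B) * s)"
      using g by (intro mult_left_mono S) auto
    also have "sqrt (3 * real A / ((1 - \<gamma>) * real K)) * real N = sqrt (3 * real A * real N / (1 - \<gamma>)) * (1 / sqrt (real i))"
    proof -
      have *: "p / (q * (w * r)) * (r * r) = p * r / q * (1 / w)" if "0 < r" for p q w r :: real
        using that by simp
      show ?thesis
        using *[of "sqrt (real N)" "sqrt (3 * real A)" "sqrt (1 - \<gamma>)" "sqrt (real i)"] N0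
        by (simp only: K_def of_nat_mult real_sqrt_mult[of "1 - \<gamma>"] real_sqrt_mult[of _ "real N"] real_sqrt_divide) simp
    qed
    finally show ?thesis by (simp add: Yi_def mult_ac)
  qed
  have total: "(\<Sum>y\<in>Y. \<Sum>i\<in>Fu y. norm (\<Sum>l\<in>blk i. T y l)) \<le> 8 * real H * real B * s * sqrt (3 * t1 / (1 - \<gamma>))"
  proof -
    have "(\<Sum>y\<in>Y. \<Sum>i\<in>Fu y. norm (\<Sum>l\<in>blk i. T y l)) = (\<Sum>y\<in>Y. \<Sum>i\<in>{i \<in> {1..m}. i \<in> Fu y}. norm (\<Sum>l\<in>blk i. T y l))"
    proof (intro sum.cong refl)
      fix y assume "y \<in> Y"
      then show "Fu y = {i \<in> {1..m}. i \<in> Fu y}" using Fu_range by blast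
    qed
    also have "\<dots> = (\<Sum>i\<in>{1..m}. \<Sum>y\<in>{y \<in> Y. i \<in> Fu y}. norm (\<Sum>l\<in>blk i. T y l))"
      by (rule sum.swap_restrict) (use fY in auto)
    also have "\<dots> \<le> (\<Sum>i\<in>{1..m}. 4 * real H * real B * s * sqrt (3 * real A * real N / (1 - \<gamma>)) * (1 / sqrt (real i)))"
      by (intro sum_mono inner)
    also have "\<dots> = 4 * real H * real B * s * sqrt (3 * real A * real N / (1 - \<gamma>)) * (\<Sum>i\<in>{1..m}. 1 / sqrt (real i))"
      by (simp only: sum_distrib_left)
    also have "\<dots> \<le> 4 * real H * real B * s * sqrt (3 * real A * real N / (1 - \<gamma>)) * (2 * sqrt (t1 / (real A * real N)))"
    proof (rule mult_left_mono)
      have "2 * sqrt (real m) \<le> 2 * sqrt (t1 / (real A * real N))"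
        using t0(2) A0 N0 by (simp add: m_def)
      then show "(\<Sum>i\<in>{1..m}. 1 / sqrt (real i)) \<le> 2 * sqrt (t1 / (real A * real N))"
        using sum_inverse_sqrt_le[of m] by linarith
    qed (use s g in auto)
    also have "\<dots> = 8 * real H * real B * s * (sqrt (3 * real A * real N / (1 - \<gamma>)) * sqrt (t1 / (real A * real N)))" by simp
    also have "sqrt (3 * real A * real N / (1 - \<gamma>)) * sqrt (t1 / (real A * real N)) = sqrt (3 * t1 / (1 - \<gamma>))"
      using A0 N0 by (simp flip: real_sqrt_mult)
    finally show ?thesis .
  qed
  have "(\<Sum>(h, b)\<in>Y. norm (mono_sum \<gamma> A (real h * real b powr \<gamma> - y'))) = (\<Sum>y\<in>Y. norm (mono_sum \<gamma> A (v y)))"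
    by (intro sum.cong refl) (auto simp: v_def)
  also have "\<dots> \<le> (\<Sum>y\<in>Y. 4 * ((\<Sum>i\<in>Fu y. norm (\<Sum>l\<in>blk i. T y l)) + 4 * real N * M) + e)"
  proof (rule sum_mono)
    fix y assume y: "y \<in> Y"
    show "norm (mono_sum \<gamma> A (v y)) \<le> 4 * ((\<Sum>i\<in>Fu y. norm (\<Sum>l\<in>blk i. T y l)) + 4 * real N * M) + e"
      using point[OF y] mult_left_mono[OF conjunct2[OF blocks[OF y]], of 4] by argo
  qed
  also have "\<dots> = 4 * (\<Sum>y\<in>Y. \<Sum>i\<in>Fu y. norm (\<Sum>l\<in>blk i. T y l)) + real (card Y) * (16 * real N * M + e)"
    by (simp add: sum.distrib sum_distrib_left algebra_simps)
  also have "\<dots> \<le> 4 * (8 * real H * real B * s * sqrt (3 * t1 / (1 - \<gamma>))) + 2 * real H * real B * (16 * real N * M + e)"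
  proof (intro add_mono mult_left_mono mult_right_mono total cY)
    show "0 \<le> 16 * real N * M + e" using M \<kappa> t0 X by (simp add: e_def)
  qed auto
  also have "16 * real N * M + e = 121 * t1 / real A + 18 * sqrt t1 / (X * sqrt (\<gamma> * (1 - \<gamma>))) + 2592 * X ^ 4 / (\<gamma> * (1 - \<gamma>))
          + 605 + (60 + 48 * real N) * real A / sqrt (\<gamma> * (1 - \<gamma>) * t0)"
  proof -
    have "(60 + 48 * real N) * real A / r = 60 * real A / r + 16 * real N * (3 * real A / r)" for r
      by (simp add: algebra_simps add_divide_distrib)
    then show ?thesis unfolding e_def M_def kap by simp
  qed
  finally show ?thesis by simp
qed

subsection \<open>All frequency ranges\<close>

lemma norm_mono_sum_trivial: "norm (mono_sum \<gamma> A y) \<le> 2 * real A"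
proof -
  have "norm (mono_sum \<gamma> A y) \<le> (\<Sum>a\<in>{A<..3 * A}. 1)"
    unfolding mono_sum_def by (rule sum_norm_le) (simp add: norm_ee)
  then show ?thesis by simp
qed

lemma norm_mono_sum_minus: "norm (mono_sum \<gamma> A (- y)) = norm (mono_sum \<gamma> A y)"
proof -
  have "mono_sum \<gamma> A (- y) = cnj (mono_sum \<gamma> A y)"
    by (simp add: mono_sum_def cnj_ee)
  then show ?thesis by simp
qed

text \<open>
  With \<open>\<theta> = 1 - \<gamma>\<close>, the sizes are \<open>A \<approx> N^(1 - \<theta> - \<delta>)\<close>, \<open>B \<approx> N^(\<theta> + \<delta>)\<close> and \<open>H \<approx> N^(\<theta> + \<sigma>)\<close> for
  \<open>\<delta> = 10^(-5)\<close> and \<open>\<sigma> = 2 \<sqdot> 10^(-6)\<close>; all constants and logarithms are absorbed into \<open>N^(10^(-8))\<close>.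
\<close>

locale size_scale =
  fixes \<gamma> N :: real and A B H :: nat
  assumes \<gamma>: "20803 / 24979 < \<gamma>" "\<gamma> < 1" and N: "1 < N"
    and A: "N powr (\<gamma> - 1 / 10 ^ 5 - 1 / 10 ^ 8) \<le> real A" "real A \<le> N powr (\<gamma> - 1 / 10 ^ 5)"
    and B: "N powr (1 - \<gamma> + 1 / 10 ^ 5 - 1 / 10 ^ 8) \<le> real B" "real B \<le> N powr (1 - \<gamma> + 1 / 10 ^ 5)"
    and H: "N powr (1 - \<gamma> + 2 / 10 ^ 6 - 1 / 10 ^ 8) \<le> real H" "real H \<le> N powr (1 - \<gamma> + 2 / 10 ^ 6)"
    and big: "10 ^ 6 \<le> N powr (1 / 10 ^ 8)" "1 / (1 - \<gamma>) \<le> N powr (1 / 10 ^ 8)"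
      "block_const \<gamma> \<le> N powr (1 / 10 ^ 8)" "weyl_block.weyl_const 4 \<le> N powr (1 / 10 ^ 8)"
    and two_pow: "N < 2 ^ nat \<lfloor>N powr (1 / 10 ^ 8)\<rfloor>"
    and small: "exp (- (N powr (1 / 10 ^ 8))\<^sup>2) \<le> N powr (- 2)"
begin

section \<open>Arithmetic with exponents of N\<close>

abbreviation P where "P x \<equiv> N powr x"

lemma P_pos: "0 < P x" using N by simp

lemma P_add: "P x * P y = P (x + y)" by (simp add: powr_add)

lemma P_mono: "a \<le> P x \<Longrightarrow> x \<le> y \<Longrightarrow> a \<le> P y"
  using N powr_mono[of x y N] by linarith

lemma P_antimono: "P x \<le> a \<Longrightarrow> y \<le> x \<Longrightarrow> P y \<le> a"
  using N powr_mono[of y x N] by linarith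

lemma P_mult: "0 \<le> b \<Longrightarrow> a \<le> P x \<Longrightarrow> b \<le> P y \<Longrightarrow> a * b \<le> P (x + y)"
  unfolding P_add[symmetric] by (rule mult_mono) auto

lemma P_mult_ge: "P x \<le> a \<Longrightarrow> P y \<le> b \<Longrightarrow> P (x + y) \<le> a * b"
  unfolding P_add[symmetric]
proof -
  assume a: "P x \<le> a" "P y \<le> b"
  have "0 \<le> a" using a(1) P_pos[of x] by linarith
  then show "P x * P y \<le> a * b" using a by (intro mult_mono) auto
qed

lemma P_div: "a \<le> P x \<Longrightarrow> P y \<le> b \<Longrightarrow> a / b \<le> P (x - y)"
  unfolding powr_diff using P_pos[of y] by (intro frac_le) auto

lemma P_div_ge: "P x \<le> a \<Longrightarrow> 0 < b \<Longrightarrow> b \<le> P y \<Longrightarrow> P (x - y) \<le> a / b"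
  unfolding powr_diff
proof -
  assume a: "P x \<le> a" "0 < b" "b \<le> P y"
  have "0 \<le> a" using a(1) P_pos[of x] by linarith
  then show "P x / P y \<le> a / b" using a by (intro frac_le) auto
qed

lemma P_sqrt: "a \<le> P x \<Longrightarrow> sqrt a \<le> P (x / 2)"
proof -
  assume "a \<le> P x"
  then have "sqrt a \<le> sqrt (P x)" by simp
  also have "\<dots> = P (x / 2)" using P_pos[of x] by (simp add: powr_half_sqrt[symmetric] powr_powr)
  finally show ?thesis .
qed

lemma P_sqrt_ge: "P x \<le> a \<Longrightarrow> P (x / 2) \<le> sqrt a"
proof -
  assume "P x \<le> a"
  then have "sqrt (P x) \<le> sqrt a" by simp
  also have "sqrt (P x) = P (x / 2)" using P_pos[of x] by (simp add: powr_half_sqrt[symmetric] powr_powr)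
  finally show ?thesis .
qed

lemma P_powr: "0 \<le> a \<Longrightarrow> 0 \<le> p \<Longrightarrow> a \<le> P x \<Longrightarrow> a powr p \<le> P (x * p)"
  using powr_mono2[of p a "P x"] by (simp add: powr_powr)

lemma P_powr_ge: "0 \<le> p \<Longrightarrow> P x \<le> a \<Longrightarrow> P (x * p) \<le> a powr p"
  using powr_mono2[of p "P x" a] by (simp add: powr_powr)

lemma P_power: "0 \<le> a \<Longrightarrow> a \<le> P x \<Longrightarrow> a ^ k \<le> P (x * real k)"
  using power_mono[of a "P x" k] N by (simp add: powr_powr powr_realpow[symmetric])

lemma P_power_ge: "P x \<le> a \<Longrightarrow> P (x * real k) \<le> a ^ k"
  using power_mono[of "P x" a k] N by (simp add: powr_powr powr_realpow[symmetric])

lemma P_const: "a \<le> 10 ^ 6 \<Longrightarrow> a \<le> P (1 / 10 ^ 8)" using big(1) by linarith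

text \<open>The factor 2 is paid by 10^(-8) in the exponent, like every numerical constant
  here.\<close>

lemma P_sum: "a \<le> P x \<Longrightarrow> b \<le> P x \<Longrightarrow> a + b \<le> P (1 / 10 ^ 8 + x)"
proof -
  assume "a \<le> P x" "b \<le> P x"
  then have "a + b \<le> 2 * P x" by simp
  also have "\<dots> \<le> P (1 / 10 ^ 8) * P x" using P_pos[of x] by (intro mult_right_mono P_const) auto
  finally show ?thesis by (simp add: P_add)
qed

lemma P_floor: "0 \<le> x \<Longrightarrow> P (x - 1 / 10 ^ 8) \<le> real (nat \<lfloor>P x\<rfloor>) \<and> real (nat \<lfloor>P x\<rfloor>) \<le> P x"
proof -
  assume "0 \<le> x"
  then have 1: "1 \<le> P x" using N by (simp add: ge_one_powr_ge_zero)
  have "P (x - 1 / 10 ^ 8) \<le> P x / 2"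
    unfolding powr_diff using P_const[of 2] P_pos[of x] by (intro divide_left_mono mult_pos_pos) auto
  moreover have "P x / 2 \<le> real (nat \<lfloor>P x\<rfloor>) \<and> real (nat \<lfloor>P x\<rfloor>) \<le> P x"
  proof -
    have "1 \<le> \<lfloor>P x\<rfloor>" using 1 by simp
    then have "real (nat \<lfloor>P x\<rfloor>) = of_int \<lfloor>P x\<rfloor>" "1 \<le> real_of_int \<lfloor>P x\<rfloor>" by simp_all
    moreover have "P x < of_int \<lfloor>P x\<rfloor> + 1" "of_int \<lfloor>P x\<rfloor> \<le> P x" by simp_all
    ultimately show ?thesis by argo
  qed
  ultimately show ?thesis by linarith
qed

text \<open>Takes the place of log N in the counting lemmas, as \<open>two_pow\<close> gives
  \<open>N < 2 ^ n\<close>.\<close>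

definition n where "n = nat \<lfloor>P (1 / 10 ^ 8)\<rfloor>"

lemma n_le: "real n \<le> P (1 / 10 ^ 8)" using P_floor[of "1 / 10 ^ 8"] by (simp add: n_def)

lemma pos: "0 < A" "0 < B" "0 < H"
  using A(1) B(1) H(1) P_pos[of "\<gamma> - 1 / 10 ^ 5 - 1 / 10 ^ 8"] P_pos[of "1 - \<gamma> + 1 / 10 ^ 5 - 1 / 10 ^ 8"]
    P_pos[of "1 - \<gamma> + 2 / 10 ^ 6 - 1 / 10 ^ 8"] by linarith+

lemma H_lt: "H < 2 ^ n" and B_lt: "3 * B < 2 ^ n"
proof -
  have "real H \<le> P 1" by (rule P_mono[OF H(2)]) (use \<gamma> in simp)
  also have "P 1 < 2 ^ n" using two_pow N by (simp add: n_def)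
  also have "\<dots> = real (2 ^ n)" by simp
  finally show "H < 2 ^ n" by (simp only: of_nat_less_iff)
  have "3 * real B \<le> P 1" by (rule P_mono[OF P_mult[OF _ P_const B(2)]]) (use \<gamma> in simp_all)
  then have "real (3 * B) \<le> P 1" by simp
  also have "P 1 < 2 ^ n" using two_pow N by (simp add: n_def)
  also have "\<dots> = real (2 ^ n)" by simp
  finally show "3 * B < 2 ^ n" by (simp only: of_nat_less_iff)
qed

section \<open>Pairs of frequencies, by size\<close>

definition I where "I = {1..H} \<times> {B<..3 * B}"
definition w where "w = (\<lambda>(h, b). real h * real b powr \<gamma>)"
definition G where "G p q = norm (mono_sum \<gamma> A (w p - w q))"
text \<open>The quantity \<tau> for the frequency \<open>w p - w q\<close>.\<close>

definition size where "size p q = \<bar>w p - w q\<bar> * real A powr \<gamma>"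

lemma fin_I: "finite I" by (simp add: I_def)

lemma card_I: "real (card I) = 2 * real H * real B" by (simp add: I_def card_cartesian_product)

lemma G_nonneg: "0 \<le> G p q" by (simp add: G_def)

lemma G_sym: "G p q = G q p"
  unfolding G_def using norm_mono_sum_minus[of \<gamma> A "w p - w q"] by simp

lemma A_powr: "P ((\<gamma> - 1 / 10 ^ 5) * \<gamma> - 1 / 10 ^ 8) \<le> real A powr \<gamma>"
  by (rule P_antimono[OF P_powr_ge[OF _ A(1)]]) (use \<gamma> in \<open>auto simp: algebra_simps\<close>)

text \<open>In terms of \<theta> = 1 - \<gamma>: the diagonal N^(2 \<theta>), and a proportion N^(u
  - 1) of all N^(4 \<theta>) pairs, sizes being spread up to about N.\<close>

lemma near_pairs:
  "real (card {(p, q) \<in> I \<times> I. size p q \<le> P u})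
    \<le> P (2 - 2 * \<gamma> + 12 / 10 ^ 6 + 8 / 10 ^ 8) + P (u + 3 - 4 * \<gamma> + 22 / 10 ^ 6 + 8 / 10 ^ 8)"
proof -
  define r where "r = P u / real A powr \<gamma>"
  have r0: "0 \<le> r" by (simp add: r_def)
  have r: "r \<le> P (u - ((\<gamma> - 1 / 10 ^ 5) * \<gamma> - 1 / 10 ^ 8))"
    unfolding r_def by (rule P_div[OF order_refl A_powr])
  let ?S = "{((h, b), (h', b')). h \<in> {1..H} \<and> b \<in> {B<..3 * B} \<and> h' \<in> {1..H} \<and> b' \<in> {B<..3 * B} \<and>
      \<bar>real h * real b powr \<gamma> - real h' * real b' powr \<gamma>\<bar> \<le> r}"
  have "{(p, q) \<in> I \<times> I. size p q \<le> P u} = ?S"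
    using pos by (auto simp: I_def size_def w_def r_def pos_le_divide_eq)
  then have "real (card {(p, q) \<in> I \<times> I. size p q \<le> P u}) = real (card ?S)" by simp
  also have "\<dots> \<le> 200 / \<gamma> * real n ^ 3 * (real H * real B + r * real H * real B powr (2 - \<gamma>))"
    by (rule pair_count(2)) (use \<gamma> pos r0 H_lt B_lt in auto)
  also have "\<dots> = 200 / \<gamma> * real n ^ 3 * (real H * real B) + 200 / \<gamma> * real n ^ 3 * (r * real H * real B powr (2 - \<gamma>))"
    by (rule distrib_left)
  also have "\<dots> \<le> P (2 - 2 * \<gamma> + 12 / 10 ^ 6 + 8 / 10 ^ 8) + P (u + 3 - 4 * \<gamma> + 22 / 10 ^ 6 + 8 / 10 ^ 8)"
  proof (rule add_mono)
    have g: "200 / \<gamma> \<le> 10 ^ 6" using \<gamma> by (simp add: field_simps)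
    note c = P_mult[OF _ P_const[OF g] P_power[OF _ n_le, of 3]]
    show "200 / \<gamma> * real n ^ 3 * (real H * real B) \<le> P (2 - 2 * \<gamma> + 12 / 10 ^ 6 + 8 / 10 ^ 8)"
      by (rule P_mono[OF P_mult[OF _ c P_mult[OF _ H(2) B(2)]]]) simp_all
    have "(1 - \<gamma> + d) * (2 - \<gamma>) - (\<gamma> - d) * \<gamma> = 2 + 2 * d - 3 * \<gamma>" for d by (simp add: algebra_simps)
    from this[of "1 / 10 ^ 5"] have e: "1 / 10 ^ 8 + 1 / 10 ^ 8 * real 3 + (u - ((\<gamma> - 1 / 10 ^ 5) * \<gamma> - 1 / 10 ^ 8) + (1 - \<gamma> + 2 / 10 ^ 6)
        + (1 - \<gamma> + 1 / 10 ^ 5) * (2 - \<gamma>)) \<le> u + 3 - 4 * \<gamma> + 22 / 10 ^ 6 + 8 / 10 ^ 8" by simp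
    show "200 / \<gamma> * real n ^ 3 * (r * real H * real B powr (2 - \<gamma>)) \<le> P (u + 3 - 4 * \<gamma> + 22 / 10 ^ 6 + 8 / 10 ^ 8)"
      by (intro P_mono[OF P_mult[OF _ c P_mult[OF _ P_mult[OF _ r H(2)] P_powr[OF _ _ B(2)]]] e]) (use \<gamma> r0 in auto)
  qed
  finally show ?thesis .
qed

text \<open>Separate exponents \<open>u\<close> and \<open>v\<close>, because the two terms of the
  van der Corput bound are largest at opposite ends of a range of sizes.\<close>

lemma G_bound:
  assumes u: "P u \<le> size p q" and v: "size p q \<le> 3 * P v" and uv: "1 / 2 \<le> v" "v \<le> 11 / 10"
  shows "G p q \<le> P (v / 2 + 8 / 10 ^ 8) + P (\<gamma> - 1 / 10 ^ 5 - u / 2 + 8 / 10 ^ 8)"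
proof -
  define y where "y = \<bar>w p - w q\<bar>"
  have "0 < y * real A powr \<gamma>" using u P_pos[of u] unfolding size_def y_def by linarith
  then have y: "0 < y" using pos by (simp add: zero_less_mult_iff)
  interpret monomial_phase \<gamma> y A by unfold_locales (use \<gamma> y pos in auto)
  have tau: "\<tau> = size p q" by (simp only: \<tau>_def size_def flip: y_def)
  have G: "G p q = norm (mono_sum \<gamma> A y)"
    unfolding G_def y_def abs_if using norm_mono_sum_minus[of \<gamma> A "w p - w q"] by simp
  define k where "k = sqrt (1 / \<kappa>)"
  have inv: "1 / \<kappa> \<le> P (2 / 10 ^ 8)"
  proof -
    have "1 / \<gamma> * (1 / (1 - \<gamma>)) \<le> P (1 / 10 ^ 8 + 1 / 10 ^ 8)"
      by (intro P_mult P_const big(2)) (use \<gamma> in \<open>auto simp: field_simps\<close>)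
    then show ?thesis by (simp add: \<kappa>_def)
  qed
  have k: "k \<le> P (1 / 10 ^ 8)" using P_sqrt[OF inv] by (simp add: k_def)
  have k0: "0 \<le> k" using kap_pos by (simp add: k_def)
  have t: "0 < \<tau>" using tau_pos .
  have v': "\<tau> \<le> P (v + 1 / 10 ^ 8)" using order.trans[OF v P_mult[OF _ P_const order_refl]] by (simp add: tau add.commute)
  have sq: "1 / sqrt (\<kappa> * \<tau>) = k / sqrt \<tau>" using kap_pos t by (simp add: k_def real_sqrt_mult real_sqrt_divide)
  have "G p q \<le> (\<tau> / real A + 2) * (121 + 12 * real A / sqrt (\<kappa> * \<tau>))" unfolding G by (rule norm_mono_sum_le)
  also have "\<dots> = 121 * \<tau> / real A + 12 * (\<tau> * (1 / sqrt (\<kappa> * \<tau>))) + 242 + 24 * real A * (1 / sqrt (\<kappa> * \<tau>))"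
    using pos by (simp add: algebra_simps add_divide_distrib)
  also have "\<dots> = (121 * \<tau> / real A + 12 * (k * sqrt \<tau>)) + 242 + 24 * real A * (k / sqrt \<tau>)"
  proof -
    have "\<tau> * (k / sqrt \<tau>) = k * (\<tau> / sqrt \<tau>)" by simp
    also have "\<tau> / sqrt \<tau> = sqrt \<tau>" using t by (intro real_div_sqrt) simp
    finally show ?thesis unfolding sq by simp
  qed
  also have "\<dots> \<le> P (v / 2 + 8 / 10 ^ 8) + P (\<gamma> - 1 / 10 ^ 5 - u / 2 + 8 / 10 ^ 8)"
  proof (rule add_mono)
    have c: "121 * \<tau> / real A \<le> P (v / 2 + 6 / 10 ^ 8)"
      by (rule P_mono[OF P_div[OF P_mult[OF _ P_const v'] A(1)]]) (use t \<gamma> uv in auto)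
    have d: "12 * (k * sqrt \<tau>) \<le> P (v / 2 + 6 / 10 ^ 8)"
      by (rule P_mono[OF P_mult[OF _ P_const P_mult[OF _ k P_sqrt[OF v']]]]) (use t k0 in \<open>auto simp: field_simps\<close>)
    have e: "242 \<le> P (1 / 10 ^ 8 + (v / 2 + 6 / 10 ^ 8))" by (rule P_mono[OF P_const]) (use uv in auto)
    show "(121 * \<tau> / real A + 12 * (k * sqrt \<tau>)) + 242 \<le> P (v / 2 + 8 / 10 ^ 8)"
      by (rule P_mono[OF P_sum[OF P_sum[OF c d] e]]) simp
    have "P (u / 2) \<le> sqrt \<tau>" using P_sqrt_ge[OF u] by (simp add: tau)
    then show "24 * real A * (k / sqrt \<tau>) \<le> P (\<gamma> - 1 / 10 ^ 5 - u / 2 + 8 / 10 ^ 8)"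
      by (intro P_mono[OF P_mult[OF _ P_mult[OF _ P_const A(2)] P_div[OF k]]]) (use k0 t in auto)
  qed
  finally show ?thesis .
qed

text \<open>A B^2 has exponent 2 - \<gamma> + 10^(-5). The gap of 2 / 10^6 contains the final saving
  1 / 10^6 and the losses by constants.\<close>

definition goal_exp where "goal_exp = 2 - \<gamma> + 8 / 10 ^ 6"

text \<open>Trivial bound for each sum. Since \<gamma> > 0.8, the diagonal dominates the count up to
  size N^0.6, and A H B = N^(2 - \<gamma> + \<sigma>): this is where \<sigma> must be smaller than
  \<delta>.\<close>

lemma low_part: "(\<Sum>(p, q)\<in>{(p, q) \<in> I \<times> I. size p q \<le> P (6 / 10)}. G p q) \<le> P goal_exp"
proof -
  let ?S = "{(p, q) \<in> I \<times> I. size p q \<le> P (6 / 10)}"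
  have "(\<Sum>(p, q)\<in>?S. G p q) \<le> (\<Sum>p\<in>?S. 2 * real A)"
    by (intro sum_mono) (auto simp: G_def norm_mono_sum_trivial)
  also have "\<dots> = 2 * real A * real (card ?S)" by simp
  also have "\<dots> \<le> 2 * real A * (P (2 - 2 * \<gamma> + 12 / 10 ^ 6 + 8 / 10 ^ 8) + P (6 / 10 + 3 - 4 * \<gamma> + 22 / 10 ^ 6 + 8 / 10 ^ 8))"
    by (intro mult_left_mono near_pairs) auto
  also have "\<dots> \<le> P goal_exp"
  proof (rule P_mono[OF P_mult[OF _ P_mult[OF _ P_const A(2)] P_sum]])
    show "P (6 / 10 + 3 - 4 * \<gamma> + 22 / 10 ^ 6 + 8 / 10 ^ 8) \<le> P (2 - 2 * \<gamma> + 12 / 10 ^ 6 + 8 / 10 ^ 8)"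
      using \<gamma> N by (intro powr_mono) auto
  qed (auto simp: goal_exp_def)
  finally show ?thesis .
qed

text \<open>Here A \<tau>^(-1/2) is the larger term, at most about N^(\<gamma> - 0.3); the count of
  pairs up to size N^0.8 leaves a factor N^(-0.01) to spare.\<close>

lemma mid_part:
  "(\<Sum>(p, q)\<in>{(p, q) \<in> I \<times> I. P (6 / 10) \<le> size p q \<and> size p q \<le> P (8 / 10)}. G p q) \<le> P goal_exp"
proof -
  let ?S = "{(p, q) \<in> I \<times> I. P (6 / 10) \<le> size p q \<and> size p q \<le> P (8 / 10)}"
  let ?S' = "{(p, q) \<in> I \<times> I. size p q \<le> P (8 / 10)}"
  let ?M = "P (\<gamma> - 3 / 10)"
  have "(\<Sum>(p, q)\<in>?S. G p q) \<le> (\<Sum>p\<in>?S. ?M)"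
  proof (intro sum_mono, clarsimp)
    fix h b h' b' assume s: "P (3 / 5) \<le> size (h, b) (h', b')" "size (h, b) (h', b') \<le> P (4 / 5)"
    have "G (h, b) (h', b') \<le> P (4 / 5 / 2 + 8 / 10 ^ 8) + P (\<gamma> - 1 / 10 ^ 5 - 3 / 5 / 2 + 8 / 10 ^ 8)"
      by (rule G_bound[OF s(1)]) (use s(2) P_pos[of "4 / 5"] in linarith)+
    also have "\<dots> \<le> P (1 / 10 ^ 8 + (\<gamma> - 1 / 10 ^ 5 - 3 / 10 + 8 / 10 ^ 8))"
      by (rule P_sum; rule P_mono[OF order_refl]) (use \<gamma> in auto)
    also have "\<dots> \<le> ?M" using N by (intro powr_mono) auto
    finally show "G (h, b) (h', b') \<le> ?M" .
  qed
  also have "\<dots> = ?M * real (card ?S)" by simp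
  also have "\<dots> \<le> ?M * real (card ?S')"
    using fin_I by (intro mult_left_mono of_nat_mono card_mono) (auto intro: finite_subset[of _ "I \<times> I"])
  also have "\<dots> \<le> ?M * (P (2 - 2 * \<gamma> + 12 / 10 ^ 6 + 8 / 10 ^ 8) + P (8 / 10 + 3 - 4 * \<gamma> + 22 / 10 ^ 6 + 8 / 10 ^ 8))"
    by (intro mult_left_mono near_pairs) auto
  also have "\<dots> \<le> P goal_exp"
  proof (rule P_mono[OF P_mult[OF _ order_refl P_sum]])
    show "P (8 / 10 + 3 - 4 * \<gamma> + 22 / 10 ^ 6 + 8 / 10 ^ 8) \<le> P (23 / 10 - 2 * \<gamma> - 1 / 100)"
      using \<gamma> N by (intro powr_mono) auto
    show "P (2 - 2 * \<gamma> + 12 / 10 ^ 6 + 8 / 10 ^ 8) \<le> P (23 / 10 - 2 * \<gamma> - 1 / 100)"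
      using \<gamma> N by (intro powr_mono) auto
  qed (auto simp: goal_exp_def)
  finally show ?thesis .
qed

lemma all_pairs: "real (card (I \<times> I)) \<le> P (4 - 4 * \<gamma> + 24 / 10 ^ 6 + 1 / 10 ^ 8)"
proof -
  have "real (card (I \<times> I)) = 4 * ((real H * real B) * (real H * real B))"
    by (simp add: card_cartesian_product card_I)
  also have "\<dots> \<le> P (1 / 10 ^ 8 + ((1 - \<gamma> + 2 / 10 ^ 6 + (1 - \<gamma> + 1 / 10 ^ 5)) + (1 - \<gamma> + 2 / 10 ^ 6 + (1 - \<gamma> + 1 / 10 ^ 5))))"
    by (intro P_mult P_const H(2) B(2)) auto
  also have "\<dots> \<le> P (4 - 4 * \<gamma> + 24 / 10 ^ 6 + 1 / 10 ^ 8)" using N by (intro powr_mono) auto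
  finally show ?thesis .
qed

text \<open>All pairs are counted, each with the bound N^(v / 2). The last assumption is N^(4
  \<theta> + v / 2) <= N^(1 + \<theta>) with a margin; at v = 1 it is the barrier \<theta> <
  1/6.\<close>

lemma high_part:
  assumes v: "9 / 10 \<le> v" "v \<le> 11 / 10" "v / 2 + 3 * (1 - \<gamma>) + 17 / 10 ^ 6 \<le> 1"
  shows "(\<Sum>(p, q)\<in>{(p, q) \<in> I \<times> I. P (8 / 10) \<le> size p q \<and> size p q \<le> 3 * P v}. G p q) \<le> P goal_exp"
proof -
  let ?S = "{(p, q) \<in> I \<times> I. P (8 / 10) \<le> size p q \<and> size p q \<le> 3 * P v}"
  let ?M = "P (v / 2 + 8 / 10 ^ 8) + P (\<gamma> - 1 / 10 ^ 5 - 8 / 10 / 2 + 8 / 10 ^ 8)"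
  have "(\<Sum>(p, q)\<in>?S. G p q) \<le> (\<Sum>p\<in>?S. ?M)"
    by (intro sum_mono) (use v in \<open>auto intro!: G_bound[where u = "8 / 10" and v = v, simplified]\<close>)
  also have "\<dots> = ?M * real (card ?S)" by simp
  also have "\<dots> \<le> ?M * real (card (I \<times> I))"
    using fin_I by (intro mult_left_mono of_nat_mono card_mono) auto
  also have "\<dots> \<le> ?M * P (4 - 4 * \<gamma> + 24 / 10 ^ 6 + 1 / 10 ^ 8)"
    by (intro mult_left_mono all_pairs) auto
  also have "\<dots> = P (v / 2 + 8 / 10 ^ 8 + (4 - 4 * \<gamma> + 24 / 10 ^ 6 + 1 / 10 ^ 8))
      + P (\<gamma> - 1 / 10 ^ 5 - 8 / 10 / 2 + 8 / 10 ^ 8 + (4 - 4 * \<gamma> + 24 / 10 ^ 6 + 1 / 10 ^ 8))"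
    by (simp only: distrib_right P_add)
  also have "\<dots> \<le> P (1 / 10 ^ 8 + (goal_exp - 1 / 10 ^ 8))"
    by (rule P_sum; rule P_mono[OF order_refl]) (use v \<gamma> in \<open>auto simp: goal_exp_def\<close>)
  finally show ?thesis by simp
qed

section \<open>The largest sizes when \<theta> is close to 1/6\<close>

lemma P_inverse: "0 < a \<Longrightarrow> 1 / a \<le> P x \<Longrightarrow> P (- x) \<le> a"
  using P_pos[of x] by (simp add: powr_minus field_simps)

lemma theta_ge: "P (- (1 / 10 ^ 8)) \<le> 1 - \<gamma>"
  by (rule P_inverse[OF _ big(2)]) (use \<gamma> in simp)

lemma kappa_ge: "P (- (2 / 10 ^ 8)) \<le> \<gamma> * (1 - \<gamma>)"
proof -
  have "1 / \<gamma> \<le> P (1 / 10 ^ 8)" by (rule P_const) (use \<gamma> in \<open>simp add: field_simps\<close>)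
  then have "P (- (1 / 10 ^ 8)) \<le> \<gamma>" by (intro P_inverse) (use \<gamma> in auto)
  from P_mult_ge[OF this theta_ge] show ?thesis by simp
qed

lemma P_one: "0 \<le> x \<Longrightarrow> 1 \<le> P x" using N by (simp add: ge_one_powr_ge_zero)

text \<open>The exponents of h, b^\<gamma> and A^\<gamma> add up to 1 + \<sigma>: \<delta>
  cancels.\<close>

lemma size_le: "p \<in> I \<Longrightarrow> q \<in> I \<Longrightarrow> size p q \<le> 3 * P (1 + 2 / 10 ^ 6)"
proof -
  have w: "0 \<le> w p \<and> w p * real A powr \<gamma> \<le> 3 * P (1 + 2 / 10 ^ 6)" if pI: "p \<in> I" for p
  proof -
    obtain h b where p: "p = (h, b)" "h \<le> H" "b \<le> 3 * B" using pI by (cases p) (auto simp: I_def)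
    have "real b powr \<gamma> \<le> (3 * real B) powr \<gamma>" using p(3) \<gamma> by (intro powr_mono2) auto
    also have "\<dots> \<le> 3 * P ((1 - \<gamma> + 1 / 10 ^ 5) * \<gamma>)"
      unfolding powr_mult using powr_mono[of \<gamma> 1 3] \<gamma> P_powr[OF _ _ B(2), of \<gamma>] by (intro mult_mono) auto
    finally have b: "real b powr \<gamma> \<le> 3 * P ((1 - \<gamma> + 1 / 10 ^ 5) * \<gamma>)" .
    have a: "real A powr \<gamma> \<le> P ((\<gamma> - 1 / 10 ^ 5) * \<gamma>)" using P_powr[OF _ _ A(2), of \<gamma>] \<gamma> by simp
    have h: "real h \<le> P (1 - \<gamma> + 2 / 10 ^ 6)" using p(2) H(2) by linarith
    have "w p * real A powr \<gamma> = real h * real b powr \<gamma> * real A powr \<gamma>" by (simp add: p w_def)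
    also have "\<dots> \<le> P (1 - \<gamma> + 2 / 10 ^ 6) * (3 * P ((1 - \<gamma> + 1 / 10 ^ 5) * \<gamma>)) * P ((\<gamma> - 1 / 10 ^ 5) * \<gamma>)"
      by (intro mult_mono a b h) auto
    also have "\<dots> = 3 * P (1 - \<gamma> + 2 / 10 ^ 6 + (1 - \<gamma> + 1 / 10 ^ 5) * \<gamma> + (\<gamma> - 1 / 10 ^ 5) * \<gamma>)"
      by (simp only: P_add[symmetric] mult_ac)
    also have "1 - \<gamma> + 2 / 10 ^ 6 + (1 - \<gamma> + 1 / 10 ^ 5) * \<gamma> + (\<gamma> - 1 / 10 ^ 5) * \<gamma> = 1 + 2 / 10 ^ 6"
      by (simp add: algebra_simps)
    finally show ?thesis by (simp add: p w_def)
  qed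
  assume "p \<in> I" "q \<in> I"
  note wp = w[OF \<open>p \<in> I\<close>] and wq = w[OF \<open>q \<in> I\<close>]
  have "size p q \<le> max (w p) (w q) * real A powr \<gamma>"
    unfolding size_def using wp wq by (intro mult_right_mono) auto
  also have "\<dots> \<le> 3 * P (1 + 2 / 10 ^ 6)" using wp wq by (simp add: max_def)
  finally show ?thesis .
qed

text \<open>The choice of exponents. Q = N^0.0254 is nearly the largest for which the large sieve
  still yields H B / Q, and its sixteenth root gives s = N^(-0.00158). The block length N^0.16 must
  stay below the smallest labels, about N^(0.9968 - \<gamma>). Below size N^0.9968 the square-root
  bound alone suffices, as 0.4984 < 1 - 3 \<theta>.\<close>

definition Q where "Q = nat \<lfloor>P (254 / 10 ^ 4)\<rfloor>"
definition M where "M = nat \<lfloor>P (16 / 10 ^ 2)\<rfloor>"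
definition s where "s = P (- (158 / 10 ^ 5))"
definition t0 where "t0 = P (9968 / 10 ^ 4)"
definition t1 where "t1 = 3 * P (1 + 2 / 10 ^ 6)"

lemma Q: "P (254 / 10 ^ 4 - 1 / 10 ^ 8) \<le> real Q" "real Q \<le> P (254 / 10 ^ 4)"
  and M: "P (16 / 10 ^ 2 - 1 / 10 ^ 8) \<le> real M" "real M \<le> P (16 / 10 ^ 2)"
  using P_floor[of "254 / 10 ^ 4"] P_floor[of "16 / 10 ^ 2"] by (auto simp: Q_def M_def)

lemma t1_le: "t1 \<le> P (1 + 2 / 10 ^ 6 + 1 / 10 ^ 8)"
  unfolding t1_def by (rule P_mono[OF P_mult[OF _ P_const order_refl]]) auto

lemma K_low: "P (9968 / 10 ^ 4 - \<gamma> + 1 / 10 ^ 5 - 1 / 10 ^ 8) \<le> \<gamma> * t0 / (3 * real A)"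
proof -
  have "3 / \<gamma> \<le> 10 ^ 6" using \<gamma> by (simp add: field_simps)
  then have 1: "3 / \<gamma> * real A \<le> P (1 / 10 ^ 8 + (\<gamma> - 1 / 10 ^ 5))" by (intro P_mult P_const A(2)) auto
  have "P (9968 / 10 ^ 4 - (1 / 10 ^ 8 + (\<gamma> - 1 / 10 ^ 5))) \<le> t0 / (3 / \<gamma> * real A)"
    unfolding t0_def by (rule P_div_ge[OF order_refl _ 1]) (use \<gamma> pos in auto)
  then show ?thesis by (simp add: algebra_simps)
qed

lemma HB: "P (2 - 2 * \<gamma> + 12 / 10 ^ 6 - 2 / 10 ^ 8) \<le> real H * real B" "real H * real B \<le> P (2 - 2 * \<gamma> + 12 / 10 ^ 6)"
  by (rule P_antimono[OF P_mult_ge[OF H(1) B(1)]]; simp) (rule P_mono[OF P_mult[OF _ H(2) B(2)]]; simp)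

text \<open>Of the two terms under the root, \<open>D1\<close> (large sieve with the diagonal pairs)
  is critical and needs the upper bound on \<gamma>; \<open>D2\<close> (close pairs) has room,
  thanks to blocks as long as N^0.16.\<close>

lemma weyl_total_le:
  assumes g: "\<gamma> \<le> 8334 / 10 ^ 4" and K: "\<gamma> * t0 / (3 * real A) \<le> real K" "real K \<le> t1 / real A"
  shows "weyl_total \<gamma> A B H n M Q (P (1 / 10 ^ 8)) K \<le> 2 * real H * real B * s ^ 16"
proof -
  have Kl: "P (9968 / 10 ^ 4 - \<gamma> + 1 / 10 ^ 5 - 1 / 10 ^ 8) \<le> real K" using K_low K(1) by linarith
  have Ku: "real K \<le> P (1 - \<gamma> + 12 / 10 ^ 6 + 2 / 10 ^ 8)"
    by (rule P_mono[OF order.trans[OF K(2) P_div[OF t1_le A(1)]]]) simp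
  have wc: "0 < weyl_block.weyl_const 4"
    by (rule weyl_block.weyl_const_pos[of 1 1 1]) (simp add: weyl_block_def)
  let ?hb = "real H * real B"
  define e where "e = exp (- (P (1 / 10 ^ 8))\<^sup>2)"
  have e: "0 \<le> e" "e \<le> P (- 2)" using small by (auto simp: e_def)
  define r where "r = real A * real Q ^ 4 / real K ^ 4"
  define D1 where "D1 = (1 + r) * (real n ^ 3 * ?hb + ?hb\<^sup>2 * e)"
  define D2 where "D2 = real n ^ 3 * P (1 / 10 ^ 8) * real H * real B powr (2 - \<gamma>) / real A powr \<gamma> * (real K ^ 5 + real A * real K) / real M"
  have r0: "0 \<le> r" by (simp add: r_def)
  \<comment> \<open>\<gamma> + 4 * 0.0254 - 4 * (0.9968 - \<gamma>) = 5 \<gamma> - 3.8856.\<close>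
  have r: "r \<le> P (5 * \<gamma> - 38856 / 10 ^ 4)"
    unfolding r_def
    by (rule P_mono[OF P_div[OF P_mult[OF _ A(2) P_power[OF _ Q(2), of 4]] P_power_ge[OF Kl, of 4]]]) (use \<gamma> in auto)
  have r1: "1 + r \<le> P (1 / 10 ^ 8 + (5 * \<gamma> - 38856 / 10 ^ 4))"
    by (rule P_sum[OF P_one r]) (use \<gamma> in auto)
  have n3: "real n ^ 3 \<le> P (1 / 10 ^ 8 * real 3)" by (rule P_power[OF _ n_le]) auto
  have d1: "real n ^ 3 * ?hb \<le> P (2 - 2 * \<gamma> + 13 / 10 ^ 6)"
    by (rule P_mono[OF P_mult[OF _ n3 HB(2)]]) auto
  have d2: "?hb\<^sup>2 * e \<le> P (2 - 2 * \<gamma> + 13 / 10 ^ 6)"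
    by (rule P_mono[OF P_mult[OF _ P_power[OF _ HB(2), of 2] e(2)]]) (use e \<gamma> in auto)
  \<comment> \<open>Up to small margins this is 3 \<gamma> - 1.8856 <= 4 - 4 \<gamma> - 0.0510, that
    is \<gamma> <= 0.8335.\<close>
  have D1: "D1 \<le> P (4 - 4 * \<gamma> - 510 / 10 ^ 4)"
    unfolding D1_def
    by (rule P_mono[OF P_mult[OF _ r1 P_sum[OF d1 d2]]]) (use e g in auto)
  have c: "real n ^ 3 * P (1 / 10 ^ 8) \<le> P (1 / 10 ^ 8 * real 3 + 1 / 10 ^ 8)" by (rule P_mult[OF _ n3 order_refl]) auto
  have "(1 - \<gamma> + d) * (2 - \<gamma>) - (\<gamma> - d) * \<gamma> = 2 + 2 * d - 3 * \<gamma>" for d by (simp add: algebra_simps)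
  from this[of "1 / 10 ^ 5"]
  have x: "1 / 10 ^ 8 * real 3 + 1 / 10 ^ 8 + (1 - \<gamma> + 2 / 10 ^ 6) + (1 - \<gamma> + 1 / 10 ^ 5) * (2 - \<gamma>) - ((\<gamma> - 1 / 10 ^ 5) * \<gamma> - 1 / 10 ^ 8)
     \<le> 3 - 4 * \<gamma> + 23 / 10 ^ 6" by simp
  have f: "real n ^ 3 * P (1 / 10 ^ 8) * real H * real B powr (2 - \<gamma>) / real A powr \<gamma> \<le> P (3 - 4 * \<gamma> + 23 / 10 ^ 6)"
    by (rule P_mono[OF P_div[OF P_mult[OF _ P_mult[OF _ c H(2)] P_powr[OF _ _ B(2)]] A_powr] x]) (use \<gamma> in auto)
  have k5: "real K ^ 5 \<le> P (1 + 3 / 10 ^ 6)" by (rule P_mono[OF P_power[OF _ Ku]]) (use \<gamma> in auto)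
  have AK: "real A * real K \<le> P (1 + 3 / 10 ^ 6)" by (rule P_mono[OF P_mult[OF _ A(2) Ku]]) auto
  have D2: "D2 \<le> P (4 - 4 * \<gamma> - 510 / 10 ^ 4)"
    unfolding D2_def
    by (rule P_mono[OF P_div[OF P_mult[OF _ f P_sum[OF k5 AK]] M(1)]]) auto
  have "block_const \<gamma> * (D1 + D2) \<le> P (1 / 10 ^ 8) * (D1 + D2)"
    using r0 e by (intro mult_right_mono big(3)) (auto simp: D1_def D2_def)
  also have "\<dots> \<le> P (1 / 10 ^ 8 + (1 / 10 ^ 8 + (4 - 4 * \<gamma> - 510 / 10 ^ 4)))"
    by (rule P_mult[OF _ order_refl P_sum[OF D1 D2]]) (use r0 e in \<open>auto simp: D1_def D2_def\<close>)
  finally have "sqrt (block_const \<gamma> * (D1 + D2)) \<le> P ((1 / 10 ^ 8 + (1 / 10 ^ 8 + (4 - 4 * \<gamma> - 510 / 10 ^ 4))) / 2)"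
    by (rule P_sqrt)
  also have "\<dots> \<le> P (2 - 2 * \<gamma> + 12 / 10 ^ 6 - 2 / 10 ^ 8 + (- (254 / 10 ^ 4)))" using N by (intro powr_mono) auto
  also have "\<dots> \<le> ?hb * P (- (254 / 10 ^ 4))" unfolding P_add[symmetric] by (intro mult_right_mono HB) auto
  finally have sq: "sqrt (block_const \<gamma> * (D1 + D2)) \<le> ?hb * P (- (254 / 10 ^ 4))" .
  have i: "1 / real Q \<le> P (0 - (254 / 10 ^ 4 - 1 / 10 ^ 8))" by (rule P_div[OF _ Q(1)]) (use P_one[of 0] in simp)
  have "weyl_total \<gamma> A B H n M Q (P (1 / 10 ^ 8)) K = weyl_block.weyl_const 4 * (2 * real H * real B / real Q + sqrt (block_const \<gamma> * (D1 + D2)))"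
    by (simp add: weyl_total_def D1_def D2_def r_def e_def)
  also have "\<dots> \<le> weyl_block.weyl_const 4 * (?hb * (2 * (1 / real Q) + P (- (254 / 10 ^ 4))))"
    using sq wc by (intro mult_left_mono) (auto simp: algebra_simps)
  also have "\<dots> = ?hb * (weyl_block.weyl_const 4 * (2 * (1 / real Q) + P (- (254 / 10 ^ 4))))" by simp
  also have "\<dots> \<le> ?hb * P (- (158 / 10 ^ 5) * real 16)"
  proof (intro mult_left_mono)
    have a: "2 * (1 / real Q) \<le> P (2 / 10 ^ 8 - 254 / 10 ^ 4)" by (rule P_mono[OF P_mult[OF _ P_const i]]) auto
    have b: "P (- (254 / 10 ^ 4)) \<le> P (2 / 10 ^ 8 - 254 / 10 ^ 4)" using N by (intro powr_mono) auto
    show "weyl_block.weyl_const 4 * (2 * (1 / real Q) + P (- (254 / 10 ^ 4))) \<le> P (- (158 / 10 ^ 5) * real 16)"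
      by (rule P_mono[OF P_mult[OF _ big(4) P_sum[OF a b]]]) auto
  qed auto
  also have "P (- (158 / 10 ^ 5) * real 16) = s ^ 16"
    unfolding s_def using N by (simp add: powr_powr flip: powr_realpow)
  also have "?hb * s ^ 16 \<le> 2 * real H * real B * s ^ 16" by (simp add: s_def)
  finally show ?thesis .
qed

text \<open>
  Here the bound on \<open>\<gamma>\<close> is used to the full: the exponent \<open>0.49844\<close> must not exceed \<open>1 - 3 \<theta>\<close> minus a small margin,
  and \<open>\<theta> < 4176 / 24979 = 0.167180...\<close>. Without the saving of \<open>s\<close> it would be \<open>1 / 2\<close>.
\<close>

lemma top_single:
  assumes g: "\<gamma> \<le> 8334 / 10 ^ 4" and q: "q \<in> I"
  shows "(\<Sum>p\<in>{p \<in> I. t0 \<le> (w p - w q) * real A powr \<gamma>}. G p q) \<le> real H * real B * P (49844 / 10 ^ 5)"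
proof -
  \<comment> \<open>The tails of stationary phase leave N^(1/2) / X, which has to be below
    N^0.49844; the error X^4 is harmless for such a small exponent.\<close>
  define X where "X = P (3 / 10 ^ 3)"
  define Y where "Y = {(h, b). h \<in> {1..H} \<and> b \<in> {B<..3 * B} \<and> t0 \<le> (real h * real b powr \<gamma> - w q) * real A powr \<gamma>
       \<and> (real h * real b powr \<gamma> - w q) * real A powr \<gamma> \<le> t1}"
  have "{p \<in> I. t0 \<le> (w p - w q) * real A powr \<gamma>} \<subseteq> Y"
  proof
    fix p assume p: "p \<in> {p \<in> I. t0 \<le> (w p - w q) * real A powr \<gamma>}"
    then have "(w p - w q) * real A powr \<gamma> \<le> size p q" by (auto simp: size_def intro!: mult_right_mono)
    also have "\<dots> \<le> t1" unfolding t1_def using p q by (intro size_le) auto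
    finally show "p \<in> Y" using p by (auto simp: Y_def w_def I_def)
  qed
  then have Y: "{p \<in> I. t0 \<le> (w p - w q) * real A powr \<gamma>} = Y" by (auto simp: Y_def w_def I_def)
  have th: "sqrt (1 - \<gamma>) \<ge> P (- (1 / 10 ^ 8) / 2)" by (rule P_sqrt_ge[OF theta_ge])
  have ka: "sqrt (\<gamma> * (1 - \<gamma>)) \<ge> P (- (2 / 10 ^ 8) / 2)" by (rule P_sqrt_ge[OF kappa_ge])
  have kt: "sqrt (\<gamma> * (1 - \<gamma>) * t0) \<ge> P ((- (2 / 10 ^ 8) + 9968 / 10 ^ 4) / 2)"
    unfolding t0_def by (intro P_sqrt_ge P_mult_ge kappa_ge order_refl)
  have t0p: "0 < t0" "0 < t1" unfolding t0_def t1_def using P_pos by auto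
  have Qp: "0 < Q" "Q \<le> M"
  proof -
    have "0 < real Q" using Q(1) P_pos[of "254 / 10 ^ 4 - 1 / 10 ^ 8"] by linarith
    then show "0 < Q" by simp
    have "P (254 / 10 ^ 4) \<le> P (16 / 10 ^ 2 - 1 / 10 ^ 8)" using N by (intro powr_mono) auto
    then have "real Q \<le> real M" using Q(2) M(1) by linarith
    then show "Q \<le> M" by simp
  qed
  have Xle: "12 * X * sqrt (\<gamma> * (1 - \<gamma>) * t1) \<le> real A"
  proof -
    have 1: "\<gamma> * (1 - \<gamma>) * t1 \<le> P (1 + 2 / 10 ^ 6 + 1 / 10 ^ 8)"
    proof -
      have "\<gamma> * (1 - \<gamma>) * t1 \<le> 1 * t1" using \<gamma> t0p by (intro mult_right_mono mult_le_one) auto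
      then show ?thesis using t1_le by linarith
    qed
    have "12 * X * sqrt (\<gamma> * (1 - \<gamma>) * t1) \<le> P (\<gamma> - 1 / 10 ^ 5 - 1 / 10 ^ 8)"
      unfolding X_def
      by (rule P_mono[OF P_mult[OF _ P_mult[OF _ P_const order_refl] P_sqrt[OF 1]]]) (use \<gamma> t0p in auto)
    then show ?thesis using A(1) by linarith
  qed
  have NQ: "real M + 4 * real Q \<le> \<gamma> * t0 / (3 * real A)"
  proof -
    have 1: "4 * real Q \<le> P (16 / 10 ^ 2)" by (rule P_mono[OF P_mult[OF _ P_const Q(2)]]) auto
    have "real M + 4 * real Q \<le> P (9968 / 10 ^ 4 - \<gamma> + 1 / 10 ^ 5 - 1 / 10 ^ 8)"
      by (rule P_mono[OF P_sum[OF M(2) 1]]) (use g in auto)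
    then show ?thesis using K_low by linarith
  qed
  have "(\<Sum>p\<in>Y. G p q) = (\<Sum>(h, b)\<in>Y. norm (mono_sum \<gamma> A (real h * real b powr \<gamma> - w q)))"
    by (intro sum.cong refl) (auto simp: G_def w_def)
  also have "\<dots> \<le> 32 * real H * real B * s * sqrt (3 * t1 / (1 - \<gamma>))
      + 2 * real H * real B * (121 * t1 / real A + 18 * sqrt t1 / (X * sqrt (\<gamma> * (1 - \<gamma>))) + 2592 * X ^ 4 / (\<gamma> * (1 - \<gamma>))
          + 605 + (60 + 48 * real M) * real A / sqrt (\<gamma> * (1 - \<gamma>) * t0))"
    unfolding Y_def
    by (rule top_range[where n = n and Q = Q and t = "P (1 / 10 ^ 8)"])
      (use \<gamma> pos H_lt B_lt Qp t0p Xle NQ weyl_total_le[OF g] P_pos[of "- (158 / 10 ^ 5)"] P_one in \<open>simp_all add: s_def X_def\<close>)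
  also have "\<dots> = (real H * real B) * (32 * (s * (sqrt (3 * t1) / sqrt (1 - \<gamma>)))
      + 2 * (121 * t1 / real A + 18 * sqrt t1 / (X * sqrt (\<gamma> * (1 - \<gamma>))) + 2592 * X ^ 4 / (\<gamma> * (1 - \<gamma>))
          + 605 + (60 + 48 * real M) * real A / sqrt (\<gamma> * (1 - \<gamma>) * t0)))"
    by (simp only: real_sqrt_divide distrib_left distrib_right mult_ac)
  also have "\<dots> \<le> real H * real B * P (49844 / 10 ^ 5)"
  proof (rule mult_left_mono)
    let ?u = "498435 / 10 ^ 6"
    \<comment> \<open>The main term: exponent 1/2 - 0.00158 plus small margins.\<close>
    have a1: "32 * (s * (sqrt (3 * t1) / sqrt (1 - \<gamma>))) \<le> P ?u"
    proof -
      have 1: "3 * t1 \<le> P (1 / 10 ^ 8 + (1 + 2 / 10 ^ 6 + 1 / 10 ^ 8))" by (rule P_mult[OF _ P_const t1_le]) (use t0p in auto)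
      show ?thesis unfolding s_def
        by (rule P_mono[OF P_mult[OF _ P_const P_mult[OF _ order_refl P_div[OF P_sqrt[OF 1] th]]]]) (use \<gamma> t0p in auto)
    qed
    have a2: "121 * t1 / real A \<le> P (1 / 2 - 2 / 10 ^ 3)"
      by (rule P_mono[OF P_div[OF P_mult[OF _ P_const t1_le] A(1)]]) (use \<gamma> t0p in auto)
    have a3: "18 * sqrt t1 / (X * sqrt (\<gamma> * (1 - \<gamma>))) \<le> P (1 / 2 - 2 / 10 ^ 3)"
      unfolding X_def
      by (rule P_mono[OF P_div[OF P_mult[OF _ P_const P_sqrt[OF t1_le]] P_mult_ge[OF order_refl ka]]]) (use t0p in auto)
    have a4: "2592 * X ^ 4 / (\<gamma> * (1 - \<gamma>)) \<le> P (1 / 2 - 2 / 10 ^ 3)"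
      unfolding X_def
      by (rule P_mono[OF P_div[OF P_mult[OF _ P_const P_power[OF _ order_refl]] kappa_ge]]) auto
    have a5: "605 \<le> P (1 / 2 - 2 / 10 ^ 3)" by (rule P_mono[OF P_const]) auto
    have a6: "(60 + 48 * real M) * real A / sqrt (\<gamma> * (1 - \<gamma>) * t0) \<le> P (1 / 2 - 2 / 10 ^ 3)"
    proof -
      have 1: "60 \<le> P (16 / 10 ^ 2 + 1 / 10 ^ 8)" by (rule P_mono[OF P_const]) auto
      have 2: "48 * real M \<le> P (16 / 10 ^ 2 + 1 / 10 ^ 8)" by (rule P_mono[OF P_mult[OF _ P_const M(2)]]) auto
      show ?thesis
        by (rule P_mono[OF P_div[OF P_mult[OF _ P_sum[OF 1 2] A(2)] kt]]) (use g in auto)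
    qed
    let ?v = "1 / 2 - 2 / 10 ^ 3 :: real"
    have "2 * (121 * t1 / real A + 18 * sqrt t1 / (X * sqrt (\<gamma> * (1 - \<gamma>))) + 2592 * X ^ 4 / (\<gamma> * (1 - \<gamma>))
          + 605 + (60 + 48 * real M) * real A / sqrt (\<gamma> * (1 - \<gamma>) * t0)) \<le> 10 * P ?v"
    proof -
      have "2 * (a + b + c + d + e) \<le> 10 * z" if "a \<le> z" "b \<le> z" "c \<le> z" "d \<le> z" "e \<le> z" for a b c d e z :: real
        using that by simp
      from this[OF a2 a3 a4 a5 a6] show ?thesis .
    qed
    also have "\<dots> \<le> P ?u" by (rule P_mono[OF P_mult[OF _ P_const order_refl]]) auto
    finally have "2 * (121 * t1 / real A + 18 * sqrt t1 / (X * sqrt (\<gamma> * (1 - \<gamma>))) + 2592 * X ^ 4 / (\<gamma> * (1 - \<gamma>))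
          + 605 + (60 + 48 * real M) * real A / sqrt (\<gamma> * (1 - \<gamma>) * t0)) \<le> P ?u" .
    from P_sum[OF a1 this]
    show "32 * (s * (sqrt (3 * t1) / sqrt (1 - \<gamma>)))
      + 2 * (121 * t1 / real A + 18 * sqrt t1 / (X * sqrt (\<gamma> * (1 - \<gamma>))) + 2592 * X ^ 4 / (\<gamma> * (1 - \<gamma>))
          + 605 + (60 + 48 * real M) * real A / sqrt (\<gamma> * (1 - \<gamma>) * t0)) \<le> P (49844 / 10 ^ 5)"
      by (rule P_mono) simp
  qed simp
  finally show ?thesis unfolding Y .
qed

text \<open>Split by the sign of \<open>w p - w q\<close>. By the symmetry of \<open>G\<close> both
  halves are sums over one index with the other fixed, so \<open>top_single\<close> applies to
  each.\<close>

lemma top_part: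
  assumes g: "\<gamma> \<le> 8334 / 10 ^ 4"
  shows "(\<Sum>(p, q)\<in>{(p, q) \<in> I \<times> I. t0 \<le> size p q}. G p q) \<le> P goal_exp"
proof -
  let ?S = "\<lambda>q. {p \<in> I. t0 \<le> (w p - w q) * real A powr \<gamma>}"
  let ?S' = "\<lambda>q. {p \<in> I. t0 \<le> (w q - w p) * real A powr \<gamma>}"
  have "{(p, q) \<in> I \<times> I. t0 \<le> size p q} = (\<lambda>(q, p). (p, q)) ` (SIGMA q:I. ?S q \<union> ?S' q)"
  proof -
    have "t0 \<le> size p q \<longleftrightarrow> t0 \<le> (w p - w q) * real A powr \<gamma> \<or> t0 \<le> (w q - w p) * real A powr \<gamma>" for p q
    proof -
      have "size p q = \<bar>(w p - w q) * real A powr \<gamma>\<bar>" by (simp add: size_def abs_mult)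
      then show ?thesis by (auto simp: left_diff_distrib)
    qed
    then show ?thesis by force
  qed
  then have "(\<Sum>(p, q)\<in>{(p, q) \<in> I \<times> I. t0 \<le> size p q}. G p q) = (\<Sum>(q, p)\<in>(SIGMA q:I. ?S q \<union> ?S' q). G p q)"
    by (simp add: sum.reindex inj_on_def split_beta)
  also have "\<dots> = (\<Sum>q\<in>I. \<Sum>p\<in>?S q \<union> ?S' q. G p q)"
    by (rule sum.Sigma[symmetric]) (use fin_I in auto)
  also have "\<dots> \<le> (\<Sum>q\<in>I. (\<Sum>p\<in>?S q. G p q) + (\<Sum>p\<in>?S' q. G p q))"
    by (intro sum_mono) (use fin_I in \<open>simp add: sum_Un G_nonneg sum_nonneg\<close>)
  also have "\<dots> = (\<Sum>q\<in>I. \<Sum>p\<in>?S q. G p q) + (\<Sum>q\<in>I. \<Sum>p\<in>?S' q. G p q)" by (rule sum.distrib)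
  also have "(\<Sum>q\<in>I. \<Sum>p\<in>?S' q. G p q) = (\<Sum>p\<in>I. \<Sum>q\<in>?S p. G q p)"
    by (subst sum.swap_restrict[OF fin_I fin_I]) (simp add: G_sym)
  also have "(\<Sum>q\<in>I. \<Sum>p\<in>?S q. G p q) + (\<Sum>p\<in>I. \<Sum>q\<in>?S p. G q p) = 2 * (\<Sum>q\<in>I. \<Sum>p\<in>?S q. G p q)" by simp
  also have "\<dots> \<le> 2 * (\<Sum>q\<in>I. real H * real B * P (49844 / 10 ^ 5))"
    by (intro mult_left_mono sum_mono top_single g) auto
  also have "\<dots> = 4 * ((real H * real B) * ((real H * real B) * P (49844 / 10 ^ 5)))" by (simp add: card_I)
  also have "\<dots> \<le> P goal_exp"
    by (rule P_mono[OF P_mult[OF _ P_const P_mult[OF _ HB(2) P_mult[OF _ HB(2) order_refl]]]]) (use \<gamma> in \<open>auto simp: goal_exp_def\<close>)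
  finally show ?thesis .
qed

lemma pair_sum: "(\<Sum>(p, q)\<in>I \<times> I. G p q) \<le> real A * (real B)\<^sup>2 * P (- (1 / 10 ^ 6))"
proof -
  let ?S = "\<lambda>f. {(p, q) \<in> I \<times> I. f (size p q)}"
  have top: "(\<Sum>(p, q)\<in>?S (\<lambda>x. P (8 / 10) \<le> x). G p q) \<le> 2 * P goal_exp"
  \<comment> \<open>0.8334 is just above 5/6. Beyond it \<open>high_part\<close> covers all sizes up
    to the maximum; below it the sizes from N^0.9968 on are left to \<open>top_part\<close>.\<close>
  proof (cases "\<gamma> \<le> 8334 / 10 ^ 4")
    case True
    have "(\<Sum>(p, q)\<in>?S (\<lambda>x. P (8 / 10) \<le> x). G p q) \<le> (\<Sum>(p, q)\<in>?S (\<lambda>x. P (8 / 10) \<le> x \<and> x \<le> 3 * P (9968 / 10 ^ 4)) \<union> ?S (\<lambda>x. t0 \<le> x). G p q)"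
    proof (rule sum_mono2)
      have "t0 \<le> 3 * P (9968 / 10 ^ 4)" by (simp add: t0_def)
      then show "?S (\<lambda>x. P (8 / 10) \<le> x) \<subseteq> ?S (\<lambda>x. P (8 / 10) \<le> x \<and> x \<le> 3 * P (9968 / 10 ^ 4)) \<union> ?S (\<lambda>x. t0 \<le> x)"
        by auto
      show "finite (?S (\<lambda>x. P (8 / 10) \<le> x \<and> x \<le> 3 * P (9968 / 10 ^ 4)) \<union> ?S (\<lambda>x. t0 \<le> x))"
        by (rule finite_subset[of _ "I \<times> I"]) (use fin_I in auto)
    qed (auto simp: G_nonneg)
    also have "\<dots> \<le> (\<Sum>(p, q)\<in>?S (\<lambda>x. P (8 / 10) \<le> x \<and> x \<le> 3 * P (9968 / 10 ^ 4)). G p q) + (\<Sum>(p, q)\<in>?S (\<lambda>x. t0 \<le> x). G p q)"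
    proof -
      have "finite (?S f)" for f by (rule finite_subset[of _ "I \<times> I"]) (use fin_I in auto)
      then show ?thesis by (subst sum_Un) (auto intro!: sum_nonneg simp: G_nonneg)
    qed
    also have "\<dots> \<le> P goal_exp + P goal_exp"
      by (intro add_mono high_part top_part True) (use \<gamma> in auto)
    finally show ?thesis by simp
  next
    case False
    have "?S (\<lambda>x. P (8 / 10) \<le> x) = ?S (\<lambda>x. P (8 / 10) \<le> x \<and> x \<le> 3 * P (1 + 2 / 10 ^ 6))" using size_le by auto
    then have "(\<Sum>(p, q)\<in>?S (\<lambda>x. P (8 / 10) \<le> x). G p q) \<le> P goal_exp"
      using high_part[of "1 + 2 / 10 ^ 6"] False by simp
    then show ?thesis using P_pos[of goal_exp] by linarith
  qed
  have fS: "finite (?S f)" for f by (rule finite_subset[of _ "I \<times> I"]) (use fin_I in auto)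
  have "(\<Sum>(p, q)\<in>I \<times> I. G p q) = (\<Sum>(p, q)\<in>?S (\<lambda>x. x \<le> P (6 / 10)) \<union> (?S (\<lambda>x. P (6 / 10) \<le> x \<and> x \<le> P (8 / 10)) \<union> ?S (\<lambda>x. P (8 / 10) \<le> x)). G p q)"
    by (intro sum.cong refl) auto
  also have "\<dots> \<le> (\<Sum>(p, q)\<in>?S (\<lambda>x. x \<le> P (6 / 10)). G p q) + (\<Sum>(p, q)\<in>?S (\<lambda>x. P (6 / 10) \<le> x \<and> x \<le> P (8 / 10)) \<union> ?S (\<lambda>x. P (8 / 10) \<le> x). G p q)"
    using fS by (subst sum_Un) (auto intro!: sum_nonneg simp: G_nonneg)
  also have "(\<Sum>(p, q)\<in>?S (\<lambda>x. P (6 / 10) \<le> x \<and> x \<le> P (8 / 10)) \<union> ?S (\<lambda>x. P (8 / 10) \<le> x). G p q)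
      \<le> (\<Sum>(p, q)\<in>?S (\<lambda>x. P (6 / 10) \<le> x \<and> x \<le> P (8 / 10)). G p q) + (\<Sum>(p, q)\<in>?S (\<lambda>x. P (8 / 10) \<le> x). G p q)"
    using fS by (subst sum_Un) (auto intro!: sum_nonneg simp: G_nonneg)
  finally have "(\<Sum>(p, q)\<in>I \<times> I. G p q) \<le> 4 * P goal_exp" using low_part mid_part top by linarith
  also have "\<dots> \<le> P (\<gamma> - 1 / 10 ^ 5 - 1 / 10 ^ 8 + (1 - \<gamma> + 1 / 10 ^ 5 - 1 / 10 ^ 8) * real 2 + (- (1 / 10 ^ 6)))"
    by (rule P_mono[OF P_mult[OF _ P_const order_refl]]) (auto simp: goal_exp_def)
  also have "\<dots> \<le> real A * (real B)\<^sup>2 * P (- (1 / 10 ^ 6))"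
    by (intro P_mult_ge A(1) P_power_ge B(1) order_refl)
  finally show ?thesis .
qed

end

subsection \<open>Second moment and Fejer kernel\<close>

lemma (in size_scale) variance:
  fixes c :: "nat \<Rightarrow> complex"
  assumes c: "\<And>h. norm (c h) \<le> c0" and S: "S \<subseteq> {B<..3 * B}"
  shows "(\<Sum>a\<in>{A<..3 * A}. (norm (\<Sum>h\<in>{1..H}. c h * (\<Sum>b\<in>S. ee (real h * (real a * real b) powr \<gamma>))))\<^sup>2)
    \<le> c0\<^sup>2 * (real A * (real B)\<^sup>2 * P (- (1 / 10 ^ 6)))"
proof -
  let ?I = "{1..H} \<times> S"
  have c0: "0 \<le> c0" using c[of 0] norm_ge_zero[of "c 0"] by linarith
  have IS: "?I \<subseteq> I" using S by (auto simp: I_def)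
  have fI: "finite ?I" by (rule finite_subset[OF IS fin_I])
  define z where "z a = (\<Sum>p\<in>?I. c (fst p) * ee (w p * real a powr \<gamma>))" for a :: nat
  have z: "(\<Sum>h\<in>{1..H}. c h * (\<Sum>b\<in>S. ee (real h * (real a * real b) powr \<gamma>))) = z a" for a
    by (auto simp: z_def w_def sum_distrib_left sum.cartesian_product split_beta powr_mult mult_ac intro!: sum.cong)
  have zz: "complex_of_real ((norm (z a))\<^sup>2) = (\<Sum>p\<in>?I. \<Sum>q\<in>?I. c (fst p) * cnj (c (fst q)) * ee ((w p - w q) * real a powr \<gamma>))" for a
    unfolding complex_norm_square z_def cnj_sum sum_product
    by (intro sum.cong refl) (simp add: left_diff_distrib ee_diff)
  have "complex_of_real (\<Sum>a\<in>{A<..3 * A}. (norm (z a))\<^sup>2) = (\<Sum>a\<in>{A<..3 * A}. \<Sum>p\<in>?I. \<Sum>q\<in>?I. c (fst p) * cnj (c (fst q)) * ee ((w p - w q) * real a powr \<gamma>))"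
    by (simp only: of_real_sum zz)
  also have "\<dots> = (\<Sum>p\<in>?I. \<Sum>a\<in>{A<..3 * A}. \<Sum>q\<in>?I. c (fst p) * cnj (c (fst q)) * ee ((w p - w q) * real a powr \<gamma>))"
    by (rule sum.swap)
  also have "\<dots> = (\<Sum>p\<in>?I. \<Sum>q\<in>?I. \<Sum>a\<in>{A<..3 * A}. c (fst p) * cnj (c (fst q)) * ee ((w p - w q) * real a powr \<gamma>))"
    by (intro sum.cong refl sum.swap)
  also have "\<dots> = (\<Sum>p\<in>?I. \<Sum>q\<in>?I. c (fst p) * cnj (c (fst q)) * mono_sum \<gamma> A (w p - w q))"
    by (simp only: mono_sum_def sum_distrib_left)
  finally have eq: "complex_of_real (\<Sum>a\<in>{A<..3 * A}. (norm (z a))\<^sup>2) = (\<Sum>p\<in>?I. \<Sum>q\<in>?I. c (fst p) * cnj (c (fst q)) * mono_sum \<gamma> A (w p - w q))" .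
  have "(\<Sum>a\<in>{A<..3 * A}. (norm (z a))\<^sup>2) = norm (complex_of_real (\<Sum>a\<in>{A<..3 * A}. (norm (z a))\<^sup>2))"
    by (simp add: sum_nonneg del: of_real_sum)
  also have "\<dots> \<le> (\<Sum>p\<in>?I. \<Sum>q\<in>?I. c0\<^sup>2 * G p q)"
    unfolding eq
  proof (intro sum_norm_le)
    fix p q :: "nat \<times> nat"
    have "norm (c (fst p)) * norm (c (fst q)) \<le> c0 * c0" using c c0 by (intro mult_mono) auto
    then show "norm (c (fst p) * cnj (c (fst q)) * mono_sum \<gamma> A (w p - w q)) \<le> c0\<^sup>2 * G p q"
      unfolding norm_mult complex_mod_cnj G_def power2_eq_square by (rule mult_right_mono) simp
  qed
  also have "\<dots> = c0\<^sup>2 * (\<Sum>(p, q)\<in>?I \<times> ?I. G p q)" by (simp add: sum_distrib_left sum.cartesian_product split_beta)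
  also have "\<dots> \<le> c0\<^sup>2 * (\<Sum>(p, q)\<in>I \<times> I. G p q)"
    by (intro mult_left_mono sum_mono2) (use fin_I IS in \<open>auto simp: G_nonneg\<close>)
  also have "\<dots> \<le> c0\<^sup>2 * (real A * (real B)\<^sup>2 * P (- (1 / 10 ^ 6)))"
    by (intro mult_left_mono pair_sum) auto
  finally show ?thesis by (simp only: z)
qed

text \<open>Induction on \<open>L\<close>: the cross terms of the new highest frequency supply
  exactly the new summand of each autocorrelation.\<close>

lemma trig_square:
  fixes r :: "nat \<Rightarrow> real"
  shows "(norm (\<Sum>m<L. r m * ee (real m * x)))\<^sup>2
    = (\<Sum>m<L. (r m)\<^sup>2) + 2 * Re (\<Sum>h\<in>{1..<L}. (\<Sum>m<L - h. r m * r (m + h)) * ee (real h * x))"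
proof (induction L)
  case (Suc L)
  let ?S = "\<Sum>m<L. r m * ee (real m * x)" and ?t = "r L * ee (real L * x)"
  have sq: "(norm (u + v))\<^sup>2 = (norm u)\<^sup>2 + 2 * Re (cnj u * v) + (norm v)\<^sup>2" for u v :: complex
    unfolding cmod_power2 by (simp add: power2_eq_square algebra_simps)
  have "cnj ?S * ?t = (\<Sum>m<L. (r m * r L) * ee (real (L - m) * x))"
    unfolding cnj_sum sum_distrib_right
    by (intro sum.cong refl) (simp add: of_nat_diff left_diff_distrib right_diff_distrib ee_diff mult_ac)
  also have "\<dots> = (\<Sum>h\<in>{1..<Suc L}. (r (L - h) * r L) * ee (real h * x))"
    by (rule sum.reindex_bij_witness[of _ "\<lambda>h. L - h" "\<lambda>m. L - m"]) auto
  finally have cr: "cnj ?S * ?t = (\<Sum>h\<in>{1..<Suc L}. (r (L - h) * r L) * ee (real h * x))" .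
  have "(\<Sum>h\<in>{1..<Suc L}. (\<Sum>m<Suc L - h. r m * r (m + h)) * ee (real h * x))
      = (\<Sum>h\<in>{1..<Suc L}. (\<Sum>m<L - h. r m * r (m + h)) * ee (real h * x)) + cnj ?S * ?t"
    unfolding cr sum.distrib[symmetric]
    by (intro sum.cong refl) (simp add: Suc_diff_le distrib_right)
  also have "(\<Sum>h\<in>{1..<Suc L}. (\<Sum>m<L - h. r m * r (m + h)) * ee (real h * x))
      = (\<Sum>h\<in>{1..<L}. (\<Sum>m<L - h. r m * r (m + h)) * ee (real h * x))"
    by (rule sum.mono_neutral_right) auto
  finally have st: "Re (\<Sum>h\<in>{1..<Suc L}. (\<Sum>m<Suc L - h. r m * r (m + h)) * ee (real h * x))
      = Re (\<Sum>h\<in>{1..<L}. (\<Sum>m<L - h. r m * r (m + h)) * ee (real h * x)) + Re (cnj ?S * ?t)" by simp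
  have "(norm (\<Sum>m<Suc L. r m * ee (real m * x)))\<^sup>2 = (norm (?S + ?t))\<^sup>2" by simp
  also have "\<dots> = (norm ?S)\<^sup>2 + 2 * Re (cnj ?S * ?t) + (r L)\<^sup>2"
    unfolding sq by (simp add: norm_mult)
  finally show ?case unfolding st Suc by simp
qed simp

text \<open>On the range of summation the coefficient at m is the number of ways to write m as a sum
  of \<open>j\<close> integers below \<open>J\<close>. Later only their sign and their independence
  of x matter.\<close>

lemma dirichlet_power:
  "\<exists>r. (\<forall>m. 0 \<le> r m) \<and> (\<forall>x. (\<Sum>k<J. ee (real k * x)) ^ j = (\<Sum>m<j * J + 1. complex_of_real (r m) * ee (real m * x)))"
proof (induction j)
  case 0
  show ?case by (intro exI[of _ "\<lambda>_. 1"]) simp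
next
  case (Suc j)
  then obtain r where r: "\<And>m. 0 \<le> r m" and eq: "\<And>x. (\<Sum>k<J. ee (real k * x)) ^ j = (\<Sum>m<j * J + 1. complex_of_real (r m) * ee (real m * x))"
    by blast
  let ?R = "{..<j * J + 1} \<times> {..<J}" and ?L = "{..<Suc j * J + 1}"
  define r' where "r' l = (\<Sum>p\<in>{p \<in> ?R. fst p + snd p = l}. r (fst p))" for l
  have "(\<Sum>k<J. ee (real k * x)) ^ Suc j = (\<Sum>m\<in>?L. complex_of_real (r' m) * ee (real m * x))" for x
  proof -
    have "(\<Sum>k<J. ee (real k * x)) ^ Suc j = (\<Sum>p\<in>?R. r (fst p) * ee (real (fst p) * x) * ee (real (snd p) * x))"
    proof -
      have "(\<Sum>m\<in>X. f m) * (\<Sum>k\<in>Z. g k) = (\<Sum>p\<in>X \<times> Z. f (fst p) * g (snd p))" for f g :: "nat \<Rightarrow> complex" and X Z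
        by (simp add: sum_product sum.cartesian_product split_beta)
      then show ?thesis unfolding power_Suc2 eq .
    qed
    also have "\<dots> = (\<Sum>p\<in>?R. r (fst p) * ee (real (fst p + snd p) * x))"
      by (intro sum.cong refl) (simp add: distrib_right ee_add)
    also have "\<dots> = (\<Sum>l\<in>?L. \<Sum>p\<in>{p \<in> ?R. fst p + snd p = l}. r (fst p) * ee (real (fst p + snd p) * x))"
      by (rule sum.group[symmetric]) auto
    also have "\<dots> = (\<Sum>l\<in>?L. complex_of_real (r' l) * ee (real l * x))"
      by (auto simp: r'_def sum_distrib_right intro!: sum.cong)
    finally show ?thesis .
  qed
  moreover have "0 \<le> r' m" for m using r by (simp add: r'_def sum_nonneg)
  ultimately show ?case by blast
qed

text \<open>\<open>c\<close> is the normalised autocorrelation of the coefficients \<open>r\<close>.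
  The lower bound for \<open>c0\<close> is Cauchy-Schwarz combined with the value 1 of the kernel at
  0; \<open>c h <= c0\<close> follows from 2 r r' <= r^2 + r'^2.\<close>

lemma fejer_kernel:
  assumes J: "0 < J"
  obtains c0 :: real and c :: "nat \<Rightarrow> real"
  where "1 / (real j * real J + 1) \<le> c0" "\<And>h. 0 \<le> c h" "\<And>h. c h \<le> c0"
    "\<And>x. (norm (\<Sum>k<J. ee (real k * x)) / real J) ^ (2 * j) = c0 + 2 * Re (\<Sum>h\<in>{1..j * J}. c h * ee (real h * x))"
proof -
  obtain r where r: "\<And>m. 0 \<le> r m" and eq: "\<And>x. (\<Sum>k<J. ee (real k * x)) ^ j = (\<Sum>m<j * J + 1. complex_of_real (r m) * ee (real m * x))"
    using dirichlet_power[of J j] by blast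
  define L where "L = j * J + 1"
  define W where "W = real J ^ (2 * j)"
  have W: "0 < W" using J by (simp add: W_def)
  define c0 where "c0 = (\<Sum>m<L. (r m)\<^sup>2) / W"
  define c where "c h = (\<Sum>m<L - h. r m * r (m + h)) / W" for h
  show ?thesis
  proof (rule that[of c0 c])
    have "complex_of_real (\<Sum>m<L. r m) = complex_of_real (real J ^ j)"
      using eq[of 0] by (simp add: L_def)
    then have sr: "(\<Sum>m<L. r m) = real J ^ j" unfolding of_real_eq_iff .
    have "W = (\<Sum>m<L. r m)\<^sup>2" by (simp add: sr W_def power_mult mult.commute)
    also have "\<dots> \<le> (\<Sum>m<L. (r m)\<^sup>2) * real L" using sum_squared_le_sum_of_squares[of r "{..<L}"] by simp
    finally have "W \<le> (\<Sum>m<L. (r m)\<^sup>2) * real L" .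
    then show "1 / (real j * real J + 1) \<le> c0"
      proof -
      assume "W \<le> (\<Sum>m<L. (r m)\<^sup>2) * real L"
      then have "1 \<le> c0 * real L" using W by (simp add: c0_def)
      moreover have "0 < real L" unfolding L_def of_nat_0_less_iff by simp
      ultimately have "1 / real L \<le> c0" by (simp only: pos_divide_le_eq)
      then show ?thesis by (simp add: L_def add.commute)
    qed
    show "0 \<le> c h" for h using W r by (simp add: c_def sum_nonneg)
    show "c h \<le> c0" for h
    proof -
      have "(\<Sum>m<L - h. r m * r (m + h)) \<le> (\<Sum>m<L - h. ((r m)\<^sup>2 + (r (m + h))\<^sup>2) / 2)"
      proof (rule sum_mono)
        fix m
        show "r m * r (m + h) \<le> ((r m)\<^sup>2 + (r (m + h))\<^sup>2) / 2"
          using sum_squares_bound[of "r m" "r (m + h)"] by simp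
      qed
      also have "\<dots> = ((\<Sum>m<L - h. (r m)\<^sup>2) + (\<Sum>m<L - h. (r (m + h))\<^sup>2)) / 2"
        by (simp add: sum.distrib flip: sum_divide_distrib)
      also have "\<dots> \<le> ((\<Sum>m<L. (r m)\<^sup>2) + (\<Sum>m<L. (r m)\<^sup>2)) / 2"
      proof (intro divide_right_mono add_mono)
        show "(\<Sum>m<L - h. (r m)\<^sup>2) \<le> (\<Sum>m<L. (r m)\<^sup>2)" by (rule sum_mono2) auto
        have "(\<Sum>m<L - h. (r (m + h))\<^sup>2) = (\<Sum>m\<in>(\<lambda>m. m + h) ` {..<L - h}. (r m)\<^sup>2)"
          by (subst sum.reindex) (auto simp: inj_on_def)
        also have "\<dots> \<le> (\<Sum>m<L. (r m)\<^sup>2)" by (rule sum_mono2) auto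
        finally show "(\<Sum>m<L - h. (r (m + h))\<^sup>2) \<le> (\<Sum>m<L. (r m)\<^sup>2)" .
      qed simp
      finally show ?thesis using W by (simp add: c_def c0_def divide_right_mono)
    qed
    fix x
    have "(norm (\<Sum>k<J. ee (real k * x)) / real J) ^ (2 * j) = (norm ((\<Sum>k<J. ee (real k * x)) ^ j))\<^sup>2 / W"
      by (simp add: power_divide W_def norm_power power_mult mult.commute flip: power_mult)
    also have "\<dots> = ((\<Sum>m<L. (r m)\<^sup>2) + 2 * Re (\<Sum>h\<in>{1..<L}. (\<Sum>m<L - h. r m * r (m + h)) * ee (real h * x))) / W"
      unfolding eq L_def[symmetric] trig_square ..
    also have "\<dots> = c0 + 2 * Re (complex_of_real (1 / W) * (\<Sum>h\<in>{1..<L}. (\<Sum>m<L - h. r m * r (m + h)) * ee (real h * x)))"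
    proof -
      have "Re (complex_of_real a * z) = a * Re z" for a z by simp
      then show ?thesis by (simp only: c0_def add_divide_distrib) simp
    qed
    also have "complex_of_real (1 / W) * (\<Sum>h\<in>{1..<L}. (\<Sum>m<L - h. r m * r (m + h)) * ee (real h * x))
        = (\<Sum>h\<in>{1..j * J}. c h * ee (real h * x))"
      unfolding sum_distrib_left by (rule sum.cong) (auto simp: L_def c_def)
    finally show "(norm (\<Sum>k<J. ee (real k * x)) / real J) ^ (2 * j) = c0 + 2 * Re (\<Sum>h\<in>{1..j * J}. c h * ee (real h * x))" .
  qed
qed

text \<open>A geometric sum; the denominator \<open>norm (ee x - 1)\<close> is at least pi d / 3 >
  d.\<close>

lemma norm_dirichlet_le:
  assumes "\<bar>x - of_int i\<bar> \<le> 1 / 2" "0 < d" "d / 2 \<le> \<bar>x - of_int i\<bar>"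
  shows "norm (\<Sum>k<J. ee (real k * x)) \<le> 2 / d"
proof -
  define k where "k = x - of_int i"
  have ex: "ee x = ee k" using ee_add[of k "of_int i"] by (simp add: k_def)
  have "pi / 3 * d \<le> 2 * pi / 3 * \<bar>k\<bar>" using assms(3) by (simp add: k_def field_simps)
  also have "\<dots> \<le> norm (ee x - 1)" unfolding ex by (rule norm_ee_minus_1_ge) (use assms in \<open>simp add: k_def\<close>)
  finally have low: "pi / 3 * d \<le> norm (ee x - 1)" .
  have "(\<Sum>k<J. ee (real k * x)) = (\<Sum>k<J. ee x ^ k)"
    by (intro sum.cong refl) (simp add: ee_def Complex.DeMoivre mult_ac)
  then have "(ee x - 1) * (\<Sum>k<J. ee (real k * x)) = ee x ^ J - 1" by (simp add: power_diff_1_eq)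
  then have "norm (ee x - 1) * norm (\<Sum>k<J. ee (real k * x)) = norm (ee x ^ J - 1)" by (simp flip: norm_mult)
  also have "\<dots> \<le> 2" using norm_triangle_ineq4[of "ee x ^ J" 1] by (simp add: norm_power)
  finally have "norm (ee x - 1) * norm (\<Sum>k<J. ee (real k * x)) \<le> 2" .
  then have "pi / 3 * d * norm (\<Sum>k<J. ee (real k * x)) \<le> 2"
    using low mult_right_mono[OF low norm_ge_zero[of "\<Sum>k<J. ee (real k * x)"]] by linarith
  moreover have "d * norm (\<Sum>k<J. ee (real k * x)) \<le> pi / 3 * d * norm (\<Sum>k<J. ee (real k * x))"
    using pi_gt3 assms by (intro mult_right_mono) auto
  ultimately have "d * norm (\<Sum>k<J. ee (real k * x)) \<le> 2" by linarith
  then show ?thesis using assms by (simp add: pos_le_divide_eq mult.commute)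
qed

subsection \<open>Divisors and smooth numbers\<close>

lemma card_divisors_prime_power_mult:
  fixes p m :: nat
  assumes "prime p" "0 < m"
  shows "card {d. d dvd p ^ v * m} \<le> (v + 1) * card {d. d dvd m}"
proof -
  have fin: "finite {d. d dvd m}" using assms(2) by simp
  have "{d. d dvd p ^ v * m} \<subseteq> (\<lambda>(i, e). p ^ i * e) ` ({..v} \<times> {d. d dvd m})"
  proof
    fix d assume "d \<in> {d. d dvd p ^ v * m}"
    then obtain b c where d: "d = b * c" "b dvd p ^ v" "c dvd m" using division_decomp[of d "p ^ v" m] by auto
    then obtain i where "i \<le> v" "b = p ^ i" using divides_primepow_nat[OF assms(1)] by blast
    then show "d \<in> (\<lambda>(i, e). p ^ i * e) ` ({..v} \<times> {d. d dvd m})" using d by force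
  qed
  then have "card {d. d dvd p ^ v * m} \<le> card ((\<lambda>(i, e). p ^ i * e) ` ({..v} \<times> {d. d dvd m}))"
    using fin by (intro card_mono) auto
  also have "\<dots> \<le> card ({..v} \<times> {d. d dvd m})" by (rule card_image_le) (use fin in auto)
  finally show ?thesis by (simp add: card_cartesian_product)
qed

text \<open>Prime powers are split off one at a time. If p^\<epsilon> >= 2, then v + 1 <= p^(v
  \<epsilon>) outright; each of the finitely many smaller primes costs one factor \<open>K\<close>,
  whence the constant \<open>K ^ P0\<close>.\<close>

lemma divisor_bound:
  fixes \<epsilon> :: real
  assumes \<epsilon>: "0 < \<epsilon>"
  obtains C :: real where "1 \<le> C" "\<And>n::nat. 0 < n \<Longrightarrow> real (card {d. d dvd n}) \<le> C * real n powr \<epsilon>"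
proof -
  define K where "K = 1 + 1 / (\<epsilon> * ln 2)"
  define P0 where "P0 = nat \<lceil>2 powr (1 / \<epsilon>)\<rceil>"
  define S where "S n = {p \<in> prime_factors n. p < P0}" for n
  have K: "1 \<le> K" using \<epsilon> by (simp add: K_def)
  have small: "real v + 1 \<le> K * (real p ^ v) powr \<epsilon>" if "2 \<le> p" for p v :: nat
  proof -
    have "real v * (\<epsilon> * ln 2) + 1 \<le> exp (real v * (\<epsilon> * ln 2))" using exp_ge_add_one_self[of "real v * (\<epsilon> * ln 2)"] by linarith
    also have "\<dots> = (2 ^ v) powr \<epsilon>" by (simp add: powr_def ln_realpow mult_ac)
    also have "\<dots> \<le> (real p ^ v) powr \<epsilon>" using that \<epsilon> by (intro powr_mono2 power_mono) auto
    finally have *: "real v * (\<epsilon> * ln 2) + 1 \<le> (real p ^ v) powr \<epsilon>" .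
    have e2: "0 < \<epsilon> * ln 2" using \<epsilon> by simp
    have "real v + 1 \<le> (1 + 1 / (\<epsilon> * ln 2)) * (real v * (\<epsilon> * ln 2) + 1)"
    proof -
      have "(1 + 1 / q) * (real v * q + 1) = real v + 1 + (real v * q + 1 / q)" if "0 < q" for q
        using that by (simp add: field_simps)
      moreover have "0 \<le> real v * (\<epsilon> * ln 2) + 1 / (\<epsilon> * ln 2)" using e2 \<epsilon> by (intro add_nonneg_nonneg mult_nonneg_nonneg) auto
      ultimately show ?thesis using e2 by simp
    qed
    also have "\<dots> \<le> K * (real p ^ v) powr \<epsilon>" unfolding K_def using * e2 by (intro mult_left_mono) auto
    finally show ?thesis .
  qed
  have large: "real v + 1 \<le> (real p ^ v) powr \<epsilon>" if "P0 \<le> p" for p v :: nat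
  proof -
    have "2 powr (1 / \<epsilon>) \<le> real p" using that by (simp add: P0_def)
    then have "(2 powr (1 / \<epsilon>)) powr \<epsilon> \<le> real p powr \<epsilon>" using \<epsilon> by (intro powr_mono2) auto
    then have "2 \<le> real p powr \<epsilon>" using \<epsilon> by (simp add: powr_powr)
    then have "2 ^ v \<le> (real p powr \<epsilon>) ^ v" by (intro power_mono) auto
    also have "\<dots> = (real p ^ v) powr \<epsilon>" by (cases "p = 0") (use \<epsilon> \<open>2 \<le> real p powr \<epsilon>\<close> in \<open>auto simp: powr_realpow[symmetric] powr_powr mult.commute\<close>)
    finally have "2 ^ v \<le> (real p ^ v) powr \<epsilon>" .
    moreover have "real v + 1 \<le> 2 ^ v"
      using Bernoulli_inequality[of "1::real" v] by simp
    ultimately show ?thesis by linarith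
  qed
  have main: "real (card {d. d dvd n}) \<le> K ^ card (S n) * real n powr \<epsilon>" if "0 < n" for n :: nat
    using that
  proof (induction n rule: less_induct)
    case (less n)
    show ?case
    proof (cases "n = 1")
      case True
      then show ?thesis by (simp add: S_def)
    next
      case False
      then obtain p where p: "prime p" "p dvd n" using prime_factor_nat by blast
      define v where "v = multiplicity p n"
      define m where "m = n div p ^ v"
      have n: "n = p ^ v * m" by (simp add: m_def v_def multiplicity_dvd)
      have m0: "0 < m" using n less.prems by (cases m) auto
      have v0: "0 < v" unfolding v_def using p less.prems by (simp add: prime_multiplicity_gt_zero_iff)
      have npm: "\<not> p dvd m"
        unfolding m_def v_def using p less.prems by (intro multiplicity_decompose) auto
      have "1 < p ^ v" using p(1) v0 prime_gt_1_nat one_less_power by blast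
      then have mn: "m < n" using m0 by (simp add: n)
      have p2: "2 \<le> p" using p(1) prime_ge_2_nat by blast
      have pf: "prime_factors n = insert p (prime_factors m)"
        unfolding n using p(1) m0 v0 prime_gt_0_nat[OF p(1)]
        by (simp add: prime_factors_product prime_factorization_prime_power)
      have "real (card {d. d dvd n}) \<le> real ((v + 1) * card {d. d dvd m})"
        unfolding n by (intro of_nat_mono card_divisors_prime_power_mult p m0)
      also have "\<dots> = (real v + 1) * real (card {d. d dvd m})" by (simp add: distrib_right)
      also have "\<dots> \<le> (real v + 1) * (K ^ card (S m) * real m powr \<epsilon>)"
        by (intro mult_left_mono less.IH mn m0) auto
      also have "\<dots> \<le> K ^ card (S n) * (real p ^ v) powr \<epsilon> * real m powr \<epsilon>"
      proof (cases "p < P0")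
        case True
        have "S n = insert p (S m)" using True by (auto simp: S_def pf)
        moreover have "p \<notin> S m" using npm by (auto simp: S_def)
        ultimately have "card (S n) = Suc (card (S m))" by (simp add: S_def)
        then show ?thesis using small[OF p2, of v] K
          mult_right_mono[of "real v + 1" "K * (real p ^ v) powr \<epsilon>" "K ^ card (S m) * real m powr \<epsilon>"] by (simp add: mult_ac)
      next
        case False
        then have "S n = S m" by (auto simp: S_def pf)
        then show ?thesis using large[of p v] False K
          mult_right_mono[of "real v + 1" "(real p ^ v) powr \<epsilon>" "K ^ card (S m) * real m powr \<epsilon>"] by (simp add: mult_ac)
      qed
      also have "\<dots> = K ^ card (S n) * real n powr \<epsilon>" by (simp add: n powr_mult)
      finally show ?thesis .
    qed
  qed
  show ?thesis
  proof (rule that[of "K ^ P0"])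
    show "1 \<le> K ^ P0" using K by simp
    fix n :: nat assume n: "0 < n"
    have "card (S n) \<le> card {..<P0}" by (intro card_mono) (auto simp: S_def)
    then have "K ^ card (S n) \<le> K ^ P0" using K by (intro power_increasing) auto
    then have "K ^ card (S n) * real n powr \<epsilon> \<le> K ^ P0 * real n powr \<epsilon>" by (intro mult_right_mono) auto
    then show "real (card {d. d dvd n}) \<le> K ^ P0 * real n powr \<epsilon>" using main[OF n] by linarith
  qed
qed

text \<open>Each factor is confined to a range of ratio 1 + 1/k, so that the product stays within a
  factor e < 3 of \<open>M ^ k\<close> although all factors vary independently.\<close>

definition short_products :: "nat \<Rightarrow> nat \<Rightarrow> nat set" where
  "short_products k M = (\<lambda>f. \<Prod>i<k. f i) ` (PiE {..<k} (\<lambda>_. {M<..M + M div k}))"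

lemma short_products_range:
  assumes k: "0 < k" and M: "0 < M" and s: "s \<in> short_products k M"
  shows "M ^ k < s" "s \<le> 3 * M ^ k" "\<And>p. prime p \<Longrightarrow> p dvd s \<Longrightarrow> p \<le> 2 * M"
proof -
  obtain f where f: "s = (\<Prod>i<k. f i)" "\<And>i. i < k \<Longrightarrow> M < f i \<and> f i \<le> M + M div k"
    using s by (auto simp: short_products_def PiE_iff)
  have "(\<Prod>i<k. M) < (\<Prod>i<k. f i)" proof (rule prod_mono_strict[of 0])
    fix i assume "i \<in> {..<k}"
    then show "0 \<le> M \<and> M \<le> f i" "0 < f i" using f(2)[of i] by auto
  qed (use k M f(2)[of 0] in auto)
  then show "M ^ k < s" by (simp add: f)
  have "real s = (\<Prod>i<k. real (f i))" by (simp add: f)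
  also have "\<dots> \<le> (\<Prod>i<k. real M * (1 + 1 / real k))"
  proof (intro prod_mono conjI)
    fix i assume "i \<in> {..<k}"
    then have "real (f i) \<le> real M + real (M div k)" using f(2)[of i] by (simp flip: of_nat_add)
    also have "real (M div k) \<le> real M / real k" by (rule of_nat_div_le_of_nat)
    finally show "real (f i) \<le> real M * (1 + 1 / real k)" by (simp add: distrib_left)
  qed auto
  also have "\<dots> = real M ^ k * (1 + 1 / real k) ^ k" by (simp add: power_mult_distrib)
  also have "\<dots> \<le> real M ^ k * 3"
    using exp_ge_one_plus_x_over_n_power_n[of k 1] k exp_le by (intro mult_left_mono) auto
  finally have "real s \<le> real (3 * M ^ k)" by simp
  then show "s \<le> 3 * M ^ k" by (simp only: of_nat_le_iff)
  fix p :: nat assume "prime p" "p dvd s"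
  then obtain i where "i < k" "p dvd f i" by (auto simp: f prime_dvd_prod_iff)
  then have "p \<le> M + M div k" using f(2)[of i] dvd_imp_le[of p "f i"] by fastforce
  then show "p \<le> 2 * M" using div_le_dividend[of M k] by linarith
qed

text \<open>Each product has at most \<open>T ^ k\<close> preimages among the tuples, because every
  factor divides it.\<close>

lemma card_short_products:
  assumes k: "0 < k" and M: "0 < M" and T: "\<And>s. 0 < s \<Longrightarrow> s \<le> 3 * M ^ k \<Longrightarrow> real (card {d. d dvd s}) \<le> T"
  shows "real (M div k) ^ k \<le> real (card (short_products k M)) * T ^ k"
proof -
  let ?F = "PiE {..<k} (\<lambda>_. {M<..M + M div k})"
  define g where "g f = (\<Prod>i<k. f i)" for f :: "nat \<Rightarrow> nat"
  have fF: "finite ?F" by (intro finite_PiE) auto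
  have S: "short_products k M = g ` ?F" by (simp add: short_products_def g_def)
  have "real (M div k) ^ k = real (card ?F)" by (simp add: card_PiE)
  also have "card ?F = (\<Sum>s\<in>short_products k M. card {f \<in> ?F. g f = s})"
    unfolding S using sum.image_gen[OF fF, of "\<lambda>_. 1::nat" g] by simp
  also have "real \<dots> \<le> (\<Sum>s\<in>short_products k M. T ^ k)"
    unfolding of_nat_sum
  proof (rule sum_mono)
    fix s assume s: "s \<in> short_products k M"
    note sr = short_products_range[OF k M s]
    have s0: "0 < s" using sr(1) by linarith
    have "{f \<in> ?F. g f = s} \<subseteq> PiE {..<k} (\<lambda>_. {d. d dvd s})"
      unfolding PiE_def by (auto simp: g_def intro: dvd_prodI)
    then have "card {f \<in> ?F. g f = s} \<le> card (PiE {..<k} (\<lambda>_. {d. d dvd s}))"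
      using s0 by (intro card_mono finite_PiE) auto
    then have "real (card {f \<in> ?F. g f = s}) \<le> real (card {d. d dvd s}) ^ k"
      by (simp add: card_PiE flip: of_nat_power)
    also have "\<dots> \<le> T ^ k" by (intro power_mono T s0 sr) auto
    finally show "real (card {f \<in> ?F. g f = s}) \<le> T ^ k" .
  qed
  finally show ?thesis by simp
qed

subsection \<open>Smooth values of the floor of a power\<close>

text \<open>The condition that - m^\<gamma> lies in [0, d) modulo one, written with the ceiling
  because that integer becomes the n with floor (n^c) = m.\<close>

definition hit :: "real \<Rightarrow> real \<Rightarrow> nat \<Rightarrow> bool" where
  "hit \<gamma> d m \<longleftrightarrow> of_int \<lceil>real m powr \<gamma>\<rceil> - real m powr \<gamma> < d"

text \<open>For each \<open>a\<close> the kernel summed over \<open>b\<close> is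
  \<open>card T * c0\<close> plus an oscillating part, which by \<open>variance\<close> and
  Chebyshev's inequality is small for at least half of \<open>S\<close>. Values of \<open>b\<close>
  without a hit contribute at most \<open>c0 / 4\<close> each, so hits must supply the rest.\<close>

lemma (in size_scale) many_hits:
  fixes S T :: "nat set" and d :: real and J j :: nat
  assumes S: "S \<subseteq> {A<..3 * A}" "real A * P (- (2 / 10 ^ 7)) \<le> real (card S)"
    and T: "T \<subseteq> {B<..3 * B}" "real B * P (- (2 / 10 ^ 7)) \<le> real (card T)"
    and d: "0 < d" "d \<le> 1" and J: "0 < J" "j * J \<le> H"
    and tail: "(2 / (real J * d)) ^ (2 * j) \<le> 1 / (4 * (real j * real J + 1))"
  shows "real (card S) * real (card T) / (4 * (real j * real J + 1)) \<le> real (card {(a, b) \<in> S \<times> T. hit \<gamma> d (a * b)})"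
proof -
  obtain c0 :: real and c :: "nat \<Rightarrow> real" where c0: "1 / (real j * real J + 1) \<le> c0" and c: "\<And>h. 0 \<le> c h" "\<And>h. c h \<le> c0"
    and ker: "\<And>x. (norm (\<Sum>k<J. ee (real k * x)) / real J) ^ (2 * j) = c0 + 2 * Re (\<Sum>h\<in>{1..j * J}. c h * ee (real h * x))"
    by (rule fejer_kernel[OF J(1), of j], rule that)
  define \<psi> where "\<psi> x = (norm (\<Sum>k<J. ee (real k * x)) / real J) ^ (2 * j)" for x
  have jJ: "0 < real j * real J + 1" by (intro add_nonneg_pos) auto
  have c0p: "0 < c0" using c0 jJ by (meson less_le_trans zero_less_divide_1_iff)
  have fin: "finite S" "finite T" using S(1) T(1) finite_subset by blast+
  have pos_card: "0 < real (card S)" "0 < real (card T)"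
    using S(2) T(2) pos P_pos[of "- (2 / 10 ^ 7)"] mult_pos_pos[of "real A" "P (- (2 / 10 ^ 7))"] mult_pos_pos[of "real B" "P (- (2 / 10 ^ 7))"]
    by linarith+
  \<comment> \<open>Absorbs the shift by d / 2 into the coefficients and extends them by zero beyond
    the degree \<open>j * J\<close>, so that sums run up to \<open>H\<close>.\<close>
  define c' where "c' h = (if h \<le> j * J then c h * ee (real h * d / 2) else 0)" for h
  have c': "norm (c' h) \<le> c0" for h using c[of h] by (simp add: c'_def norm_mult)
  \<comment> \<open>Centred: without a hit the distance of \<open>x m\<close> from every integer is
    at least d / 2, where \<open>norm_dirichlet_le\<close> applies.\<close>
  define x where "x m = of_int \<lceil>real m powr \<gamma>\<rceil> - real m powr \<gamma> - d / 2" for m :: nat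
  define z where "z a = (\<Sum>h\<in>{1..H}. c' h * (\<Sum>b\<in>T. ee (real h * (real a * real b) powr \<gamma>)))" for a :: nat
  have \<psi>_le1: "\<psi> y \<le> 1" for y
  proof -
    have "norm (\<Sum>k<J. ee (real k * y)) \<le> (\<Sum>k<J. 1)" by (rule sum_norm_le) simp
    then show ?thesis unfolding \<psi>_def using J by (intro power_le_one) auto
  qed
  have \<psi>_tail: "\<psi> (x m) \<le> c0 / 4" if "\<not> hit \<gamma> d m" for m
  proof -
    have "d / 2 \<le> x m" "x m < 1 - d / 2" using that unfolding hit_def x_def by linarith+
    then obtain i where i: "\<bar>x m - of_int i\<bar> \<le> 1 / 2" "d / 2 \<le> \<bar>x m - of_int i\<bar>"
    proof (cases "x m \<le> 1 / 2")
      case True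
      then show ?thesis using that[of 0] \<open>d / 2 \<le> x m\<close> d by simp
    next
      case False
      then show ?thesis using that[of 1] \<open>x m < 1 - d / 2\<close> d by simp
    qed
    have "norm (\<Sum>k<J. ee (real k * x m)) / real J \<le> 2 / d / real J"
      by (intro divide_right_mono norm_dirichlet_le[OF i(1) d(1) i(2)]) auto
    then have "\<psi> (x m) \<le> (2 / (real J * d)) ^ (2 * j)"
      unfolding \<psi>_def by (intro power_mono) (auto simp: mult.commute)
    also note tail
    also have "1 / (4 * (real j * real J + 1)) = 1 / (real j * real J + 1) / 4"
      by (simp only: divide_divide_eq_left mult.commute)
    also have "\<dots> \<le> c0 / 4" using c0 by (intro divide_right_mono) auto
    finally show ?thesis .
  qed
  have \<psi>_eq: "\<psi> (x m) = c0 + 2 * Re (\<Sum>h\<in>{1..H}. c' h * ee (real h * real m powr \<gamma>))" for m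
  proof -
    have "Re (c h * ee (real h * x m)) = Re (c' h * ee (real h * real m powr \<gamma>))" if "h \<in> {1..j * J}" for h
    proof -
      have "real h * x m = of_int (int h * \<lceil>real m powr \<gamma>\<rceil>) - (real h * d / 2 + real h * real m powr \<gamma>)"
        by (simp add: x_def algebra_simps)
      then have "ee (real h * x m) = cnj (ee (real h * d / 2) * ee (real h * real m powr \<gamma>))"
        by (simp only: ee_diff ee_int cnj_ee flip: ee_add) simp
      then have "c h * ee (real h * x m) = cnj (c h * (ee (real h * d / 2) * ee (real h * real m powr \<gamma>)))" by simp
      then have "Re (c h * ee (real h * x m)) = Re (c h * (ee (real h * d / 2) * ee (real h * real m powr \<gamma>)))"
        by (simp only: cnj.simps)
      then show ?thesis using that by (simp add: c'_def mult.assoc)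
    qed
    then have "Re (\<Sum>h\<in>{1..j * J}. c h * ee (real h * x m)) = Re (\<Sum>h\<in>{1..j * J}. c' h * ee (real h * real m powr \<gamma>))"
      unfolding Re_sum by (intro sum.cong refl)
    also have "(\<Sum>h\<in>{1..j * J}. c' h * ee (real h * real m powr \<gamma>)) = (\<Sum>h\<in>{1..H}. c' h * ee (real h * real m powr \<gamma>))"
      by (rule sum.mono_neutral_left) (use J in \<open>auto simp: c'_def\<close>)
    finally show ?thesis by (simp add: \<psi>_def ker)
  qed
  define f where "f a = real (card {b \<in> T. hit \<gamma> d (a * b)})" for a :: nat
  have f: "real (card T) * c0 * (3 / 4) - 2 * norm (z a) \<le> f a" for a
  proof -
    have "(\<Sum>b\<in>T. \<psi> (x (a * b))) = (\<Sum>b\<in>T. c0 + 2 * Re (\<Sum>h\<in>{1..H}. c' h * ee (real h * (real a * real b) powr \<gamma>)))"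
      by (simp only: \<psi>_eq of_nat_mult)
    also have "\<dots> = real (card T) * c0 + 2 * Re (\<Sum>b\<in>T. \<Sum>h\<in>{1..H}. c' h * ee (real h * (real a * real b) powr \<gamma>))"
      unfolding Re_sum sum.distrib sum_distrib_left by simp
    also have "(\<Sum>b\<in>T. \<Sum>h\<in>{1..H}. c' h * ee (real h * (real a * real b) powr \<gamma>)) = z a"
      unfolding z_def sum_distrib_left by (rule sum.swap)
    finally have e: "(\<Sum>b\<in>T. \<psi> (x (a * b))) = real (card T) * c0 + 2 * Re (z a)" .
    have "(\<Sum>b\<in>T. \<psi> (x (a * b))) \<le> (\<Sum>b\<in>T. (if hit \<gamma> d (a * b) then 1 else 0) + c0 / 4)"
    proof (rule sum_mono)
      fix b
      show "\<psi> (x (a * b)) \<le> (if hit \<gamma> d (a * b) then 1 else 0) + c0 / 4"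
        using \<psi>_le1[of "x (a * b)"] \<psi>_tail[of "a * b"] c0p by auto
    qed
    also have "\<dots> = f a + real (card T) * c0 / 4"
      using fin by (simp add: sum.distrib f_def sum.If_cases Int_def)
    finally have "real (card T) * c0 + 2 * Re (z a) \<le> f a + real (card T) * c0 / 4" unfolding e .
    moreover have "- Re (z a) \<le> norm (z a)" using abs_Re_le_cmod[of "z a"] by linarith
    ultimately show ?thesis by linarith
  qed
  \<comment> \<open>3/4 - 2/8 = 1/2, so outside the exceptional set \<open>X\<close> there are at
    least \<open>card T * c0 / 2\<close> hits.\<close>
  define t where "t = real (card T) * c0 / 8"
  define X where "X = {a \<in> S. t < norm (z a)}"
  have t: "0 < t" using pos_card c0p by (simp add: t_def)
  have fX: "finite X" "X \<subseteq> S" using fin by (auto simp: X_def)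
  have "real (card X) * t\<^sup>2 = (\<Sum>a\<in>X. t\<^sup>2)" by simp
  also have "\<dots> \<le> (\<Sum>a\<in>X. (norm (z a))\<^sup>2)" using t by (intro sum_mono power_mono) (auto simp: X_def)
  also have "\<dots> \<le> (\<Sum>a\<in>{A<..3 * A}. (norm (z a))\<^sup>2)" using fX S(1) by (intro sum_mono2) auto
  also have "\<dots> \<le> c0\<^sup>2 * (real A * (real B)\<^sup>2 * P (- (1 / 10 ^ 6)))"
    unfolding z_def by (rule variance[OF c' T(1)])
  finally have "real (card X) * (real (card T))\<^sup>2 * c0\<^sup>2 \<le> (64 * (real A * (real B)\<^sup>2 * P (- (1 / 10 ^ 6)))) * c0\<^sup>2"
    by (simp add: t_def power_divide power_mult_distrib algebra_simps)
  then have X1: "real (card X) * (real (card T))\<^sup>2 \<le> 64 * (real A * (real B)\<^sup>2 * P (- (1 / 10 ^ 6)))"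
    using c0p by (simp add: mult_le_cancel_right)
  have "real (card X) * (real B * P (- (2 / 10 ^ 7)))\<^sup>2 \<le> real (card X) * (real (card T))\<^sup>2"
    by (intro mult_left_mono power_mono T(2)) auto
  also note X1
  also have "64 * (real A * (real B)\<^sup>2 * P (- (1 / 10 ^ 6))) \<le> (real A * (real B)\<^sup>2) * P (1 / 10 ^ 8 - 1 / 10 ^ 6)"
  proof -
    have "64 * P (- (1 / 10 ^ 6)) \<le> P (1 / 10 ^ 8 - 1 / 10 ^ 6)" by (rule P_mono[OF P_mult[OF _ P_const order_refl]]) auto
    then show ?thesis using mult_left_mono[of "64 * P (- (1 / 10 ^ 6))" "P (1 / 10 ^ 8 - 1 / 10 ^ 6)" "real A * (real B)\<^sup>2"] by (simp add: mult_ac)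
  qed
  finally have "(real B)\<^sup>2 * (real (card X) * (P (- (2 / 10 ^ 7)))\<^sup>2) \<le> (real B)\<^sup>2 * (real A * P (1 / 10 ^ 8 - 1 / 10 ^ 6))"
    by (simp add: power_mult_distrib mult_ac)
  then have X2: "real (card X) * (P (- (2 / 10 ^ 7)))\<^sup>2 \<le> real A * P (1 / 10 ^ 8 - 1 / 10 ^ 6)"
    using pos by (simp add: mult_le_cancel_left)
  have PP: "(P (- (2 / 10 ^ 7)))\<^sup>2 = P (- (4 / 10 ^ 7))" by (simp add: power2_eq_square P_add)
  \<comment> \<open>The variance saves N^(- 10 / 10^7), the squared density of \<open>T\<close>
    costs N^(4 / 10^7); what remains is below half the density N^(- 2 / 10^7) of
    \<open>S\<close>.\<close>
  have "real (card X) = real (card X) * (P (- (2 / 10 ^ 7)))\<^sup>2 * P (4 / 10 ^ 7)"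
    unfolding PP mult.assoc P_add using N by simp
  also have "\<dots> \<le> real A * P (1 / 10 ^ 8 - 1 / 10 ^ 6) * P (4 / 10 ^ 7)" using X2 by (rule mult_right_mono) simp
  also have "\<dots> = real A * P (1 / 10 ^ 8 - 6 / 10 ^ 7)" by (simp add: mult.assoc P_add)
  also have "\<dots> \<le> real A * (P (- (2 / 10 ^ 7)) / 2)"
  proof (rule mult_left_mono)
    have "2 * P (1 / 10 ^ 8 - 6 / 10 ^ 7) \<le> P (- (2 / 10 ^ 7))" by (rule P_mono[OF P_mult[OF _ P_const order_refl]]) auto
    then show "P (1 / 10 ^ 8 - 6 / 10 ^ 7) \<le> P (- (2 / 10 ^ 7)) / 2" by simp
  qed simp
  also have "\<dots> \<le> real (card S) / 2" using S(2) by simp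
  finally have cX: "real (card X) \<le> real (card S) / 2" .
  have "{(a, b) \<in> S \<times> T. hit \<gamma> d (a * b)} = (SIGMA a:S. {b \<in> T. hit \<gamma> d (a * b)})" by auto
  then have "real (card {(a, b) \<in> S \<times> T. hit \<gamma> d (a * b)}) = (\<Sum>a\<in>S. f a)"
    using fin by (simp add: card_SigmaI f_def)
  also have "\<dots> \<ge> (\<Sum>a\<in>S - X. f a)" using fin by (intro sum_mono2) (auto simp: f_def)
  also have "(\<Sum>a\<in>S - X. f a) \<ge> (\<Sum>a\<in>S - X. real (card T) * c0 / 2)"
  proof (rule sum_mono)
    fix a assume "a \<in> S - X"
    then have "norm (z a) \<le> real (card T) * c0 / 8" by (auto simp: X_def t_def)
    then show "real (card T) * c0 / 2 \<le> f a" using f[of a] by linarith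
  qed
  also have "(\<Sum>a\<in>S - X. real (card T) * c0 / 2) = real (card (S - X)) * (real (card T) * c0 / 2)" by simp
  also have "real (card (S - X)) = real (card S) - real (card X)"
    using fX fin by (simp add: card_Diff_subset of_nat_diff card_mono)
  also have "(real (card S) - real (card X)) * (real (card T) * c0 / 2) \<ge> real (card S) / 2 * (real (card T) * c0 / 2)"
    using cX pos_card c0p by (intro mult_right_mono) auto
  also have "real (card S) / 2 * (real (card T) * c0 / 2) = real (card S) * real (card T) / 4 * c0" by simp
  also have "\<dots> \<ge> real (card S) * real (card T) / 4 * (1 / (real j * real J + 1))"
    by (intro mult_left_mono c0) auto
  finally show ?thesis by simp
qed

text \<open>By the mean value theorem m^(1/c) and (m + 1)^(1/c) are at least \<open>d\<close> apart,
  so the integer found just above m^(1/c) is still below (m + 1)^(1/c).\<close>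

lemma hit_floor:
  fixes c d :: real and m :: nat
  assumes c: "1 < c" and m: "0 < m" and d: "d \<le> 1 / c * (real m + 1) powr (1 / c - 1)" and h: "hit (1 / c) d m"
  defines "n \<equiv> nat \<lceil>real m powr (1 / c)\<rceil>"
  shows "real m powr (1 / c) \<le> real n" "real n \<le> real m powr (1 / c) + 1" "nat \<lfloor>real n powr c\<rfloor> = m"
proof -
  let ?t = "real m powr (1 / c)"
  have n: "real n = of_int \<lceil>?t\<rceil>" unfolding n_def by (simp add: of_nat_nat ceiling_mono[of 0, simplified])
  show t: "?t \<le> real n" "real n \<le> ?t + 1" unfolding n by linarith+
  have "\<exists>z. real m < z \<and> z < real m + 1 \<and> (real m + 1) powr (1 / c) - ?t = (real m + 1 - real m) * (1 / c * z powr (1 / c - 1))"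
    by (rule MVT2) (use m in \<open>auto intro!: derivative_eq_intros\<close>)
  then obtain z where z: "real m < z" "z < real m + 1" "(real m + 1) powr (1 / c) - ?t = 1 / c * z powr (1 / c - 1)" by auto
  have "(real m + 1) powr (1 / c - 1) \<le> z powr (1 / c - 1)" using z m c by (intro powr_mono2') auto
  then have "d \<le> (real m + 1) powr (1 / c) - ?t" unfolding z(3) using d c
    by (meson divide_nonneg_nonneg mult_left_mono order.trans less_imp_le zero_le_one less_trans zero_less_one)
  then have up: "real n < (real m + 1) powr (1 / c)" using h unfolding n hit_def by linarith
  have "real m = ?t powr c" using c by (simp add: powr_powr)
  also have "\<dots> \<le> real n powr c" using t c by (intro powr_mono2) auto
  finally have 1: "real m \<le> real n powr c" .
  have "real n powr c < ((real m + 1) powr (1 / c)) powr c" using up c by (intro powr_less_mono2) auto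
  also have "\<dots> = real m + 1" using c by (simp add: powr_powr)
  finally have 2: "real n powr c < real m + 1" .
  have "\<lfloor>real n powr c\<rfloor> = int m" using 1 2 by (simp add: floor_eq_iff)
  then show "nat \<lfloor>real n powr c\<rfloor> = m" by simp
qed

text \<open>Rounding down loses a factor of at most 2, thus 2^k in the power, which N^w pays
  for.\<close>

lemma floor_root_power:
  fixes N e :: real and k :: nat
  assumes "1 < N" "0 < e" "0 < k" "0 < w" "2 ^ k \<le> N powr w"
  defines "M \<equiv> nat \<lfloor>N powr (e / real k)\<rfloor>"
  shows "N powr (e / real k) / 2 \<le> real M" "real M \<le> N powr (e / real k)"
    "N powr (e - w) \<le> real (M ^ k)" "real (M ^ k) \<le> N powr e" "0 < M"
proof -
  let ?X = "N powr (e / real k)"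
  have "1 \<le> ?X" using assms(1-3) by (intro ge_one_powr_ge_zero) auto
  then have "1 \<le> \<lfloor>?X\<rfloor>" by simp
  then have "real M = of_int \<lfloor>?X\<rfloor>" "1 \<le> real_of_int \<lfloor>?X\<rfloor>" by (simp_all add: M_def)
  moreover have "?X < of_int \<lfloor>?X\<rfloor> + 1" "of_int \<lfloor>?X\<rfloor> \<le> ?X" by simp_all
  ultimately show M: "?X / 2 \<le> real M" "real M \<le> ?X" by argo+
  have Xk: "?X ^ k = N powr e" using assms(1,3) by (simp add: powr_powr flip: powr_realpow)
  show "real (M ^ k) \<le> N powr e" using power_mono[OF M(2), of k] by (simp add: Xk)
  have "N powr (e - w) \<le> N powr e / 2 ^ k"
    unfolding powr_diff using assms(1,5) by (intro divide_left_mono) auto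
  also have "\<dots> = (?X / 2) ^ k" by (simp add: power_divide Xk)
  also have "\<dots> \<le> real M ^ k" using M(1) assms(1) by (intro power_mono) auto
  finally show "N powr (e - w) \<le> real (M ^ k)" by simp
  show "0 < M" using \<open>1 \<le> \<lfloor>?X\<rfloor>\<close> by (simp add: M_def)
qed

text \<open>The divisor bound is used with exponent u / k, so that its k-th power costs about N^u;
  another N^u pays for the constants, among them (2 k)^k from
  \<open>M \<le> 2 * k * (M div k)\<close>.\<close>

lemma card_short_products_ge:
  fixes N e w u C :: real and k :: nat
  assumes N: "1 < N" "0 < e" "e \<le> 1" and k: "0 < k" and w: "0 < w" "w \<le> u" "w \<le> e / real k" "2 ^ k \<le> N powr w" "2 * real k \<le> N powr w"
    and u: "u \<le> 1" and C: "1 \<le> C" "\<And>n::nat. 0 < n \<Longrightarrow> real (card {d. d dvd n}) \<le> C * real n powr (u / real k)"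
      "9 * (2 * C * real k) ^ k \<le> N powr w"
  defines "M \<equiv> nat \<lfloor>N powr (e / real k)\<rfloor>"
  shows "real (M ^ k) * N powr (- (2 * u)) \<le> real (card (short_products k M))"
proof -
  note M = floor_root_power[OF N(1,2) k w(1,4), folded M_def]
  define T where "T = C * (9 * N) powr (u / real k)"
  have T0: "0 \<le> T" using C by (simp add: T_def)
  have T: "real (card {d. d dvd s}) \<le> T" if s: "0 < s" "s \<le> 3 * M ^ k" for s
  proof -
    have "N powr e \<le> N powr 1" using N by (intro powr_mono) auto
    then have N1: "N powr e \<le> N" using N by simp
    have "real s \<le> real (3 * M ^ k)" using s(2) by (rule of_nat_mono)
    also have "\<dots> \<le> 9 * N" using M(4) N1 N by simp
    finally have "real s powr (u / real k) \<le> (9 * N) powr (u / real k)" using w by (intro powr_mono2) auto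
    then show ?thesis using C(2)[OF s(1)] C(1) mult_left_mono[of "real s powr (u / real k)" "(9 * N) powr (u / real k)" C]
      unfolding T_def by linarith
  qed
  have "real k \<le> N powr (e / real k) / 2" using w(3,5) N powr_mono[of w "e / real k" N] by linarith
  then have "real k \<le> real M" using M(1) by linarith
  then have kM: "k \<le> M" by simp
  have "M \<le> 2 * k * (M div k)"
  proof -
    have "M < (M div k + 1) * k" using k by (metis Suc_eq_plus1 dividend_less_div_times div_times_less_eq_dividend mult.commute mult_Suc add.commute)
    have "1 \<le> M div k" using kM k by (simp add: div_greater_zero_iff Suc_le_eq)
    then have "k * 1 \<le> k * (M div k)" by (rule mult_le_mono2)
    moreover have "(M div k + 1) * k = k * (M div k) + k" "2 * k * (M div k) = k * (M div k) + k * (M div k)" by simp_all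
    ultimately show ?thesis using \<open>M < (M div k + 1) * k\<close> by linarith
  qed
  then have "real M \<le> real (2 * k * (M div k))" by (rule of_nat_mono)
  then have "real (M ^ k) \<le> (2 * real k * real (M div k)) ^ k" by (simp add: power_mono)
  also have "\<dots> = (2 * real k) ^ k * real (M div k) ^ k" by (simp only: power_mult_distrib)
  also have "\<dots> \<le> (2 * real k) ^ k * (real (card (short_products k M)) * T ^ k)"
    by (intro mult_left_mono card_short_products k M(5) T) auto
  also have "\<dots> = real (card (short_products k M)) * ((2 * C * real k) ^ k * (9 * N) powr u)"
  proof -
    have "((9 * N) powr (u / real k)) ^ k = (9 * N) powr u" using N k by (simp add: powr_powr flip: powr_realpow)
    then show ?thesis by (simp add: T_def power_mult_distrib)
  qed
  also have "\<dots> \<le> real (card (short_products k M)) * N powr (2 * u)"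
  proof (rule mult_left_mono)
    have "9 powr u \<le> (9::real)" using powr_mono[of u 1 9] u by simp
    then have "(2 * C * real k) ^ k * (9 * N) powr u \<le> (2 * C * real k) ^ k * (9 * N powr u)"
      using C N by (intro mult_left_mono) (auto simp: powr_mult)
    also have "\<dots> = 9 * (2 * C * real k) ^ k * N powr u" by simp
    also have "\<dots> \<le> N powr u * N powr u"
    proof (rule mult_right_mono)
      have "N powr w \<le> N powr u" using N w(2) by (intro powr_mono) auto
      then show "9 * (2 * C * real k) ^ k \<le> N powr u" using C(3) by linarith
    qed simp
    finally show "(2 * C * real k) ^ k * (9 * N) powr u \<le> N powr (2 * u)" by (simp flip: powr_add)
  qed simp
  finally have "real (M ^ k) * N powr (- (2 * u)) \<le> real (card (short_products k M)) * N powr (2 * u) * N powr (- (2 * u))"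
    by (rule mult_right_mono) simp
  then show ?thesis using N by (simp add: mult.assoc flip: powr_add)
qed

text \<open>With u = \<epsilon> / 20, the sets of products and the kernel lose at most N^(8 u), and
  the multiplicity of the integers found loses N^(2 u). Together this is N^(\<epsilon> / 2), less
  than the allowed N^(\<gamma> \<epsilon>).\<close>

lemma smooth_count:
  fixes c \<epsilon> C w N :: real and k j :: nat
  assumes c: "1 < c" "c < 24979 / 20803" and e: "0 < \<epsilon>" "\<epsilon> < 1 / 10 ^ 7"
    and k: "4 / \<epsilon> \<le> real k" and j: "20 / \<epsilon> \<le> real j"
    and C: "1 \<le> C" "\<And>n::nat. 0 < n \<Longrightarrow> real (card {d. d dvd n}) \<le> C * real n powr (\<epsilon> / 20 / real k)"
    and N: "1 < N" and w: "0 < w" "w \<le> \<epsilon> / 20" "w \<le> (1 - 1 / c) / real k"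
    and big: "10 ^ 6 \<le> N powr w" "1 / (1 - 1 / c) \<le> N powr w" "block_const (1 / c) \<le> N powr w" "weyl_block.weyl_const 4 \<le> N powr w"
      "9 * (2 * C * real k) ^ k \<le> N powr w" "480 * real j \<le> N powr w"
    and two_pow: "N < 2 ^ nat \<lfloor>N powr (1 / 10 ^ 8)\<rfloor>"
    and small: "exp (- (N powr (1 / 10 ^ 8))\<^sup>2) \<le> N powr (- 2)"
  shows "N powr (1 / c * (1 - \<epsilon>)) \<le> real (card (smooth_ps_set c \<epsilon> (18 * N powr (1 / c))))"
proof -
  define \<gamma> where "\<gamma> = 1 / c"
  have \<gamma>: "20803 / 24979 < \<gamma>" "\<gamma> < 1" using c by (auto simp: \<gamma>_def field_simps)
  define u where "u = \<epsilon> / 20"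
  have u: "0 < u" "u \<le> 5 / 10 ^ 9" "w \<le> u" using e w by (auto simp: u_def)
  have k0: "0 < k" and j0: "0 < j" using k j e by (auto intro!: gr0I simp: field_simps)
  have mono: "N powr x \<le> N powr y" if "x \<le> y" for x y using that N by (intro powr_mono) auto
  have k1: "1 \<le> C * real k" using C(1) k0 mult_mono[of 1 C 1 "real k"] by simp
  have Ck: "2 ^ k \<le> N powr w" "2 * real k \<le> N powr w"
  proof -
    have p: "(2 * C * real k) ^ k \<le> N powr w" using big(5) zero_le_power[of "2 * C * real k" k] k1 by linarith
    have "(2::real) ^ k \<le> (2 * C * real k) ^ k" using k1 by (intro power_mono) auto
    then show "2 ^ k \<le> N powr w" using p by linarith
    have "2 * real k \<le> 2 * C * real k" using C(1) k0 by simp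
    also have "\<dots> \<le> (2 * C * real k) ^ k" using k1 k0 by (intro self_le_power) auto
    finally show "2 * real k \<le> N powr w" using p by linarith
  qed
  let ?e1 = "\<gamma> - 1 / 10 ^ 5" and ?e2 = "1 - \<gamma> + 1 / 10 ^ 5"
  define M1 where "M1 = nat \<lfloor>N powr (?e1 / real k)\<rfloor>"
  define M2 where "M2 = nat \<lfloor>N powr (?e2 / real k)\<rfloor>"
  have e12: "0 < ?e1" "?e1 \<le> 1" "0 < ?e2" "?e2 \<le> 1" using \<gamma> by auto
  have wk: "w \<le> ?e1 / real k" "w \<le> ?e2 / real k"
    using w(3) divide_right_mono[of "1 - \<gamma>" ?e1 "real k"] divide_right_mono[of "1 - \<gamma>" ?e2 "real k"] \<gamma>
    unfolding \<gamma>_def[symmetric] by auto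
  note M1 = floor_root_power[OF N e12(1) k0 w(1) Ck(1), folded M1_def]
  note M2 = floor_root_power[OF N e12(3) k0 w(1) Ck(1), folded M2_def]
  define A where "A = M1 ^ k"
  define B where "B = M2 ^ k"
  define H where "H = nat \<lfloor>N powr (1 - \<gamma> + 2 / 10 ^ 6)\<rfloor>"
  have H: "N powr (1 - \<gamma> + 2 / 10 ^ 6 - w) \<le> real H" "real H \<le> N powr (1 - \<gamma> + 2 / 10 ^ 6)"
    using floor_root_power(2,3)[OF N _ _ w(1), of "1 - \<gamma> + 2 / 10 ^ 6" 1] big(1) \<gamma> by (auto simp: H_def)
  have w8: "w \<le> 1 / 10 ^ 8" using u by simp
  note big' = order.trans[OF _ mono[OF w8]]
  interpret sc: size_scale \<gamma> N A B H
  proof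
    show "N powr (\<gamma> - 1 / 10 ^ 5 - 1 / 10 ^ 8) \<le> real A" "real A \<le> N powr (\<gamma> - 1 / 10 ^ 5)"
      unfolding A_def using M1(3,4) mono[of "?e1 - 1 / 10 ^ 8" "?e1 - w"] w8 by linarith+
    show "N powr (1 - \<gamma> + 1 / 10 ^ 5 - 1 / 10 ^ 8) \<le> real B" "real B \<le> N powr (1 - \<gamma> + 1 / 10 ^ 5)"
      unfolding B_def using M2(3,4) mono[of "?e2 - 1 / 10 ^ 8" "?e2 - w"] w8 by linarith+
    show "N powr (1 - \<gamma> + 2 / 10 ^ 6 - 1 / 10 ^ 8) \<le> real H" "real H \<le> N powr (1 - \<gamma> + 2 / 10 ^ 6)"
      using H mono[of "1 - \<gamma> + 2 / 10 ^ 6 - 1 / 10 ^ 8" "1 - \<gamma> + 2 / 10 ^ 6 - w"] w8 by linarith+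
    show "10 ^ 6 \<le> N powr (1 / 10 ^ 8)" "1 / (1 - \<gamma>) \<le> N powr (1 / 10 ^ 8)" "block_const \<gamma> \<le> N powr (1 / 10 ^ 8)"
      "weyl_block.weyl_const 4 \<le> N powr (1 / 10 ^ 8)"
      unfolding \<gamma>_def by (rule big'[OF big(1)] big'[OF big(2)] big'[OF big(3)] big'[OF big(4)])+
  qed (use \<gamma> N two_pow small in auto)
  let ?P = "\<lambda>x. N powr x"
  define S where "S = short_products k M1"
  define T where "T = short_products k M2"
  have S: "real A * ?P (- (2 * u)) \<le> real (card S)"
    unfolding S_def A_def M1_def
    by (rule card_short_products_ge[OF N e12(1,2) k0 w(1) u(3) wk(1) Ck _ C(1) C(2)[folded u_def] big(5)]) (use u in auto)
  have T: "real B * ?P (- (2 * u)) \<le> real (card T)"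
    unfolding T_def B_def M2_def
    by (rule card_short_products_ge[OF N e12(3,4) k0 w(1) u(3) wk(2) Ck _ C(1) C(2)[folded u_def] big(5)]) (use u in auto)
  have ST: "S \<subseteq> {A<..3 * A}" "T \<subseteq> {B<..3 * B}"
    using short_products_range(1,2)[OF k0 M1(5)] short_products_range(1,2)[OF k0 M2(5)] by (auto simp: S_def T_def A_def B_def)
  have fin: "finite S" "finite T" using ST finite_subset by blast+
  \<comment> \<open>All products a b are at most 9 N, so 10 N bounds a b + 1, and one
    \<open>d\<close> meets the assumption of \<open>hit_floor\<close> for all of them.\<close>
  define d where "d = \<gamma> * (10 * N) powr (\<gamma> - 1)"
  have d: "0 < d" "d \<le> 1" "?P (\<gamma> - 1) / 20 \<le> d"
  proof -
    show "0 < d" using \<gamma> N by (simp add: d_def)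
    have "(10 * N) powr (\<gamma> - 1) \<le> (10 * N) powr 0" using \<gamma> N by (intro powr_mono) auto
    then show "d \<le> 1" unfolding d_def using \<gamma> N by (intro mult_le_one) auto
    have "(10::real) powr (- 1) \<le> 10 powr (\<gamma> - 1)" using \<gamma> by (intro powr_mono) auto
    then have "1 / 10 \<le> (10::real) powr (\<gamma> - 1)" by (simp add: powr_minus_divide)
    then have "1 / 10 * ?P (\<gamma> - 1) \<le> 10 powr (\<gamma> - 1) * ?P (\<gamma> - 1)" by (rule mult_right_mono) simp
    then have "1 / 2 * (1 / 10 * ?P (\<gamma> - 1)) \<le> \<gamma> * (10 powr (\<gamma> - 1) * ?P (\<gamma> - 1))"
      by (rule mult_mono[rotated]) (use \<gamma> in auto)
    then show "?P (\<gamma> - 1) / 20 \<le> d" using N by (simp add: d_def powr_mult)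
  qed
  \<comment> \<open>J d >= 2 N^u makes the kernel quotient at most N^(- u) off the interval; raised
    to 2 j, with u j >= 1, it is at most N^(-2), well below the mean value.\<close>
  define J where "J = nat \<lceil>2 * ?P u / d\<rceil>"
  have Pud: "1 \<le> ?P u / d"
  proof -
    have "1 \<le> ?P u" using N u by (intro ge_one_powr_ge_zero) auto
    then show ?thesis using d by (simp add: pos_le_divide_eq)
  qed
  have J: "2 * ?P u / d \<le> real J" "real J \<le> 2 * ?P u / d + 1"
  proof -
    have "0 \<le> 2 * ?P u / d" using d by simp
    then have "0 \<le> \<lceil>2 * ?P u / d\<rceil>" by linarith
    then have "real J = of_int \<lceil>2 * ?P u / d\<rceil>" by (simp add: J_def)
    then show "2 * ?P u / d \<le> real J" "real J \<le> 2 * ?P u / d + 1" by linarith+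
  qed
  have J0: "0 < J" using J(1) Pud by (intro gr0I) auto
  have Jle: "real J \<le> 60 * ?P (u + 1 - \<gamma>)"
  proof -
    have "real J \<le> 3 * (?P u / d)" using J(2) Pud by simp
    also have "?P u / d \<le> ?P u / (?P (\<gamma> - 1) / 20)" by (intro divide_left_mono mult_pos_pos d) (use N in auto)
    also have "\<dots> = 20 * ?P (u + 1 - \<gamma>)" by (simp add: powr_diff powr_add)
    finally show ?thesis by simp
  qed
  have jJ1: "1 \<le> real j * real J" using j0 J0 mult_mono[of 1 "real j" 1 "real J"] by simp
  have jJ: "8 * (real j * real J) \<le> ?P (w + u + 1 - \<gamma>)"
  proof -
    have "8 * (real j * real J) \<le> 8 * (real j * (60 * ?P (u + 1 - \<gamma>)))" by (intro mult_left_mono Jle) auto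
    also have "\<dots> = 480 * real j * ?P (u + 1 - \<gamma>)" by simp
    also have "\<dots> \<le> ?P w * ?P (u + 1 - \<gamma>)" by (intro mult_right_mono big) auto
    also have "\<dots> = ?P (w + u + 1 - \<gamma>)" by (simp add: sc.P_add algebra_simps)
    finally show ?thesis .
  qed
  have jJ4: "4 * (real j * real J + 1) \<le> ?P (w + u + 1 - \<gamma>)"
  proof -
    have "4 * (y + 1) \<le> z" if "8 * y \<le> z" "1 \<le> y" for y z :: real using that by simp
    from this[OF jJ jJ1] show ?thesis .
  qed
  have jJH: "j * J \<le> H"
  proof -
    have "real (j * J) \<le> 8 * (real j * real J)" by simp
    also note jJ
    also have "?P (w + u + 1 - \<gamma>) \<le> ?P (1 - \<gamma> + 2 / 10 ^ 6 - w)" using u by (intro mono) auto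
    also note H(1)
    finally show ?thesis by (simp only: of_nat_le_iff)
  qed
  have tail: "(2 / (real J * d)) ^ (2 * j) \<le> 1 / (4 * (real j * real J + 1))"
  proof -
    have "2 * ?P u \<le> real J * d" using J(1) d by (simp add: pos_divide_le_eq)
    then have "2 / (real J * d) \<le> 2 / (2 * ?P u)" using J0 d N by (intro divide_left_mono mult_pos_pos) auto
    also have "\<dots> = ?P (- u)" by (simp add: powr_minus_divide)
    finally have "(2 / (real J * d)) ^ (2 * j) \<le> ?P (- u) ^ (2 * j)" using d by (intro power_mono) auto
    also have "\<dots> = ?P (- u * real (2 * j))" using powr_realpow[of "?P (- u)" "2 * j"] N by (simp add: powr_powr)
    also have "\<dots> \<le> ?P (- 2)"
    proof (rule mono)
      have "1 \<le> u * real j" using j e by (simp add: u_def field_simps)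
      then show "- u * real (2 * j) \<le> - 2" by simp
    qed
    also have "\<dots> \<le> 1 / ?P (w + u + 1 - \<gamma>)" unfolding powr_minus_divide[symmetric] using u \<gamma> by (intro mono) auto
    also have "\<dots> \<le> 1 / (4 * (real j * real J + 1))" 
      using jJ4 jJ1 N by (intro divide_left_mono mult_pos_pos add_nonneg_pos) auto
    finally show ?thesis .
  qed
  define Z where "Z = {(a, b) \<in> S \<times> T. hit \<gamma> d (a * b)}"
  have "real (card S) * real (card T) / (4 * (real j * real J + 1)) \<le> real (card Z)"
    unfolding Z_def
  proof (rule sc.many_hits[OF ST(1) _ ST(2) _ d(1,2) J0 jJH tail])
    have 1: "?P (- (2 / 10 ^ 7)) \<le> ?P (- (2 * u))" using u by (intro mono) auto
    show "real A * ?P (- (2 / 10 ^ 7)) \<le> real (card S)" "real B * ?P (- (2 / 10 ^ 7)) \<le> real (card T)"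
      using S T mult_left_mono[OF 1, of "real A"] mult_left_mono[OF 1, of "real B"] by linarith+
  qed
  \<comment> \<open>As \<open>?e1 + ?e2 = 1\<close>, the number of pairs is about N, and j J is
    about N^(1 - \<gamma>). The losses are 5 u + 3 w <= 8 u.\<close>
  moreover have "?P (\<gamma> - 8 * u) \<le> real (card S) * real (card T) / (4 * (real j * real J + 1))"
  proof -
    have a: "?P (?e1 - w + - (2 * u)) \<le> real (card S)"
      using S sc.P_mult_ge[OF M1(3) order_refl, of "- (2 * u)"] unfolding A_def by linarith
    have b: "?P (?e2 - w + - (2 * u)) \<le> real (card T)"
      using T sc.P_mult_ge[OF M2(3) order_refl, of "- (2 * u)"] unfolding B_def by linarith
    have "?P (?e1 - w + - (2 * u) + (?e2 - w + - (2 * u)) - (w + u + 1 - \<gamma>)) \<le> real (card S) * real (card T) / (4 * (real j * real J + 1))"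
      by (rule sc.P_div_ge[OF sc.P_mult_ge[OF a b] _ jJ4]) (use jJ1 in auto)
    then show ?thesis by (rule sc.P_antimono) (use u in auto)
  qed
  ultimately have Z: "?P (\<gamma> - 8 * u) \<le> real (card Z)" by linarith
  define \<phi> where "\<phi> = (\<lambda>(a, b). nat \<lceil>real (a * b) powr \<gamma>\<rceil>)"
  let ?W = "smooth_ps_set c \<epsilon> (18 * ?P \<gamma>)"
  have AB: "real A * real B \<le> N" "?P (1 - 2 * w) \<le> real A * real B"
  proof -
    have "real A * real B \<le> ?P (?e1 + ?e2)" unfolding A_def B_def by (intro sc.P_mult M1(4) M2(4)) simp
    then show "real A * real B \<le> N" using N by simp
    have "?P (?e1 - w + (?e2 - w)) \<le> real A * real B" unfolding A_def B_def by (intro sc.P_mult_ge M1(3) M2(3))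
    then show "?P (1 - 2 * w) \<le> real A * real B" by (rule sc.P_antimono) simp
  qed
  have Zprop: "\<phi> z \<in> ?W \<and> nat \<lfloor>real (\<phi> z) powr c\<rfloor> = fst z * snd z \<and> 0 < fst z * snd z \<and> real (fst z * snd z) \<le> 9 * N" if z: "z \<in> Z" for z
  proof -
    obtain a b where ab: "z = (a, b)" "a \<in> S" "b \<in> T" "hit \<gamma> d (a * b)" using z by (auto simp: Z_def)
    have r: "A < a" "a \<le> 3 * A" "B < b" "b \<le> 3 * B" using ab(2,3) ST by auto
    have m0: "0 < a * b" using r by simp
    have "A * B \<le> a * b" using r by (intro mult_le_mono) auto
    then have lo: "real A * real B \<le> real (a * b)" by (simp flip: of_nat_mult)
    have "a * b \<le> (3 * A) * (3 * B)" using r by (intro mult_le_mono) auto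
    then have "real (a * b) \<le> real ((3 * A) * (3 * B))" by (rule of_nat_mono)
    then have hi: "real (a * b) \<le> 9 * N" using AB(1) by simp
    have "d \<le> 1 / c * (real (a * b) + 1) powr (1 / c - 1)"
    proof -
      have "0 < real (a * b) + 1" by linarith
      then show ?thesis unfolding d_def \<gamma>_def using c hi N by (intro mult_left_mono powr_mono2') (auto simp del: of_nat_mult)
    qed
    note hf = hit_floor[OF c(1) m0 this ab(4)[unfolded \<gamma>_def]]
    let ?n = "nat \<lceil>real (a * b) powr (1 / c)\<rceil>"
    have n: "\<phi> z = ?n" by (simp add: \<phi>_def ab \<gamma>_def)
    have two: "2 \<le> ?n"
    proof -
      have "1 * 1 < a * b" using r sc.pos by (intro mult_strict_mono) auto
      then have "1 < real (a * b)" by (simp flip: of_nat_mult)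
      then have "1 < real (a * b) powr (1 / c)" using c by (intro gr_one_powr) auto
      then show ?thesis using hf(1) by linarith
    qed
    have up: "real ?n \<le> 18 * ?P \<gamma>"
    proof -
      have "real (a * b) powr (1 / c) \<le> (9 * N) powr \<gamma>" unfolding \<gamma>_def using hi c by (intro powr_mono2) auto
      also have "\<dots> \<le> 9 * ?P \<gamma>" unfolding powr_mult using powr_mono[of \<gamma> 1 9] \<gamma> by (intro mult_right_mono) auto
      moreover have "1 \<le> ?P \<gamma>" using N \<gamma> by (intro ge_one_powr_ge_zero) auto
      ultimately show ?thesis using hf(2) by linarith
    qed
    \<comment> \<open>Converts a bound in N into one in n: the prime factors are at most 2 N^(1/k)
      <= N^(\<epsilon> / 2) <= n^\<epsilon>.\<close>
    have low: "?P (1 / 2) \<le> real ?n"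
    proof -
      have "?P (1 / 2) \<le> ?P ((1 - 2 * w) * \<gamma>)"
      proof (rule mono)
        have "99 / 100 * (2 / 3) \<le> (1 - 2 * w) * \<gamma>" using u \<gamma> by (intro mult_mono) auto
        then show "1 / 2 \<le> (1 - 2 * w) * \<gamma>" by simp
      qed
      also have "\<dots> \<le> real (a * b) powr (1 / c)" unfolding \<gamma>_def[symmetric]
        by (rule sc.P_powr_ge) (use \<gamma> AB(2) lo in auto)
      also note hf(1)
      finally show ?thesis .
    qed
    have "real (largest_prime_factor (a * b)) \<le> real ?n powr \<epsilon>"
    proof -
      have "1 < a * b" using r sc.pos mult_strict_mono[of 1 a 1 b] by simp
      then have "prime_factors (a * b) \<noteq> {}" by (metis less_irrefl less_numeral_extra(1) nat_neq_iff One_nat_def prime_factorization_empty_iff set_mset_eq_empty_iff nat_dvd_1_iff_1 is_unit_mult_iff nat_mult_eq_1_iff m0)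
      then have "largest_prime_factor (a * b) \<in> prime_factors (a * b)" unfolding largest_prime_factor_def by (intro Max_in) auto
      then have q: "prime (largest_prime_factor (a * b))" "largest_prime_factor (a * b) dvd a * b" by (auto simp: in_prime_factors_iff)
      then have "largest_prime_factor (a * b) dvd a \<or> largest_prime_factor (a * b) dvd b" by (simp add: prime_dvd_mult_iff)
      then have "largest_prime_factor (a * b) \<le> 2 * M1 \<or> largest_prime_factor (a * b) \<le> 2 * M2"
        using short_products_range(3)[OF k0 M1(5) ab(2)[unfolded S_def] q(1)] short_products_range(3)[OF k0 M2(5) ab(3)[unfolded T_def] q(1)] by blast
      then have "real (largest_prime_factor (a * b)) \<le> 2 * real M1 \<or> real (largest_prime_factor (a * b)) \<le> 2 * real M2"
        by linarith
      moreover have "real M1 \<le> ?P (1 / real k)" "real M2 \<le> ?P (1 / real k)"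
        using M1(2) M2(2) mono[of "?e1 / real k" "1 / real k"] mono[of "?e2 / real k" "1 / real k"] e12
          divide_right_mono[of ?e1 1 "real k"] divide_right_mono[of ?e2 1 "real k"] by force+
      ultimately have "real (largest_prime_factor (a * b)) \<le> 2 * ?P (1 / real k)" by linarith
      also have "\<dots> \<le> ?P w * ?P (1 / real k)" using big(1) by (intro mult_right_mono) auto
      also have "\<dots> = ?P (w + 1 / real k)" by (rule sc.P_add)
      also have "\<dots> \<le> ?P (1 / 2 * \<epsilon>)"
      proof (rule mono)
        have "1 / real k \<le> \<epsilon> / 4" using k k0 e by (simp add: field_simps)
        then show "w + 1 / real k \<le> 1 / 2 * \<epsilon>" using w(2) e by linarith
      qed
      also have "\<dots> \<le> real ?n powr \<epsilon>" by (rule sc.P_powr_ge) (use low e in auto)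
      finally show ?thesis .
    qed
    then have "\<phi> z \<in> ?W" unfolding n smooth_ps_set_def mem_Collect_eq hf(3) using two up by (intro conjI)
    then show ?thesis using m0 hi hf(3) n unfolding ab fst_conv snd_conv by (intro conjI) auto
  qed
  have fW: "finite ?W"
  proof (rule finite_subset)
    show "?W \<subseteq> {..nat \<lfloor>18 * ?P \<gamma>\<rfloor>}" by (auto simp: smooth_ps_set_def le_nat_floor)
  qed simp
  have fZ: "finite Z" using fin unfolding Z_def by (auto intro: finite_subset[of _ "S \<times> T"])
  \<comment> \<open>Several pairs can lead to the same n. But n determines the product a b as floor
    (n^c), so the multiplicity is at most the number of divisors of that product.\<close>
  have "card Z = (\<Sum>n\<in>\<phi> ` Z. card {z \<in> Z. \<phi> z = n})"
    using sum.image_gen[OF fZ, of "\<lambda>_. 1::nat" \<phi>] by simp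
  then have "real (card Z) = (\<Sum>n\<in>\<phi> ` Z. real (card {z \<in> Z. \<phi> z = n}))" by simp
  also have "\<dots> \<le> (\<Sum>n\<in>\<phi> ` Z. ?P (2 * u))"
  proof (rule sum_mono)
    fix n assume "n \<in> \<phi> ` Z"
    then obtain z0 where z0: "z0 \<in> Z" "n = \<phi> z0" by blast
    define m where "m = nat \<lfloor>real n powr c\<rfloor>"
    have m: "0 < m" "real m \<le> 9 * N" using Zprop[OF z0(1)] by (auto simp: m_def z0(2))
    have fib: "fst z * snd z = m" if "z \<in> Z" "\<phi> z = n" for z using Zprop[OF that(1)] that(2) by (simp add: m_def)
    have "inj_on fst {z \<in> Z. \<phi> z = n}"
    proof (rule inj_onI)
      fix x y assume x: "x \<in> {z \<in> Z. \<phi> z = n}" and y: "y \<in> {z \<in> Z. \<phi> z = n}" and xy: "fst x = fst y"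
      have "fst x * snd x = fst x * snd y" using fib[of x] fib[of y] x y xy by simp
      moreover have "fst x \<noteq> 0" using fib[of x] x m by (intro notI) auto
      ultimately show "x = y" using xy by (simp add: prod_eq_iff)
    qed
    then have "card {z \<in> Z. \<phi> z = n} = card (fst ` {z \<in> Z. \<phi> z = n})" by (simp add: card_image)
    also have "\<dots> \<le> card {d. d dvd m}"
      using m(1) fib by (intro card_mono) (auto intro: dvdI[of _ _ "snd _"] dest!: fib)
    finally have "real (card {z \<in> Z. \<phi> z = n}) \<le> C * real m powr (u / real k)"
      using C(2)[OF m(1)] by (simp add: u_def)
    also have "\<dots> \<le> C * (9 * ?P u)"
    proof (rule mult_left_mono)
      have uk: "u / real k \<le> u" "0 \<le> u / real k" using u k0 by (auto simp: field_simps)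
      have "real m powr (u / real k) \<le> (9 * N) powr (u / real k)" using m uk by (intro powr_mono2) auto
      also have "\<dots> \<le> 9 powr 1 * ?P u"
        unfolding powr_mult using uk u N by (intro mult_mono powr_mono) auto
      finally show "real m powr (u / real k) \<le> 9 * ?P u" by simp
    qed (use C in simp)
    also have "\<dots> = 9 * C * ?P u" by simp
    also have "\<dots> \<le> ?P w * ?P u"
    proof (rule mult_right_mono)
      have "C \<le> 2 * C * real k" using k1 C k0 mult_left_mono[of 1 "2 * real k" C] by simp
      also have "\<dots> \<le> (2 * C * real k) ^ k" using k1 k0 by (intro self_le_power) auto
      finally show "9 * C \<le> ?P w" using big(5) by linarith
    qed simp
    also have "\<dots> \<le> ?P (2 * u)" unfolding sc.P_add using u by (intro mono) auto
    finally show "real (card {z \<in> Z. \<phi> z = n}) \<le> ?P (2 * u)" .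
  qed
  also have "\<dots> = real (card (\<phi> ` Z)) * ?P (2 * u)" by simp
  also have "\<dots> \<le> real (card ?W) * ?P (2 * u)"
    using fW Zprop by (intro mult_right_mono of_nat_mono card_mono) auto
  finally have "real (card Z) \<le> real (card ?W) * ?P (2 * u)" .
  then have "?P (\<gamma> - 8 * u) \<le> real (card ?W) * ?P (2 * u)" using Z by linarith
  then have "?P (\<gamma> - 8 * u - 2 * u) \<le> real (card ?W)"
    unfolding powr_diff[of N _ "2 * u"] using sc.P_pos[of "2 * u"] by (simp add: pos_divide_le_eq)
  moreover have "?P (\<gamma> * (1 - \<epsilon>)) \<le> ?P (\<gamma> - 8 * u - 2 * u)"
  proof (rule mono)
    have "1 / 2 * \<epsilon> \<le> \<gamma> * \<epsilon>" using \<gamma> e by (intro mult_right_mono) auto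
    then show "\<gamma> * (1 - \<epsilon>) \<le> \<gamma> - 8 * u - 2 * u" by (simp add: u_def algebra_simps)
  qed
  ultimately show ?thesis unfolding \<gamma>_def by linarith
qed

text \<open>All largeness conditions of \<open>smooth_count\<close> hold eventually in N, and N is
  chosen so that 18 N^(1/c) = x.\<close>

lemma smooth_ps_lower_bound:
  fixes c \<epsilon> :: real
  assumes c: "1 < c" "c < 24979 / 20803" and e: "0 < \<epsilon>" "\<epsilon> < 1 / 10 ^ 7"
  shows "\<exists>C>0. \<exists>x\<^sub>0. \<forall>x\<ge>x\<^sub>0. real (card (smooth_ps_set c \<epsilon> x)) \<ge> C * x powr (1 - \<epsilon>)"
proof -
  define k where "k = nat \<lceil>4 / \<epsilon>\<rceil>"
  define j where "j = nat \<lceil>20 / \<epsilon>\<rceil>"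
  have k: "4 / \<epsilon> \<le> real k" and j: "20 / \<epsilon> \<le> real j" unfolding k_def j_def by linarith+
  have k0: "0 < k" using k e by (auto intro!: gr0I simp: field_simps)
  obtain C :: real where C: "1 \<le> C" "\<And>n::nat. 0 < n \<Longrightarrow> real (card {d. d dvd n}) \<le> C * real n powr (\<epsilon> / 20 / real k)"
    by (rule divisor_bound[of "\<epsilon> / 20 / real k"]) (use e k0 in auto)
  define w where "w = min (\<epsilon> / 20) ((1 - 1 / c) / real k)"
  have w: "0 < w" "w \<le> \<epsilon> / 20" "w \<le> (1 - 1 / c) / real k" using e k0 c by (auto simp: w_def)
  have ev: "\<forall>\<^sub>F N in at_top. K \<le> N powr w" for K :: real
    using w(1) by real_asymp
  have "\<forall>\<^sub>F N::real in at_top. 1 < N \<and> 10 ^ 6 \<le> N powr w \<and> 1 / (1 - 1 / c) \<le> N powr w \<and> block_const (1 / c) \<le> N powr w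
      \<and> weyl_block.weyl_const 4 \<le> N powr w \<and> 9 * (2 * C * real k) ^ k \<le> N powr w \<and> 480 * real j \<le> N powr w
      \<and> N < 2 powr (N powr (1 / 10 ^ 8) - 1) \<and> exp (- (N powr (1 / 10 ^ 8))\<^sup>2) \<le> N powr (- 2)"
    by (intro eventually_conj ev eventually_gt_at_top) real_asymp+
  then obtain N0 where N0: "\<And>N::real. N0 \<le> N \<Longrightarrow> 1 < N \<and> 10 ^ 6 \<le> N powr w \<and> 1 / (1 - 1 / c) \<le> N powr w \<and> block_const (1 / c) \<le> N powr w
      \<and> weyl_block.weyl_const 4 \<le> N powr w \<and> 9 * (2 * C * real k) ^ k \<le> N powr w \<and> 480 * real j \<le> N powr w
      \<and> N < 2 powr (N powr (1 / 10 ^ 8) - 1) \<and> exp (- (N powr (1 / 10 ^ 8))\<^sup>2) \<le> N powr (- 2)"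
    unfolding eventually_at_top_linorder by blast
  show "\<exists>C>0. \<exists>x\<^sub>0. \<forall>x\<ge>x\<^sub>0. real (card (smooth_ps_set c \<epsilon> x)) \<ge> C * x powr (1 - \<epsilon>)"
  proof (rule exI[of _ "1 / 18"], intro conjI, simp, rule exI[of _ "18 * (max 1 N0) powr (1 / c)"], intro allI impI)
    fix x :: real assume x: "18 * (max 1 N0) powr (1 / c) \<le> x"
    define N where "N = (x / 18) powr c"
    have x18: "max 1 N0 powr (1 / c) \<le> x / 18" using x by simp
    have "max 1 N0 = (max 1 N0 powr (1 / c)) powr c" using c by (simp add: powr_powr)
    also have "\<dots> \<le> N" unfolding N_def using x18 c by (intro powr_mono2) auto
    finally have "N0 \<le> N" by simp
    note NN = N0[OF this]
    have x0: "0 < x / 18"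
    proof -
      have "0 < max 1 N0 powr (1 / c)" by (simp add: max_def)
      then show ?thesis using x18 by linarith
    qed
    then have Nc: "N powr (1 / c) = x / 18" using c by (simp add: N_def powr_powr)
    have two: "N < 2 ^ nat \<lfloor>N powr (1 / 10 ^ 8)\<rfloor>"
    proof -
      have "N powr (1 / 10 ^ 8) - 1 \<le> real (nat \<lfloor>N powr (1 / 10 ^ 8)\<rfloor>)" by linarith
      then have "2 powr (N powr (1 / 10 ^ 8) - 1) \<le> 2 powr real (nat \<lfloor>N powr (1 / 10 ^ 8)\<rfloor>)" by (intro powr_mono) auto
      also have "\<dots> = 2 ^ nat \<lfloor>N powr (1 / 10 ^ 8)\<rfloor>" by (rule powr_realpow) simp
      finally show ?thesis using NN by linarith
    qed
    have "1 / 18 * x powr (1 - \<epsilon>) \<le> (1 / 18) powr (1 - \<epsilon>) * x powr (1 - \<epsilon>)"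
    proof (rule mult_right_mono)
      have "(1 / 18) powr 1 \<le> (1 / 18 :: real) powr (1 - \<epsilon>)" using e by (intro powr_mono') auto
      then show "1 / 18 \<le> (1 / 18 :: real) powr (1 - \<epsilon>)" by simp
    qed simp
    also have "\<dots> = (x / 18) powr (1 - \<epsilon>)" by (simp add: powr_divide)
    also have "\<dots> = N powr (1 / c * (1 - \<epsilon>))" by (simp only: Nc[symmetric] powr_powr)
    also have "\<dots> \<le> real (card (smooth_ps_set c \<epsilon> (18 * N powr (1 / c))))"
      by (rule smooth_count[OF c e k j C _ w]) (use e NN two in auto)
    also have "18 * N powr (1 / c) = x" by (simp add: Nc)
    finally show "real (card (smooth_ps_set c \<epsilon> x)) \<ge> 1 / 18 * x powr (1 - \<epsilon>)" .
  qed
qed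

theorem theorem6:
  fixes c :: real
  assumes "1 < c" and "c < 24979 / 20803"
  shows "\<exists>\<epsilon>\<^sub>0>0. \<forall>\<epsilon>. 0 < \<epsilon> \<and> \<epsilon> < \<epsilon>\<^sub>0 \<longrightarrow>
           (\<exists>C>0. \<exists>x\<^sub>0. \<forall>x\<ge>x\<^sub>0.
              real (card (smooth_ps_set c \<epsilon> x)) \<ge> C * x powr (1 - \<epsilon>))"
\<comment> \<open>Below this threshold \<epsilon> / 20 < 5 / 10^9, so all losses depending on
  \<epsilon> stay inside the fixed margins of \<open>size_scale\<close> and
  \<open>many_hits\<close>.\<close>
proof (rule exI[of _ "1 / 10 ^ 7"], intro conjI allI impI)
  fix \<epsilon> :: real assume "0 < \<epsilon> \<and> \<epsilon> < 1 / 10 ^ 7"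
  then show "\<exists>C>0. \<exists>x\<^sub>0. \<forall>x\<ge>x\<^sub>0. real (card (smooth_ps_set c \<epsilon> x)) \<ge> C * x powr (1 - \<epsilon>)"
    using smooth_ps_lower_bound[OF assms] by blast
qed simp

end
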